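(* Let $p$ be a prime, let $A,B,C,D\in\mathbf{Z}_p$, let $S=S_{A,B,C,D}\subset\mathbb{A}^3$ be the surface $x^2+y^2+z^2+xyz=Ax+By+Cz+D$, and let $\Gamma=\langle s_1,s_2,s_3\rangle$ be the group generated by the three Vieta involutions. Assume that $S(\mathbf{Z}_p)$ does not contain any finite $\Gamma$-orbit. Let $\mu$ be a probability measure on $\{s_1,s_2,s_3\}$ with $\mu(s_1)\mu(s_2)\mu(s_3)>0$. Let $\nu$ be an ergodic $\mu$-stationary probability measure on $S(\mathbf{Q}_p)$. Then: (1) $\nu$ is supported on an orbit closure $\overline{\Gamma(x)}$, for some $x\in S(\mathbf{Z}_p)$; (2) this orbit closure is a clopen subset; (3) $\nu$ is equal to the normalized symplectic measure on $\overline{\Gamma(x)}$. Moreover, there are only finitely many orbit closures in $S(\mathbf{Z}_p)$, and the convex set of $\mu$-stationary measures on $S(\mathbf{Q}_p)$ is a finite dimensional simplex.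
   Context: The Vieta involutions are $s_1(x,y,z)=(-x+A-yz,\,y,\,z)$, $s_2(x,y,z)=(x,\,-y+B-zx,\,z)$, $s_3(x,y,z)=(x,\,y,\,-z+C-xy)$; they are automorphisms of $S$. $S(\mathbf{Q}_p)$ and $S(\mathbf{Z}_p)$ carry the $p$-adic topology. A probability measure $\nu$ on $S(\mathbf{Q}_p)$ is $\mu$-stationary if $\sum_i\mu(s_i)\,\nu(s_i^{-1}(E))=\nu(E)$ for every Borel set $E$; it is ergodic if it is extremal in the convex set of $\mu$-stationary probability measures. On the smooth locus of $S$ there is a regular $2$-form $$\Omega=\frac{dx\wedge dy}{2z-C+xy}=\frac{dy\wedge dz}{2x-A+yz}=\frac{dz\wedge dx}{2y-B+zx}.$$ By $p$-adic integration it defines a measure (also denoted $\Omega$) on $S(\mathbf{Z}_p)$. For a non-empty open subset $U$ of $S(\mathbf{Z}_p)$, the normalized symplectic measure on $U$ is $\frac{1}{\int_U\Omega}\,\Omega|_U$. *)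

theory Defs
  imports
    "HOL-Probability.Probability"
    "HOL-Algebra.Bij"
    "HOL-Algebra.Generated_Groups"
    "HOL-Library.Function_Algebras"
    "Berlekamp_Zassenhaus.Finite_Field"
begin

section \<open>The field of p-adic numbers\<close>

subsection \<open>The p-adic absolute value on the rationals\<close>

definition padic_abs :: "nat \<Rightarrow> rat \<Rightarrow> real" where
  "padic_abs p q = (if q = 0 then 0 else
     real p powi (int (multiplicity (int p) (snd (quotient_of q)))
                - int (multiplicity (int p) (fst (quotient_of q)))))"

definition padic_cauchy :: "nat \<Rightarrow> (nat \<Rightarrow> rat) \<Rightarrow> bool" where
  "padic_cauchy p X \<longleftrightarrow> (\<forall>e>0. \<exists>N. \<forall>m\<ge>N. \<forall>n\<ge>N. padic_abs p (X m - X n) < e)"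

definition padic_rel :: "nat \<Rightarrow> (nat \<Rightarrow> rat) \<Rightarrow> (nat \<Rightarrow> rat) \<Rightarrow> bool" where
  "padic_rel p X Y \<longleftrightarrow> padic_cauchy p X \<and> padic_cauchy p Y \<and>
     (\<lambda>n. padic_abs p (X n - Y n)) \<longlonglongrightarrow> 0"

context
  fixes p :: nat
  assumes p: "prime p"
begin

lemma padic_abs_divide:
  assumes "a \<noteq> 0" "b \<noteq> 0"
  shows "padic_abs p (of_int a / of_int b) =
    real p powi (int (multiplicity (int p) b) - int (multiplicity (int p) a))"
proof -
  obtain c d where cd: "quotient_of (of_int a / of_int b) = (c, d)"
    by (cases "quotient_of (of_int a / of_int b)")
  have d: "d > 0" using cd by (rule quotient_of_denom_pos)
  have "of_int a / of_int b = (of_int c / of_int d :: rat)"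
    using cd by (rule quotient_of_div)
  then have "of_int (a * d) = (of_int (c * b) :: rat)"
    using assms d by (simp add: field_simps)
  then have eq: "a * d = c * b" by (simp only: of_int_eq_iff)
  then have c: "c \<noteq> 0" using assms d by auto
  have pp: "prime_elem (int p)" using p by auto
  have "multiplicity (int p) a + multiplicity (int p) d =
        multiplicity (int p) c + multiplicity (int p) b"
    using eq prime_elem_multiplicity_mult_distrib[OF pp, of a d]
      prime_elem_multiplicity_mult_distrib[OF pp, of c b] assms c d by simp
  then have "int (multiplicity (int p) d) - int (multiplicity (int p) c) =
        int (multiplicity (int p) b) - int (multiplicity (int p) a)" by linarith
  then show ?thesis using assms cd by (simp add: padic_abs_def)
qed

lemma rat_common_denom:
  fixes x y :: rat
  obtains a b d :: int where "d \<noteq> 0" "x = of_int a / of_int d" "y = (of_int b / of_int d :: rat)"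
proof -
  obtain a1 d1 where 1: "quotient_of x = (a1, d1)" by (cases "quotient_of x")
  obtain a2 d2 where 2: "quotient_of y = (a2, d2)" by (cases "quotient_of y")
  have "d1 > 0" "d2 > 0" "x = of_int a1 / of_int d1" "y = of_int a2 / of_int d2"
    using 1 2 quotient_of_denom_pos quotient_of_div by blast+
  then have "d1 * d2 \<noteq> 0" "x = of_int (a1 * d2) / of_int (d1 * d2)"
    "y = of_int (a2 * d1) / of_int (d1 * d2)" by (auto simp: field_simps)
  then show ?thesis by (rule that)
qed

lemma padic_abs_zero [simp]: "padic_abs p 0 = 0"
  by (simp add: padic_abs_def)

lemma padic_abs_pos: "x \<noteq> 0 \<Longrightarrow> padic_abs p x > 0"
  using prime_gt_0_nat[OF p] by (simp add: padic_abs_def)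

lemma padic_abs_nonneg [simp]: "padic_abs p x \<ge> 0"
  using padic_abs_pos[of x] by (cases "x = 0") auto

lemma padic_abs_eq_0 [simp]: "padic_abs p x = 0 \<longleftrightarrow> x = 0"
  using padic_abs_pos[of x] by (cases "x = 0") auto

lemma padic_abs_one [simp]: "padic_abs p 1 = 1"
  using padic_abs_divide[of 1 1] by simp

lemma padic_abs_mult: "padic_abs p (x * y) = padic_abs p x * padic_abs p y"
proof (cases "x = 0 \<or> y = 0")
  case False
  obtain a b d where d: "d \<noteq> 0" "x = of_int a / of_int d" "y = of_int b / of_int d"
    by (rule rat_common_denom)
  with False have ab: "a \<noteq> 0" "b \<noteq> 0" by auto
  have pp: "prime_elem (int p)" using p by auto
  have p0: "real p \<noteq> 0" using prime_gt_0_nat[OF p] by simp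
  have "x * y = of_int (a * b) / of_int (d * d)" using d by simp
  then have "padic_abs p (x * y) =
      real p powi (int (multiplicity (int p) (d * d)) - int (multiplicity (int p) (a * b)))"
    using padic_abs_divide[of "a * b" "d * d"] ab d(1) by simp
  also have "int (multiplicity (int p) (d * d)) - int (multiplicity (int p) (a * b)) =
      (int (multiplicity (int p) d) - int (multiplicity (int p) a)) +
      (int (multiplicity (int p) d) - int (multiplicity (int p) b))"
    using ab d(1) by (simp add: prime_elem_multiplicity_mult_distrib[OF pp])
  also have "real p powi \<dots> = padic_abs p x * padic_abs p y"
    using ab d(1) p0 by (simp only: d(2,3) padic_abs_divide power_int_add simp_thms)
  finally show ?thesis .
qed auto

lemma padic_abs_minus [simp]: "padic_abs p (- x) = padic_abs p x"
proof -
  have "padic_abs p (- 1) * padic_abs p (- 1) = 1"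
    using padic_abs_mult[of "- 1" "- 1"] by simp
  then have "padic_abs p (- 1) = 1"
    using padic_abs_nonneg[of "- 1"] by (simp add: square_eq_1_iff)
  then show ?thesis using padic_abs_mult[of "- 1" x] by simp
qed

lemma padic_abs_commute: "padic_abs p (x - y) = padic_abs p (y - x)"
  using padic_abs_minus[of "x - y"] by simp

lemma padic_abs_minus_diff: "padic_abs p (- x - - y) = padic_abs p (x - y)"
  unfolding minus_diff_minus by (rule padic_abs_minus)

lemma padic_abs_ultra: "padic_abs p (x + y) \<le> max (padic_abs p x) (padic_abs p y)"
proof (cases "x = 0 \<or> y = 0 \<or> x + y = 0")
  case True
  then show ?thesis by (auto simp: le_max_iff_disj)
next
  case False
  obtain a b d where d: "d \<noteq> 0" "x = of_int a / of_int d" "y = of_int b / of_int d"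
    by (rule rat_common_denom)
  have xy: "x + y = of_int (a + b) / of_int d" using d by (simp add: add_divide_distrib)
  with False d have ab: "a \<noteq> 0" "b \<noteq> 0" "a + b \<noteq> 0" by (auto simp del: of_int_add)
  have p1: "real p \<ge> 1" using prime_gt_0_nat[OF p] by simp
  let ?m = "multiplicity (int p)"
  have "min (?m a) (?m b) \<le> ?m (a + b)"
  proof (rule multiplicity_geI)
    show "int p ^ min (?m a) (?m b) dvd a + b"
      by (intro dvd_add multiplicity_dvd') auto
    show "\<not> is_unit (int p)" using p by (metis prime_int_nat_transfer not_prime_unit prime_nat_int_transfer)
  qed (fact ab)
  then have "?m a \<le> ?m (a + b) \<or> ?m b \<le> ?m (a + b)" by (auto simp: min_def split: if_splits)
  then have "padic_abs p (x + y) \<le> padic_abs p x \<or> padic_abs p (x + y) \<le> padic_abs p y"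
    unfolding xy unfolding d(2,3) padic_abs_divide[OF ab(1) d(1)]
      padic_abs_divide[OF ab(2) d(1)] padic_abs_divide[OF ab(3) d(1)]
  proof (rule disj_forward)
  qed (intro power_int_increasing p1, simp)+
  then show ?thesis by (simp add: le_max_iff_disj)
qed

lemma padic_abs_triangle: "padic_abs p (x + y) \<le> padic_abs p x + padic_abs p y"
  using padic_abs_ultra[of x y] padic_abs_nonneg[of x] padic_abs_nonneg[of y] by linarith

lemma padic_abs_triangle_diff: "padic_abs p (x - z) \<le> padic_abs p (x - y) + padic_abs p (y - z)"
  using padic_abs_triangle[of "x - y" "y - z"] by simp

lemma padic_abs_reverse_triangle: "\<bar>padic_abs p x - padic_abs p y\<bar> \<le> padic_abs p (x - y)"
  using padic_abs_triangle[of "x - y" y] padic_abs_triangle[of "y - x" x]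
  by (simp add: padic_abs_commute[of y x])

lemma padic_abs_inverse: "padic_abs p (inverse x) = inverse (padic_abs p x)"
proof (cases "x = 0")
  case False
  then have "padic_abs p x * padic_abs p (inverse x) = 1"
    by (simp flip: padic_abs_mult)
  then show ?thesis by (metis inverse_unique)
qed simp


subsection \<open>Cauchy sequences\<close>

lemma padic_cauchy_const: "padic_cauchy p (\<lambda>n. x)"
  by (simp add: padic_cauchy_def)

lemma padic_cauchy_convergent:
  assumes "padic_cauchy p X"
  shows "convergent (\<lambda>n. padic_abs p (X n))"
proof -
  have "Cauchy (\<lambda>n. padic_abs p (X n))"
  proof (rule metric_CauchyI)
    fix e :: real assume "e > 0"
    then obtain N where "\<forall>m\<ge>N. \<forall>n\<ge>N. padic_abs p (X m - X n) < e"
      using assms by (auto simp: padic_cauchy_def)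
    then show "\<exists>N. \<forall>m\<ge>N. \<forall>n\<ge>N. dist (padic_abs p (X m)) (padic_abs p (X n)) < e"
      by (metis dist_real_def padic_abs_reverse_triangle order_le_less_trans)
  qed
  then show ?thesis by (simp add: Cauchy_convergent_iff)
qed

lemma padic_cauchy_bounded:
  assumes "padic_cauchy p X"
  obtains b where "b > 0" "\<And>n. padic_abs p (X n) \<le> b"
proof -
  have "Bseq (\<lambda>n. padic_abs p (X n))"
    using padic_cauchy_convergent[OF assms] by (rule convergent_imp_Bseq)
  then obtain b where "b > 0" "\<forall>n. norm (padic_abs p (X n)) \<le> b" by (rule BseqE)
  then show ?thesis using that by auto
qed

lemma padic_cauchy_add:
  assumes "padic_cauchy p X" "padic_cauchy p Y"
  shows "padic_cauchy p (\<lambda>n. X n + Y n)"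
  unfolding padic_cauchy_def
proof (intro allI impI)
  fix e :: real assume "e > 0"
  then have e: "e / 2 > 0" by simp
  obtain M where M: "\<forall>m\<ge>M. \<forall>n\<ge>M. padic_abs p (X m - X n) < e / 2"
    using assms(1) e unfolding padic_cauchy_def by blast
  obtain N where N: "\<forall>m\<ge>N. \<forall>n\<ge>N. padic_abs p (Y m - Y n) < e / 2"
    using assms(2) e unfolding padic_cauchy_def by blast
  have "padic_abs p (X m + Y m - (X n + Y n)) < e" if "m \<ge> max M N" "n \<ge> max M N" for m n
  proof -
    have "padic_abs p (X m + Y m - (X n + Y n)) \<le>
        padic_abs p (X m - X n) + padic_abs p (Y m - Y n)"
      using padic_abs_triangle[of "X m - X n" "Y m - Y n"] by (simp add: algebra_simps)
    moreover have "padic_abs p (X m - X n) < e / 2" "padic_abs p (Y m - Y n) < e / 2"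
      using M N that by auto
    ultimately show ?thesis by linarith
  qed
  then show "\<exists>N. \<forall>m\<ge>N. \<forall>n\<ge>N. padic_abs p (X m + Y m - (X n + Y n)) < e" by blast
qed

lemma padic_cauchy_minus: "padic_cauchy p X \<Longrightarrow> padic_cauchy p (\<lambda>n. - X n)"
  unfolding padic_cauchy_def padic_abs_minus_diff .

lemma padic_cauchy_mult:
  assumes "padic_cauchy p X" "padic_cauchy p Y"
  shows "padic_cauchy p (\<lambda>n. X n * Y n)"
  unfolding padic_cauchy_def
proof (intro allI impI)
  fix e :: real assume "e > 0"
  obtain b where b: "b > 0" "\<And>n. padic_abs p (X n) \<le> b"
    using padic_cauchy_bounded[OF assms(1)] by blast
  obtain c where c: "c > 0" "\<And>n. padic_abs p (Y n) \<le> c"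
    using padic_cauchy_bounded[OF assms(2)] by blast
  have e: "e / 2 / c > 0" "e / 2 / b > 0" using \<open>e > 0\<close> b c by auto
  obtain M where M: "\<forall>m\<ge>M. \<forall>n\<ge>M. padic_abs p (X m - X n) < e / 2 / c"
    using assms(1) e unfolding padic_cauchy_def by blast
  obtain N where N: "\<forall>m\<ge>N. \<forall>n\<ge>N. padic_abs p (Y m - Y n) < e / 2 / b"
    using assms(2) e unfolding padic_cauchy_def by blast
  have "padic_abs p (X m * Y m - X n * Y n) < e" if "m \<ge> max M N" "n \<ge> max M N" for m n
  proof -
    have "X m * Y m - X n * Y n = (X m - X n) * Y m + X n * (Y m - Y n)"
      by (simp add: algebra_simps)
    then have "padic_abs p (X m * Y m - X n * Y n) \<le>
        padic_abs p (X m - X n) * padic_abs p (Y m) + padic_abs p (X n) * padic_abs p (Y m - Y n)"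
      by (metis padic_abs_triangle padic_abs_mult)
    also have "padic_abs p (X m - X n) * padic_abs p (Y m) \<le> padic_abs p (X m - X n) * c"
      using c by (simp add: mult_left_mono)
    also have "padic_abs p (X n) * padic_abs p (Y m - Y n) \<le> b * padic_abs p (Y m - Y n)"
      using b by (simp add: mult_right_mono)
    also have "padic_abs p (X m - X n) * c < e / 2"
      using M that by (simp only: max.bounded_iff flip: pos_less_divide_eq[OF c(1)])
    also have "b * padic_abs p (Y m - Y n) < e / 2"
      using N that by (simp only: max.bounded_iff mult.commute[of b] flip: pos_less_divide_eq[OF b(1)])
    finally show ?thesis by simp
  qed
  then show "\<exists>N. \<forall>m\<ge>N. \<forall>n\<ge>N. padic_abs p (X m * Y m - X n * Y n) < e" by blast
qed

lemma padic_cauchy_nonvanishing: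
  assumes "padic_cauchy p X" "\<not> (\<lambda>n. padic_abs p (X n)) \<longlonglongrightarrow> 0"
  obtains b N where "b > 0" "\<And>n. n \<ge> N \<Longrightarrow> padic_abs p (X n) > b"
proof -
  obtain L where L: "(\<lambda>n. padic_abs p (X n)) \<longlonglongrightarrow> L"
    using padic_cauchy_convergent[OF assms(1)] by (auto simp: convergent_def)
  have "L \<ge> 0" using L by (rule LIMSEQ_le_const) auto
  with assms(2) L have "L > 0" by (cases "L = 0") auto
  then have "eventually (\<lambda>n. padic_abs p (X n) > L / 2) sequentially"
    using L by (intro order_tendstoD) auto
  then show ?thesis using that[of "L / 2"] \<open>L > 0\<close> by (auto simp: eventually_sequentially)
qed

lemma padic_cauchy_inverse:
  assumes "padic_cauchy p X" "\<not> (\<lambda>n. padic_abs p (X n)) \<longlonglongrightarrow> 0"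
  shows "padic_cauchy p (\<lambda>n. inverse (X n))"
  unfolding padic_cauchy_def
proof (intro allI impI)
  fix e :: real assume "e > 0"
  obtain b N where b: "b > 0" "\<And>n. n \<ge> N \<Longrightarrow> padic_abs p (X n) > b"
    using padic_cauchy_nonvanishing[OF assms] by blast
  have "e * (b * b) > 0" using \<open>e > 0\<close> b by simp
  then obtain M where M: "\<forall>m\<ge>M. \<forall>n\<ge>M. padic_abs p (X m - X n) < e * (b * b)"
    using assms(1) unfolding padic_cauchy_def by blast
  have "padic_abs p (inverse (X m) - inverse (X n)) < e"
    if mn: "m \<ge> max M N" "n \<ge> max M N" for m n
  proof -
    have bm: "padic_abs p (X m) > b" "padic_abs p (X n) > b" using b mn by auto
    then have nz: "X m \<noteq> 0" "X n \<noteq> 0" using b(1) by auto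
    have "inverse (X m) - inverse (X n) = (X n - X m) * inverse (X m * X n)"
      using nz by (simp add: field_simps)
    then have "padic_abs p (inverse (X m) - inverse (X n)) =
        padic_abs p (X n - X m) / (padic_abs p (X m) * padic_abs p (X n))"
      by (simp add: padic_abs_mult padic_abs_inverse divide_inverse)
    also have "\<dots> \<le> padic_abs p (X n - X m) / (b * b)"
      using bm b(1) by (intro divide_left_mono mult_mono) auto
    also have "\<dots> < e" using M mn b(1) by (simp add: pos_divide_less_eq)
    finally show ?thesis .
  qed
  then show "\<exists>N. \<forall>m\<ge>N. \<forall>n\<ge>N. padic_abs p (inverse (X m) - inverse (X n)) < e" by blast
qed

lemma padic_abs_tendsto_0I:
  assumes "\<And>n. padic_abs p (X n) \<le> g n" "g \<longlonglongrightarrow> 0"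
  shows "(\<lambda>n. padic_abs p (X n)) \<longlonglongrightarrow> 0"
  using assms(2) by (rule Lim_null_comparison[rotated]) (simp add: assms(1))

lemma padic_rel_refl: "padic_cauchy p X \<Longrightarrow> padic_rel p X X"
  by (simp add: padic_rel_def)

lemma part_equivp_padic_rel: "part_equivp (padic_rel p)"
proof (rule part_equivpI)
  show "\<exists>X. padic_rel p X X" using padic_rel_refl padic_cauchy_const by blast
  show "symp (padic_rel p)"
  proof (rule sympI)
    fix X Y assume "padic_rel p X Y"
    moreover have "(\<lambda>n. padic_abs p (X n - Y n)) = (\<lambda>n. padic_abs p (Y n - X n))"
      by (intro ext padic_abs_commute)
    ultimately show "padic_rel p Y X" unfolding padic_rel_def by simp
  qed
  show "transp (padic_rel p)"
  proof (rule transpI)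
    fix X Y Z assume *: "padic_rel p X Y" "padic_rel p Y Z"
    have "(\<lambda>n. padic_abs p (X n - Y n) + padic_abs p (Y n - Z n)) \<longlonglongrightarrow> 0 + 0"
      using * unfolding padic_rel_def by (intro tendsto_add) auto
    then have "(\<lambda>n. padic_abs p (X n - Z n)) \<longlonglongrightarrow> 0"
      by (intro padic_abs_tendsto_0I[OF padic_abs_triangle_diff]) simp
    then show "padic_rel p X Z" using * unfolding padic_rel_def by blast
  qed
qed

lemma padic_rel_add:
  assumes "padic_rel p X X'" "padic_rel p Y Y'"
  shows "padic_rel p (\<lambda>n. X n + Y n) (\<lambda>n. X' n + Y' n)"
proof -
  have "(\<lambda>n. padic_abs p (X n - X' n) + padic_abs p (Y n - Y' n)) \<longlonglongrightarrow> 0 + 0"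
    using assms unfolding padic_rel_def by (intro tendsto_add) auto
  then have lim: "(\<lambda>n. padic_abs p (X n - X' n) + padic_abs p (Y n - Y' n)) \<longlonglongrightarrow> 0" by simp
  have "padic_abs p (X n + Y n - (X' n + Y' n)) \<le>
      padic_abs p (X n - X' n) + padic_abs p (Y n - Y' n)" for n
    using padic_abs_triangle[of "X n - X' n" "Y n - Y' n"] by (simp add: algebra_simps)
  then have "(\<lambda>n. padic_abs p (X n + Y n - (X' n + Y' n))) \<longlonglongrightarrow> 0"
    using lim by (rule padic_abs_tendsto_0I)
  then show ?thesis using assms unfolding padic_rel_def by (simp add: padic_cauchy_add)
qed

lemma padic_rel_minus:
  assumes "padic_rel p X X'"
  shows "padic_rel p (\<lambda>n. - X n) (\<lambda>n. - X' n)"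
  using assms unfolding padic_rel_def padic_abs_minus_diff by (simp add: padic_cauchy_minus)

lemma padic_rel_mult:
  assumes "padic_rel p X X'" "padic_rel p Y Y'"
  shows "padic_rel p (\<lambda>n. X n * Y n) (\<lambda>n. X' n * Y' n)"
proof -
  have cauchy: "padic_cauchy p X" "padic_cauchy p X'" "padic_cauchy p Y" "padic_cauchy p Y'"
    using assms by (auto simp: padic_rel_def)
  obtain b where b: "b > 0" "\<And>n. padic_abs p (X' n) \<le> b"
    using padic_cauchy_bounded[OF cauchy(2)] by blast
  obtain c where c: "c > 0" "\<And>n. padic_abs p (Y n) \<le> c"
    using padic_cauchy_bounded[OF cauchy(3)] by blast
  have "(\<lambda>n. padic_abs p (X n - X' n) * c + b * padic_abs p (Y n - Y' n)) \<longlonglongrightarrow> 0 * c + b * 0"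
    using assms unfolding padic_rel_def by (intro tendsto_intros) auto
  then have lim: "(\<lambda>n. padic_abs p (X n - X' n) * c + b * padic_abs p (Y n - Y' n)) \<longlonglongrightarrow> 0"
    by simp
  have "padic_abs p (X n * Y n - X' n * Y' n) \<le>
      padic_abs p (X n - X' n) * c + b * padic_abs p (Y n - Y' n)" for n
  proof -
    have "X n * Y n - X' n * Y' n = (X n - X' n) * Y n + X' n * (Y n - Y' n)"
      by (simp add: algebra_simps)
    then have "padic_abs p (X n * Y n - X' n * Y' n) \<le>
        padic_abs p (X n - X' n) * padic_abs p (Y n) + padic_abs p (X' n) * padic_abs p (Y n - Y' n)"
      by (metis padic_abs_triangle padic_abs_mult)
    also have "\<dots> \<le> padic_abs p (X n - X' n) * c + b * padic_abs p (Y n - Y' n)"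
      using b c by (intro add_mono mult_left_mono mult_right_mono) auto
    finally show ?thesis .
  qed
  then have "(\<lambda>n. padic_abs p (X n * Y n - X' n * Y' n)) \<longlonglongrightarrow> 0"
    using lim by (rule padic_abs_tendsto_0I)
  then show ?thesis using cauchy unfolding padic_rel_def by (simp add: padic_cauchy_mult)
qed

lemma padic_rel_abs_diff:
  assumes "padic_rel p X Y"
  shows "(\<lambda>n. padic_abs p (X n) - padic_abs p (Y n)) \<longlonglongrightarrow> 0"
proof (rule Lim_null_comparison)
  show "(\<lambda>n. padic_abs p (X n - Y n)) \<longlonglongrightarrow> 0"
    using assms unfolding padic_rel_def by blast
qed (simp add: padic_abs_reverse_triangle)

lemma padic_rel_abs_tendsto:
  assumes "padic_rel p X Y"
  shows "(\<lambda>n. padic_abs p (X n)) \<longlonglongrightarrow> L \<longleftrightarrow> (\<lambda>n. padic_abs p (Y n)) \<longlonglongrightarrow> L"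
proof
  assume "(\<lambda>n. padic_abs p (X n)) \<longlonglongrightarrow> L"
  from this padic_rel_abs_diff[OF assms]
  show "(\<lambda>n. padic_abs p (Y n)) \<longlonglongrightarrow> L" by (rule Lim_transform2)
next
  assume "(\<lambda>n. padic_abs p (Y n)) \<longlonglongrightarrow> L"
  from this padic_rel_abs_diff[OF assms]
  show "(\<lambda>n. padic_abs p (X n)) \<longlonglongrightarrow> L" by (rule Lim_transform)
qed

lemma padic_rel_inverse:
  assumes "padic_rel p X Y" "\<not> (\<lambda>n. padic_abs p (X n)) \<longlonglongrightarrow> 0"
  shows "padic_rel p (\<lambda>n. inverse (X n)) (\<lambda>n. inverse (Y n))"
proof -
  have cauchy: "padic_cauchy p X" "padic_cauchy p Y"
    using assms by (auto simp: padic_rel_def)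
  have nv: "\<not> (\<lambda>n. padic_abs p (Y n)) \<longlonglongrightarrow> 0"
    using assms padic_rel_abs_tendsto by blast
  obtain b N where b: "b > 0" "\<And>n. n \<ge> N \<Longrightarrow> padic_abs p (X n) > b"
    using padic_cauchy_nonvanishing[OF cauchy(1) assms(2)] by blast
  obtain c M where c: "c > 0" "\<And>n. n \<ge> M \<Longrightarrow> padic_abs p (Y n) > c"
    using padic_cauchy_nonvanishing[OF cauchy(2) nv] by blast
  have lim: "(\<lambda>n. padic_abs p (X n - Y n) / (b * c)) \<longlonglongrightarrow> 0"
    using assms(1) unfolding padic_rel_def by (intro tendsto_divide_zero) auto
  have "norm (padic_abs p (inverse (X n) - inverse (Y n))) \<le> padic_abs p (X n - Y n) / (b * c)"
    if "n \<ge> max M N" for n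
  proof -
    have bm: "padic_abs p (X n) > b" "padic_abs p (Y n) > c" using b c that by auto
    then have nz: "X n \<noteq> 0" "Y n \<noteq> 0" using b(1) c(1) by auto
    have "inverse (X n) - inverse (Y n) = (Y n - X n) * inverse (X n * Y n)"
      using nz by (simp add: field_simps)
    then have "padic_abs p (inverse (X n) - inverse (Y n)) =
        padic_abs p (X n - Y n) / (padic_abs p (X n) * padic_abs p (Y n))"
      by (simp add: padic_abs_mult padic_abs_inverse divide_inverse padic_abs_commute)
    also have "\<dots> \<le> padic_abs p (X n - Y n) / (b * c)"
      using bm b(1) c(1) by (intro divide_left_mono mult_mono) auto
    finally show ?thesis by simp
  qed
  then have "eventually (\<lambda>n. norm (padic_abs p (inverse (X n) - inverse (Y n)))
      \<le> padic_abs p (X n - Y n) / (b * c)) sequentially"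
    by (intro eventually_sequentiallyI[of "max M N"])
  then have "(\<lambda>n. padic_abs p (inverse (X n) - inverse (Y n))) \<longlonglongrightarrow> 0"
    using lim by (rule Lim_null_comparison)
  then show ?thesis
    using padic_cauchy_inverse[OF cauchy(1) assms(2)] padic_cauchy_inverse[OF cauchy(2) nv]
    by (simp add: padic_rel_def)
qed

end


subsection \<open>The completion\<close>

text \<open>The prime is carried by the type: \<open>'p padic\<close> is the completion of the rationals for
  the p-adic absolute value with p the (prime) cardinality of \<open>'p\<close>.\<close>

typedef (overloaded) ('p::prime_card) padic =
  "{c. \<exists>X. padic_rel CARD('p) X X \<and> c = Collect (padic_rel CARD('p) X)}"
  morphisms padic_class Padic_class
  using padic_rel_refl[OF prime_card padic_cauchy_const[OF prime_card]] by blast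

definition Padic :: "(nat \<Rightarrow> rat) \<Rightarrow> 'p::prime_card padic" where
  "Padic X = Padic_class (Collect (padic_rel CARD('p) X))"

definition rep_padic :: "'p::prime_card padic \<Rightarrow> nat \<Rightarrow> rat" where
  "rep_padic x = (SOME X. X \<in> padic_class x)"

definition cr_padic :: "(nat \<Rightarrow> rat) \<Rightarrow> 'p::prime_card padic \<Rightarrow> bool" where
  "cr_padic \<equiv> \<lambda>X x. padic_rel CARD('p) X X \<and> Padic X = x"

lemma Quotient_padic:
  "Quotient (padic_rel CARD('p::prime_card)) Padic (rep_padic :: 'p padic \<Rightarrow> _) cr_padic"
proof -
  interpret q: quot_type "padic_rel CARD('p)" Padic_class "padic_class :: 'p padic \<Rightarrow> _"
  proof
    show "part_equivp (padic_rel CARD('p))" by (rule part_equivp_padic_rel[OF prime_card])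
    show "\<exists>X. padic_rel CARD('p) X X \<and> padic_class x = Collect (padic_rel CARD('p) X)"
      for x :: "'p padic" using padic_class[of x] by blast
    show "Padic_class (padic_class x) = x" for x :: "'p padic" by (rule padic_class_inverse)
    show "padic_class (Padic_class c :: 'p padic) = c"
      if "\<exists>X. padic_rel CARD('p) X X \<and> c = Collect (padic_rel CARD('p) X)" for c
      using that by (intro Padic_class_inverse) blast
    show "padic_class x = padic_class y \<longleftrightarrow> x = y" for x y :: "'p padic"
      by (rule padic_class_inject)
  qed
  have "q.abs = Padic" "q.rep = rep_padic"
    by (auto simp: fun_eq_iff q.abs_def q.rep_def Padic_def rep_padic_def)
  then have "Quotient3 (padic_rel CARD('p)) Padic (rep_padic :: 'p padic \<Rightarrow> _)"
    using q.Quotient by simp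
  from this cr_padic_def show ?thesis by (rule Quotient3_to_Quotient)
qed

setup_lifting Quotient_padic

lemma Padic_cases:
  obtains X where "padic_cauchy CARD('p) X" "x = (Padic X :: 'p::prime_card padic)"
  using Quotient_rep_reflp[OF Quotient_padic, of x] Quotient_abs_rep[OF Quotient_padic, of x]
  unfolding padic_rel_def by metis

lemma Padic_eq_iff:
  assumes "padic_cauchy CARD('p) X" "padic_cauchy CARD('p) Y"
  shows "Padic X = (Padic Y :: 'p::prime_card padic) \<longleftrightarrow>
    (\<lambda>n. padic_abs CARD('p) (X n - Y n)) \<longlonglongrightarrow> 0"
  using Quotient_rel[OF Quotient_padic[where 'p='p], of X Y] assms
    padic_rel_refl[OF prime_card assms(1)] padic_rel_refl[OF prime_card assms(2)]
  by (simp only: padic_rel_def simp_thms)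

instantiation padic :: (prime_card) field
begin

lift_definition zero_padic :: "'a padic" is "\<lambda>n. 0"
  by (simp add: padic_rel_refl padic_cauchy_const prime_card)

lift_definition one_padic :: "'a padic" is "\<lambda>n. 1"
  by (simp add: padic_rel_refl padic_cauchy_const prime_card)

lift_definition plus_padic :: "'a padic \<Rightarrow> 'a padic \<Rightarrow> 'a padic" is "\<lambda>X Y n. X n + Y n"
  by (rule padic_rel_add[OF prime_card])

lift_definition uminus_padic :: "'a padic \<Rightarrow> 'a padic" is "\<lambda>X n. - X n"
  by (rule padic_rel_minus[OF prime_card])

lift_definition times_padic :: "'a padic \<Rightarrow> 'a padic \<Rightarrow> 'a padic" is "\<lambda>X Y n. X n * Y n"
  by (rule padic_rel_mult[OF prime_card])

lift_definition inverse_padic :: "'a padic \<Rightarrow> 'a padic" is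
  "\<lambda>X. if (\<lambda>n. padic_abs CARD('a) (X n)) \<longlonglongrightarrow> 0 then (\<lambda>n. 0) else (\<lambda>n. inverse (X n))"
proof -
  fix X Y assume rel: "padic_rel CARD('a) X Y"
  show "padic_rel CARD('a)
      (if (\<lambda>n. padic_abs CARD('a) (X n)) \<longlonglongrightarrow> 0 then \<lambda>n. 0 else (\<lambda>n. inverse (X n)))
      (if (\<lambda>n. padic_abs CARD('a) (Y n)) \<longlonglongrightarrow> 0 then \<lambda>n. 0 else (\<lambda>n. inverse (Y n)))"
  proof (cases "(\<lambda>n. padic_abs CARD('a) (X n)) \<longlonglongrightarrow> 0")
    case True
    then have "(\<lambda>n. padic_abs CARD('a) (Y n)) \<longlonglongrightarrow> 0"
      using padic_rel_abs_tendsto[OF prime_card rel] by blast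
    with True show ?thesis
      by (simp only: if_True padic_rel_refl[OF prime_card] padic_cauchy_const[OF prime_card])
  next
    case False
    then have "\<not> (\<lambda>n. padic_abs CARD('a) (Y n)) \<longlonglongrightarrow> 0"
      using padic_rel_abs_tendsto[OF prime_card rel] by blast
    then show ?thesis
      by (simp only: False if_False padic_rel_inverse[OF prime_card rel False])
  qed
qed

definition minus_padic :: "'a padic \<Rightarrow> 'a padic \<Rightarrow> 'a padic"
  where "minus_padic x y = x + - y"

definition divide_padic :: "'a padic \<Rightarrow> 'a padic \<Rightarrow> 'a padic"
  where "divide_padic x y = x * inverse y"

lemma Padic_add:
  "padic_cauchy CARD('a) X \<Longrightarrow> padic_cauchy CARD('a) Y \<Longrightarrow>
     Padic X + Padic Y = (Padic (\<lambda>n. X n + Y n) :: 'a padic)"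
  by (intro plus_padic.abs_eq padic_rel_refl[OF prime_card])

lemma Padic_uminus:
  "padic_cauchy CARD('a) X \<Longrightarrow> - Padic X = (Padic (\<lambda>n. - X n) :: 'a padic)"
  by (intro uminus_padic.abs_eq padic_rel_refl[OF prime_card])

lemma Padic_mult:
  "padic_cauchy CARD('a) X \<Longrightarrow> padic_cauchy CARD('a) Y \<Longrightarrow>
     Padic X * Padic Y = (Padic (\<lambda>n. X n * Y n) :: 'a padic)"
  by (intro times_padic.abs_eq padic_rel_refl[OF prime_card])

lemma Padic_inverse:
  "padic_cauchy CARD('a) X \<Longrightarrow> inverse (Padic X) = (Padic
     (if (\<lambda>n. padic_abs CARD('a) (X n)) \<longlonglongrightarrow> 0 then \<lambda>n. 0 else (\<lambda>n. inverse (X n))) :: 'a padic)"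
  by (intro inverse_padic.abs_eq padic_rel_refl[OF prime_card])

instance
proof
  note [simp] = Padic_add Padic_uminus Padic_mult zero_padic_def one_padic_def
    padic_cauchy_add[OF prime_card] padic_cauchy_mult[OF prime_card]
    padic_cauchy_minus[OF prime_card] padic_cauchy_const[OF prime_card]
  fix a b c :: "'a padic"
  obtain X where X [simp]: "padic_cauchy CARD('a) X" and a: "a = Padic X" by (rule Padic_cases)
  obtain Y where Y [simp]: "padic_cauchy CARD('a) Y" and b: "b = Padic Y" by (rule Padic_cases)
  obtain Z where Z [simp]: "padic_cauchy CARD('a) Z" and c: "c = Padic Z" by (rule Padic_cases)
  show "a + b + c = a + (b + c)" by (simp add: a b c add.assoc)
  show "a + b = b + a" by (simp add: a b add.commute)
  show "0 + a = a" by (simp add: a)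
  show "- a + a = 0" by (simp add: a)
  show "a - b = a + - b" by (rule minus_padic_def)
  show "a * b * c = a * (b * c)" by (simp add: a b c mult.assoc)
  show "a * b = b * a" by (simp add: a b mult.commute)
  show "1 * a = a" by (simp add: a)
  show "(a + b) * c = a * c + b * c" by (simp add: a b c distrib_right)
  show "(0::'a padic) \<noteq> 1"
    by (simp add: Padic_eq_iff padic_abs_minus[OF prime_card] padic_abs_one[OF prime_card]
        LIMSEQ_const_iff)
  show "inverse (0::'a padic) = 0"
    by (simp add: Padic_inverse padic_abs_zero[OF prime_card])
  show "a div b = a * inverse b" by (rule divide_padic_def)
  show "inverse a * a = 1" if "a \<noteq> 0"
  proof -
    have nv: "\<not> (\<lambda>n. padic_abs CARD('a) (X n)) \<longlonglongrightarrow> 0"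
      using that by (simp add: a Padic_eq_iff)
    obtain e N where e: "e > 0" "\<And>n. n \<ge> N \<Longrightarrow> padic_abs CARD('a) (X n) > e"
      using padic_cauchy_nonvanishing[OF prime_card X nv] by blast
    have "X n \<noteq> 0" if "n \<ge> N" for n
      using e(1) e(2)[OF that] by (auto simp: padic_abs_def)
    then have "eventually (\<lambda>n. padic_abs CARD('a) (inverse (X n) * X n - 1) = 0) sequentially"
      by (intro eventually_sequentiallyI[of N]) (simp add: padic_abs_def)
    then have "(\<lambda>n. padic_abs CARD('a) (inverse (X n) * X n - 1)) \<longlonglongrightarrow> 0"
      by (rule tendsto_eventually)
    then show ?thesis
      using padic_cauchy_inverse[OF prime_card X nv] nv
      by (simp add: a Padic_inverse Padic_eq_iff)
  qed
qed

end

lift_definition padic_norm :: "'p::prime_card padic \<Rightarrow> real"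
  is "\<lambda>X. lim (\<lambda>n. padic_abs CARD('p) (X n))"
  by (simp only: lim_def padic_rel_abs_tendsto[OF prime_card])

lemma padic_norm_Padic:
  assumes "padic_cauchy CARD('p) X"
  shows "(\<lambda>n. padic_abs CARD('p) (X n)) \<longlonglongrightarrow> padic_norm (Padic X :: 'p::prime_card padic)"
  using padic_cauchy_convergent[OF prime_card assms] padic_norm.abs_eq[OF padic_rel_refl[OF prime_card assms]]
  by (simp only: convergent_LIMSEQ_iff)

lemma padic_norm_const:
  "padic_norm (Padic (\<lambda>_. q) :: 'p::prime_card padic) = padic_abs CARD('p) q"
  using padic_norm_Padic[OF padic_cauchy_const[OF prime_card, where 'a1='p], of q]
  by (simp only: LIMSEQ_const_iff)

lemma padic_norm_eq_0: "padic_norm x = 0 \<longleftrightarrow> x = (0 :: 'p::prime_card padic)"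
proof -
  obtain X where X: "padic_cauchy CARD('p) X" "x = Padic X" by (rule Padic_cases)
  have "x = 0 \<longleftrightarrow> (\<lambda>n. padic_abs CARD('p) (X n)) \<longlonglongrightarrow> 0"
    using Padic_eq_iff[OF X(1) padic_cauchy_const[OF prime_card], of 0]
    by (simp only: X(2) zero_padic_def diff_0_right)
  then show ?thesis
    using padic_norm_Padic[OF X(1)] LIMSEQ_unique unfolding X(2) by metis
qed

lemma padic_norm_mult: "padic_norm (x * y) = padic_norm x * padic_norm (y :: 'p::prime_card padic)"
proof -
  obtain X where X: "padic_cauchy CARD('p) X" "x = Padic X" by (rule Padic_cases)
  obtain Y where Y: "padic_cauchy CARD('p) Y" "y = Padic Y" by (rule Padic_cases)
  have "(\<lambda>n. padic_abs CARD('p) (X n * Y n)) \<longlonglongrightarrow> padic_norm (x * y)"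
    using padic_norm_Padic[OF padic_cauchy_mult[OF prime_card X(1) Y(1)]]
    by (simp only: X(2) Y(2) Padic_mult[OF X(1) Y(1)])
  moreover have "(\<lambda>n. padic_abs CARD('p) (X n * Y n)) \<longlonglongrightarrow> padic_norm x * padic_norm y"
    unfolding padic_abs_mult[OF prime_card] X(2) Y(2)
    by (intro tendsto_mult padic_norm_Padic X Y)
  ultimately show ?thesis by (rule LIMSEQ_unique)
qed

lemma padic_norm_uminus: "padic_norm (- x) = padic_norm (x :: 'p::prime_card padic)"
proof -
  obtain X where X: "padic_cauchy CARD('p) X" "x = Padic X" by (rule Padic_cases)
  have "(\<lambda>n. padic_abs CARD('p) (X n)) \<longlonglongrightarrow> padic_norm (- x)"
    using padic_norm_Padic[OF padic_cauchy_minus[OF prime_card X(1)]]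
    by (simp only: X(2) Padic_uminus[OF X(1)] padic_abs_minus[OF prime_card])
  then show ?thesis using padic_norm_Padic[OF X(1)] unfolding X(2) by (rule LIMSEQ_unique)
qed

lemma padic_norm_ultra:
  "padic_norm (x + y) \<le> max (padic_norm x) (padic_norm (y :: 'p::prime_card padic))"
proof -
  obtain X where X: "padic_cauchy CARD('p) X" "x = Padic X" by (rule Padic_cases)
  obtain Y where Y: "padic_cauchy CARD('p) Y" "y = Padic Y" by (rule Padic_cases)
  have "(\<lambda>n. padic_abs CARD('p) (X n + Y n)) \<longlonglongrightarrow> padic_norm (x + y)"
    using padic_norm_Padic[OF padic_cauchy_add[OF prime_card X(1) Y(1)]]
    by (simp only: X(2) Y(2) Padic_add[OF X(1) Y(1)])
  moreover have "(\<lambda>n. max (padic_abs CARD('p) (X n)) (padic_abs CARD('p) (Y n)))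
      \<longlonglongrightarrow> max (padic_norm x) (padic_norm y)"
    unfolding X(2) Y(2) by (intro tendsto_max padic_norm_Padic X Y)
  ultimately show ?thesis
    by (rule LIMSEQ_le) (use padic_abs_ultra[OF prime_card] in blast)
qed

lemma padic_norm_nonneg: "padic_norm (x :: 'p::prime_card padic) \<ge> 0"
  using padic_norm_ultra[of x "- x"] padic_norm_eq_0[of "0 :: 'p padic"]
  by (simp add: padic_norm_uminus)

instantiation padic :: (prime_card) metric_space
begin

definition dist_padic :: "'a padic \<Rightarrow> 'a padic \<Rightarrow> real"
  where "dist_padic x y = padic_norm (x - y)"

definition uniformity_padic :: "('a padic \<times> 'a padic) filter"
  where "uniformity_padic = (INF e\<in>{0<..}. principal {(x, y). dist x y < e})"

definition open_padic :: "'a padic set \<Rightarrow> bool"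
  where "open_padic U \<longleftrightarrow> (\<forall>x\<in>U. eventually (\<lambda>(x', y). x' = x \<longrightarrow> y \<in> U) uniformity)"

instance
proof
  fix x y z :: "'a padic"
  show "dist x y = 0 \<longleftrightarrow> x = y" by (simp add: dist_padic_def padic_norm_eq_0)
  have "dist x y \<le> max (padic_norm (x - z)) (padic_norm (z - y))"
    using padic_norm_ultra[of "x - z" "z - y"] by (simp add: dist_padic_def)
  also have "padic_norm (z - y) = dist y z"
    using padic_norm_uminus[of "y - z"] by (simp add: dist_padic_def)
  finally show "dist x y \<le> dist x z + dist y z"
    using padic_norm_nonneg[of "x - z"] padic_norm_nonneg[of "y - z"]
    by (simp add: dist_padic_def)
qed (simp_all only: uniformity_padic_def open_padic_def)

end

definition padic_ints :: "'p::prime_card padic set" where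
  "padic_ints = {x. padic_norm x \<le> 1}"

definition padic_haar :: "'p::prime_card padic measure" where
  "padic_haar = (THE M. sets M = sets borel \<and> (\<forall>a. distr M borel (\<lambda>x. a + x) = M) \<and>
     emeasure M padic_ints = 1)"


section \<open>The surfaces and their Vieta involutions\<close>

type_synonym 'p padic3 = "'p padic \<times> 'p padic \<times> 'p padic"

definition surface ::
  "'p::prime_card padic \<Rightarrow> 'p padic \<Rightarrow> 'p padic \<Rightarrow> 'p padic \<Rightarrow> 'p padic3 set" where
  "surface A B C D = {(x, y, z). x\<^sup>2 + y\<^sup>2 + z\<^sup>2 + x * y * z = A * x + B * y + C * z + D}"

definition int_surface ::
  "'p::prime_card padic \<Rightarrow> 'p padic \<Rightarrow> 'p padic \<Rightarrow> 'p padic \<Rightarrow> 'p padic3 set" where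
  "int_surface A B C D = surface A B C D \<inter> padic_ints \<times> padic_ints \<times> padic_ints"

text \<open>The involutions are taken on the whole affine space, where they are bijective as well;
  they preserve every surface of the family with the given \<open>A, B, C\<close>.\<close>

definition vieta1 :: "'p::prime_card padic \<Rightarrow> 'p padic3 \<Rightarrow> 'p padic3" where
  "vieta1 A = (\<lambda>(x, y, z). (- x + A - y * z, y, z))"

definition vieta2 :: "'p::prime_card padic \<Rightarrow> 'p padic3 \<Rightarrow> 'p padic3" where
  "vieta2 B = (\<lambda>(x, y, z). (x, - y + B - z * x, z))"

definition vieta3 :: "'p::prime_card padic \<Rightarrow> 'p padic3 \<Rightarrow> 'p padic3" where
  "vieta3 C = (\<lambda>(x, y, z). (x, y, - z + C - x * y))"

definition vieta_group ::
  "'p::prime_card padic \<Rightarrow> 'p padic \<Rightarrow> 'p padic \<Rightarrow> ('p padic3 \<Rightarrow> 'p padic3) set" where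
  "vieta_group A B C = generate (BijGroup UNIV) {vieta1 A, vieta2 B, vieta3 C}"

definition vieta_orbit ::
  "'p::prime_card padic \<Rightarrow> 'p padic \<Rightarrow> 'p padic \<Rightarrow> 'p padic3 \<Rightarrow> 'p padic3 set" where
  "vieta_orbit A B C u = {g u | g. g \<in> vieta_group A B C}"

lemma vieta_involutive:
  "vieta1 A (vieta1 A u) = u" "vieta2 B (vieta2 B u) = u" "vieta3 C (vieta3 C u) = u"
  by (cases u; simp add: vieta1_def vieta2_def vieta3_def)+

lemma vieta_in_Bij: "{vieta1 A, vieta2 B, vieta3 C} \<subseteq> carrier (BijGroup UNIV)"
  by (auto simp: BijGroup_def Bij_def intro!: o_bij vieta_involutive ext)

lemma vieta_surface:
  assumes "u \<in> surface A B C D"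
  shows "vieta1 A u \<in> surface A B C D" "vieta2 B u \<in> surface A B C D"
    "vieta3 C u \<in> surface A B C D"
  using assms
  by (auto simp: vieta1_def vieta2_def vieta3_def surface_def power2_eq_square algebra_simps)


section \<open>The symplectic measure\<close>

text \<open>\<open>chart_volume \<pi> g U\<close> is the p-adic integral over \<open>U\<close> of the 2-form \<open>(du \<and> dv) / g\<close>,
  where \<open>\<pi> = (u, v)\<close> is injective on \<open>U\<close> and \<open>g\<close> does not vanish on \<open>U\<close>.\<close>

definition chart_volume ::
  "('p::prime_card padic3 \<Rightarrow> 'p padic \<times> 'p padic) \<Rightarrow> ('p padic3 \<Rightarrow> 'p padic) \<Rightarrow> 'p padic3 set \<Rightarrow> ennreal"
  where
  "chart_volume \<pi> g U = (\<integral>\<^sup>+w\<in>\<pi> ` U. ennreal (1 / padic_norm (g (the_inv_into U \<pi> w)))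
     \<partial>(padic_haar \<Otimes>\<^sub>M padic_haar))"

text \<open>The three charts are given by the projections to two coordinates, in which \<open>\<Omega>\<close> is
  \<open>dx \<and> dy / (2z - C + xy)\<close>, \<open>dy \<and> dz / (2x - A + yz)\<close> and \<open>dz \<and> dx / (2y - B + zx)\<close>. The
  denominators are the partial derivatives of the equation, so that on the smooth locus one of
  them is non-zero and the corresponding projection is locally injective. Singular points carry
  no mass.\<close>

definition symplectic_measure ::
  "'p::prime_card padic \<Rightarrow> 'p padic \<Rightarrow> 'p padic \<Rightarrow> 'p padic \<Rightarrow> 'p padic3 measure" where
  "symplectic_measure A B C D = (THE M.
     let fx = (\<lambda>(x, y, z). 2 * x - A + y * z);
         fy = (\<lambda>(x, y, z). 2 * y - B + z * x);
         fz = (\<lambda>(x, y, z). 2 * z - C + x * y);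
         pxy = (\<lambda>(x, y, z). (x, y));
         pyz = (\<lambda>(x, y, z). (y, z));
         pzx = (\<lambda>(x, y, z). (z, x))
     in sets M = sets (restrict_space borel (int_surface A B C D)) \<and>
       (\<forall>(\<pi>, g) \<in> {(pxy, fz), (pyz, fx), (pzx, fy)}.
          \<forall>U \<in> sets M. inj_on \<pi> U \<and> 0 \<notin> g ` U \<longrightarrow> emeasure M U = chart_volume \<pi> g U) \<and>
       emeasure M {u \<in> int_surface A B C D. fx u = 0 \<and> fy u = 0 \<and> fz u = 0} = 0)"


section \<open>Stationary and ergodic measures\<close>

definition stationary_measures ::
  "'p::prime_card padic \<Rightarrow> 'p padic \<Rightarrow> 'p padic \<Rightarrow> 'p padic \<Rightarrow>
   ('p padic3 \<Rightarrow> 'p padic3) pmf \<Rightarrow> 'p padic3 measure set" where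
  "stationary_measures A B C D \<mu> =
     {\<nu>. prob_space \<nu> \<and> sets \<nu> = sets (restrict_space borel (surface A B C D)) \<and>
        (\<forall>E \<in> sets \<nu>. (\<Sum>s\<in>{vieta1 A, vieta2 B, vieta3 C}.
            pmf \<mu> s * measure \<nu> (s -` E \<inter> space \<nu>)) = measure \<nu> E)}"

text \<open>Convex-geometric notions for sets of measures refer to the real vector space of functions
  on sets, in which a finite measure \<open>\<nu>\<close> is represented by the set function \<open>measure \<nu>\<close>.\<close>

instantiation "fun" :: (type, real_vector) real_vector
begin

definition scaleR_fun :: "real \<Rightarrow> ('a \<Rightarrow> 'b) \<Rightarrow> 'a \<Rightarrow> 'b"
  where "scaleR_fun r f = (\<lambda>x. r *\<^sub>R f x)"

instance
  by standard (simp_all add: scaleR_fun_def fun_eq_iff algebra_simps)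

end

lemma inj_on_measure_stationary: "inj_on measure (stationary_measures A B C D \<mu>)"
proof (rule inj_onI)
  fix M N assume *: "M \<in> stationary_measures A B C D \<mu>" "N \<in> stationary_measures A B C D \<mu>"
    and eq: "measure M = measure N"
  interpret M: prob_space M using * by (simp add: stationary_measures_def)
  interpret N: prob_space N using * by (simp add: stationary_measures_def)
  show "M = N"
    using * by (intro measure_eqI)
      (simp_all add: stationary_measures_def M.emeasure_eq_measure N.emeasure_eq_measure eq)
qed

definition ergodic_measures ::
  "'p::prime_card padic \<Rightarrow> 'p padic \<Rightarrow> 'p padic \<Rightarrow> 'p padic \<Rightarrow>
   ('p padic3 \<Rightarrow> 'p padic3) pmf \<Rightarrow> 'p padic3 measure set" where
  "ergodic_measures A B C D \<mu> = {\<nu> \<in> stationary_measures A B C D \<mu>.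
     measure \<nu> extreme_point_of (measure ` stationary_measures A B C D \<mu>)}"

text \<open>The library's \<open>simplex\<close> is restricted to Euclidean spaces. As there, the empty set is a
  simplex (of dimension -1).\<close>

definition finite_dim_simplex :: "'a::real_vector set \<Rightarrow> bool" where
  "finite_dim_simplex X \<longleftrightarrow> (\<exists>V. finite V \<and> \<not> affine_dependent V \<and> X = convex hull V)"

end

theory Submission
  imports Defs
begin

text \<open>On \<open>S(Z\<^sub>p)\<close> the involutions are isometries, so orbit closures partition it. A suitable power of
  the rotation \<open>s\<^sub>1 s\<^sub>2\<close> is close to the identity, hence its iterates on a fibre of
  \<open>z\<close> fill a disc of that fibre unless the orbit is finite; finite rotation orbits consist of common
  fixed points except over finitely many \<open>z\<close>. As no orbit of the whole group is finite, some orbit point is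
  moved by two transverse rotations; filling along both fibrations yields an open set, and orbit
  closures are open. By compactness there are finitely many.

  The involution \<open>s\<^sub>i\<close> preserves a projection to two coordinates and negates the partial
  derivative in the density of \<open>\<Omega>\<close>, so \<open>\<Omega>\<close> is invariant. On an orbit closure
  the action on balls of a given radius is transitive, so by the maximum principle a stationary measure gives
  them equal mass and is proportional to \<open>\<Omega>\<close>. Off \<open>S(Z\<^sub>p)\<close> the orbits are
  trees escaping to infinity, and a positive strictly superharmonic function, multiplicative along the tree,
  shows that a stationary measure cannot charge this set. Hence stationary measures are the mixtures of the
  normalized restrictions of \<open>\<Omega>\<close>, whose extreme points are these restrictions.\<close>

section \<open>The p-adic numbers\<close>

text \<open>No analytic flow interpolates the iterates of a rotation. The displacement of the n-th
  iterate is compared with n times the first displacement, and the error is smaller than this main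
  term by a factor that is uniform in n; this works for p = 2 as well. To turn displacements into
  positions on a fibre, one coordinate must be a good parameter of the fibre conic, that is, the
  derivative in the other one must stay away from 0. Hence the radii depend on the norm of a
  derivative at a base point, and transversality includes a nonvanishing derivative.

  A point where all three partial derivatives vanish is fixed by the three involutions. The absence
  of finite orbits therefore makes the integral surface smooth, and by compactness Omega has finite
  mass there. Both \<open>padic_haar\<close> and \<open>symplectic_measure\<close> are definite
  descriptions: existence and uniqueness come before any computation with them.

  The multiplicative function on the trees takes one weight per involution. The weights have to beat
  the unequal probabilities of the three involutions simultaneously, which is an explicit inequality
  between three numbers.\<close>

lemma card_prime_gt_1: "CARD('p::prime_card) > 1"
  using prime_card[where 'a='p] prime_gt_1_nat by blast

lemma card_power_gt_0 [simp]: "real CARD('p::prime_card) ^ n > 0"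
  using card_prime_gt_1[where 'p='p] by simp

lemma padic_norm_0 [simp]: "padic_norm (0::'p::prime_card padic) = 0"
  by (simp add: padic_norm_eq_0)

lemma padic_norm_1 [simp]: "padic_norm (1::'p::prime_card padic) = 1"
  unfolding one_padic_def padic_norm_const by (rule padic_abs_one[OF prime_card])

lemma padic_norm_pos: "x \<noteq> 0 \<Longrightarrow> padic_norm (x::'p::prime_card padic) > 0"
  using padic_norm_nonneg[of x] padic_norm_eq_0[of x] by linarith

lemma padic_norm_diff_commute: "padic_norm (x - y) = padic_norm (y - x :: 'p::prime_card padic)"
  using padic_norm_uminus[of "x - y"] by simp

lemma padic_norm_diff_ultra:
  "padic_norm (x - y) \<le> max (padic_norm x) (padic_norm (y :: 'p::prime_card padic))"
  using padic_norm_ultra[of x "- y"] by (simp add: padic_norm_uminus)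

lemma padic_norm_add_le:
  "padic_norm x \<le> r \<Longrightarrow> padic_norm y \<le> r \<Longrightarrow> padic_norm (x + y :: 'p::prime_card padic) \<le> r"
  using padic_norm_ultra[of x y] by linarith

lemma padic_norm_diff_le:
  "padic_norm x \<le> r \<Longrightarrow> padic_norm y \<le> r \<Longrightarrow> padic_norm (x - y :: 'p::prime_card padic) \<le> r"
  using padic_norm_diff_ultra[of x y] by linarith

lemma padic_norm_add_less:
  "padic_norm x < r \<Longrightarrow> padic_norm y < r \<Longrightarrow> padic_norm (x + y :: 'p::prime_card padic) < r"
  using padic_norm_ultra[of x y] by linarith

lemma padic_norm_diff_less:
  "padic_norm x < r \<Longrightarrow> padic_norm y < r \<Longrightarrow> padic_norm (x - y :: 'p::prime_card padic) < r"
  using padic_norm_diff_ultra[of x y] by linarith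

lemma padic_norm_trans:
  "padic_norm (x - y) \<le> r \<Longrightarrow> padic_norm (y - z) \<le> r \<Longrightarrow> padic_norm (x - z :: 'p::prime_card padic) \<le> r"
  using padic_norm_add_le[of "x - y" r "y - z"] by simp

lemma padic_norm_add_eq:
  assumes "padic_norm y < padic_norm (x :: 'p::prime_card padic)"
  shows "padic_norm (x + y) = padic_norm x"
proof (rule antisym)
  show "padic_norm (x + y) \<le> padic_norm x" using padic_norm_ultra[of x y] assms by linarith
  show "padic_norm x \<le> padic_norm (x + y)"
    using padic_norm_diff_ultra[of "x + y" y] assms by (auto simp: max_def split: if_splits)
qed

text \<open>Ultrametric triangles are isosceles. In this form the fact is used throughout: a
  perturbation smaller than \<open>x\<close> does not change its norm, so derivatives and
  displacements have locally constant norm.\<close>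

lemma padic_norm_eq_of_close:
  assumes "padic_norm (x - y) < padic_norm (x :: 'p::prime_card padic)"
  shows "padic_norm y = padic_norm x"
  using padic_norm_add_eq[of "y - x" x] assms by (simp add: padic_norm_diff_commute)

lemma padic_norm_inverse: "padic_norm (inverse x) = inverse (padic_norm (x :: 'p::prime_card padic))"
proof (cases "x = 0")
  case False
  then have "padic_norm x * padic_norm (inverse x) = 1"
    by (simp flip: padic_norm_mult)
  then show ?thesis by (metis inverse_unique)
qed simp

lemma padic_norm_divide: "padic_norm (x / y) = padic_norm x / padic_norm (y :: 'p::prime_card padic)"
  by (simp add: divide_inverse padic_norm_mult padic_norm_inverse)

lemma padic_norm_power: "padic_norm (x ^ n) = padic_norm (x :: 'p::prime_card padic) ^ n"
  by (induction n) (simp_all add: padic_norm_mult)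

lemma padic_norm_mult_le:
  "padic_norm x \<le> r \<Longrightarrow> padic_norm y \<le> 1 \<Longrightarrow> padic_norm (x * y :: 'p::prime_card padic) \<le> r"
  using mult_mono[of "padic_norm x" r "padic_norm y" 1] padic_norm_nonneg[of x] padic_norm_nonneg[of y]
  by (simp add: padic_norm_mult)

lemma padic_norm_mult_le':
  "padic_norm x \<le> 1 \<Longrightarrow> padic_norm y \<le> r \<Longrightarrow> padic_norm (x * y :: 'p::prime_card padic) \<le> r"
  using padic_norm_mult_le[of y r x] by (simp add: mult.commute)

subsection \<open>Integers and rationals inside the p-adic numbers\<close>

lemma Padic_const_of_nat: "(of_nat k :: 'p::prime_card padic) = Padic (\<lambda>_. of_nat k)"
proof (induction k)
  case (Suc k)
  show ?case
    by (simp add: Suc.IH one_padic_def add.commute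
        Padic_add[OF padic_cauchy_const[OF prime_card] padic_cauchy_const[OF prime_card]])
qed (simp add: zero_padic_def)

lemma Padic_const_of_int: "(of_int k :: 'p::prime_card padic) = Padic (\<lambda>_. of_int k)"
  by (cases k rule: int_cases2)
    (simp_all add: Padic_const_of_nat Padic_uminus[OF padic_cauchy_const[OF prime_card]])

lemma Padic_const_diff:
  "(Padic (\<lambda>_. q) :: 'p::prime_card padic) - Padic (\<lambda>_. r) = Padic (\<lambda>_. q - r)"
  by (simp add: minus_padic_def Padic_uminus[OF padic_cauchy_const[OF prime_card]]
      Padic_add[OF padic_cauchy_const[OF prime_card] padic_cauchy_const[OF prime_card]])

lemma Padic_const_fract:
  assumes "b \<noteq> 0"
  shows "(Padic (\<lambda>_. of_int a / of_int b) :: 'p::prime_card padic) = of_int a / of_int b"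
proof -
  have "(Padic (\<lambda>_. of_int a / of_int b) :: 'p padic) * of_int b = of_int a"
    using assms by (simp add: Padic_const_of_int
        Padic_mult[OF padic_cauchy_const[OF prime_card] padic_cauchy_const[OF prime_card]])
  moreover have "(of_int b :: 'p padic) \<noteq> 0"
  proof
    assume "(of_int b :: 'p padic) = 0"
    then have "padic_abs CARD('p) (of_int b) = 0"
      by (metis Padic_const_of_int padic_norm_const padic_norm_0)
    then show False using assms padic_abs_pos[OF prime_card, where 'a1='p, of "of_int b :: rat"] by simp
  qed
  ultimately show ?thesis by (simp add: field_simps)
qed

lemma padic_norm_of_int:
  assumes "k \<noteq> 0"
  shows "padic_norm (of_int k :: 'p::prime_card padic) =
    1 / real CARD('p) ^ multiplicity (int CARD('p)) k"
  using padic_abs_divide[OF prime_card assms, of 1, where 'a1='p]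
  by (simp add: Padic_const_of_int padic_norm_const power_int_minus field_simps)

lemma padic_norm_of_int_le_iff:
  "padic_norm (of_int k :: 'p::prime_card padic) \<le> 1 / real CARD('p) ^ n \<longleftrightarrow> int CARD('p) ^ n dvd k"
proof (cases "k = 0")
  case False
  have p1: "real CARD('p) > 1" using card_prime_gt_1[where 'p='p] by simp
  have "\<not> is_unit (int CARD('p))" using card_prime_gt_1[where 'p='p] by simp
  then have "int CARD('p) ^ n dvd k \<longleftrightarrow> n \<le> multiplicity (int CARD('p)) k"
    using False by (intro power_dvd_iff_le_multiplicity) auto
  also have "\<dots> \<longleftrightarrow> real CARD('p) ^ n \<le> real CARD('p) ^ multiplicity (int CARD('p)) k"
    using p1 by simp
  also have "\<dots> \<longleftrightarrow> padic_norm (of_int k :: 'p padic) \<le> 1 / real CARD('p) ^ n"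
    unfolding padic_norm_of_int[OF False] using p1 by (simp add: field_simps)
  finally show ?thesis ..
qed (use card_prime_gt_1[where 'p='p] in simp)

lemma padic_norm_of_int_le_1: "padic_norm (of_int k :: 'p::prime_card padic) \<le> 1"
  using padic_norm_of_int_le_iff[of k 0, where 'p='p] by simp

lemma padic_norm_of_nat_le_1: "padic_norm (of_nat k :: 'p::prime_card padic) \<le> 1"
  using padic_norm_of_int_le_1[of "int k"] by simp

lemma padic_norm_of_nat_diff_le_iff:
  assumes "j \<le> k"
  shows "padic_norm (of_nat k - of_nat j :: 'p::prime_card padic) \<le> 1 / real CARD('p) ^ n \<longleftrightarrow>
    CARD('p) ^ n dvd k - j"
proof -
  have "(of_nat k - of_nat j :: 'p padic) = of_int (int (k - j))" using assms by (simp add: of_nat_diff)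
  then show ?thesis
    unfolding padic_norm_of_int_le_iff by (metis int_dvd_int_iff of_nat_power padic_norm_of_int_le_iff)
qed

lemma padic_norm_p [simp]: "padic_norm (of_nat CARD('p) :: 'p::prime_card padic) = 1 / real CARD('p)"
proof -
  have "multiplicity (int CARD('p)) (int CARD('p)) = 1"
    using card_prime_gt_1[where 'p='p] by (intro multiplicity_self) auto
  then show ?thesis using padic_norm_of_int[of "int CARD('p)", where 'p='p] card_prime_gt_1[where 'p='p] by simp
qed

lemma padic_norm_of_nat_eq_1:
  assumes "\<not> CARD('p::prime_card) dvd n"
  shows "padic_norm (of_nat n :: 'p padic) = 1"
proof -
  have "n \<noteq> 0" using assms by (metis dvd_0_right)
  moreover have "multiplicity (int CARD('p)) (int n) = 0"
    using assms by (intro not_dvd_imp_multiplicity_0) auto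
  ultimately show ?thesis using padic_norm_of_int[of "int n", where 'p='p] by simp
qed

lemma padic_rat_dense:
  assumes "e > 0"
  shows "\<exists>q. padic_norm (x - Padic (\<lambda>_. q) :: 'p::prime_card padic) < e"
proof -
  obtain X where X: "padic_cauchy CARD('p) X" "x = (Padic X :: 'p padic)" by (rule Padic_cases)
  \<comment> \<open>Half of \<open>e\<close>, because passing to the limit keeps only a non-strict
    bound.\<close>
  have "e / 2 > 0" using assms by simp
  then obtain N where N: "\<forall>m\<ge>N. \<forall>n\<ge>N. padic_abs CARD('p) (X m - X n) < e / 2"
    using X(1) unfolding padic_cauchy_def by blast
  let ?q = "X N"
  have c: "padic_cauchy CARD('p) (\<lambda>n. X n + - ?q)"
    by (rule padic_cauchy_add[OF prime_card X(1) padic_cauchy_const[OF prime_card]])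
  have eq: "x - Padic (\<lambda>_. ?q) = (Padic (\<lambda>n. X n + - ?q) :: 'p padic)"
    unfolding X(2) minus_padic_def Padic_uminus[OF padic_cauchy_const[OF prime_card]]
    by (rule Padic_add[OF X(1) padic_cauchy_const[OF prime_card]])
  have "(\<lambda>n. padic_abs CARD('p) (X n + - ?q)) \<longlonglongrightarrow> padic_norm (x - Padic (\<lambda>_. ?q) :: 'p padic)"
    unfolding eq by (rule padic_norm_Padic[OF c])
  moreover have "\<forall>n\<ge>N. padic_abs CARD('p) (X n + - ?q) \<le> e / 2"
    using N by (metis less_imp_le order_refl diff_conv_add_uminus)
  ultimately have "padic_norm (x - Padic (\<lambda>_. ?q) :: 'p padic) \<le> e / 2"
    by (intro LIMSEQ_le_const2[where X="\<lambda>n. padic_abs CARD('p) (X n + - ?q)"]) auto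
  then show ?thesis using assms by (intro exI[of _ ?q]) linarith
qed

lemma padic_fract_dense:
  assumes "e > 0"
  obtains a b where "b > 0" "coprime a b" "padic_norm (x - of_int a / of_int b :: 'p::prime_card padic) < e"
proof -
  obtain q where q: "padic_norm (x - Padic (\<lambda>_. q)) < e" using padic_rat_dense[OF assms] by blast
  obtain a b where ab: "quotient_of q = (a, b)" by (cases "quotient_of q")
  have "b > 0" "coprime a b" "q = of_int a / of_int b"
    using ab quotient_of_denom_pos quotient_of_coprime quotient_of_div by blast+
  then show ?thesis using that q Padic_const_fract[of b a, where 'p='p] by auto
qed

text \<open>A rational that is closer to \<open>x\<close> than the norm of \<open>x\<close> has the
  same norm, and the norm of a fraction is an integral power of p.\<close>

lemma padic_norm_value:
  assumes "x \<noteq> (0 :: 'p::prime_card padic)"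
  shows "\<exists>k. padic_norm x = real CARD('p) powi k"
proof -
  obtain a b where ab: "b > 0" "padic_norm (x - of_int a / of_int b) < padic_norm x"
    using padic_fract_dense[OF padic_norm_pos[OF assms]] by metis
  have p0: "real CARD('p) \<noteq> 0" using card_prime_gt_1[where 'p='p] by simp
  have eq: "padic_norm x = padic_norm (of_int a / of_int b :: 'p padic)"
    using padic_norm_eq_of_close[OF ab(2)] by simp
  then have a: "a \<noteq> 0" using padic_norm_pos[OF assms] by auto
  have "padic_norm x = real CARD('p) powi
      (int (multiplicity (int CARD('p)) b) - int (multiplicity (int CARD('p)) a))"
    unfolding eq padic_norm_divide using a ab(1) p0
    by (simp add: padic_norm_of_int power_int_diff)
  then show ?thesis by blast
qed

text \<open>The gap above 1 in the discrete value group. It later makes the descent in the trees of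
  non-integral points geometric.\<close>

lemma padic_norm_gt_1_imp:
  assumes "padic_norm (x :: 'p::prime_card padic) > 1"
  shows "padic_norm x \<ge> real CARD('p)"
proof -
  have p1: "real CARD('p) > 1" using card_prime_gt_1[where 'p='p] by simp
  obtain k where k: "padic_norm x = real CARD('p) powi k"
    using padic_norm_value[of x] assms by fastforce
  have "k \<ge> 1"
  proof (rule ccontr)
    assume "\<not> k \<ge> 1"
    then have "real CARD('p) powi k \<le> real CARD('p) powi 0"
      using p1 by (intro power_int_increasing) auto
    then show False using assms k by simp
  qed
  then have "real CARD('p) powi 1 \<le> real CARD('p) powi k"
    using p1 by (intro power_int_increasing) auto
  then show ?thesis using k by simp
qed

text \<open>Approximate \<open>x\<close> by a fraction a/b in lowest terms. As a/b is integral, p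
  cannot divide b, so b has an inverse c modulo p^n, and the residue is that of a c.\<close>

lemma padic_residue:
  assumes "padic_norm (x :: 'p::prime_card padic) \<le> 1"
  shows "\<exists>a < CARD('p) ^ n. padic_norm (x - of_nat a) \<le> 1 / real CARD('p) ^ n"
proof -
  have p1: "real CARD('p) > 1" using card_prime_gt_1[where 'p='p] by simp
  have e: "1 / real CARD('p) ^ n > 0" "1 / real CARD('p) ^ n \<le> 1" using p1 by auto
  obtain a b where ab: "b > 0" "coprime a b" "padic_norm (x - of_int a / of_int b) < 1 / real CARD('p) ^ n"
    using padic_fract_dense[OF e(1)] by metis
  have b0: "padic_norm (of_int b :: 'p padic) > 0" using ab(1) p1 by (simp add: padic_norm_of_int)
  have "padic_norm (of_int a / of_int b :: 'p padic) \<le> 1"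
  proof -
    have "padic_norm (x - (x - of_int a / of_int b)) \<le> 1"
      using ab(3) e(2) assms by (intro padic_norm_diff_le[of x 1 "x - of_int a / of_int b"]) linarith+
    then show ?thesis by simp
  qed
  then have le: "padic_norm (of_int a :: 'p padic) \<le> padic_norm (of_int b :: 'p padic)"
    using b0 by (simp add: padic_norm_divide)
  have pb: "\<not> int CARD('p) dvd b"
  proof
    assume d: "int CARD('p) dvd b"
    then have "padic_norm (of_int b :: 'p padic) \<le> 1 / real CARD('p) ^ 1"
      by (subst padic_norm_of_int_le_iff) simp
    then have "padic_norm (of_int a :: 'p padic) \<le> 1 / real CARD('p) ^ 1" using le by simp
    then have "int CARD('p) dvd a" by (subst (asm) padic_norm_of_int_le_iff) simp
    with d ab(2) have "is_unit (int CARD('p))" by (meson coprime_common_divisor)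
    then show False using card_prime_gt_1[where 'p='p] by simp
  qed
  then have b1: "padic_norm (of_int b :: 'p padic) = 1"
    using ab(1) by (simp add: padic_norm_of_int not_dvd_imp_multiplicity_0)
  have "coprime (int CARD('p)) b"
    using pb prime_card[where 'a='p] by (intro prime_imp_coprime) auto
  then have "coprime b (int CARD('p) ^ n)" by (simp add: coprime_commute)
  then obtain c where c: "[b * c = 1] (mod (int CARD('p) ^ n))"
    using cong_solve_coprime_int by blast
  define m where "m = nat ((a * c) mod (int CARD('p) ^ n))"
  have pn: "int CARD('p) ^ n > 0" using card_prime_gt_1[where 'p='p] by simp
  then have m: "int m = (a * c) mod (int CARD('p) ^ n)" by (simp add: m_def)
  have "int m < int CARD('p) ^ n" unfolding m using pn by simp
  then have mlt: "m < CARD('p) ^ n" by (metis of_nat_less_iff of_nat_power)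
  have "[b * int m = b * (a * c)] (mod (int CARD('p) ^ n))"
    unfolding m by (intro cong_mult cong_refl cong_mod_leftI)
  also have "b * (a * c) = a * (b * c)" by simp
  also have "[a * (b * c) = a * 1] (mod (int CARD('p) ^ n))"
    using c by (intro cong_mult cong_refl)
  finally have "int CARD('p) ^ n dvd b * int m - a" by (simp add: cong_iff_dvd_diff)
  then have "padic_norm (of_int (b * int m - a) :: 'p padic) \<le> 1 / real CARD('p) ^ n"
    by (subst padic_norm_of_int_le_iff)
  moreover have "of_int a / of_int b - of_nat m = - (of_int (b * int m - a) / of_int b :: 'p padic)"
  proof -
    have "(of_int b :: 'p padic) \<noteq> 0" using b0 by auto
    then show ?thesis by (simp add: field_simps)
  qed
  ultimately have "padic_norm (of_int a / of_int b - of_nat m :: 'p padic) \<le> 1 / real CARD('p) ^ n"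
  proof -
    assume le: "padic_norm (of_int (b * int m - a) :: 'p padic) \<le> 1 / real CARD('p) ^ n"
      and eq: "of_int a / of_int b - of_nat m = - (of_int (b * int m - a) / of_int b :: 'p padic)"
    show ?thesis unfolding eq padic_norm_uminus padic_norm_divide b1 using le by simp
  qed
  then have "padic_norm (x - of_nat m) \<le> 1 / real CARD('p) ^ n"
    using ab(3) padic_norm_trans[of x "of_int a / of_int b" _ "of_nat m"] by simp
  then show ?thesis using mlt by blast
qed

lemma padic_residue_unique:
  assumes "a < CARD('p::prime_card) ^ n" "b < CARD('p) ^ n"
    "padic_norm (of_nat a - of_nat b :: 'p padic) \<le> 1 / real CARD('p) ^ n"
  shows "a = b"
proof -
  have *: "i = j" if "i \<le> j" "j < CARD('p) ^ n"
    "padic_norm (of_nat j - of_nat i :: 'p padic) \<le> 1 / real CARD('p) ^ n" for i j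
  proof -
    have "CARD('p) ^ n dvd j - i" using that padic_norm_of_nat_diff_le_iff[OF that(1)] by blast
    moreover have "j - i < CARD('p) ^ n" using that by simp
    ultimately have "j - i = 0" by (meson dvd_imp_le linorder_not_le not_gr_zero)
    then show ?thesis using that by simp
  qed
  show ?thesis
  proof (cases "a \<le> b")
    case True
    then show ?thesis using * assms by (simp only: padic_norm_diff_commute[of "of_nat a"])
  next
    case False
    then show ?thesis using *[of b a] assms by simp
  qed
qed

subsection \<open>Topology\<close>

lemma padic_radius_small:
  assumes "(e::real) > 0"
  shows "\<exists>n. 1 / real CARD('p::prime_card) ^ n < e"
proof -
  have "1 / real CARD('p) < 1" using card_prime_gt_1[where 'p='p] by simp
  then obtain n where "(1 / real CARD('p)) ^ n < e" using real_arch_pow_inv[OF assms] by blast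
  then show ?thesis by (auto simp: power_one_over)
qed

lemma mem_padic_cball: "y \<in> cball a r \<longleftrightarrow> padic_norm (y - a :: 'p::prime_card padic) \<le> r"
  by (simp add: dist_padic_def padic_norm_diff_commute)

lemma padic_ints_eq_cball: "(padic_ints :: 'p::prime_card padic set) = cball 0 1"
  by (auto simp: padic_ints_def mem_padic_cball simp del: mem_cball)

lemma open_padic_cball:
  assumes "r > 0"
  shows "open (cball (a :: 'p::prime_card padic) r)"
proof -
  have "ball x r \<subseteq> cball a r" if "x \<in> cball a r" for x
    using that padic_norm_trans[of _ x r a] by (auto simp: dist_padic_def padic_norm_diff_commute)
  then show ?thesis unfolding open_contains_ball using assms by blast
qed

text \<open>Replace the n-th term by a rational \<open>q n\<close> within 1/(n+1) of it. The
  sequence \<open>q\<close> is again Cauchy, hence defines a p-adic number, and this number is the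
  limit.\<close>

instance padic :: (prime_card) complete_space
proof
  fix X :: "nat \<Rightarrow> 'a padic" assume X: "Cauchy X"
  have "\<forall>n. \<exists>q. padic_norm (X n - Padic (\<lambda>_. q)) < 1 / real (Suc n)"
    by (intro allI padic_rat_dense) simp
  then obtain q where q: "\<And>n. padic_norm (X n - Padic (\<lambda>_. q n)) < 1 / real (Suc n)" by metis
  have bound: "padic_norm (X m - X n) < e \<Longrightarrow> 1 / real (Suc m) < e \<Longrightarrow> 1 / real (Suc n) < e \<Longrightarrow>
      padic_abs CARD('a) (q m - q n) < e" for m n e
  proof -
    assume *: "padic_norm (X m - X n) < e" "1 / real (Suc m) < e" "1 / real (Suc n) < e"
    have "padic_norm ((X m - X n) - (X m - Padic (\<lambda>_. q m)) + (X n - Padic (\<lambda>_. q n))) < e"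
      using * q[of m] q[of n]
      by (intro padic_norm_add_less[of "(X m - X n) - (X m - Padic (\<lambda>_. q m))"]
          padic_norm_diff_less[of "X m - X n"]) linarith+
    also have "(X m - X n) - (X m - Padic (\<lambda>_. q m)) + (X n - Padic (\<lambda>_. q n)) = Padic (\<lambda>_. q m - q n)"
      by (simp flip: Padic_const_diff)
    finally show ?thesis by (simp add: padic_norm_const)
  qed
  have inv_small: "\<exists>N. \<forall>n\<ge>N. 1 / real (Suc n) < e" if "e > 0" for e :: real
  proof -
    have "(\<lambda>n. 1 / real (Suc n)) \<longlonglongrightarrow> 0" by (rule LIMSEQ_Suc[OF lim_1_over_n])
    then have "eventually (\<lambda>n. 1 / real (Suc n) < e) sequentially" using that by (rule order_tendstoD(2))
    then show ?thesis by (simp only: eventually_sequentially)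
  qed
  have cauchy: "padic_cauchy CARD('a) q"
    unfolding padic_cauchy_def
  proof (intro allI impI)
    fix e :: real assume e: "e > 0"
    obtain M where M: "\<forall>m\<ge>M. \<forall>n\<ge>M. dist (X m) (X n) < e" using X e unfolding Cauchy_def by blast
    obtain N where N: "\<forall>n\<ge>N. 1 / real (Suc n) < e" using inv_small[OF e] by blast
    show "\<exists>N. \<forall>m\<ge>N. \<forall>n\<ge>N. padic_abs CARD('a) (q m - q n) < e"
    proof (intro exI[of _ "max M N"] allI impI)
      fix m n assume "m \<ge> max M N" "n \<ge> max M N"
      then have "dist (X m) (X n) < e" "1 / real (Suc m) < e" "1 / real (Suc n) < e"
        using M N by (simp_all only: max.bounded_iff)
      then show "padic_abs CARD('a) (q m - q n) < e" unfolding dist_padic_def by (rule bound)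
    qed
  qed
  have "X \<longlonglongrightarrow> Padic q"
  proof (rule metric_LIMSEQ_I)
    fix e :: real assume e: "e > 0"
    then have e2: "e / 2 > 0" by simp
    obtain M where M: "\<forall>m\<ge>M. \<forall>n\<ge>M. padic_abs CARD('a) (q m - q n) < e / 2"
      using cauchy e2 unfolding padic_cauchy_def by blast
    obtain N where N: "\<forall>n\<ge>N. 1 / real (Suc n) < e" using inv_small[OF e] by blast
    have "dist (X n) (Padic q) < e" if n: "n \<ge> max M N" for n
    proof -
      have c: "padic_cauchy CARD('a) (\<lambda>k. q n + - q k)"
        by (intro padic_cauchy_add[OF prime_card] padic_cauchy_const[OF prime_card]
            padic_cauchy_minus[OF prime_card] cauchy)
      have eq: "Padic (\<lambda>_. q n) - Padic q = (Padic (\<lambda>k. q n + - q k) :: 'a padic)"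
        unfolding minus_padic_def Padic_uminus[OF cauchy]
        by (intro Padic_add padic_cauchy_const[OF prime_card] padic_cauchy_minus[OF prime_card] cauchy)
      have "\<forall>k\<ge>M. padic_abs CARD('a) (q n + - q k) \<le> e / 2"
        using M n by (metis diff_conv_add_uminus less_imp_le max.bounded_iff)
      then have "padic_norm (Padic (\<lambda>_. q n) - Padic q :: 'a padic) \<le> e / 2"
        unfolding eq by (intro LIMSEQ_le_const2[OF padic_norm_Padic[OF c]]) auto
      moreover have "padic_norm (X n - Padic (\<lambda>_. q n)) < e"
        using q[of n] N n by (meson less_trans max.bounded_iff)
      ultimately have "padic_norm ((X n - Padic (\<lambda>_. q n)) + (Padic (\<lambda>_. q n) - Padic q)) < e"
        using e by (intro padic_norm_add_less) auto
      then show ?thesis by (simp add: dist_padic_def)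
    qed
    then show "\<exists>N. \<forall>n\<ge>N. dist (X n) (Padic q) < e" by blast
  qed
  then show "convergent X" by (auto simp: convergent_def)
qed

instance padic :: (prime_card) topological_ab_group_add
proof
  fix a b :: "'a padic"
  show "((\<lambda>x. fst x + snd x) \<longlongrightarrow> a + b) (nhds a \<times>\<^sub>F nhds b)"
    unfolding tendsto_iff
  proof (intro allI impI)
    fix e :: real assume "e > 0"
    then have "eventually (\<lambda>x. dist x a < e) (nhds a)" "eventually (\<lambda>x. dist x b < e) (nhds b)"
      by (auto simp: eventually_nhds_metric)
    then have "eventually (\<lambda>x. dist (fst x) a < e \<and> dist (snd x) b < e) (nhds a \<times>\<^sub>F nhds b)"
      by (rule eventually_prodI)
    then show "eventually (\<lambda>x. dist (fst x + snd x) (a + b) < e) (nhds a \<times>\<^sub>F nhds b)"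
    proof (rule eventually_mono)
      fix x :: "'a padic \<times> 'a padic"
      assume "dist (fst x) a < e \<and> dist (snd x) b < e"
      then have "padic_norm ((fst x - a) + (snd x - b)) < e"
        by (intro padic_norm_add_less) (auto simp: dist_padic_def)
      then show "dist (fst x + snd x) (a + b) < e" by (simp add: dist_padic_def algebra_simps)
    qed
  qed
  show "(uminus \<longlongrightarrow> - a) (nhds a)"
    unfolding tendsto_iff
  proof (intro allI impI)
    fix e :: real assume "e > 0"
    moreover have "dist (- x) (- a) = dist x a" for x
      using padic_norm_uminus[of "x - a"] by (simp add: dist_padic_def)
    ultimately show "eventually (\<lambda>x. dist (- x) (- a) < e) (nhds a)"
      by (auto simp: eventually_nhds_metric)
  qed
qed

instance padic :: (prime_card) topological_semigroup_mult
proof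
  fix a b :: "'a padic"
  show "((\<lambda>x. fst x * snd x) \<longlongrightarrow> a * b) (nhds a \<times>\<^sub>F nhds b)"
    unfolding tendsto_iff
  proof (intro allI impI)
    fix e :: real assume e: "e > 0"
    \<comment> \<open>Larger than both norms; together with \<open>d \<le> 1\<close> it also bounds
      the second factor near \<open>b\<close>.\<close>
    define c where "c = 1 + padic_norm a + padic_norm b"
    have c: "c \<ge> 1" "padic_norm a < c" "padic_norm b < c"
      using padic_norm_nonneg[of a] padic_norm_nonneg[of b] by (auto simp: c_def)
    define d where "d = min 1 (e / c)"
    have d: "d > 0" "d \<le> 1" "d * c \<le> e" using e c by (auto simp: d_def min_def field_simps)
    have "eventually (\<lambda>x. dist x a < d) (nhds a)" "eventually (\<lambda>x. dist x b < d) (nhds b)"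
      using d by (auto simp: eventually_nhds_metric)
    then have "eventually (\<lambda>x. dist (fst x) a < d \<and> dist (snd x) b < d) (nhds a \<times>\<^sub>F nhds b)"
      by (rule eventually_prodI)
    then show "eventually (\<lambda>x. dist (fst x * snd x) (a * b) < e) (nhds a \<times>\<^sub>F nhds b)"
    proof (rule eventually_mono)
      fix x :: "'a padic \<times> 'a padic"
      assume "dist (fst x) a < d \<and> dist (snd x) b < d"
      then have x: "padic_norm (fst x - a) < d" "padic_norm (snd x - b) < d"
        by (auto simp: dist_padic_def)
      have sb: "padic_norm (snd x) < c"
        using x(2) d(2) c padic_norm_ultra[of "snd x - b" b] by auto
      have lt: "u * v < d * c" if "0 \<le> u" "u < d" "0 \<le> v" "v < c" for u v
        using that by (intro mult_strict_mono') auto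
      have "padic_norm ((fst x - a) * snd x + (snd x - b) * a) < d * c"
        using x sb c padic_norm_nonneg by (intro padic_norm_add_less) (auto simp: padic_norm_mult intro!: lt)
      also have "(fst x - a) * snd x + (snd x - b) * a = fst x * snd x - a * b" by (simp add: algebra_simps)
      finally show "dist (fst x * snd x) (a * b) < e" using d by (simp add: dist_padic_def)
    qed
  qed
qed

instance padic :: (prime_card) topological_monoid_mult ..

lemma countable_padic_centers:
  obtains Q :: "'p::prime_card padic set" where "countable Q" "\<And>x e. e > 0 \<Longrightarrow> \<exists>q\<in>Q. padic_norm (x - q) < e"
proof
  show "countable (range (\<lambda>q. Padic (\<lambda>_. q) :: 'p padic))" by simp
  show "\<exists>q\<in>range (\<lambda>q. Padic (\<lambda>_. q)). padic_norm (x - q) < e" if "e > 0" for x :: "'p padic" and e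
    using padic_rat_dense[OF that, of x] by blast
qed

instance padic :: (prime_card) second_countable_topology
proof
  obtain Q :: "'a padic set" where Q: "countable Q" "\<And>x e. e > 0 \<Longrightarrow> \<exists>q\<in>Q. padic_norm (x - q) < e"
    using countable_padic_centers by metis
  let ?r = "\<lambda>n. 1 / real CARD('a) ^ n"
  define B where "B = (\<lambda>(q, n). cball q (?r n)) ` (Q \<times> (UNIV :: nat set))"
  have "topological_basis B"
  proof (rule topological_basisI)
    fix B' assume "B' \<in> B"
    then show "open B'" by (auto simp: B_def open_padic_cball)
  next
    fix U :: "'a padic set" and x assume U: "open U" "x \<in> U"
    then obtain e where e: "e > 0" "\<And>y. dist y x < e \<Longrightarrow> y \<in> U" by (auto simp: open_dist)
    obtain n where n: "?r n < e" using padic_radius_small[OF e(1), where 'p='a] by blast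
    obtain q where q: "q \<in> Q" "padic_norm (x - q) < ?r n" using Q(2)[of "?r n" x] by auto
    have "cball q (?r n) \<subseteq> U"
    proof
      fix y assume "y \<in> cball q (?r n)"
      then have "padic_norm (y - x) \<le> ?r n" using q
        padic_norm_trans[of y q _ x] by (auto simp: mem_padic_cball padic_norm_diff_commute simp del: mem_cball)
      then show "y \<in> U" using n e(2) by (simp add: dist_padic_def)
    qed
    moreover have "x \<in> cball q (?r n)" using q by (auto simp: mem_padic_cball simp del: mem_cball)
    ultimately show "\<exists>B'\<in>B. x \<in> B' \<and> B' \<subseteq> U" using q(1) by (auto simp: B_def)
  qed
  moreover have "countable B" using Q(1) by (auto simp: B_def)
  ultimately show "\<exists>B::'a padic set set. countable B \<and> open = generate_topology B"
    using topological_basis_imp_subbasis by blast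
qed

lemma compact_padic_ints: "compact (padic_ints :: 'p::prime_card padic set)"
  unfolding compact_eq_totally_bounded
proof (intro conjI allI impI)
  show "Topological_Spaces.complete (padic_ints :: 'p padic set)"
    unfolding padic_ints_eq_cball by (simp add: complete_eq_closed)
  fix e :: real assume "e > 0"
  then obtain n where n: "1 / real CARD('p) ^ n < e" using padic_radius_small[where 'p='p] by blast
  show "\<exists>k. finite k \<and> (padic_ints :: 'p padic set) \<subseteq> (\<Union>x\<in>k. ball x e)"
  proof (intro exI[of _ "of_nat ` {..<CARD('p) ^ n}"] conjI subsetI)
    fix x :: "'p padic" assume "x \<in> padic_ints"
    then obtain a where "a < CARD('p) ^ n" "padic_norm (x - of_nat a) \<le> 1 / real CARD('p) ^ n"
      using padic_residue[of x n] by (auto simp: padic_ints_def)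
    then show "x \<in> (\<Union>x\<in>of_nat ` {..<CARD('p) ^ n}. ball x e)"
      using n by (auto simp: dist_padic_def padic_norm_diff_commute intro!: bexI[of _ a])
  qed simp
qed

section \<open>The sup norm on triples and the Vieta involutions\<close>

text \<open>The product metric on triples is Euclidean and not ultrametric. The maximum norm is
  ultrametric, and for it the involutions are isometries of the integral cube; it defines the same
  topology.\<close>

definition sup_norm :: "'p::prime_card padic3 \<Rightarrow> real" where
  "sup_norm u = max (padic_norm (fst u)) (max (padic_norm (fst (snd u))) (padic_norm (snd (snd u))))"

definition smul :: "'p::prime_card padic \<Rightarrow> 'p padic3 \<Rightarrow> 'p padic3" where
  "smul c u = (c * fst u, c * fst (snd u), c * snd (snd u))"

definition int_cube :: "'p::prime_card padic3 set" where
  "int_cube = {u. sup_norm u \<le> 1}"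

lemma sup_norm_le_iff:
  "sup_norm u \<le> r \<longleftrightarrow> padic_norm (fst u) \<le> r \<and> padic_norm (fst (snd u)) \<le> r \<and> padic_norm (snd (snd u)) \<le> r"
  by (simp add: sup_norm_def)

lemma padic_norm_le_sup_norm:
  "padic_norm (fst u) \<le> sup_norm u" "padic_norm (fst (snd u)) \<le> sup_norm u"
  "padic_norm (snd (snd u)) \<le> sup_norm u"
  by (simp_all add: sup_norm_def)

lemma sup_norm_nonneg [simp]: "sup_norm u \<ge> 0"
  using padic_norm_le_sup_norm(1)[of u] padic_norm_nonneg[of "fst u"] by linarith

lemma sup_norm_0 [simp]: "sup_norm 0 = 0"
  by (simp add: sup_norm_def)

lemma sup_norm_eq_0 [simp]: "sup_norm u = 0 \<longleftrightarrow> u = 0"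
proof
  assume "sup_norm u = 0"
  then have "padic_norm (fst u) \<le> 0" "padic_norm (fst (snd u)) \<le> 0" "padic_norm (snd (snd u)) \<le> 0"
    using sup_norm_le_iff[of u 0] by auto
  then have "padic_norm (fst u) = 0" "padic_norm (fst (snd u)) = 0" "padic_norm (snd (snd u)) = 0"
    using padic_norm_nonneg by (meson antisym)+
  then show "u = 0" by (auto simp: padic_norm_eq_0 prod_eq_iff)
qed simp

lemma sup_norm_pos: "u \<noteq> 0 \<Longrightarrow> sup_norm u > 0"
  using sup_norm_nonneg[of u] sup_norm_eq_0[of u] by linarith

lemma sup_norm_uminus [simp]: "sup_norm (- u) = sup_norm u"
  by (simp add: sup_norm_def padic_norm_uminus)

lemma sup_norm_diff_commute: "sup_norm (u - v) = sup_norm (v - u)"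
  using sup_norm_uminus[of "u - v"] by simp

lemma sup_norm_add_le: "sup_norm u \<le> r \<Longrightarrow> sup_norm v \<le> r \<Longrightarrow> sup_norm (u + v) \<le> r"
  by (auto simp: sup_norm_le_iff intro: padic_norm_add_le)

lemma sup_norm_diff_le: "sup_norm u \<le> r \<Longrightarrow> sup_norm v \<le> r \<Longrightarrow> sup_norm (u - v) \<le> r"
  using sup_norm_add_le[of u r "- v"] by simp

lemma sup_norm_trans: "sup_norm (u - v) \<le> r \<Longrightarrow> sup_norm (v - w) \<le> r \<Longrightarrow> sup_norm (u - w) \<le> r"
  using sup_norm_add_le[of "u - v" r "v - w"] by simp

lemma sup_norm_smul: "sup_norm (smul c u) = padic_norm c * sup_norm u"
  by (simp add: sup_norm_def smul_def padic_norm_mult max_mult_distrib_left padic_norm_nonneg)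

lemma smul_diff: "smul c (u - v) = smul c u - smul c v"
  by (simp add: smul_def algebra_simps)

lemma smul_add_left: "smul (c + d) u = smul c u + smul d u"
  by (simp add: smul_def algebra_simps)

lemma smul_smul: "smul c (smul d u) = smul (c * d) u"
  by (simp add: smul_def mult.assoc)

lemma smul_0_1 [simp]: "smul 0 u = 0" "smul 1 u = u"
  by (simp_all add: smul_def zero_prod_def)

lemma mem_int_cube_iff: "u \<in> int_cube \<longleftrightarrow> sup_norm u \<le> 1"
  by (simp add: int_cube_def)

lemma int_cube_eq: "int_cube = padic_ints \<times> padic_ints \<times> padic_ints"
  by (auto simp: mem_int_cube_iff sup_norm_def padic_ints_def)

lemma int_surface_eq: "int_surface A B C D = surface A B C D \<inter> int_cube"
  by (simp add: int_surface_def int_cube_eq)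

lemma compact_int_cube: "compact (int_cube :: 'p::prime_card padic3 set)"
  unfolding int_cube_eq by (intro compact_Times compact_padic_ints)

lemma sup_norm_le_dist: "sup_norm (u - v) \<le> dist u v"
proof -
  obtain x y z x' y' z' where [simp]: "u = (x, y, z)" "v = (x', y', z')" by (cases u; cases v)
  have "dist x x' \<le> dist u v" "dist (y, z) (y', z') \<le> dist u v"
    using dist_fst_le[of u v] dist_snd_le[of u v] by simp_all
  moreover have "dist y y' \<le> dist (y, z) (y', z')" "dist z z' \<le> dist (y, z) (y', z')"
    using dist_fst_le[of "(y, z)" "(y', z')"] dist_snd_le[of "(y, z)" "(y', z')"] by simp_all
  ultimately show ?thesis by (simp add: sup_norm_le_iff dist_padic_def)
qed

text \<open>The Euclidean distance is at most the sum of the three coordinate distances. With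
  \<open>sup_norm_le_dist\<close> this gives the equivalence of the two topologies.\<close>

lemma dist_le_sup_norm: "dist u v \<le> 3 * sup_norm (u - v)"
proof -
  obtain x y z x' y' z' where [simp]: "u = (x, y, z)" "v = (x', y', z')" by (cases u; cases v)
  have "dist u v \<le> dist x x' + dist (y, z) (y', z')"
    unfolding dist_prod_def by (rule order_trans[OF sqrt_sum_squares_le_sum]) auto
  also have "dist (y, z) (y', z') \<le> dist y y' + dist z z'"
    unfolding dist_prod_def by (rule order_trans[OF sqrt_sum_squares_le_sum]) auto
  finally show ?thesis using padic_norm_le_sup_norm[of "u - v"] by (simp add: dist_padic_def)
qed

lemma closure_sup_norm: "v \<in> closure S \<longleftrightarrow> (\<forall>e>0. \<exists>w\<in>S. sup_norm (v - w) \<le> e)"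
proof
  assume v: "v \<in> closure S"
  show "\<forall>e>0. \<exists>w\<in>S. sup_norm (v - w) \<le> e"
  proof (intro allI impI)
    fix e :: real assume "e > 0"
    then obtain w where "w \<in> S" "dist w v < e" using v by (auto simp: closure_approachable)
    then show "\<exists>w\<in>S. sup_norm (v - w) \<le> e"
      using sup_norm_le_dist[of v w] by (intro bexI[of _ w]) (auto simp: dist_commute)
  qed
next
  assume *: "\<forall>e>0. \<exists>w\<in>S. sup_norm (v - w) \<le> e"
  show "v \<in> closure S"
    unfolding closure_approachable
  proof (intro allI impI)
    fix e :: real assume e: "e > 0"
    \<comment> \<open>\<open>e / 6\<close> and not \<open>e / 3\<close>: after the factor 3 the
      inequality must still be strict.\<close>
    then obtain w where "w \<in> S" "sup_norm (v - w) \<le> e / 6" using * by (meson divide_pos_pos zero_less_numeral)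
    then show "\<exists>w\<in>S. dist w v < e"
      using dist_le_sup_norm[of w v] e by (intro bexI[of _ w]) (auto simp: sup_norm_diff_commute)
  qed
qed

lemma open_sup_norm: "open S \<longleftrightarrow> (\<forall>u\<in>S. \<exists>e>0. \<forall>v. sup_norm (v - u) \<le> e \<longrightarrow> v \<in> S)"
proof
  assume S: "open S"
  show "\<forall>u\<in>S. \<exists>e>0. \<forall>v. sup_norm (v - u) \<le> e \<longrightarrow> v \<in> S"
  proof
    fix u assume "u \<in> S"
    then obtain e where e: "e > 0" "\<forall>v. dist v u < e \<longrightarrow> v \<in> S" using S by (auto simp: open_dist)
    have "v \<in> S" if v: "sup_norm (v - u) \<le> e / 6" for v
    proof -
      have "dist v u < e" using e(1) v dist_le_sup_norm[of v u] by linarith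
      then show ?thesis using e(2) by blast
    qed
    then show "\<exists>e>0. \<forall>v. sup_norm (v - u) \<le> e \<longrightarrow> v \<in> S" using e(1) by (intro exI[of _ "e / 6"]) auto
  qed
next
  assume *: "\<forall>u\<in>S. \<exists>e>0. \<forall>v. sup_norm (v - u) \<le> e \<longrightarrow> v \<in> S"
  show "open S"
    unfolding open_dist
  proof
    fix u assume "u \<in> S"
    then obtain e where e: "e > 0" "\<forall>v. sup_norm (v - u) \<le> e \<longrightarrow> v \<in> S" using * by blast
    have "v \<in> S" if v: "dist v u < e" for v
    proof -
      have "sup_norm (v - u) \<le> e" using v sup_norm_le_dist[of v u] by linarith
      then show ?thesis using e(2) by blast
    qed
    then show "\<exists>e>0. \<forall>y. dist y u < e \<longrightarrow> y \<in> S" using e(1) by blast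
  qed
qed

section \<open>Cyclic symmetry of the family of surfaces\<close>

definition cyc :: "'p::prime_card padic3 \<Rightarrow> 'p padic3" where
  "cyc u = (fst (snd u), snd (snd u), fst u)"

lemma cyc_simps [simp]: "cyc (x, y, z) = (y, z, x)"
  by (simp add: cyc_def)

lemma cyc_cyc_cyc [simp]: "cyc (cyc (cyc u)) = u"
  by (simp add: cyc_def)

lemma cyc_inject [simp]: "cyc u = cyc v \<longleftrightarrow> u = v"
  by (auto simp: cyc_def prod_eq_iff)

lemma cyc_diff: "cyc u - cyc v = cyc (u - v)"
  by (simp add: cyc_def)

lemma sup_norm_cyc [simp]: "sup_norm (cyc u) = sup_norm u"
  by (auto simp: sup_norm_def cyc_def)

text \<open>Rotating the coordinates together with the parameters, (A, B, C) to (B, C, A), permutes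
  the three involutions. What is proved for one coordinate or one fibration therefore transfers to
  the other two.\<close>

lemma cyc_vieta:
  "cyc (vieta1 A u) = vieta3 A (cyc u)" "cyc (vieta2 B u) = vieta1 B (cyc u)" "cyc (vieta3 C u) = vieta2 C (cyc u)"
  by (cases u; simp add: vieta1_def vieta2_def vieta3_def mult.commute)+

definition vietas :: "'p::prime_card padic \<Rightarrow> 'p padic \<Rightarrow> 'p padic \<Rightarrow> ('p padic3 \<Rightarrow> 'p padic3) set" where
  "vietas A B C = {vieta1 A, vieta2 B, vieta3 C}"

lemma vietas_involutive: "s \<in> vietas A B C \<Longrightarrow> s (s u) = u"
  by (auto simp: vietas_def vieta_involutive)

lemma vieta1_nonexpansive:
  assumes "u \<in> int_cube" "v \<in> int_cube"
  shows "sup_norm (vieta1 A u - vieta1 A v) \<le> sup_norm (u - v)"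
proof -
  obtain x y z x' y' z' where [simp]: "u = (x, y, z)" "v = (x', y', z')" by (cases u; cases v)
  have i: "padic_norm z \<le> 1" "padic_norm y' \<le> 1" using assms by (auto simp: int_cube_eq padic_ints_def)
  let ?r = "sup_norm (u - v)"
  have r: "padic_norm (x - x') \<le> ?r" "padic_norm (y - y') \<le> ?r" "padic_norm (z - z') \<le> ?r"
    using padic_norm_le_sup_norm[of "u - v"] by auto
  have "padic_norm (- (x - x') - ((y - y') * z + y' * (z - z'))) \<le> ?r"
    using r i by (intro padic_norm_diff_le[of "- (x - x')"] padic_norm_add_le[of "(y - y') * z"]
        padic_norm_mult_le padic_norm_mult_le') (auto simp: padic_norm_uminus simp del: minus_diff_eq)
  also have "- (x - x') - ((y - y') * z + y' * (z - z')) = (- x + A - y * z) - (- x' + A - y' * z')"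
    by (simp add: algebra_simps)
  finally show ?thesis using r by (simp add: vieta1_def sup_norm_le_iff)
qed

lemma vieta1_int_cube:
  assumes "A \<in> padic_ints" "u \<in> int_cube"
  shows "vieta1 A u \<in> int_cube"
proof -
  obtain x y z where [simp]: "u = (x, y, z)" by (cases u)
  show ?thesis using assms
    by (auto simp: int_cube_eq vieta1_def padic_ints_def padic_norm_uminus
        intro!: padic_norm_diff_le padic_norm_add_le padic_norm_mult_le)
qed

lemma cyc_int_cube [simp]: "cyc u \<in> int_cube \<longleftrightarrow> u \<in> int_cube"
  unfolding mem_int_cube_iff by simp

context
  fixes A B C D :: "'p::prime_card padic"
  assumes ints: "A \<in> padic_ints" "B \<in> padic_ints" "C \<in> padic_ints"
begin

lemma vietas_int_cube:
  assumes s: "s \<in> vietas A B C" and u: "u \<in> int_cube"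
  shows "s u \<in> int_cube"
proof -
  consider "s = vieta1 A" | "s = vieta2 B" | "s = vieta3 C" using s by (auto simp: vietas_def)
  then show ?thesis
  proof cases
    case 1
    then show ?thesis using vieta1_int_cube[OF ints(1) u] by simp
  next
    case 2
    have "cyc (s u) \<in> int_cube" unfolding 2 cyc_vieta
      using vieta1_int_cube[OF ints(2) cyc_int_cube[THEN iffD2, OF u]] .
    then show ?thesis unfolding cyc_int_cube .
  next
    case 3
    have "cyc (cyc (s u)) \<in> int_cube" unfolding 3 cyc_vieta
      using vieta1_int_cube[OF ints(3) cyc_int_cube[THEN iffD2, OF cyc_int_cube[THEN iffD2, OF u]]] .
    then show ?thesis unfolding cyc_int_cube .
  qed
qed

lemma vietas_nonexpansive:
  assumes s: "s \<in> vietas A B C" and u: "u \<in> int_cube" "v \<in> int_cube"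
  shows "sup_norm (s u - s v) \<le> sup_norm (u - v)"
proof -
  consider "s = vieta1 A" | "s = vieta2 B" | "s = vieta3 C" using s by (auto simp: vietas_def)
  then show ?thesis
  proof cases
    case 1
    then show ?thesis using vieta1_nonexpansive[OF u] by simp
  next
    case 2
    have "sup_norm (cyc (s u) - cyc (s v)) \<le> sup_norm (cyc u - cyc v)"
      unfolding 2 cyc_vieta
      using vieta1_nonexpansive[OF cyc_int_cube[THEN iffD2, OF u(1)] cyc_int_cube[THEN iffD2, OF u(2)]] .
    then show ?thesis by (simp add: cyc_diff)
  next
    case 3
    have "sup_norm (cyc (cyc (s u)) - cyc (cyc (s v))) \<le> sup_norm (cyc (cyc u) - cyc (cyc v))"
      unfolding 3 cyc_vieta using u by (intro vieta1_nonexpansive) (simp_all only: cyc_int_cube)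
    then show ?thesis by (simp add: cyc_diff)
  qed
qed

text \<open>A nonexpansive involution is an isometry: apply the bound once more, to the two
  images.\<close>

lemma vietas_isometry:
  assumes s: "s \<in> vietas A B C" and u: "u \<in> int_cube" "v \<in> int_cube"
  shows "sup_norm (s u - s v) = sup_norm (u - v)"
proof (rule antisym)
  show "sup_norm (s u - s v) \<le> sup_norm (u - v)" by (rule vietas_nonexpansive[OF s u])
  show "sup_norm (u - v) \<le> sup_norm (s u - s v)"
    using vietas_nonexpansive[OF s vietas_int_cube[OF s u(1)] vietas_int_cube[OF s u(2)]]
    unfolding vietas_involutive[OF s] .
qed

lemma vietas_int_surface:
  assumes s: "s \<in> vietas A B C" and u: "u \<in> int_surface A B C D"
  shows "s u \<in> int_surface A B C D"
proof -
  have "u \<in> surface A B C D" "u \<in> int_cube" using u by (auto simp: int_surface_eq)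
  then have "s u \<in> surface A B C D" "s u \<in> int_cube"
    using s vieta_surface[of u A B C D] vietas_int_cube[OF s, of u] by (auto simp: vietas_def)
  then show ?thesis by (simp add: int_surface_eq)
qed

end

subsection \<open>Orbits\<close>

text \<open>The generators are their own inverses, so words in them already give the whole orbit.
  Induction on such words replaces induction on elements of the generated group.\<close>

inductive_set vorb :: "'p::prime_card padic \<Rightarrow> 'p padic \<Rightarrow> 'p padic \<Rightarrow> 'p padic3 \<Rightarrow> 'p padic3 set"
  for A B C u where
  vorb_base: "u \<in> vorb A B C u"
| vorb_step: "v \<in> vorb A B C u \<Longrightarrow> s \<in> vietas A B C \<Longrightarrow> s v \<in> vorb A B C u"

lemma vieta_orbit_eq_vorb: "vieta_orbit A B C u = vorb A B C u"
proof
  interpret G: group "BijGroup (UNIV :: 'a padic3 set)" by (rule group_BijGroup)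
  have H: "vietas A B C \<subseteq> carrier (BijGroup UNIV)"
    using vieta_in_Bij[of A B C] by (simp add: vietas_def)
  have mult: "g \<otimes>\<^bsub>BijGroup UNIV\<^esub> h = g \<circ> h"
    if "g \<in> carrier (BijGroup UNIV)" "h \<in> carrier (BijGroup UNIV)" for g h :: "'a padic3 \<Rightarrow> 'a padic3"
    using that by (auto simp: BijGroup_def compose_def)
  have one: "\<one>\<^bsub>BijGroup (UNIV :: 'a padic3 set)\<^esub> = id" by (auto simp: BijGroup_def)
  have inv: "inv\<^bsub>BijGroup UNIV\<^esub> s = s" if s: "s \<in> vietas A B C" for s
  proof (rule G.inv_equality)
    show "s \<otimes>\<^bsub>BijGroup UNIV\<^esub> s = \<one>\<^bsub>BijGroup UNIV\<^esub>"
    proof -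
      have "s \<in> carrier (BijGroup UNIV)" using s H by blast
      then show ?thesis using vietas_involutive[OF s] by (simp only: mult one) (auto simp: o_def)
    qed
  qed (use s H in auto)
  have closed: "g \<in> generate (BijGroup UNIV) (vietas A B C) \<Longrightarrow> v \<in> vorb A B C u \<Longrightarrow> g v \<in> vorb A B C u" for g v
  proof (induction g arbitrary: v rule: generate.induct)
    case one
    then show ?case by (simp add: \<open>\<one>\<^bsub>BijGroup UNIV\<^esub> = id\<close>)
  next
    case (incl h)
    then show ?case by (simp add: vorb_step)
  next
    case (inv h)
    then show ?case using \<open>\<And>s. s \<in> vietas A B C \<Longrightarrow> inv\<^bsub>BijGroup UNIV\<^esub> s = s\<close> by (simp add: vorb_step)
  next
    case (eng h1 h2)
    then have "h1 \<in> carrier (BijGroup UNIV)" "h2 \<in> carrier (BijGroup UNIV)"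
      using G.generate_in_carrier[OF H] by auto
    then show ?case using eng by (simp add: mult)
  qed
  then show "vieta_orbit A B C u \<subseteq> vorb A B C u"
    using closed[OF _ vorb_base] unfolding vieta_orbit_def vieta_group_def vietas_def[symmetric] by blast
  show "vorb A B C u \<subseteq> vieta_orbit A B C u"
  proof
    fix v assume "v \<in> vorb A B C u"
    then have "\<exists>g \<in> generate (BijGroup UNIV) (vietas A B C). v = g u"
    proof induction
      case vorb_base
      then show ?case using generate.one[of "BijGroup UNIV" "vietas A B C"] one by (metis id_apply)
    next
      case (vorb_step v s)
      then obtain g where g: "g \<in> generate (BijGroup UNIV) (vietas A B C)" "v = g u" by blast
      have "s \<otimes>\<^bsub>BijGroup UNIV\<^esub> g \<in> generate (BijGroup UNIV) (vietas A B C)"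
        by (rule generate.eng[OF generate.incl[OF vorb_step.hyps(2)] g(1)])
      moreover have "s \<otimes>\<^bsub>BijGroup UNIV\<^esub> g = s \<circ> g"
        using vorb_step.hyps(2) H g(1) G.generate_in_carrier[OF H] by (intro mult) auto
      ultimately show ?case using g(2) by (intro bexI[of _ "s \<circ> g"]) auto
    qed
    then show "v \<in> vieta_orbit A B C u"
      unfolding vieta_orbit_def vieta_group_def vietas_def[symmetric] by blast
  qed
qed

lemma vorb_trans: "v \<in> vorb A B C u \<Longrightarrow> w \<in> vorb A B C v \<Longrightarrow> w \<in> vorb A B C u"
proof (rotate_tac, induction rule: vorb.induct)
  case (vorb_step w s)
  show ?case by (rule vorb.vorb_step[OF vorb_step.IH[OF vorb_step.prems] vorb_step.hyps(2)])
qed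

lemma vorb_sym: "v \<in> vorb A B C u \<Longrightarrow> u \<in> vorb A B C v"
proof (induction rule: vorb.induct)
  case (vorb_step v s)
  have "s (s v) \<in> vorb A B C (s v)" by (rule vorb.vorb_step[OF vorb_base vorb_step.hyps(2)])
  then have "v \<in> vorb A B C (s v)" unfolding vietas_involutive[OF vorb_step.hyps(2)] .
  then show ?case using vorb_step.IH by (rule vorb_trans)
qed (rule vorb_base)

lemma vorb_eq: "v \<in> vorb A B C u \<Longrightarrow> vorb A B C v = vorb A B C u"
  using vorb_trans vorb_sym by blast

lemma cyc_vietas: "s \<in> vietas A B C \<Longrightarrow> \<exists>t \<in> vietas B C A. \<forall>u. cyc (s u) = t (cyc u)"
  by (auto simp: vietas_def cyc_vieta)

lemma cyc_vorb: "v \<in> vorb A B C u \<Longrightarrow> cyc v \<in> vorb B C A (cyc u)"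
proof (induction rule: vorb.induct)
  case (vorb_step v s)
  obtain t where t: "t \<in> vietas B C A" "cyc (s v) = t (cyc v)" using cyc_vietas[OF vorb_step.hyps(2)] by blast
  show ?case unfolding t(2) by (rule vorb.vorb_step[OF vorb_step.IH t(1)])
qed (rule vorb_base)

lemma cyc_vorb_iff: "cyc v \<in> vorb B C A (cyc u) \<longleftrightarrow> v \<in> vorb A B C u"
  using cyc_vorb[of v A B C u] cyc_vorb[OF cyc_vorb, of "cyc v" B C A "cyc u"] by auto

lemma cyc_int_surface [simp]: "cyc u \<in> int_surface B C A D \<longleftrightarrow> u \<in> int_surface A B C D"
  by (cases u) (auto simp: int_surface_def surface_def algebra_simps)

lemma cyc_closure_vorb: "cyc v \<in> closure (vorb B C A (cyc u)) \<longleftrightarrow> v \<in> closure (vorb A B C u)"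
proof -
  have "(\<exists>w\<in>vorb B C A (cyc u). sup_norm (cyc v - w) \<le> e) \<longleftrightarrow> (\<exists>w\<in>vorb A B C u. sup_norm (v - w) \<le> e)" for e
  proof
    assume "\<exists>w\<in>vorb B C A (cyc u). sup_norm (cyc v - w) \<le> e"
    then obtain w where w: "w \<in> vorb B C A (cyc u)" "sup_norm (cyc v - w) \<le> e" by blast
    define w' where "w' = cyc (cyc w)"
    have "w = cyc w'" by (simp add: w'_def)
    then show "\<exists>w\<in>vorb A B C u. sup_norm (v - w) \<le> e"
      using w by (auto simp: cyc_vorb_iff cyc_diff)
  next
    assume "\<exists>w\<in>vorb A B C u. sup_norm (v - w) \<le> e"
    then obtain w where w: "w \<in> vorb A B C u" "sup_norm (v - w) \<le> e" by blast
    then show "\<exists>w\<in>vorb B C A (cyc u). sup_norm (cyc v - w) \<le> e"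
      by (intro bexI[of _ "cyc w"]) (auto simp: cyc_vorb cyc_diff)
  qed
  then show ?thesis unfolding closure_sup_norm by simp
qed

context
  fixes A B C D :: "'p::prime_card padic"
  assumes ints: "A \<in> padic_ints" "B \<in> padic_ints" "C \<in> padic_ints"
begin

lemma vorb_int_surface: "v \<in> vorb A B C u \<Longrightarrow> u \<in> int_surface A B C D \<Longrightarrow> v \<in> int_surface A B C D"
proof (induction rule: vorb.induct)
  case (vorb_step v s)
  show ?case by (rule vietas_int_surface[OF ints vorb_step.hyps(2) vorb_step.IH[OF vorb_step.prems]])
qed

text \<open>The word that leads from \<open>u\<close> to \<open>w\<close>, applied to
  \<open>v\<close>, gives a point at the same distance from \<open>w\<close>, since the generators
  are isometries of the cube.\<close>

lemma vorb_shadow: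
  assumes "w \<in> vorb A B C u" "u \<in> int_cube" "v \<in> int_cube" "sup_norm (u - v) \<le> r"
  shows "w \<in> int_cube \<and> (\<exists>w' \<in> vorb A B C v. w' \<in> int_cube \<and> sup_norm (w - w') \<le> r)"
  using assms
proof (induction rule: vorb.induct)
  case vorb_base
  then show ?case using vorb.vorb_base by blast
next
  case (vorb_step w s)
  then obtain w' where w': "w \<in> int_cube" "w' \<in> vorb A B C v" "w' \<in> int_cube" "sup_norm (w - w') \<le> r" by blast
  then show ?case
    using vietas_isometry[OF ints vorb_step.hyps(2), of w w'] vietas_int_cube[OF ints vorb_step.hyps(2)]
      vorb.vorb_step[OF w'(2) vorb_step.hyps(2)] by metis
qed

text \<open>If a word carries \<open>u\<close> close to \<open>v\<close>, the inverse word carries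
  \<open>v\<close> equally close to \<open>u\<close>.\<close>

lemma closure_vorb_sym:
  assumes "u \<in> int_cube" "v \<in> int_cube" "v \<in> closure (vorb A B C u)"
  shows "u \<in> closure (vorb A B C v)"
  unfolding closure_sup_norm
proof (intro allI impI)
  fix e :: real assume "e > 0"
  then obtain w where w: "w \<in> vorb A B C u" "sup_norm (v - w) \<le> e"
    using assms(3) unfolding closure_sup_norm by blast
  have "w \<in> int_cube" using vorb_shadow[OF w(1) assms(1,1), of 0] by simp
  then show "\<exists>w\<in>vorb A B C v. sup_norm (u - w) \<le> e"
    using vorb_shadow[OF vorb_sym[OF w(1)] _ assms(2), of e] w(2) by (auto simp: sup_norm_diff_commute)
qed

text \<open>A point \<open>u1\<close> of the orbit of \<open>u\<close> close to \<open>v\<close>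
  shadows the word leading from \<open>v\<close> close to \<open>w\<close>. The ultrametric
  inequality keeps the total error at \<open>e\<close>.\<close>

lemma closure_vorb_trans:
  assumes "u \<in> int_cube" "v \<in> int_cube" "v \<in> closure (vorb A B C u)" "w \<in> closure (vorb A B C v)"
  shows "w \<in> closure (vorb A B C u)"
  unfolding closure_sup_norm
proof (intro allI impI)
  fix e :: real assume e: "e > 0"
  then obtain w1 where w1: "w1 \<in> vorb A B C v" "sup_norm (w - w1) \<le> e"
    using assms(4) unfolding closure_sup_norm by blast
  obtain u1 where u1: "u1 \<in> vorb A B C u" "sup_norm (v - u1) \<le> e"
    using e assms(3) unfolding closure_sup_norm by blast
  have "u1 \<in> int_cube" using vorb_shadow[OF u1(1) assms(1,1), of 0] by simp
  then obtain w' where w': "w' \<in> vorb A B C u1" "sup_norm (w1 - w') \<le> e"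
    using vorb_shadow[OF w1(1) assms(2) _ u1(2)] by blast
  have "sup_norm (w - w') \<le> e" using w1(2) w'(2) by (rule sup_norm_trans)
  then show "\<exists>w'\<in>vorb A B C u. sup_norm (w - w') \<le> e" using vorb_trans[OF u1(1) w'(1)] by blast
qed

lemma closure_vorb_eq:
  assumes "u \<in> int_cube" "v \<in> int_cube" "v \<in> closure (vorb A B C u)"
  shows "closure (vorb A B C v) = closure (vorb A B C u)"
  using closure_vorb_trans[OF assms] closure_vorb_trans[OF assms(2,1) closure_vorb_sym[OF assms]] by blast

end

section \<open>Iterates of maps close to the identity\<close>

text \<open>The hypothesis \<open>near\<close> says that f - id is Lipschitz with constant
  \<open>q\<close>. Ultrametric errors do not accumulate, so every iterate satisfies it with the
  same constant.\<close>

lemma near_identity_iterate: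
  fixes f :: "'p::prime_card padic3 \<Rightarrow> 'p padic3"
  assumes inv: "\<And>u. u \<in> X \<Longrightarrow> f u \<in> X"
    and near: "\<And>u v. u \<in> X \<Longrightarrow> v \<in> X \<Longrightarrow> sup_norm ((f u - f v) - (u - v)) \<le> q * sup_norm (u - v)"
    and q: "q \<ge> 0" "q \<le> 1" and u: "u \<in> X" "v \<in> X"
  shows "(f ^^ n) u \<in> X \<and> (f ^^ n) v \<in> X \<and>
    sup_norm (((f ^^ n) u - (f ^^ n) v) - (u - v)) \<le> q * sup_norm (u - v)"
proof (induction n)
  case 0
  then show ?case using u q by simp
next
  case (Suc n)
  let ?a = "(f ^^ n) u" and ?b = "(f ^^ n) v"
  have "q * sup_norm (u - v) \<le> 1 * sup_norm (u - v)"
    using q sup_norm_nonneg[of "u - v"] by (intro mult_right_mono) auto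
  then have "sup_norm (((?a - ?b) - (u - v)) + (u - v)) \<le> sup_norm (u - v)"
    using Suc.IH by (intro sup_norm_add_le[of "(?a - ?b) - (u - v)"]) auto
  then have "q * sup_norm (?a - ?b) \<le> q * sup_norm (u - v)"
    using q by (intro mult_left_mono) auto
  then have "sup_norm ((f ?a - f ?b) - (?a - ?b)) \<le> q * sup_norm (u - v)"
    using near[of ?a ?b] Suc.IH by linarith
  moreover have "sup_norm ((?a - ?b) - (u - v)) \<le> q * sup_norm (u - v)" using Suc.IH by blast
  ultimately have "sup_norm ((f ?a - f ?b) - (u - v)) \<le> q * sup_norm (u - v)" by (rule sup_norm_trans)
  then show ?case using Suc.IH inv by simp
qed

text \<open>Since \<open>f\<close> is close to the identity, \<open>n \<mapsto> f\<^sup>n u\<close> is close to the affine function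
  \<open>n \<mapsto> u + n (f u - u)\<close>; the factor \<open>|n|\<close> in the error term comes from factoring
  \<open>n = p n'\<close> and replacing \<open>f\<close> by \<open>f\<^sup>p\<close>.\<close>

lemma near_identity_growth:
  fixes f :: "'p::prime_card padic3 \<Rightarrow> 'p padic3"
  assumes inv: "\<And>u. u \<in> X \<Longrightarrow> f u \<in> X"
    and near: "\<And>u v. u \<in> X \<Longrightarrow> v \<in> X \<Longrightarrow> sup_norm ((f u - f v) - (u - v)) \<le> q * sup_norm (u - v)"
    and q: "q \<ge> 0" "real CARD('p) * q \<le> 1" and u: "u \<in> X"
  shows "sup_norm ((f ^^ n) u - u - smul (of_nat n) (f u - u)) \<le>
    padic_norm (of_nat n :: 'p padic) * (real CARD('p) * q) * sup_norm (f u - u)"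
  using inv near
\<comment> \<open>The map is generalised because for n divisible by p the induction hypothesis is
  applied to the p-th iterate of \<open>f\<close>.\<close>
proof (induction n arbitrary: f rule: less_induct)
  case (less n f)
  let ?P = "real CARD('p)" and ?w = "f u - u"
  have P: "?P > 1" using card_prime_gt_1[where 'p='p] by simp
  have q1: "q \<le> 1" using mult_right_mono[of 1 ?P q] P q by simp
  have iter: "(f ^^ n) u \<in> X \<and> (f ^^ n) v \<in> X \<and>
      sup_norm (((f ^^ n) u - (f ^^ n) v) - (u - v)) \<le> q * sup_norm (u - v)" if "u \<in> X" "v \<in> X" for u v n
    by (rule near_identity_iterate[of X f, OF less.prems q(1) q1 that])
  \<comment> \<open>The same estimate without the factor |m|. It suffices when p does not divide the
    exponent, where that factor is 1.\<close>
  have crude: "sup_norm ((f ^^ m) u - u - smul (of_nat m) ?w) \<le> q * sup_norm ?w" for m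
  proof (induction m)
    case 0
    then show ?case using q by (simp add: minus_prod_def)
  next
    case (Suc m)
    have "sup_norm (((f ^^ m) (f u) - (f ^^ m) u) - (f u - u)) \<le> q * sup_norm ?w"
      using iter[of "f u" u m] less.prems(1) u by blast
    then have "sup_norm ((((f ^^ m) (f u) - (f ^^ m) u) - ?w) + ((f ^^ m) u - u - smul (of_nat m) ?w))
        \<le> q * sup_norm ?w"
      using Suc.IH by (rule sup_norm_add_le)
    also have "(((f ^^ m) (f u) - (f ^^ m) u) - ?w) + ((f ^^ m) u - u - smul (of_nat m) ?w) =
        (f ^^ Suc m) u - u - smul (of_nat (Suc m)) ?w"
      by (simp add: funpow_swap1 smul_add_left algebra_simps)
    finally show ?case .
  qed
  consider "n = 0" | "\<not> CARD('p) dvd n" | "n > 0" "CARD('p) dvd n" by blast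
  then show ?case
  proof cases
    case 1
    then show ?thesis by simp
  next
    case 2
    have "q * sup_norm ?w \<le> 1 * (?P * q) * sup_norm ?w"
      using P q mult_right_mono[of 1 ?P q] by (intro mult_right_mono) auto
    then show ?thesis using crude[of n] padic_norm_of_nat_eq_1[OF 2] by simp
  next
    case 3
    then obtain m where n: "n = CARD('p) * m" by auto
    have m: "m < n" using 3 n card_prime_gt_1[where 'p='p] by simp
    define g where "g = f ^^ CARD('p)"
    let ?w' = "g u - u"
    have gm: "(f ^^ n) u = (g ^^ m) u" by (simp add: n g_def funpow_mult)
    have ginv: "\<And>v. v \<in> X \<Longrightarrow> g v \<in> X" using iter unfolding g_def by blast
    have gnear: "\<And>u v. u \<in> X \<Longrightarrow> v \<in> X \<Longrightarrow> sup_norm ((g u - g v) - (u - v)) \<le> q * sup_norm (u - v)"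
      using iter unfolding g_def by blast
    have cr: "sup_norm (?w' - smul (of_nat CARD('p)) ?w) \<le> q * sup_norm ?w"
      using crude[of "CARD('p)"] by (simp add: g_def)
    have "q * sup_norm ?w \<le> 1 / ?P * sup_norm ?w"
      using q P by (intro mult_right_mono) (auto simp: field_simps)
    \<comment> \<open>The p-th iterate moves \<open>u\<close> at most 1/p times as far as
      \<open>f\<close> does. This supplies the missing factor |p| in |n| = |p| |m|.\<close>
    then have w': "sup_norm ((?w' - smul (of_nat CARD('p)) ?w) + smul (of_nat CARD('p)) ?w) \<le> 1 / ?P * sup_norm ?w"
      using cr by (intro sup_norm_add_le[of "?w' - smul (of_nat CARD('p)) ?w"]) (auto simp: sup_norm_smul)
    let ?c = "padic_norm (of_nat m :: 'p padic)"
    have nn: "padic_norm (of_nat n :: 'p padic) = 1 / ?P * ?c" by (simp add: n padic_norm_mult)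
    have c0: "?c \<ge> 0" by (rule padic_norm_nonneg)
    have "sup_norm ((g ^^ m) u - u - smul (of_nat m) ?w') \<le> ?c * (?P * q) * sup_norm ?w'"
      by (rule less.IH[OF m ginv gnear])
    also have "\<dots> \<le> ?c * (?P * q) * (1 / ?P * sup_norm ?w)"
      using w' c0 q P by (intro mult_left_mono) auto
    finally have 1: "sup_norm ((g ^^ m) u - u - smul (of_nat m) ?w') \<le>
        padic_norm (of_nat n :: 'p padic) * (?P * q) * sup_norm ?w"
      unfolding nn by (simp add: mult_ac)
    have "sup_norm (smul (of_nat m) (?w' - smul (of_nat CARD('p)) ?w)) \<le> ?c * (q * sup_norm ?w)"
      unfolding sup_norm_smul using cr c0 by (rule mult_left_mono)
    also have "\<dots> = padic_norm (of_nat n :: 'p padic) * (?P * q) * sup_norm ?w"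
      unfolding nn using P by (simp add: field_simps)
    finally have 2: "sup_norm (smul (of_nat m) (?w' - smul (of_nat CARD('p)) ?w)) \<le>
        padic_norm (of_nat n :: 'p padic) * (?P * q) * sup_norm ?w" .
    have "(f ^^ n) u - u - smul (of_nat n) ?w = ((g ^^ m) u - u - smul (of_nat m) ?w') +
        smul (of_nat m) (?w' - smul (of_nat CARD('p)) ?w)"
      unfolding gm by (simp add: n smul_diff smul_smul mult.commute)
    then show ?thesis using sup_norm_add_le[OF 1 2] by (simp only:)
  qed
qed

text \<open>After rescaling, the sequence is an isometric copy of the natural numbers with the
  p-adic metric. Its first p^k terms lie in distinct residue classes modulo p^k, hence in all of
  them.\<close>

lemma padic_orbit_dense:
  fixes \<phi> :: "nat \<Rightarrow> 'p::prime_card padic"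
    and c :: "'p padic"
  assumes scale: "\<And>m d. padic_norm (\<phi> (m + d) - \<phi> m) = padic_norm (of_nat d :: 'p padic) * padic_norm c"
    and c: "c \<noteq> 0" and x: "padic_norm (x - \<phi> 0) \<le> padic_norm c"
  shows "\<exists>n. padic_norm (x - \<phi> n) \<le> padic_norm c / real CARD('p) ^ k"
proof -
  let ?M = "CARD('p) ^ k" and ?r = "1 / real CARD('p) ^ k"
  have c0: "padic_norm c > 0" using padic_norm_pos[OF c] .
  define \<psi> where "\<psi> n = (\<phi> n - \<phi> 0) / c" for n
  have "padic_norm (\<psi> n) \<le> 1" for n
    using scale[of 0 n] c0 padic_norm_of_nat_le_1[of n, where 'p='p]
    by (simp add: \<psi>_def padic_norm_divide)
  then have "\<exists>a<?M. padic_norm (\<psi> n - of_nat a) \<le> ?r" for n by (intro padic_residue)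
  then obtain \<rho> where \<rho>: "\<And>n. \<rho> n < ?M" "\<And>n. padic_norm (\<psi> n - of_nat (\<rho> n)) \<le> ?r" by metis
  have inj_aux: "m = n" if mn: "m \<le> n" "n < ?M" "\<rho> m = \<rho> n" for m n
  proof -
    have "padic_norm (of_nat (\<rho> n) - \<psi> m) \<le> ?r"
      using \<rho>(2)[of m] mn(3) by (simp add: padic_norm_diff_commute)
    then have "padic_norm (\<psi> n - \<psi> m) \<le> ?r" using padic_norm_trans[OF \<rho>(2)[of n]] by blast
    moreover have "\<psi> n - \<psi> m = (\<phi> n - \<phi> m) / c" by (simp add: \<psi>_def diff_divide_distrib)
    ultimately have "padic_norm (of_nat (n - m) :: 'p padic) \<le> ?r"
      using scale[of m "n - m"] mn(1) c0 by (simp add: padic_norm_divide)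
    then have "padic_norm (of_nat (n - m) - of_nat 0 :: 'p padic) \<le> ?r" by simp
    then have "n - m = 0" using mn(2) by (intro padic_residue_unique[where 'p='p]) auto
    then show ?thesis using mn(1) by simp
  qed
  have "inj_on \<rho> {..<?M}"
  proof (rule inj_onI)
    fix m n assume "m \<in> {..<?M}" "n \<in> {..<?M}" "\<rho> m = \<rho> n"
    then show "m = n" using inj_aux[of m n] inj_aux[of n m] by (cases "m \<le> n") auto
  qed
  moreover have "\<rho> ` {..<?M} \<subseteq> {..<?M}" using \<rho>(1) by auto
  ultimately have surj: "\<rho> ` {..<?M} = {..<?M}" by (intro endo_inj_surj) auto
  have "padic_norm ((x - \<phi> 0) / c) \<le> 1" using x c0 by (simp add: padic_norm_divide)
  then obtain a where a: "a < ?M" "padic_norm ((x - \<phi> 0) / c - of_nat a) \<le> ?r"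
    using padic_residue by blast
  then obtain n where n: "\<rho> n = a" using surj by (metis imageE lessThan_iff)
  have "padic_norm (of_nat a - \<psi> n) \<le> ?r" using \<rho>(2)[of n] n by (simp add: padic_norm_diff_commute)
  then have "padic_norm ((x - \<phi> 0) / c - \<psi> n) \<le> ?r" by (rule padic_norm_trans[OF a(2)])
  moreover have "(x - \<phi> 0) / c - \<psi> n = (x - \<phi> n) / c" by (simp add: \<psi>_def diff_divide_distrib)
  ultimately have "padic_norm (x - \<phi> n) \<le> padic_norm c / real CARD('p) ^ k"
    using c0 by (simp add: padic_norm_divide field_simps)
  then show ?thesis by blast
qed

text \<open>\<open>\<pi>\<close> is a coordinate that sees at least the proportion
  \<open>\<rho>\<close> of the first displacement. As p q is below \<open>\<rho>\<close>, the error
  in \<open>near_identity_growth\<close> is smaller than the coordinate of the displacement, so the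
  coordinates of the iterates form a scaled copy of the natural numbers with the p-adic metric and
  are dense in a disc. Compactness of the cube then yields a limit point with the exact coordinate
  \<open>x\<close>.\<close>

lemma near_identity_fill:
  fixes f :: "'p::prime_card padic3 \<Rightarrow> 'p padic3"
  assumes X: "X \<subseteq> int_cube"
    and inv: "\<And>u. u \<in> X \<Longrightarrow> f u \<in> X"
    and near: "\<And>u v. u \<in> X \<Longrightarrow> v \<in> X \<Longrightarrow> sup_norm ((f u - f v) - (u - v)) \<le> q * sup_norm (u - v)"
    and q: "q \<ge> 0" "real CARD('p) * q < \<rho>" "\<rho> \<le> 1" and u: "u \<in> X"
    and \<pi>: "\<And>u v. \<pi> (u - v) = \<pi> u - \<pi> v" "\<And>u. padic_norm (\<pi> u) \<le> sup_norm u"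
      "\<And>c u. \<pi> (smul c u) = c * \<pi> u"
    and w: "f u \<noteq> u" "\<rho> * sup_norm (f u - u) \<le> padic_norm (\<pi> (f u - u))"
    and x: "padic_norm (x - \<pi> u) \<le> padic_norm (\<pi> (f u - u))"
  shows "\<exists>v \<in> closure (range (\<lambda>n. (f ^^ n) u)). \<pi> v = x \<and> \<rho> * sup_norm (v - u) \<le> padic_norm (x - \<pi> u)"
proof -
  let ?P = "real CARD('p)" and ?w = "f u - u"
  define c where "c = \<pi> ?w"
  have P: "?P > 1" using card_prime_gt_1[where 'p='p] by simp
  have q1: "?P * q \<le> 1" using q by linarith
  have qle: "q \<le> ?P * q" using P q mult_right_mono[of 1 ?P q] by simp
  have q2: "q \<le> 1" using qle q1 by linarith
  have w0: "sup_norm ?w > 0" using w(1) by (intro sup_norm_pos) simp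
  have big: "?P * q * sup_norm ?w < padic_norm c"
    using w(2) mult_strict_right_mono[OF q(2) w0] by (simp add: c_def)
  have "?P * q * sup_norm ?w \<ge> 0" using q P w0 by (intro mult_nonneg_nonneg) auto
  then have c: "c \<noteq> 0" using big by auto
  have iter: "(f ^^ n) u \<in> X \<and> (f ^^ n) v \<in> X \<and>
      sup_norm (((f ^^ n) u - (f ^^ n) v) - (u - v)) \<le> q * sup_norm (u - v)" if "u \<in> X" "v \<in> X" for u v n
    by (rule near_identity_iterate[of X f, OF inv near q(1) q2 that])
  have iterX: "(f ^^ n) u \<in> X" for n using iter u by blast
  have grow: "sup_norm ((f ^^ d) u - u - smul (of_nat d) ?w) \<le>
      padic_norm (of_nat d :: 'p padic) * (?P * q) * sup_norm ?w" for d
    by (rule near_identity_growth[of X f, OF inv near q(1) q1 u])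
  have disp: "sup_norm ((f ^^ d) u - u) \<le> padic_norm (of_nat d :: 'p padic) * sup_norm ?w" for d
  proof -
    let ?d = "padic_norm (of_nat d :: 'p padic)"
    have "?d * (?P * q) * sup_norm ?w \<le> ?d * sup_norm ?w"
      using q1 q P by (intro mult_right_mono mult_left_le) (auto simp: padic_norm_nonneg)
    then have "sup_norm (((f ^^ d) u - u - smul (of_nat d) ?w) + smul (of_nat d) ?w) \<le> ?d * sup_norm ?w"
      using grow[of d] by (intro sup_norm_add_le[of "(f ^^ d) u - u - smul (of_nat d) ?w"]) (auto simp: sup_norm_smul)
    then show ?thesis by simp
  qed
  \<comment> \<open>An equality although all inputs are estimates: the main term |d| |c| strictly
    dominates the error, so it decides the norm.\<close>
  have scale: "padic_norm (\<pi> ((f ^^ (m + d)) u) - \<pi> ((f ^^ m) u)) = padic_norm (of_nat d :: 'p padic) * padic_norm c" for m d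
  proof (cases "d = 0")
    case False
    let ?d = "padic_norm (of_nat d :: 'p padic)"
    \<comment> \<open>A positive number has nonzero norm: d < p^d, so d is its own residue modulo
      p^d and differs from the residue 0.\<close>
    have "\<not> padic_norm (of_nat d :: 'p padic) \<le> 0"
    proof
      assume "padic_norm (of_nat d :: 'p padic) \<le> 0"
      then have "padic_norm (of_nat d - of_nat 0 :: 'p padic) \<le> 1 / real CARD('p) ^ d"
        by (simp add: order_trans[of _ 0])
      then have "d = 0" using less_exp[of d] card_prime_gt_1[where 'p='p]
        by (intro padic_residue_unique[where 'p='p and n=d and b=0]) (auto intro: power_gt_expt)
      then show False using False by simp
    qed
    then have d0: "?d > 0" by simp
    let ?e = "((f ^^ m) ((f ^^ d) u) - (f ^^ m) u) - ((f ^^ d) u - u)"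
    let ?b = "?d * (?P * q) * sup_norm ?w"
    have "sup_norm ?e \<le> q * sup_norm ((f ^^ d) u - u)" using iter[OF iterX u] by blast
    also have "\<dots> \<le> q * (?d * sup_norm ?w)" using disp q by (intro mult_left_mono) auto
    also have "\<dots> \<le> (?P * q) * (?d * sup_norm ?w)" using qle d0 w0 by (intro mult_right_mono) auto
    finally have "sup_norm ?e \<le> ?b" by (simp add: mult_ac)
    then have le: "sup_norm (?e + ((f ^^ d) u - u - smul (of_nat d) ?w)) \<le> ?b"
      using grow[of d] by (rule sup_norm_add_le)
    have "?e + ((f ^^ d) u - u - smul (of_nat d) ?w) = (f ^^ (m + d)) u - (f ^^ m) u - smul (of_nat d) ?w"
      unfolding funpow_add o_apply by (simp only: algebra_simps)
    then have "sup_norm ((f ^^ (m + d)) u - (f ^^ m) u - smul (of_nat d) ?w) \<le> ?b"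
      using le by (simp only:)
    then have "padic_norm (\<pi> ((f ^^ (m + d)) u - (f ^^ m) u - smul (of_nat d) ?w)) \<le> ?b"
      by (rule order_trans[OF \<pi>(2)])
    then have "padic_norm ((\<pi> ((f ^^ (m + d)) u) - \<pi> ((f ^^ m) u)) - of_nat d * c) \<le> ?b"
      by (simp add: \<pi>(1,3) c_def)
    also have "\<dots> < ?d * padic_norm c" using big d0 by (simp add: mult.assoc)
    also have "\<dots> = padic_norm (of_nat d * c)" by (simp add: padic_norm_mult)
    finally have "padic_norm (of_nat d * c - (\<pi> ((f ^^ (m + d)) u) - \<pi> ((f ^^ m) u))) < padic_norm (of_nat d * c)"
      by (subst padic_norm_diff_commute)
    from padic_norm_eq_of_close[OF this] show ?thesis by (simp add: padic_norm_mult)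
  qed simp
  have "\<exists>n. padic_norm (x - \<pi> ((f ^^ n) u)) \<le> padic_norm c / ?P ^ k" for k
    by (rule padic_orbit_dense[where \<phi>="\<lambda>n. \<pi> ((f ^^ n) u)", OF scale c]) (use x in \<open>simp add: c_def\<close>)
  then obtain N where N: "\<And>k. padic_norm (x - \<pi> ((f ^^ N k) u)) \<le> padic_norm c / ?P ^ k" by metis
  have "\<forall>k. (f ^^ N k) u \<in> int_cube" using iterX X by blast
  then obtain v \<sigma> where v: "strict_mono \<sigma>" "((\<lambda>k. (f ^^ N k) u) \<circ> \<sigma>) \<longlonglongrightarrow> v"
    using compact_int_cube[where 'p='p] unfolding compact_def by meson
  let ?y = "\<lambda>k. (f ^^ N (\<sigma> k)) u"
  have lim: "?y \<longlonglongrightarrow> v" using v(2) by (simp add: o_def)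
  have "v \<in> closure (range (\<lambda>n. (f ^^ n) u))"
    unfolding closure_sequential by (intro exI[of _ ?y]) (use lim in auto)
  have supto: "(\<lambda>k. sup_norm (?y k - v)) \<longlonglongrightarrow> 0"
  proof (rule Lim_null_comparison)
    show "\<forall>\<^sub>F k in sequentially. norm (sup_norm (?y k - v)) \<le> dist (?y k) v"
      by (simp add: sup_norm_le_dist)
    show "(\<lambda>k. dist (?y k) v) \<longlonglongrightarrow> 0" using lim by (rule tendsto_dist_iff[THEN iffD1])
  qed
  have eps: "\<exists>k. sup_norm (?y k - v) < e \<and> padic_norm (x - \<pi> (?y k)) < e" if e: "e > 0" for e
  proof -
    have "\<exists>j. 1 / ?P ^ j < e / padic_norm c"
      using padic_radius_small[of "e / padic_norm c", where 'p='p] e padic_norm_pos[OF c] by simp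
    then obtain j where j: "padic_norm c / ?P ^ j < e"
      using padic_norm_pos[OF c] by (auto simp: field_simps)
    have "eventually (\<lambda>k. sup_norm (?y k - v) < e) sequentially"
      using supto e by (rule order_tendstoD(2))
    moreover have "eventually (\<lambda>k. k \<ge> j) sequentially" by (rule eventually_ge_at_top)
    ultimately have "eventually (\<lambda>k. sup_norm (?y k - v) < e \<and> k \<ge> j) sequentially"
      by (rule eventually_conj)
    then obtain k where k: "sup_norm (?y k - v) < e" "k \<ge> j"
      by (metis (mono_tags, lifting) eventually_happens' sequentially_bot)
    have "\<sigma> k \<ge> j" using seq_suble[OF v(1), of k] k(2) by linarith
    then have "padic_norm c / ?P ^ \<sigma> k \<le> padic_norm c / ?P ^ j"
      using P padic_norm_pos[OF c] by (intro divide_left_mono power_increasing) auto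
    then show ?thesis using N[of "\<sigma> k"] j k(1) by (intro exI[of _ k]) linarith
  qed
  have "\<pi> v = x"
  proof (rule ccontr)
    assume "\<pi> v \<noteq> x"
    then have e: "padic_norm (x - \<pi> v) > 0" by (intro padic_norm_pos) simp
    then obtain k where k: "sup_norm (?y k - v) < padic_norm (x - \<pi> v)" "padic_norm (x - \<pi> (?y k)) < padic_norm (x - \<pi> v)"
      using eps by blast
    have "padic_norm (\<pi> (?y k) - \<pi> v) < padic_norm (x - \<pi> v)"
      using \<pi>(2)[of "?y k - v"] k(1) by (simp add: \<pi>(1))
    with k(2) have "padic_norm ((x - \<pi> (?y k)) + (\<pi> (?y k) - \<pi> v)) < padic_norm (x - \<pi> v)"
      by (rule padic_norm_add_less)
    then show False by simp
  qed
  moreover have "\<rho> * sup_norm (v - u) \<le> padic_norm (x - \<pi> u)"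
  proof (cases "v = u")
    case False
    have \<rho>0: "\<rho> > 0" using q P by (smt (verit) mult_nonneg_nonneg)
    \<comment> \<open>At most the distance from \<open>v\<close> to \<open>u\<close>. An iterate
      within \<open>e\<close> of \<open>v\<close> is therefore at least as far from \<open>u\<close>
      as \<open>v\<close> is, and the lower bound for the coordinate of the iterate passes to the
      limit.\<close>
    define e where "e = \<rho> * sup_norm (v - u)"
    have e: "e > 0" "e \<le> sup_norm (v - u)" using False \<rho>0 q(3) sup_norm_pos[of "v - u"] by (auto simp: e_def mult_left_le_one_le)
    show ?thesis
    proof (rule ccontr)
      assume n: "\<not> ?thesis"
      obtain k where k: "sup_norm (?y k - v) < e" "padic_norm (x - \<pi> (?y k)) < e" using eps[OF e(1)] by blast
      have "sup_norm (?y k - u) \<ge> sup_norm (v - u)"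
      proof (rule ccontr)
        assume "\<not> ?thesis"
        moreover have "sup_norm ((?y k - u) - (?y k - v)) \<le> max (sup_norm (?y k - u)) (sup_norm (?y k - v))"
          by (rule sup_norm_diff_le) auto
        ultimately show False using k(1) e(2) by simp
      qed
      then have "e \<le> \<rho> * sup_norm (?y k - u)" using \<rho>0 by (simp add: e_def)
      also have "\<dots> \<le> \<rho> * (padic_norm (of_nat (N (\<sigma> k)) :: 'p padic) * sup_norm ?w)"
        using disp \<rho>0 by (intro mult_left_mono) auto
      also have "\<dots> \<le> padic_norm (of_nat (N (\<sigma> k)) :: 'p padic) * padic_norm c"
        using mult_left_mono[OF w(2) padic_norm_nonneg[of "of_nat (N (\<sigma> k)) :: 'p padic"]] by (simp add: c_def mult_ac)
      also have "\<dots> = padic_norm (\<pi> (?y k) - \<pi> u)" using scale[of 0 "N (\<sigma> k)"] by simp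
      finally have ge: "e \<le> padic_norm (\<pi> (?y k) - \<pi> u)" .
      have "padic_norm ((x - \<pi> u) - (x - \<pi> (?y k))) < e"
        using n k(2) by (intro padic_norm_diff_less[of "x - \<pi> u"]) (auto simp: e_def)
      then show False using ge by simp
    qed
  qed (use padic_norm_nonneg in simp)
  ultimately show ?thesis using \<open>v \<in> closure (range (\<lambda>n. (f ^^ n) u))\<close> by blast
qed

section \<open>Rotations along the fibres\<close>

definition rot :: "'p::prime_card padic \<Rightarrow> 'p padic \<Rightarrow> 'p padic3 \<Rightarrow> 'p padic3" where
  "rot A B u = vieta1 A (vieta2 B u)"

text \<open>The linear part of the rotation on the fibre over \<open>z\<close>. A difference of two
  points of the fibre has third coordinate 0, and there it acts as a matrix of trace z^2 - 2 and
  determinant 1.\<close>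

definition rot_lin :: "'p::prime_card padic \<Rightarrow> 'p padic3 \<Rightarrow> 'p padic3" where
  "rot_lin z u = ((z\<^sup>2 - 1) * fst u + z * fst (snd u), - (z * fst u) - fst (snd u), snd (snd u))"

lemma rot_third [simp]: "snd (snd (rot A B u)) = snd (snd u)"
  by (cases u) (simp add: rot_def vieta1_def vieta2_def)

lemma rot_iter_third [simp]: "snd (snd ((rot A B ^^ n) u)) = snd (snd u)"
  by (induction n) auto

lemma rot_diff:
  assumes "snd (snd u) = z" "snd (snd v) = z"
  shows "rot A B u - rot A B v = rot_lin z (u - v)"
  using assms by (cases u; cases v)
    (simp add: rot_def rot_lin_def vieta1_def vieta2_def algebra_simps power2_eq_square)

lemma rot_iter_diff:
  assumes "snd (snd u) = z" "snd (snd v) = z"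
  shows "(rot A B ^^ n) u - (rot A B ^^ n) v = (rot_lin z ^^ n) (u - v)"
  by (induction n) (auto simp: rot_diff[of _ z] assms)

lemma rot_lin_smul: "(rot_lin z ^^ n) (smul c u) = smul c ((rot_lin z ^^ n) u)"
proof (induction n)
  case (Suc n)
  have "rot_lin z (smul c v) = smul c (rot_lin z v)" for v
    by (simp add: rot_lin_def smul_def algebra_simps)
  then show ?case using Suc by simp
qed simp

lemma rot_lin_third: "snd (snd ((rot_lin z ^^ n) u)) = snd (snd u)"
  by (induction n) (auto simp: rot_lin_def)

section \<open>Traces of the powers of the linear part\<close>

lemma rot_lin_cayley_hamilton:
  assumes "snd (snd u) = 0"
  shows "rot_lin z (rot_lin z u) = smul (z\<^sup>2 - 2) (rot_lin z u) - u"
  using assms by (cases u) (simp add: rot_lin_def smul_def algebra_simps power2_eq_square)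

text \<open>The trace of the n-th power of a matrix of determinant 1 and trace z^2 - 2, as a
  polynomial in z. It is a Chebyshev polynomial in disguise: if z^2 - 2 = t + 1/t, its value is t^n
  + t^(-n).\<close>

fun trace_poly :: "nat \<Rightarrow> 'a::comm_ring_1 poly" where
  "trace_poly 0 = [:2:]"
| "trace_poly (Suc 0) = [:-2, 0, 1:]"
| "trace_poly (Suc (Suc n)) = [:-2, 0, 1:] * trace_poly (Suc n) - trace_poly n"

lemma degree_trace_poly: "degree (trace_poly n :: 'a::idom poly) = 2 * n"
proof (induction n rule: trace_poly.induct)
  case (3 n)
  have "trace_poly (Suc n) \<noteq> (0 :: 'a poly)" using 3(1) by auto
  then have "degree ([:-2, 0, 1:] * trace_poly (Suc n) :: 'a poly) = 2 + 2 * Suc n"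
    using 3(1) by (subst degree_mult_eq) auto
  moreover have "degree (- trace_poly n :: 'a poly) < 2 + 2 * Suc n" using 3(2) by simp
  ultimately have "degree ([:-2, 0, 1:] * trace_poly (Suc n) + - trace_poly n :: 'a poly) = 2 + 2 * Suc n"
    by (subst degree_add_eq_left) auto
  then show ?case by simp
qed auto

lemma finite_trace_poly_eq_2:
  assumes "n \<ge> 1"
  shows "finite {z :: 'a::idom. poly (trace_poly n) z = 2}"
proof -
  have "trace_poly n - [:2:] \<noteq> (0 :: 'a poly)"
  proof
    assume "trace_poly n - [:2:] = (0 :: 'a poly)"
    then have "trace_poly n = ([:2:] :: 'a poly)" by simp
    then have "degree (trace_poly n :: 'a poly) = 0" by (metis degree_pCons_0)
    then show False using assms by (simp add: degree_trace_poly)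
  qed
  then have "finite {z :: 'a. poly (trace_poly n - [:2:]) z = 0}" by (rule poly_roots_finite)
  then show ?thesis by simp
qed

text \<open>For a 2 by 2 matrix M of determinant 1, M^n + M^(-n) is the scalar tr(M^n). Multiplied
  by M^m with m at least n, the identity contains no inverse.\<close>

lemma rot_lin_trace:
  assumes "snd (snd v) = 0" "n \<le> m"
  shows "(rot_lin z ^^ (m + n)) v + (rot_lin z ^^ (m - n)) v = smul (poly (trace_poly n) z) ((rot_lin z ^^ m) v)"
  using assms(2)
proof (induction n rule: trace_poly.induct)
  have rec: "(rot_lin z ^^ Suc (Suc k)) v = smul (z\<^sup>2 - 2) ((rot_lin z ^^ Suc k) v) - (rot_lin z ^^ k) v" for k
    using rot_lin_cayley_hamilton[of "(rot_lin z ^^ k) v" z] by (simp add: rot_lin_third assms(1))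
  {
    case 1
    then show ?case by (simp add: smul_def prod_eq_iff)
  next
    case 2
    then obtain k where m: "m = Suc k" by (cases m) auto
    show ?case using rec[of k] by (simp add: m power2_eq_square algebra_simps)
  next
    case (3 n)
    then obtain k where m: "m = Suc (Suc (n + k))" by (metis add_Suc le_Suc_ex)
    have 1: "(rot_lin z ^^ (m + Suc n)) v + (rot_lin z ^^ Suc k) v = smul (poly (trace_poly (Suc n)) z) ((rot_lin z ^^ m) v)"
      using 3(1) 3(3) by (simp add: m)
    have 2: "(rot_lin z ^^ (m + n)) v + (rot_lin z ^^ Suc (Suc k)) v = smul (poly (trace_poly n) z) ((rot_lin z ^^ m) v)"
      using 3(2) 3(3) by (simp add: m)
    have add: "smul c (a + b) = smul c a + smul c b" for c :: "'a padic" and a b by (simp add: smul_def algebra_simps)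
    have "(rot_lin z ^^ (m + Suc (Suc n))) v + (rot_lin z ^^ k) v =
        (smul (z\<^sup>2 - 2) ((rot_lin z ^^ (m + Suc n)) v) - (rot_lin z ^^ (m + n)) v) +
        (smul (z\<^sup>2 - 2) ((rot_lin z ^^ Suc k) v) - (rot_lin z ^^ Suc (Suc k)) v)"
      using rec[of "m + n"] rec[of k] by simp
    also have "\<dots> = smul (z\<^sup>2 - 2) ((rot_lin z ^^ (m + Suc n)) v + (rot_lin z ^^ Suc k) v) -
        ((rot_lin z ^^ (m + n)) v + (rot_lin z ^^ Suc (Suc k)) v)"
      by (simp only: add) (simp only: algebra_simps)
    also have "\<dots> = smul (poly (trace_poly (Suc (Suc n))) z) ((rot_lin z ^^ m) v)"
      unfolding 1 2 by (simp add: smul_def prod_eq_iff algebra_simps power2_eq_square)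
    finally show ?case by (simp add: m)
  }
qed

text \<open>The dihedral relation: a reflection conjugates the rotation to its inverse, written as r
  s r = s to avoid the inverse.\<close>

lemma vieta_rot: "rot A B (vieta2 B (rot A B u)) = vieta2 B u" "rot A B (vieta1 A (rot A B u)) = vieta1 A u"
  by (simp_all add: rot_def vieta_involutive)

lemma vieta_rot_iter:
  "(rot A B ^^ n) (vieta2 B ((rot A B ^^ n) u)) = vieta2 B u"
  "(rot A B ^^ n) (vieta1 A ((rot A B ^^ n) u)) = vieta1 A u"
proof (induction n)
  case (Suc n)
  have swap: "(rot A B ^^ Suc n) x = (rot A B ^^ n) (rot A B x)" for x by (simp add: funpow_swap1)
  { case 1 show ?case unfolding swap[of "vieta2 B ((rot A B ^^ Suc n) u)"]
      by (simp only: funpow.simps o_apply vieta_rot Suc) }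
  { case 2 show ?case unfolding swap[of "vieta1 A ((rot A B ^^ Suc n) u)"]
      by (simp only: funpow.simps o_apply vieta_rot Suc) }
qed auto

lemma inj_rot_iter: "inj (rot A B ^^ n)"
proof (induction n)
  case (Suc n)
  have "inj (rot A B)" unfolding rot_def by (intro injI) (metis vieta_involutive)
  from inj_compose[OF this Suc] show ?case by (simp only: funpow.simps)
qed simp

section \<open>Free and finite orbits of a rotation\<close>

definition free_rot :: "'p::prime_card padic \<Rightarrow> 'p padic \<Rightarrow> 'p padic3 \<Rightarrow> bool" where
  "free_rot A B u \<longleftrightarrow> (\<forall>n\<ge>1. (rot A B ^^ n) u \<noteq> u)"

lemma free_rot_inj:
  assumes "free_rot A B u" "(rot A B ^^ i) u = (rot A B ^^ j) u"
  shows "i = j"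
proof -
  have *: "i = j" if "i \<le> j" "(rot A B ^^ i) u = (rot A B ^^ j) u" for i j
  proof -
    have "(rot A B ^^ i) u = (rot A B ^^ i) ((rot A B ^^ (j - i)) u)"
      using that by (simp flip: funpow_add[THEN fun_cong, unfolded o_apply])
    then have "u = (rot A B ^^ (j - i)) u" by (rule injD[OF inj_rot_iter])
    then have "\<not> j - i \<ge> 1" using assms(1) unfolding free_rot_def by metis
    then show ?thesis using that by simp
  qed
  show ?thesis using *[of i j] *[of j i] assms(2) by (cases "i \<le> j") auto
qed

lemma free_rot_iter:
  assumes "free_rot A B u"
  shows "free_rot A B ((rot A B ^^ n) u)"
  unfolding free_rot_def
proof (intro allI impI notI)
  fix m :: nat assume "m \<ge> 1" "(rot A B ^^ m) ((rot A B ^^ n) u) = (rot A B ^^ n) u"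
  then show False using free_rot_inj[OF assms, of "m + n" n] by (simp add: funpow_add)
qed

text \<open>In the infinite dihedral group generated by \<open>s\<^sub>1, s\<^sub>2\<close>, reflections fixing two points of a
  free orbit of the rotation would produce a fixed point of a power of the rotation.\<close>

lemma free_rot_finite_fixed:
  assumes "free_rot A B u"
  shows "finite {n. vieta2 B ((rot A B ^^ n) u) = (rot A B ^^ n) u}"
    and "finite {n. vieta1 A ((rot A B ^^ n) u) = (rot A B ^^ n) u}"
proof -
  have gen: "finite {n. s ((rot A B ^^ n) u) = (rot A B ^^ n) u}"
    if s: "\<And>n u. (rot A B ^^ n) (s ((rot A B ^^ n) u)) = s u" for s
  proof -
    have *: "\<not> i < j" if ij: "s ((rot A B ^^ i) u) = (rot A B ^^ i) u" "s ((rot A B ^^ j) u) = (rot A B ^^ j) u" for i j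
    proof
      assume "i < j"
      define w d where "w = (rot A B ^^ i) u" and "d = j - i"
      have "(rot A B ^^ j) u = (rot A B ^^ d) w"
        using \<open>i < j\<close> by (simp add: w_def d_def flip: funpow_add[THEN fun_cong, unfolded o_apply])
      then have "(rot A B ^^ d) ((rot A B ^^ d) w) = w" using s[of d w] ij by (simp add: w_def)
      then have "(rot A B ^^ (d + d)) w = w" by (simp add: funpow_add)
      moreover have "d + d \<ge> 1" using \<open>i < j\<close> by (simp add: d_def)
      ultimately show False using free_rot_iter[OF assms, of i] unfolding free_rot_def w_def by blast
    qed
    show ?thesis
    proof (cases "\<exists>i. s ((rot A B ^^ i) u) = (rot A B ^^ i) u")
      case True
      then obtain i where "s ((rot A B ^^ i) u) = (rot A B ^^ i) u" by blast
      then have "{n. s ((rot A B ^^ n) u) = (rot A B ^^ n) u} \<subseteq> {i}" using * nat_neq_iff by blast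
      then show ?thesis by (rule finite_subset) simp
    qed simp
  qed
  show "finite {n. vieta2 B ((rot A B ^^ n) u) = (rot A B ^^ n) u}" by (rule gen[OF vieta_rot_iter(1)])
  show "finite {n. vieta1 A ((rot A B ^^ n) u) = (rot A B ^^ n) u}" by (rule gen[OF vieta_rot_iter(2)])
qed

text \<open>The two involutions change different coordinates, so they can agree at a point only by
  both fixing it.\<close>

lemma rot_fixed_imp:
  assumes "rot A B u = u"
  shows "vieta1 A u = u \<and> vieta2 B u = u"
proof -
  have "vieta2 B u = vieta1 A u" using assms vieta_involutive(1) unfolding rot_def by metis
  then show ?thesis by (cases u) (auto simp: vieta1_def vieta2_def)
qed

text \<open>The displacement v of \<open>u\<close> under one rotation is fixed by the n-th power M
  of the linear part, hence v + v = tr(M) v. If the trace is not 2, then v = 0.\<close>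

lemma rot_power_fixed_imp:
  assumes "(rot A B ^^ n) u = u" "poly (trace_poly n) (snd (snd u)) \<noteq> 2"
  shows "rot A B u = u"
proof -
  let ?z = "snd (snd u)"
  define v where "v = rot A B u - u"
  have v0: "snd (snd v) = 0" by (simp add: v_def)
  have "(rot_lin ?z ^^ n) v = (rot A B ^^ n) (rot A B u) - (rot A B ^^ n) u"
    unfolding v_def by (rule rot_iter_diff[symmetric]) auto
  also have "\<dots> = v" using assms(1) by (simp add: funpow_swap1[symmetric] v_def)
  finally have n: "(rot_lin ?z ^^ n) v = v" .
  then have "(rot_lin ?z ^^ (n + n)) v = v" by (simp add: funpow_add)
  then have "v + v = smul (poly (trace_poly n) ?z) v"
    using rot_lin_trace[OF v0, of n n ?z] n by simp
  then have "smul (poly (trace_poly n) ?z - 2) v = 0"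
    by (cases v) (auto simp: smul_def zero_prod_def algebra_simps)
  then have "v = 0" using assms(2) by (cases v) (auto simp: smul_def zero_prod_def)
  then show ?thesis by (simp add: v_def)
qed

text \<open>Pigeonhole: up to the given radius, an iterate of \<open>f\<close> is known from its
  effect on a finite net. Two iterates f^i and f^j with i < j thus agree up to that radius, and
  cancelling the isometry f^i leaves f^(j-i) close to the identity.\<close>

lemma isometry_power_near_identity:
  fixes f :: "'p::prime_card padic3 \<Rightarrow> 'p padic3"
  assumes inv: "\<And>u. u \<in> int_cube \<Longrightarrow> f u \<in> int_cube"
    and iso: "\<And>u v. u \<in> int_cube \<Longrightarrow> v \<in> int_cube \<Longrightarrow> sup_norm (f u - f v) = sup_norm (u - v)"
  shows "\<exists>N\<ge>1. \<forall>u\<in>int_cube. sup_norm ((f ^^ N) u - u) \<le> 1 / real CARD('p) ^ k"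
proof -
  let ?r = "1 / real CARD('p) ^ k"
  have invn: "(f ^^ n) u \<in> int_cube" if "u \<in> int_cube" for n u
    using that by (induction n) (auto intro: inv)
  have ison: "sup_norm ((f ^^ n) u - (f ^^ n) v) = sup_norm (u - v)" if "u \<in> int_cube" "v \<in> int_cube" for n u v
    using that by (induction n) (auto simp: iso invn)
  define E where "E = (of_nat ` {..<CARD('p) ^ k} :: 'p padic set)"
  define E3 where "E3 = E \<times> E \<times> E"
  have finE: "finite E3" by (simp add: E3_def E_def)
  have "\<exists>e\<in>E. padic_norm (x - e) \<le> ?r" if "padic_norm x \<le> 1" for x :: "'p padic"
    using padic_residue[OF that, of k] by (auto simp: E_def)
  then have near: "\<exists>e\<in>E3. sup_norm (u - e) \<le> ?r" if "u \<in> int_cube" for u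
    using that unfolding mem_int_cube_iff by (cases u) (fastforce simp: E3_def sup_norm_le_iff)
  have E_int: "e \<in> int_cube" if "e \<in> E3" for e
    using that by (auto simp: E3_def E_def mem_int_cube_iff sup_norm_le_iff padic_norm_of_nat_le_1)
  define \<rho> where "\<rho> u = (SOME e. e \<in> E3 \<and> sup_norm (u - e) \<le> ?r)" for u
  have \<rho>: "\<rho> u \<in> E3" "sup_norm (u - \<rho> u) \<le> ?r" if "u \<in> int_cube" for u
    using someI_ex[of "\<lambda>e. e \<in> E3 \<and> sup_norm (u - e) \<le> ?r"] near[OF that] unfolding \<rho>_def by blast+
  \<comment> \<open>The map induced by the n-th iterate on the net, restricted to it so that only
    finitely many maps are possible.\<close>
  define F where "F n = restrict (\<lambda>e. \<rho> ((f ^^ n) e)) E3" for n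
  have "range F \<subseteq> E3 \<rightarrow>\<^sub>E E3" unfolding F_def PiE_def Pi_def
    using \<rho>(1)[OF invn[OF E_int]] by auto
  then have "finite (range F)" using finE by (meson finite_PiE finite_subset)
  then have "\<not> inj F" using finite_imageD infinite_UNIV_nat by blast
  then obtain i j where ij: "F i = F j" "i < j" unfolding inj_def by (metis nat_neq_iff)
  define N where "N = j - i"
  have "sup_norm ((f ^^ N) u - u) \<le> ?r" if u: "u \<in> int_cube" for u
  proof -
    obtain e where e: "e \<in> E3" "sup_norm (u - e) \<le> ?r" using near[OF u] by blast
    have ei: "e \<in> int_cube" by (rule E_int[OF e(1)])
    have "\<rho> ((f ^^ i) e) = \<rho> ((f ^^ j) e)" using fun_cong[OF ij(1), of e] e(1) by (simp add: F_def)
    then have "sup_norm ((f ^^ j) e - (f ^^ i) e) \<le> ?r"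
      using \<rho>(2)[OF invn[OF ei, of j]] \<rho>(2)[OF invn[OF ei, of i]]
      by (metis sup_norm_trans sup_norm_diff_commute)
    moreover have "sup_norm ((f ^^ j) u - (f ^^ j) e) \<le> ?r" using ison[OF u ei] e(2) by simp
    ultimately have "sup_norm ((f ^^ j) u - (f ^^ i) e) \<le> ?r" using sup_norm_trans by blast
    moreover have "sup_norm ((f ^^ i) e - (f ^^ i) u) \<le> ?r"
      using ison[OF ei u] e(2) by (simp add: sup_norm_diff_commute)
    ultimately have "sup_norm ((f ^^ j) u - (f ^^ i) u) \<le> ?r" by (rule sup_norm_trans)
    moreover have "(f ^^ j) u = (f ^^ i) ((f ^^ N) u)"
      using ij(2) by (simp add: N_def flip: funpow_add[THEN fun_cong, unfolded o_apply])
    ultimately show ?thesis using ison[OF invn[OF u] u] by simp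
  qed
  moreover have "N \<ge> 1" using ij(2) by (simp add: N_def)
  ultimately show ?thesis by blast
qed

context
  fixes A B :: "'p::prime_card padic"
  assumes AB: "A \<in> padic_ints" "B \<in> padic_ints"
begin

lemma rot_int_cube: "u \<in> int_cube \<Longrightarrow> rot A B u \<in> int_cube"
  unfolding rot_def using vietas_int_cube[OF AB, of B] AB(2) by (simp add: vietas_def)

lemma rot_iter_int_cube: "u \<in> int_cube \<Longrightarrow> (rot A B ^^ n) u \<in> int_cube"
  by (induction n) (auto intro: rot_int_cube)

lemma rot_isometry:
  assumes "u \<in> int_cube" "v \<in> int_cube"
  shows "sup_norm (rot A B u - rot A B v) = sup_norm (u - v)"
proof -
  have 1: "vieta1 A \<in> vietas A B B" "vieta2 B \<in> vietas A B B" by (auto simp: vietas_def)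
  note iso = vietas_isometry[OF AB AB(2)] and cube = vietas_int_cube[OF AB AB(2)]
  show ?thesis unfolding rot_def
    using iso[OF 1(1) cube[OF 1(2) assms(1)] cube[OF 1(2) assms(2)]] iso[OF 1(2) assms] by simp
qed

end

lemma power_near_identity_multiple:
  assumes "\<And>u. u \<in> int_cube \<Longrightarrow> f u \<in> int_cube" "\<And>u. u \<in> int_cube \<Longrightarrow> sup_norm (f u - u) \<le> r" "r \<ge> 0" "u \<in> int_cube"
  shows "(f ^^ n) u \<in> int_cube \<and> sup_norm ((f ^^ n) u - u) \<le> r"
proof (induction n)
  case (Suc n)
  then show ?case using assms sup_norm_trans[of "f ((f ^^ n) u)" "(f ^^ n) u" r u] by simp
qed (use assms in simp)

text \<open>One exponent serves both conclusions: the product of an exponent for the rotation itself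
  and one for the rotation with parameters 0. The latter fixes (0, 0, z), so on the fibre over z its
  powers are the powers of the linear part.\<close>

lemma rot_near_identity:
  fixes A B :: "'p::prime_card padic"
  assumes AB: "A \<in> padic_ints" "B \<in> padic_ints"
  obtains N where "N \<ge> 1" "\<And>u. u \<in> int_cube \<Longrightarrow> sup_norm ((rot A B ^^ N) u - u) \<le> 1 / real CARD('p) ^ k"
    "\<And>u v. u \<in> int_cube \<Longrightarrow> v \<in> int_cube \<Longrightarrow> snd (snd u) = snd (snd v) \<Longrightarrow>
      sup_norm (((rot A B ^^ N) u - (rot A B ^^ N) v) - (u - v)) \<le> 1 / real CARD('p) ^ k * sup_norm (u - v)"
proof -
  let ?r = "1 / real CARD('p) ^ k"
  have r0: "?r \<ge> 0" by simp
  have zero: "(0::'p padic) \<in> padic_ints" by (simp add: padic_ints_def)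
  obtain M where M: "M \<ge> 1" "\<And>u. u \<in> int_cube \<Longrightarrow> sup_norm ((rot A B ^^ M) u - u) \<le> ?r"
    using isometry_power_near_identity[OF rot_int_cube[OF AB] rot_isometry[OF AB], of k] by blast
  obtain M0 where M0: "M0 \<ge> 1" "\<And>u. u \<in> int_cube \<Longrightarrow> sup_norm ((rot 0 0 ^^ M0) u - (u :: 'p padic3)) \<le> ?r"
    using isometry_power_near_identity[OF rot_int_cube[OF zero zero] rot_isometry[OF zero zero], of k] by blast
  define N where "N = M * M0"
  have N1: "N \<ge> 1" using M(1) M0(1) by (simp add: N_def)
  have near: "sup_norm ((rot A B ^^ N) u - u) \<le> ?r" if "u \<in> int_cube" for u
    using power_near_identity_multiple[OF rot_iter_int_cube[OF AB, of _ M] M(2) r0 that, of M0]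
    by (simp add: N_def funpow_mult)
  have near0: "sup_norm ((rot 0 0 ^^ N) u - u) \<le> ?r" if "u \<in> int_cube" for u :: "'p padic3"
    using power_near_identity_multiple[OF rot_iter_int_cube[OF zero zero, of _ M0] M0(2) r0 that, of M]
    by (simp add: N_def funpow_mult mult.commute)
  have lin: "sup_norm ((rot_lin z ^^ N) d - d) \<le> ?r" if d: "d \<in> int_cube" "snd (snd d) = 0" and z: "padic_norm z \<le> 1"
    for z :: "'p padic" and d
  proof -
    define u where "u = (fst d, fst (snd d), z)"
    have u: "u \<in> int_cube" using d z by (simp add: u_def mem_int_cube_iff sup_norm_le_iff)
    have fix0: "(rot 0 0 ^^ N) (0, 0, z) = (0, 0, z)"
      by (induction N) (simp_all add: rot_def vieta1_def vieta2_def)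
    have "(rot 0 0 ^^ N) u - (rot 0 0 ^^ N) (0, 0, z) = (rot_lin z ^^ N) (u - (0, 0, z))"
      by (rule rot_iter_diff) (auto simp: u_def)
    moreover have ud: "u - (0, 0, z) = d" using d(2) by (simp add: u_def prod_eq_iff)
    ultimately have step: "(rot 0 0 ^^ N) u - (0, 0, z) = (rot_lin z ^^ N) d"
      unfolding fix0 by (simp only:)
    have "a - u = (a - w) - (u - w)" for a w :: "'p padic3" by (simp only: diff_diff_eq2 diff_add_cancel)
    from this[of "(rot 0 0 ^^ N) u" "(0, 0, z)"] have "(rot 0 0 ^^ N) u - u = (rot_lin z ^^ N) d - d"
      unfolding step ud .
    then show ?thesis using near0[OF u] by simp
  qed
  have "sup_norm (((rot A B ^^ N) u - (rot A B ^^ N) v) - (u - v)) \<le> ?r * sup_norm (u - v)"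
    if uv: "u \<in> int_cube" "v \<in> int_cube" "snd (snd u) = snd (snd v)" for u v
  proof (cases "u = v")
    case False
    let ?z = "snd (snd u)"
    define d where "d = u - v"
    have d0: "sup_norm d > 0" using False by (intro sup_norm_pos) (simp add: d_def)
    \<comment> \<open>A coordinate of largest norm scales \<open>d\<close> to norm 1. Linearity then
      turns the absolute bound for the scaled vector into one proportional to
      \<open>sup_norm d\<close>.\<close>
    have "sup_norm d = padic_norm (fst d) \<or> sup_norm d = padic_norm (fst (snd d)) \<or>
        sup_norm d = padic_norm (snd (snd d))"
      unfolding sup_norm_def max_def by auto
    then obtain c :: "'p padic" where c: "padic_norm c = sup_norm d" by metis
    have c0: "c \<noteq> 0" using c d0 by auto
    define d' where "d' = smul (inverse c) d"
    have d: "d = smul c d'" using c0 by (simp add: d'_def smul_smul)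
    have "inverse (sup_norm d) * sup_norm d = 1" by (rule left_inverse) (use d0 in linarith)
    then have "d' \<in> int_cube" unfolding mem_int_cube_iff d'_def sup_norm_smul padic_norm_inverse c by (simp only:)
    moreover have "snd (snd d') = 0" using uv(3) by (simp add: d'_def smul_def d_def)
    moreover have "padic_norm ?z \<le> 1" using uv(1) by (simp add: mem_int_cube_iff sup_norm_le_iff)
    ultimately have le: "sup_norm ((rot_lin ?z ^^ N) d' - d') \<le> ?r" by (rule lin)
    have "(rot A B ^^ N) u - (rot A B ^^ N) v = (rot_lin ?z ^^ N) d"
      unfolding d_def by (rule rot_iter_diff) (simp_all add: uv(3))
    then have "sup_norm (((rot A B ^^ N) u - (rot A B ^^ N) v) - (u - v)) = sup_norm ((rot_lin ?z ^^ N) d - d)"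
      by (simp add: d_def)
    also have "\<dots> = sup_norm d * sup_norm ((rot_lin ?z ^^ N) d' - d')"
      by (subst (1 2) d) (simp add: rot_lin_smul sup_norm_smul c flip: smul_diff)
    also have "\<dots> \<le> sup_norm d * ?r" using le by (intro mult_left_mono) auto
    finally show ?thesis by (simp add: d_def mult.commute)
  qed simp
  then show ?thesis using that[OF N1 near] by blast
qed

text \<open>Outside finitely many fibres, every finite orbit of the rotation is a common fixed point of the
  two involutions: a uniform power \<open>N\<close> of the rotation kills all finite orbits, and its linear part has
  trace \<open>trace_poly N\<close>.\<close>

lemma finite_bad_fibres:
  fixes A B :: "'p::prime_card padic"
  assumes AB: "A \<in> padic_ints" "B \<in> padic_ints"
  obtains T where "finite T"
    "\<And>u. u \<in> int_cube \<Longrightarrow> \<not> free_rot A B u \<Longrightarrow> snd (snd u) \<in> T \<or> (vieta1 A u = u \<and> vieta2 B u = u)"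
proof -
  \<comment> \<open>With the square, p times \<open>?q\<close> is 1/p, which is below 1 as the
    growth estimate requires.\<close>
  let ?q = "1 / real CARD('p) ^ 2"
  have P: "real CARD('p) > 1" using card_prime_gt_1[where 'p='p] by simp
  have q: "?q \<ge> 0" "real CARD('p) * ?q < 1" using P by (auto simp: power2_eq_square field_simps)
  obtain N where N: "N \<ge> 1" "\<And>u v. u \<in> int_cube \<Longrightarrow> v \<in> int_cube \<Longrightarrow> snd (snd u) = snd (snd v) \<Longrightarrow>
      sup_norm (((rot A B ^^ N) u - (rot A B ^^ N) v) - (u - v)) \<le> ?q * sup_norm (u - v)"
    using rot_near_identity[OF AB, of 2] by metis
  define T where "T = {z :: 'p padic. poly (trace_poly N) z = 2}"
  have "finite T" unfolding T_def using finite_trace_poly_eq_2[OF N(1)] .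
  moreover have "snd (snd u) \<in> T \<or> (vieta1 A u = u \<and> vieta2 B u = u)"
    if u: "u \<in> int_cube" "\<not> free_rot A B u" for u
  proof -
    obtain n where n: "n \<ge> 1" "(rot A B ^^ n) u = u" using u(2) by (auto simp: free_rot_def)
    define f X where "f = rot A B ^^ N" and "X = {v \<in> int_cube. snd (snd v) = snd (snd u)}"
    have inv: "f v \<in> X" if "v \<in> X" for v using that rot_iter_int_cube[OF AB] by (simp add: X_def f_def)
    have near: "sup_norm ((f v - f w) - (v - w)) \<le> ?q * sup_norm (v - w)" if "v \<in> X" "w \<in> X" for v w
      using N(2)[of v w] that unfolding X_def f_def by simp
    have uX: "u \<in> X" using u(1) by (simp add: X_def)
    have "(rot A B ^^ (n * k)) u = u" for k
      by (induction k) (simp_all add: funpow_add n(2))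
    then have "(f ^^ n) u = u" unfolding f_def funpow_mult by (simp add: mult.commute)
    moreover have "sup_norm ((f ^^ n) u - u - smul (of_nat n) (f u - u)) \<le>
        padic_norm (of_nat n :: 'p padic) * (real CARD('p) * ?q) * sup_norm (f u - u)"
      by (rule near_identity_growth[of X f, OF inv near q(1) less_imp_le[OF q(2)] uX])
    ultimately have le: "padic_norm (of_nat n :: 'p padic) * sup_norm (f u - u) \<le>
        padic_norm (of_nat n :: 'p padic) * (real CARD('p) * ?q) * sup_norm (f u - u)"
      by (simp add: sup_norm_smul)
    \<comment> \<open>The n-th iterate of \<open>f\<close> fixes \<open>u\<close>, so the main term
      n (f u - u) is bounded by an error that is smaller by the factor p \<open>?q\<close> < 1.
      Hence it vanishes.\<close>
    have "f u = u"
    proof (rule ccontr)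
      assume "f u \<noteq> u"
      then have s: "sup_norm (f u - u) > 0" by (intro sup_norm_pos) simp
      have n0: "padic_norm (of_nat n :: 'p padic) > 0"
        using n(1) P by (simp add: padic_norm_of_int[of "int n", where 'p='p, simplified])
      have "padic_norm (of_nat n :: 'p padic) * (real CARD('p) * ?q) * sup_norm (f u - u) <
          padic_norm (of_nat n :: 'p padic) * 1 * sup_norm (f u - u)"
        using s n0 q(2) by (intro mult_strict_right_mono mult_strict_left_mono)
      then show False using le by simp
    qed
    then show ?thesis
      using rot_power_fixed_imp[of N A B u] rot_fixed_imp[of A B u] by (auto simp: T_def f_def)
  qed
  ultimately show ?thesis using that by blast
qed

section \<open>Orbit closures are open\<close>

definition dx :: "'p::prime_card padic \<Rightarrow> 'p padic3 \<Rightarrow> 'p padic" where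
  "dx A u = 2 * fst u - A + fst (snd u) * snd (snd u)"

definition dy :: "'p::prime_card padic \<Rightarrow> 'p padic3 \<Rightarrow> 'p padic" where
  "dy B u = 2 * fst (snd u) - B + snd (snd u) * fst u"

definition dz :: "'p::prime_card padic \<Rightarrow> 'p padic3 \<Rightarrow> 'p padic" where
  "dz C u = 2 * snd (snd u) - C + fst u * fst (snd u)"

lemma d_cyc: "dx B (cyc u) = dy B u" "dy C (cyc u) = dz C u" "dz A (cyc u) = dx A u"
  by (simp_all add: dx_def dy_def dz_def cyc_def mult.commute)

text \<open>The equation is a monic quadratic in each coordinate, the involution exchanges its two
  roots, and the derivative at a root is the difference of the roots.\<close>

lemma vieta_fixed_iff: "vieta1 A u = u \<longleftrightarrow> dx A u = 0" "vieta2 B u = u \<longleftrightarrow> dy B u = 0" "vieta3 C u = u \<longleftrightarrow> dz C u = 0"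
proof -
  obtain x y z where u: "u = (x, y, z)" by (cases u)
  have 1: "b - c = d \<longleftrightarrow> d - b + c = 0" for b c d :: "'a padic"
    by (auto simp: algebra_simps)
  show "vieta1 A u = u \<longleftrightarrow> dx A u = 0" "vieta2 B u = u \<longleftrightarrow> dy B u = 0" "vieta3 C u = u \<longleftrightarrow> dz C u = 0"
    by (simp_all add: u vieta1_def vieta2_def vieta3_def dx_def dy_def dz_def 1)
qed

lemma padic_norm_double_le: "padic_norm x \<le> r \<Longrightarrow> padic_norm (2 * x :: 'p::prime_card padic) \<le> r"
  using padic_norm_mult_le'[of "of_nat 2" x r] padic_norm_of_nat_le_1[of 2, where 'p='p] by simp

lemma dx_lipschitz:
  assumes "u \<in> int_cube" "v \<in> int_cube"
  shows "padic_norm (dx A u - dx A v) \<le> sup_norm (u - v)"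
proof -
  obtain x y z x' y' z' where [simp]: "u = (x, y, z)" "v = (x', y', z')" by (cases u; cases v)
  have i: "padic_norm z \<le> 1" "padic_norm y' \<le> 1" using assms by (auto simp: mem_int_cube_iff sup_norm_le_iff)
  let ?r = "sup_norm (u - v)"
  have r: "padic_norm (x - x') \<le> ?r" "padic_norm (y - y') \<le> ?r" "padic_norm (z - z') \<le> ?r"
    using padic_norm_le_sup_norm[of "u - v"] by auto
  have "padic_norm (2 * (x - x') + ((y - y') * z + y' * (z - z'))) \<le> ?r"
    using r i by (intro padic_norm_add_le[of "2 * (x - x')"] padic_norm_add_le[of "(y - y') * z"]
        padic_norm_mult_le padic_norm_mult_le' padic_norm_double_le) auto
  also have "2 * (x - x') + ((y - y') * z + y' * (z - z')) = dx A u - dx A v"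
    by (simp add: dx_def algebra_simps)
  finally show ?thesis .
qed

lemma dy_lipschitz: "u \<in> int_cube \<Longrightarrow> v \<in> int_cube \<Longrightarrow> padic_norm (dy A u - dy A v) \<le> sup_norm (u - v)"
  using dx_lipschitz[of "cyc u" "cyc v" A] by (simp add: d_cyc cyc_diff)

lemma dz_lipschitz: "u \<in> int_cube \<Longrightarrow> v \<in> int_cube \<Longrightarrow> padic_norm (dz A u - dz A v) \<le> sup_norm (u - v)"
  using dy_lipschitz[of "cyc u" "cyc v" A] by (simp add: d_cyc cyc_diff)

lemma dx_le_1:
  assumes "A \<in> padic_ints" "u \<in> int_cube"
  shows "padic_norm (dx A u) \<le> 1"
  using assms unfolding dx_def
  by (intro padic_norm_add_le padic_norm_diff_le padic_norm_double_le padic_norm_mult_le)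
    (auto simp: padic_ints_def mem_int_cube_iff sup_norm_le_iff)

lemma dy_le_1: "A \<in> padic_ints \<Longrightarrow> u \<in> int_cube \<Longrightarrow> padic_norm (dy A u) \<le> 1"
  using dx_le_1[of A "cyc u"] by (simp add: d_cyc)

text \<open>The equation at two points of a fibre, subtracted and factored exactly. For small
  displacements the bracket on the left is dominated by the derivative, which relates the size of
  \<open>b\<close> to that of \<open>a\<close>.\<close>

lemma fibre_equation:
  assumes "(x, y, z) \<in> surface A B C D" "(x + a, y + b, z) \<in> surface A B C D"
  shows "b * (dy B (x, y, z) + (b + z * a)) = - (a * (a + dx A (x, y, z)))"
proof -
  let ?F = "\<lambda>x y. x\<^sup>2 + y\<^sup>2 + z\<^sup>2 + x * y * z - (A * x + B * y + C * z + D)"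
  have "b * (dy B (x, y, z) + (b + z * a)) + a * (a + dx A (x, y, z)) = ?F (x + a) (y + b) - ?F x y"
    by (simp add: dx_def dy_def power2_eq_square algebra_simps)
  also have "\<dots> = 0" using assms by (simp add: surface_def)
  finally show ?thesis by (simp add: eq_neg_iff_add_eq_0)
qed

text \<open>Where \<open>dy\<close> does not vanish, x is a parameter of the fibre conic. The
  hypothesis \<open>close\<close> lets \<open>dy\<close> decide the norm of the bracket in
  \<open>fibre_equation\<close>, so the y-displacement times the norm of \<open>dy\<close> is at
  most the x-displacement.\<close>

lemma conic_estimate_x:
  assumes uv: "u \<in> surface A B C D" "v \<in> surface A B C D" "u \<in> int_cube" "v \<in> int_cube"
    and A: "A \<in> padic_ints" and B: "B \<in> padic_ints"
    and third: "snd (snd u) = snd (snd v)" and close: "sup_norm (v - u) < padic_norm (dy B u)"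
  shows "padic_norm (dy B u) * sup_norm (v - u) \<le> padic_norm (fst (v - u))"
proof -
  obtain x y z where u: "u = (x, y, z)" by (cases u)
  define a b where "a = fst v - x" and "b = fst (snd v) - y"
  have v: "v = (x + a, y + b, z)" using third by (simp add: u a_def b_def prod_eq_iff)
  have d: "v - u = (a, b, 0)" by (simp add: u v)
  let ?d = "dy B u"
  have le: "padic_norm a \<le> sup_norm (v - u)" "padic_norm b \<le> sup_norm (v - u)"
    using padic_norm_le_sup_norm[of "v - u"] by (simp_all add: d)
  have z: "padic_norm z \<le> 1" using uv(3) by (simp add: u mem_int_cube_iff sup_norm_le_iff)
  have "padic_norm (b + z * a) \<le> sup_norm (v - u)"
    using le z by (intro padic_norm_add_le padic_norm_mult_le')
  then have eq1: "padic_norm (?d + (b + z * a)) = padic_norm ?d"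
    using close by (intro padic_norm_add_eq) linarith
  have "padic_norm a \<le> 1"
    using uv(3,4) by (simp add: a_def u mem_int_cube_iff sup_norm_le_iff padic_norm_diff_le)
  then have "padic_norm (a + dx A u) \<le> 1" using dx_le_1[OF A uv(3)] by (rule padic_norm_add_le)
  then have eq2: "padic_norm (a * (a + dx A u)) \<le> padic_norm a" by (intro padic_norm_mult_le) auto
  have "padic_norm (b * (?d + (b + z * a))) = padic_norm (- (a * (a + dx A u)))"
    using fibre_equation[of x y z A B C D a b] uv(1,2) by (simp add: u v)
  then have "padic_norm ?d * padic_norm b \<le> padic_norm a"
    using eq1 eq2 by (simp add: padic_norm_mult padic_norm_uminus mult.commute)
  moreover have "padic_norm ?d * padic_norm a \<le> padic_norm a"
    using dy_le_1[OF B uv(3)] by (simp add: mult_left_le_one_le padic_norm_nonneg)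
  ultimately show ?thesis by (auto simp: d sup_norm_def max_def padic_norm_nonneg)
qed

lemma conic_estimate_y:
  assumes uv: "u \<in> surface A B C D" "v \<in> surface A B C D" "u \<in> int_cube" "v \<in> int_cube"
    and A: "A \<in> padic_ints" and B: "B \<in> padic_ints"
    and third: "snd (snd u) = snd (snd v)" and close: "sup_norm (v - u) < padic_norm (dx A u)"
  shows "padic_norm (dx A u) * sup_norm (v - u) \<le> padic_norm (fst (snd (v - u)))"
proof -
  \<comment> \<open>Exchanging x and y is a symmetry if A and B are exchanged as well.\<close>
  define \<tau> where "\<tau> w = (fst (snd w), fst w, snd (snd w))" for w :: "'a padic3"
  have n: "sup_norm (\<tau> w) = sup_norm w" for w by (auto simp: \<tau>_def sup_norm_def)
  have "\<tau> w \<in> surface B A C D \<longleftrightarrow> w \<in> surface A B C D" for w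
    by (cases w) (auto simp: \<tau>_def surface_def algebra_simps)
  moreover have "\<tau> w \<in> int_cube \<longleftrightarrow> w \<in> int_cube" for w by (simp add: mem_int_cube_iff n)
  moreover have "dy A (\<tau> u) = dx A u" by (simp add: \<tau>_def dx_def dy_def mult.commute)
  moreover have "\<tau> v - \<tau> u = \<tau> (v - u)" by (simp add: \<tau>_def)
  ultimately show ?thesis
    using conic_estimate_x[of "\<tau> u" B A C D "\<tau> v"] assms by (simp add: n) (simp add: \<tau>_def)
qed

section \<open>Filling discs in the fibres of one fibration\<close>

lemma rot_iter_vorb: "(rot A B ^^ n) u \<in> vorb A B C u"
proof (induction n)
  case 0
  show ?case by (simp add: vorb_base)
next
  case (Suc n)
  have "vieta2 B ((rot A B ^^ n) u) \<in> vorb A B C u"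
    by (rule vorb_step[OF Suc]) (simp add: vietas_def)
  then have "vieta1 A (vieta2 B ((rot A B ^^ n) u)) \<in> vorb A B C u"
    by (rule vorb_step) (simp add: vietas_def)
  then show ?case unfolding funpow.simps o_apply rot_def[of A B "(rot A B ^^ n) u"] .
qed

context
  fixes A B C D :: "'p::prime_card padic"
  assumes ints: "A \<in> padic_ints" "B \<in> padic_ints" "C \<in> padic_ints"
begin

text \<open>\<open>\<pi>\<close> is one of the two coordinates along the fibre, and \<open>d\<close> the partial derivative
  with respect to the other one.\<close>

lemma fibre_fill_gen:
  assumes u0: "u0 \<in> int_surface A B C D" "free_rot A B u0" "d u0 \<noteq> 0"
    and d: "\<And>u v. u \<in> int_cube \<Longrightarrow> v \<in> int_cube \<Longrightarrow> padic_norm (d u - d v) \<le> sup_norm (u - v)"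
      "\<And>u. u \<in> int_cube \<Longrightarrow> padic_norm (d u) \<le> 1"
    and \<pi>: "\<And>u v. \<pi> (u - v) = \<pi> u - \<pi> v" "\<And>u. padic_norm (\<pi> u) \<le> sup_norm u"
      "\<And>c u. \<pi> (smul c u) = c * \<pi> u"
    and conic: "\<And>u v. u \<in> int_surface A B C D \<Longrightarrow> v \<in> int_surface A B C D \<Longrightarrow> snd (snd u) = snd (snd v) \<Longrightarrow>
      sup_norm (v - u) < padic_norm (d u) \<Longrightarrow> padic_norm (d u) * sup_norm (v - u) \<le> padic_norm (\<pi> (v - u))"
  shows "\<exists>\<delta>>0. \<forall>u \<in> int_surface A B C D. sup_norm (u - u0) \<le> \<delta> \<longrightarrow> (\<forall>x. padic_norm (x - \<pi> u) \<le> \<delta> \<longrightarrow>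
    (\<exists>v \<in> closure (vorb A B C u). \<pi> v = x \<and> snd (snd v) = snd (snd u) \<and>
      padic_norm (d u0) * sup_norm (v - u) \<le> padic_norm (x - \<pi> u)))"
proof -
  define \<rho> where "\<rho> = padic_norm (d u0)"
  have \<rho>: "\<rho> > 0" "\<rho> \<le> 1" using u0 d(2)[of u0] by (auto simp: \<rho>_def padic_norm_pos int_surface_eq)
  have P: "real CARD('p) > 1" using card_prime_gt_1[where 'p='p] by simp
  \<comment> \<open>This precision serves twice: p q < \<open>\<rho>\<close> is the hypothesis of
    \<open>near_identity_fill\<close>, and q < \<open>\<rho>\<close> puts the displacement in the
    range of the conic estimate.\<close>
  obtain k where k: "1 / real CARD('p) ^ k < \<rho> / real CARD('p)"
    using padic_radius_small[of "\<rho> / real CARD('p)", where 'p='p] \<rho> P by auto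
  let ?q = "1 / real CARD('p) ^ k"
  have q: "?q \<ge> 0" "real CARD('p) * ?q < \<rho>" using k P by (auto simp: field_simps)
  have "?q < \<rho>"
  proof -
    have "\<rho> / real CARD('p) \<le> \<rho>" using \<rho> P by (simp add: field_simps)
    then show ?thesis using k by linarith
  qed
  obtain N where N: "N \<ge> 1" "\<And>u. u \<in> int_cube \<Longrightarrow> sup_norm ((rot A B ^^ N) u - u) \<le> ?q"
    "\<And>u v. u \<in> int_cube \<Longrightarrow> v \<in> int_cube \<Longrightarrow> snd (snd u) = snd (snd v) \<Longrightarrow>
      sup_norm (((rot A B ^^ N) u - (rot A B ^^ N) v) - (u - v)) \<le> ?q * sup_norm (u - v)"
    using rot_near_identity[OF ints(1,2), of k] by metis
  define f where "f = rot A B ^^ N"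
  have fS: "f u \<in> int_surface A B C D" if "u \<in> int_surface A B C D" for u
    unfolding f_def by (rule vorb_int_surface[OF ints rot_iter_vorb that])
  have cube: "u \<in> int_cube" if "u \<in> int_surface A B C D" for u
    using that by (simp add: int_surface_eq)
  have fthird: "snd (snd (f u)) = snd (snd u)" for u by (simp add: f_def)
  have w: "\<rho> * sup_norm (f u - u) \<le> padic_norm (\<pi> (f u - u))"
    if u: "u \<in> int_surface A B C D" "padic_norm (d u) = \<rho>" for u
    using conic[OF u(1) fS[OF u(1)]] N(2)[OF cube[OF u(1)]] \<open>?q < \<rho>\<close> fthird u(2) by (simp add: f_def)
  define w0 where "w0 = f u0 - u0"
  have "w0 \<noteq> 0" using u0(2) N(1) by (auto simp: w0_def f_def free_rot_def)
  then have "\<rho> * sup_norm w0 > 0" using \<rho>(1) sup_norm_pos by (intro mult_pos_pos)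
  then have pw0: "padic_norm (\<pi> w0) > 0" using w[OF u0(1)] by (simp add: w0_def \<rho>_def)
  \<comment> \<open>Below \<open>\<rho>\<close>, so that the derivative keeps its norm at nearby
    points; below the norm of \<open>\<pi> w0\<close>, so that the displacement of \<open>f\<close>
    there has the same coordinate norm as at \<open>u0\<close>. The radius is thus uniform in
    \<open>u\<close>.\<close>
  define \<delta> where "\<delta> = min \<rho> (padic_norm (\<pi> w0)) / 2"
  have \<delta>: "\<delta> > 0" "\<delta> < \<rho>" "\<delta> < padic_norm (\<pi> w0)" using pw0 \<rho> by (auto simp: \<delta>_def min_def)
  have "\<exists>v \<in> closure (vorb A B C u). \<pi> v = x \<and> snd (snd v) = snd (snd u) \<and> \<rho> * sup_norm (v - u) \<le> padic_norm (x - \<pi> u)"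
    if u: "u \<in> int_surface A B C D" "sup_norm (u - u0) \<le> \<delta>" and x: "padic_norm (x - \<pi> u) \<le> \<delta>" for u x
  proof -
    have "padic_norm (d u0 - d u) < padic_norm (d u0)"
      using d(1)[OF cube[OF u0(1)] cube[OF u(1)]] u(2) \<delta>(2) by (simp add: \<rho>_def sup_norm_diff_commute)
    then have du: "padic_norm (d u) = \<rho>" using padic_norm_eq_of_close by (simp add: \<rho>_def)
    have iso: "sup_norm ((rot A B ^^ n) u - (rot A B ^^ n) u0) = sup_norm (u - u0)" for n
      using rot_isometry[OF ints(1,2)] rot_iter_int_cube[OF ints(1,2)] cube[OF u(1)] cube[OF u0(1)]
      by (induction n) auto
    have "sup_norm ((f u - f u0) - (u - u0)) \<le> \<delta>"
      using iso[of N] u(2) by (intro sup_norm_diff_le[of "f u - f u0"]) (auto simp: f_def)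
    then have "padic_norm (\<pi> ((f u - f u0) - (u - u0))) \<le> \<delta>" by (rule order_trans[OF \<pi>(2)])
    moreover have "\<pi> ((f u - f u0) - (u - u0)) = \<pi> (f u - u) - \<pi> w0" by (simp add: w0_def \<pi>(1))
    ultimately have "padic_norm (\<pi> w0 - \<pi> (f u - u)) < padic_norm (\<pi> w0)"
      using \<delta>(3) by (simp add: padic_norm_diff_commute)
    then have pw: "padic_norm (\<pi> (f u - u)) = padic_norm (\<pi> w0)" by (rule padic_norm_eq_of_close)
    have fu: "f u \<noteq> u"
    proof
      assume "f u = u"
      then have "padic_norm (\<pi> (f u - u)) \<le> 0" using \<pi>(2)[of "f u - u"] by simp
      then show False using pw pw0 by simp
    qed
    define X where "X = {v \<in> int_cube. snd (snd v) = snd (snd u)}"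
    have "\<exists>v \<in> closure (range (\<lambda>n. (f ^^ n) u)). \<pi> v = x \<and> \<rho> * sup_norm (v - u) \<le> padic_norm (x - \<pi> u)"
    proof (rule near_identity_fill[where X=X and q="?q"])
      show "X \<subseteq> int_cube" by (auto simp: X_def)
      show "f v \<in> X" if "v \<in> X" for v
        using that rot_iter_int_cube[OF ints(1,2)] by (simp add: X_def f_def)
      show "sup_norm ((f v - f w) - (v - w)) \<le> ?q * sup_norm (v - w)" if "v \<in> X" "w \<in> X" for v w
        using N(3)[of v w] that unfolding X_def f_def by simp
      show "u \<in> X" using cube[OF u(1)] by (simp add: X_def)
      show "padic_norm (x - \<pi> u) \<le> padic_norm (\<pi> (f u - u))" using x \<delta>(3) pw by linarith
      show "\<rho> * sup_norm (f u - u) \<le> padic_norm (\<pi> (f u - u))" by (rule w[OF u(1) du])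
    qed (use q \<rho> \<pi> fu in auto)
    then obtain v where v: "v \<in> closure (range (\<lambda>n. (f ^^ n) u))" "\<pi> v = x" "\<rho> * sup_norm (v - u) \<le> padic_norm (x - \<pi> u)"
      by blast
    have "range (\<lambda>n. (f ^^ n) u) \<subseteq> vorb A B C u"
      unfolding f_def funpow_mult using rot_iter_vorb by blast
    then have "v \<in> closure (vorb A B C u)" using v(1) closure_mono by blast
    moreover have "snd (snd v) = snd (snd u)"
    proof (rule ccontr)
      assume "snd (snd v) \<noteq> snd (snd u)"
      then have e: "padic_norm (snd (snd v) - snd (snd u)) > 0" by (intro padic_norm_pos) simp
      then have "padic_norm (snd (snd v) - snd (snd u)) / 2 > 0" by simp
      then have "\<exists>w\<in>range (\<lambda>n. (f ^^ n) u). sup_norm (v - w) \<le> padic_norm (snd (snd v) - snd (snd u)) / 2"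
        using v(1) unfolding closure_sup_norm by blast
      then obtain n where "sup_norm (v - (f ^^ n) u) \<le> padic_norm (snd (snd v) - snd (snd u)) / 2"
        by blast
      moreover have "snd (snd (v - (f ^^ n) u)) = snd (snd v) - snd (snd u)"
        by (simp add: f_def funpow_mult)
      ultimately show False using padic_norm_le_sup_norm(3)[of "v - (f ^^ n) u"] e by simp
    qed
    ultimately show ?thesis using v by blast
  qed
  then show ?thesis unfolding \<rho>_def using \<delta>(1) by blast
qed

lemma fibre_fill_x:
  assumes u0: "u0 \<in> int_surface A B C D" "free_rot A B u0" "dy B u0 \<noteq> 0"
  shows "\<exists>\<delta>>0. \<forall>u \<in> int_surface A B C D. sup_norm (u - u0) \<le> \<delta> \<longrightarrow> (\<forall>x. padic_norm (x - fst u) \<le> \<delta> \<longrightarrow>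
    (\<exists>v \<in> closure (vorb A B C u). fst v = x \<and> snd (snd v) = snd (snd u) \<and>
      padic_norm (dy B u0) * sup_norm (v - u) \<le> padic_norm (x - fst u)))"
proof (rule fibre_fill_gen[where d="dy B" and \<pi>=fst, OF u0])
  show "padic_norm (dy B u) * sup_norm (v - u) \<le> padic_norm (fst (v - u))"
    if "u \<in> int_surface A B C D" "v \<in> int_surface A B C D" "snd (snd u) = snd (snd v)"
      "sup_norm (v - u) < padic_norm (dy B u)" for u v
    using that conic_estimate_x[of u A B C D v] ints by (simp add: int_surface_eq)
qed (auto simp: dy_lipschitz dy_le_1 ints padic_norm_le_sup_norm smul_def)

lemma fibre_fill_y:
  assumes u0: "u0 \<in> int_surface A B C D" "free_rot A B u0" "dx A u0 \<noteq> 0"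
  shows "\<exists>\<delta>>0. \<forall>u \<in> int_surface A B C D. sup_norm (u - u0) \<le> \<delta> \<longrightarrow> (\<forall>x. padic_norm (x - fst (snd u)) \<le> \<delta> \<longrightarrow>
    (\<exists>v \<in> closure (vorb A B C u). fst (snd v) = x \<and> snd (snd v) = snd (snd u) \<and>
      padic_norm (dx A u0) * sup_norm (v - u) \<le> padic_norm (x - fst (snd u))))"
proof (rule fibre_fill_gen[where d="dx A" and \<pi>="\<lambda>u. fst (snd u)", OF u0])
  show "padic_norm (dx A u) * sup_norm (v - u) \<le> padic_norm (fst (snd (v - u)))"
    if "u \<in> int_surface A B C D" "v \<in> int_surface A B C D" "snd (snd u) = snd (snd v)"
      "sup_norm (v - u) < padic_norm (dx A u)" for u v
    using that conic_estimate_y[of u A B C D v] ints by (simp add: int_surface_eq)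
qed (auto simp: dx_lipschitz dx_le_1 ints padic_norm_le_sup_norm smul_def)

end

text \<open>The rotations along the fibres of z and of x are both free at the point, and the one
  condition on \<open>dy\<close> makes y the dependent coordinate on both fibres: x is a parameter
  on the first and z on the second.\<close>

definition transverse :: "'p::prime_card padic \<Rightarrow> 'p padic \<Rightarrow> 'p padic \<Rightarrow> 'p padic3 \<Rightarrow> bool" where
  "transverse A B C u \<longleftrightarrow> free_rot A B u \<and> free_rot B C (cyc u) \<and> dy B u \<noteq> 0"

text \<open>The two points carry the two roots y of one quadratic equation, and the derivative at a
  root is the difference of the roots.\<close>

lemma surface_fibre_unique:
  assumes "u \<in> surface A B C D" "v \<in> surface A B C D" "fst u = fst v" "snd (snd u) = snd (snd v)" "u \<noteq> v"
  shows "sup_norm (u - v) = padic_norm (dy B u)"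
proof -
  obtain x y z where u: "u = (x, y, z)" by (cases u)
  define b where "b = fst (snd v) - y"
  have v: "v = (x + 0, y + b, z)" using assms(3,4) by (simp add: u b_def prod_eq_iff)
  have b0: "b \<noteq> 0" using assms(5) by (auto simp: u v)
  have "b * (dy B u + b) = 0" using fibre_equation[of x y z A B C D 0 b] assms(1,2) by (simp add: u v)
  then have "dy B u = - b" using b0 by (simp add: eq_neg_iff_add_eq_0)
  then show ?thesis by (simp add: u v sup_norm_def padic_norm_uminus padic_norm_nonneg)
qed

section \<open>Filling along two fibrations: open orbit closures\<close>

lemma closed_surface: "closed (surface A B C D)"
proof -
  have "surface A B C D = {u. fst u ^ 2 + fst (snd u) ^ 2 + snd (snd u) ^ 2 + fst u * fst (snd u) * snd (snd u) =
      A * fst u + B * fst (snd u) + C * snd (snd u) + D}"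
    by (auto simp: surface_def)
  also have "closed \<dots>" by (intro closed_Collect_eq continuous_intros)
  finally show ?thesis .
qed

lemma compact_int_surface: "compact (int_surface A B C D)"
  unfolding int_surface_eq by (rule closed_Int_compact[OF closed_surface compact_int_cube])

lemma closed_int_surface: "closed (int_surface A B C D)"
  by (rule compact_imp_closed[OF compact_int_surface])

context
  fixes A B C D :: "'p::prime_card padic"
  assumes ints: "A \<in> padic_ints" "B \<in> padic_ints" "C \<in> padic_ints"
begin

lemma closure_vorb_int_surface:
  assumes "u \<in> int_surface A B C D"
  shows "closure (vorb A B C u) \<subseteq> int_surface A B C D"
  by (rule closure_minimal[OF _ closed_int_surface]) (use vorb_int_surface[OF ints _ assms] in blast)

text \<open>Move along the fibre of z to the prescribed x, then along the fibre of x to the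
  prescribed z. The final strict bound records that y has stayed on the same root of its
  equation.\<close>

lemma transverse_fill:
  assumes u0: "u0 \<in> int_surface A B C D" "transverse A B C u0"
  shows "\<exists>e>0. \<forall>x z. padic_norm (x - fst u0) \<le> e \<longrightarrow> padic_norm (z - snd (snd u0)) \<le> e \<longrightarrow>
    (\<exists>v \<in> closure (vorb A B C u0). fst v = x \<and> snd (snd v) = z \<and> sup_norm (v - u0) < padic_norm (dy B u0))"
proof -
  define \<rho> where "\<rho> = padic_norm (dy B u0)"
  have tr: "free_rot A B u0" "free_rot B C (cyc u0)" "dy B u0 \<noteq> 0" using u0(2) by (auto simp: transverse_def)
  have cube0: "u0 \<in> int_cube" using u0(1) by (simp add: int_surface_eq)
  have \<rho>: "\<rho> > 0" using tr(3) by (auto simp: \<rho>_def padic_norm_pos)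
  obtain \<delta>1 where \<delta>1: "\<delta>1 > 0" "\<And>u x. u \<in> int_surface A B C D \<Longrightarrow> sup_norm (u - u0) \<le> \<delta>1 \<Longrightarrow> padic_norm (x - fst u) \<le> \<delta>1 \<Longrightarrow>
      \<exists>v \<in> closure (vorb A B C u). fst v = x \<and> snd (snd v) = snd (snd u) \<and> \<rho> * sup_norm (v - u) \<le> padic_norm (x - fst u)"
    using fibre_fill_x[OF ints u0(1) tr(1,3)] unfolding \<rho>_def by blast
  have c: "cyc u0 \<in> int_surface B C A D" "dx B (cyc u0) \<noteq> 0" using u0(1) tr(3) by (simp_all add: d_cyc)
  obtain \<delta>2 where \<delta>2: "\<delta>2 > 0" "\<And>u x. u \<in> int_surface B C A D \<Longrightarrow> sup_norm (u - cyc u0) \<le> \<delta>2 \<Longrightarrow> padic_norm (x - fst (snd u)) \<le> \<delta>2 \<Longrightarrow>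
      \<exists>v \<in> closure (vorb B C A u). fst (snd v) = x \<and> snd (snd v) = snd (snd u) \<and> \<rho> * sup_norm (v - u) \<le> padic_norm (x - fst (snd u))"
    using fibre_fill_y[OF ints(2,3,1) c(1) tr(2) c(2)] unfolding \<rho>_def d_cyc by blast
  \<comment> \<open>A change of coordinate by \<open>e\<close> may move the point by e / rho. This
    must be at most \<open>\<delta>2\<close>, for the second move to be available, and less than
    rho, for the final bound.\<close>
  define e where "e = min (min \<delta>1 \<delta>2) (min (\<rho> * \<delta>2) (\<rho> * \<rho> / 2))"
  have e: "e > 0" "e \<le> \<delta>1" "e \<le> \<delta>2" "e / \<rho> \<le> \<delta>2" "e / \<rho> < \<rho>"
  proof -
    show "e > 0" "e \<le> \<delta>1" "e \<le> \<delta>2" using \<delta>1(1) \<delta>2(1) \<rho> by (auto simp: e_def)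
    have "e \<le> \<rho> * \<delta>2" by (simp add: e_def)
    then show "e / \<rho> \<le> \<delta>2" using \<rho> by (simp add: field_simps)
    have "e \<le> \<rho> * \<rho> / 2" by (simp add: e_def)
    also have "\<dots> < \<rho> * \<rho>" using \<rho> by simp
    finally show "e / \<rho> < \<rho>" using \<rho> by (simp add: field_simps)
  qed
  have "\<exists>v \<in> closure (vorb A B C u0). fst v = x \<and> snd (snd v) = z \<and> sup_norm (v - u0) < \<rho>"
    if xz: "padic_norm (x - fst u0) \<le> e" "padic_norm (z - snd (snd u0)) \<le> e" for x z
  proof -
    obtain v1 where v1: "v1 \<in> closure (vorb A B C u0)" "fst v1 = x" "snd (snd v1) = snd (snd u0)"
      "\<rho> * sup_norm (v1 - u0) \<le> padic_norm (x - fst u0)"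
      using \<delta>1(2)[OF u0(1), of x] \<delta>1(1) xz(1) e(2) by auto
    have v1S: "v1 \<in> int_surface A B C D" using closure_vorb_int_surface[OF u0(1)] v1(1) by blast
    have "\<rho> * sup_norm (v1 - u0) \<le> e" using v1(4) xz(1) by linarith
    then have d1: "sup_norm (v1 - u0) \<le> e / \<rho>" using \<rho> by (simp add: field_simps)
    have "cyc v1 \<in> int_surface B C A D" using v1S by simp
    moreover have "sup_norm (cyc v1 - cyc u0) \<le> \<delta>2" using d1 e(4) by (simp add: cyc_diff)
    moreover have "padic_norm (z - fst (snd (cyc v1))) \<le> \<delta>2" using v1(3) xz(2) e(3) by (simp add: cyc_def)
    ultimately obtain w where w: "w \<in> closure (vorb B C A (cyc v1))" "fst (snd w) = z"
      "snd (snd w) = snd (snd (cyc v1))" "\<rho> * sup_norm (w - cyc v1) \<le> padic_norm (z - fst (snd (cyc v1)))"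
      using \<delta>2(2) by blast
    define v2 where "v2 = cyc (cyc w)"
    have wv: "w = cyc v2" by (simp add: v2_def)
    have v2: "v2 \<in> closure (vorb A B C v1)" using w(1) unfolding wv cyc_closure_vorb .
    have "\<rho> * sup_norm (v2 - v1) \<le> e" using w(4) xz(2) v1(3) by (simp add: wv cyc_diff) (simp add: cyc_def)
    then have "sup_norm (v2 - v1) \<le> e / \<rho>" using \<rho> by (simp add: field_simps)
    then have "sup_norm (v2 - u0) \<le> e / \<rho>" using d1 by (rule sup_norm_trans)
    then have "sup_norm (v2 - u0) < \<rho>" using e(5) by linarith
    moreover have "v2 \<in> closure (vorb A B C u0)"
      by (rule closure_vorb_trans[OF ints cube0 _ v1(1) v2]) (use v1S in \<open>simp add: int_surface_eq\<close>)
    moreover have "fst v2 = x" "snd (snd v2) = z" using w(2,3) v1(2) by (simp_all add: wv cyc_def)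
    ultimately show ?thesis by blast
  qed
  then show ?thesis using e(1) unfolding \<rho>_def by blast
qed

text \<open>The filling produces a point of the closure with the same x and z as \<open>v\<close>.
  Two different such points would be at distance rho, but both are nearer than rho to
  \<open>u0\<close>.\<close>

lemma transverse_open:
  assumes u0: "u0 \<in> int_surface A B C D" "transverse A B C u0"
  shows "\<exists>e>0. \<forall>v \<in> int_surface A B C D. sup_norm (v - u0) \<le> e \<longrightarrow> v \<in> closure (vorb A B C u0)"
proof -
  define \<rho> where "\<rho> = padic_norm (dy B u0)"
  have \<rho>: "\<rho> > 0" using u0(2) by (auto simp: \<rho>_def padic_norm_pos transverse_def)
  have cube0: "u0 \<in> int_cube" using u0(1) by (simp add: int_surface_eq)
  obtain e where e: "e > 0" "\<And>x z. padic_norm (x - fst u0) \<le> e \<Longrightarrow> padic_norm (z - snd (snd u0)) \<le> e \<Longrightarrow>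
    (\<exists>v \<in> closure (vorb A B C u0). fst v = x \<and> snd (snd v) = z \<and> sup_norm (v - u0) < \<rho>)"
    using transverse_fill[OF u0] unfolding \<rho>_def by blast
  have "v \<in> closure (vorb A B C u0)" if v: "v \<in> int_surface A B C D" "sup_norm (v - u0) \<le> min e (\<rho> / 2)" for v
  proof -
    have cubev: "v \<in> int_cube" using v(1) by (simp add: int_surface_eq)
    obtain w where w: "w \<in> closure (vorb A B C u0)" "fst w = fst v" "snd (snd w) = snd (snd v)" "sup_norm (w - u0) < \<rho>"
      using e(2)[of "fst v" "snd (snd v)"] padic_norm_le_sup_norm[of "v - u0"] v(2) by force
    have "w = v"
    proof (rule ccontr)
      assume "w \<noteq> v"
      have wS: "w \<in> int_surface A B C D" using closure_vorb_int_surface[OF u0(1)] w(1) by blast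
      have lt: "sup_norm (v - u0) < \<rho>" using v(2) \<rho> by simp
      have "padic_norm (dy B u0 - dy B v) < padic_norm (dy B u0)"
        using dy_lipschitz[OF cube0 cubev, of B] lt by (simp add: \<rho>_def sup_norm_diff_commute)
      then have "padic_norm (dy B v) = \<rho>" using padic_norm_eq_of_close by (simp add: \<rho>_def)
      then have "sup_norm (v - w) = \<rho>"
        using surface_fibre_unique[of v A B C D w] v(1) wS w(2,3) \<open>w \<noteq> v\<close> by (simp add: int_surface_eq)
      moreover have "sup_norm (v - w) \<le> max (sup_norm (v - u0)) (sup_norm (w - u0))"
        using sup_norm_trans[of v u0 "max (sup_norm (v - u0)) (sup_norm (w - u0))" w]
        by (simp add: sup_norm_diff_commute)
      ultimately show False using lt w(4) by simp
    qed
    then show ?thesis using w(1) by simp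
  qed
  moreover have "min e (\<rho> / 2) > 0" using e(1) \<rho> by simp
  ultimately show ?thesis by blast
qed

text \<open>Along the infinitely many points \<open>g\<^sup>n v\<close> of a free rotation orbit, only finitely many are fixed by
  one of the two involutions, and only finitely many have both moving coordinates in exceptional fibres.\<close>

lemma free_rot_transverse:
  assumes v: "v \<in> int_surface A B C D" "free_rot A B v"
  shows "\<exists>w \<in> vorb A B C v. transverse A B C w \<or> transverse C A B (cyc (cyc w))"
proof (rule ccontr)
  assume neg: "\<not> ?thesis"
  obtain T1 where T1: "finite T1" "\<And>u. u \<in> int_cube \<Longrightarrow> \<not> free_rot B C u \<Longrightarrow> snd (snd u) \<in> T1 \<or> (vieta1 B u = u \<and> vieta2 C u = u)"
    using finite_bad_fibres[OF ints(2,3)] by blast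
  obtain T2 where T2: "finite T2" "\<And>u. u \<in> int_cube \<Longrightarrow> \<not> free_rot C A u \<Longrightarrow> snd (snd u) \<in> T2 \<or> (vieta1 C u = u \<and> vieta2 A u = u)"
    using finite_bad_fibres[OF ints(3,1)] by blast
  define g where "g n = (rot A B ^^ n) v" for n
  define F where "F = {n. vieta2 B (g n) = g n} \<union> {n. vieta1 A (g n) = g n}"
  have finF: "finite F" unfolding F_def g_def using free_rot_finite_fixed[OF v(2)] by blast
  have "g n \<in> T1 \<times> T2 \<times> {snd (snd v)}" if n: "n \<notin> F" for n
  proof -
    have gv: "g n \<in> vorb A B C v" unfolding g_def by (rule rot_iter_vorb)
    have cube: "g n \<in> int_cube" using vorb_int_surface[OF ints gv v(1)] by (simp add: int_surface_eq)
    have nz: "dy B (g n) \<noteq> 0" "dx A (g n) \<noteq> 0" using n by (simp_all add: F_def vieta_fixed_iff)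
    have free: "free_rot A B (g n)" unfolding g_def by (rule free_rot_iter[OF v(2)])
    \<comment> \<open>The two kinds of transversality denied by \<open>neg\<close> pair the
      fibration by z with the one by x, through \<open>dy\<close>, and with the one by y, through
      \<open>dx\<close>. Both derivatives are nonzero here, so freeness must fail for the
      partner.\<close>
    have n1: "\<not> free_rot B C (cyc (g n))" using neg gv free nz by (auto simp: transverse_def)
    have n2: "\<not> free_rot C A (cyc (cyc (g n)))"
      using neg gv free nz by (auto simp: transverse_def d_cyc)
    have "snd (snd (cyc (g n))) \<in> T1"
      using T1(2)[OF _ n1] cube nz by (auto simp: vieta_fixed_iff d_cyc)
    moreover have "snd (snd (cyc (cyc (g n)))) \<in> T2"
      using T2(2)[OF _ n2] cube nz by (auto simp: vieta_fixed_iff d_cyc)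
    moreover have "snd (snd (g n)) = snd (snd v)" by (simp add: g_def)
    ultimately show ?thesis by (cases "g n") auto
  qed
  then have "g ` (- F) \<subseteq> T1 \<times> T2 \<times> {snd (snd v)}" by blast
  then have "finite (g ` (- F))" using T1(1) T2(1) by (meson finite_SigmaI finite.intros finite_subset)
  moreover have "inj_on g (- F)" unfolding g_def by (intro inj_onI) (rule free_rot_inj[OF v(2)])
  ultimately have "finite (- F)" by (rule finite_imageD)
  then show False using finF by (metis Compl_eq_Diff_UNIV finite_Diff2 infinite_UNIV_nat)
qed

end

lemma finite_surface_two_coordinates:
  assumes "finite S" "finite T"
  shows "finite {u \<in> surface A B C D. fst u \<in> S \<and> fst (snd u) \<in> T}"
proof -
  have "finite {z. z\<^sup>2 + (x * y - C) * z + (x\<^sup>2 + y\<^sup>2 - A * x - B * y - D) = 0}" for x y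
  proof -
    have "finite {z. poly [:x\<^sup>2 + y\<^sup>2 - A * x - B * y - D, x * y - C, 1:] z = 0}"
      by (rule poly_roots_finite) simp
    then show ?thesis by (simp add: power2_eq_square algebra_simps)
  qed
  then have "finite (\<Union>x\<in>S. \<Union>y\<in>T. (\<lambda>z. (x, y, z)) ` {z. z\<^sup>2 + (x * y - C) * z + (x\<^sup>2 + y\<^sup>2 - A * x - B * y - D) = 0})"
    using assms by blast
  then show ?thesis
  proof (rule finite_subset[rotated], intro subsetI)
    fix u assume u: "u \<in> {u \<in> surface A B C D. fst u \<in> S \<and> fst (snd u) \<in> T}"
    obtain x y z where xyz: "u = (x, y, z)" by (cases u)
    have "z\<^sup>2 + (x * y - C) * z + (x\<^sup>2 + y\<^sup>2 - A * x - B * y - D) =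
        (x\<^sup>2 + y\<^sup>2 + z\<^sup>2 + x * y * z) - (A * x + B * y + C * z + D)"
      by (simp add: algebra_simps)
    also have "\<dots> = 0" using u by (simp add: xyz surface_def)
    finally show "u \<in> (\<Union>x\<in>S. \<Union>y\<in>T. (\<lambda>z. (x, y, z)) ` {z. z\<^sup>2 + (x * y - C) * z + (x\<^sup>2 + y\<^sup>2 - A * x - B * y - D) = 0})"
      using u by (auto simp: xyz)
  qed
qed

text \<open>Without a transverse point no rotation is free at any point of the orbit. Each
  coordinate of each point then is exceptional or makes two derivatives vanish. Two coordinates of
  the second kind would make all three derivatives vanish, so at least two coordinates lie in finite
  sets; the third is a root of a quadratic equation, and the orbit is finite.\<close>

lemma transverse_exists:
  fixes A B C D :: "'p::prime_card padic"
  assumes ints: "A \<in> padic_ints" "B \<in> padic_ints" "C \<in> padic_ints"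
    and u: "u \<in> int_surface A B C D" "\<And>v. v \<in> int_surface A B C D \<Longrightarrow> infinite (vorb A B C v)"
  shows "\<exists>v \<in> vorb A B C u. transverse A B C v \<or> transverse B C A (cyc v) \<or> transverse C A B (cyc (cyc v))"
proof (rule ccontr)
  assume neg: "\<not> ?thesis"
  have S: "v \<in> int_surface A B C D" if "v \<in> vorb A B C u" for v using vorb_int_surface[OF ints that u(1)] .
  have cube: "v \<in> int_cube" if "v \<in> vorb A B C u" for v using S[OF that] by (simp add: int_surface_eq)
  have nf: "\<not> free_rot A B v" "\<not> free_rot B C (cyc v)" "\<not> free_rot C A (cyc (cyc v))" if v: "v \<in> vorb A B C u" for v
  proof -
    show "\<not> free_rot A B v"
    proof
      assume "free_rot A B v"
      then obtain w where w: "w \<in> vorb A B C v" "transverse A B C w \<or> transverse C A B (cyc (cyc w))"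
        using free_rot_transverse[OF ints S[OF v]] by blast
      then show False using neg vorb_trans[OF v w(1)] by blast
    qed
    show "\<not> free_rot B C (cyc v)"
    proof
      assume "free_rot B C (cyc v)"
      then obtain w where w: "w \<in> vorb B C A (cyc v)" "transverse B C A w \<or> transverse A B C (cyc (cyc w))"
        using free_rot_transverse[OF ints(2,3,1), of "cyc v" D] S[OF v] by auto
      define w' where "w' = cyc (cyc w)"
      have "w = cyc w'" by (simp add: w'_def)
      then have "w' \<in> vorb A B C v" "transverse B C A (cyc w') \<or> transverse A B C w'" using w by (auto simp: cyc_vorb_iff)
      then show False using neg vorb_trans[OF v] by blast
    qed
    show "\<not> free_rot C A (cyc (cyc v))"
    proof
      assume "free_rot C A (cyc (cyc v))"
      then obtain w where w: "w \<in> vorb C A B (cyc (cyc v))" "transverse C A B w \<or> transverse B C A (cyc (cyc w))"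
        using free_rot_transverse[OF ints(3,1,2), of "cyc (cyc v)" D] S[OF v] by auto
      define w' where "w' = cyc w"
      have "w = cyc (cyc w')" by (simp add: w'_def)
      then have "w' \<in> vorb A B C v" "transverse C A B (cyc (cyc w')) \<or> transverse B C A (cyc w')" using w by (auto simp: cyc_vorb_iff)
      then show False using neg vorb_trans[OF v] by blast
    qed
  qed
  obtain Tz where Tz: "finite Tz" "\<And>u. u \<in> int_cube \<Longrightarrow> \<not> free_rot A B u \<Longrightarrow> snd (snd u) \<in> Tz \<or> (vieta1 A u = u \<and> vieta2 B u = u)"
    using finite_bad_fibres[OF ints(1,2)] by blast
  obtain Tx where Tx: "finite Tx" "\<And>u. u \<in> int_cube \<Longrightarrow> \<not> free_rot B C u \<Longrightarrow> snd (snd u) \<in> Tx \<or> (vieta1 B u = u \<and> vieta2 C u = u)"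
    using finite_bad_fibres[OF ints(2,3)] by blast
  obtain Ty where Ty: "finite Ty" "\<And>u. u \<in> int_cube \<Longrightarrow> \<not> free_rot C A u \<Longrightarrow> snd (snd u) \<in> Ty \<or> (vieta1 C u = u \<and> vieta2 A u = u)"
    using finite_bad_fibres[OF ints(3,1)] by blast
  define Q where "Q A B C S T = {u \<in> surface A B C D. fst u \<in> S \<and> fst (snd u) \<in> T}" for A B C :: "'p padic" and S T
  have finQ: "finite (Q A B C S T)" if "finite S" "finite T" for A B C S T
    unfolding Q_def by (rule finite_surface_two_coordinates[OF that])
  have sub: "vorb A B C u \<subseteq> Q A B C Tx Ty \<union> (cyc \<circ> cyc) ` Q B C A Ty Tz \<union> cyc ` Q C A B Tz Tx"
  proof
    fix v assume v: "v \<in> vorb A B C u"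
    have z: "snd (snd v) \<in> Tz \<or> (dx A v = 0 \<and> dy B v = 0)"
      using Tz(2)[OF cube[OF v] nf(1)[OF v]] by (simp add: vieta_fixed_iff)
    have x: "fst v \<in> Tx \<or> (dy B v = 0 \<and> dz C v = 0)"
      using Tx(2)[OF _ nf(2)[OF v]] cube[OF v] by (simp add: vieta_fixed_iff d_cyc) (simp add: cyc_def)
    have y: "fst (snd v) \<in> Ty \<or> (dz C v = 0 \<and> dx A v = 0)"
      using Ty(2)[OF _ nf(3)[OF v]] cube[OF v] d_cyc(1)[of C "cyc v"] d_cyc(2)[of C v] d_cyc(2)[of A "cyc v"] d_cyc(3)[of A v]
      by (simp add: vieta_fixed_iff) (simp add: cyc_def)
    have nonsing: "\<not> (dx A v = 0 \<and> dy B v = 0 \<and> dz C v = 0)"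
    proof
      assume "dx A v = 0 \<and> dy B v = 0 \<and> dz C v = 0"
      then have fix_v: "s v = v" if "s \<in> vietas A B C" for s
        using that by (auto simp: vietas_def vieta_fixed_iff)
      have "w = v" if "w \<in> vorb A B C v" for w
        using that by (induction rule: vorb.induct) (auto simp: fix_v)
      then have "vorb A B C v \<subseteq> {v}" by blast
      then have "finite (vorb A B C v)" by (rule finite_subset) simp
      then show False using u(2)[OF S[OF v]] by blast
    qed
    have vS: "v \<in> surface A B C D" using S[OF v] by (simp add: int_surface_eq)
    have c1: "cyc v \<in> surface B C A D" using vS by (cases v) (auto simp: surface_def algebra_simps)
    have c2: "cyc (cyc v) \<in> surface C A B D" using vS by (cases v) (auto simp: surface_def algebra_simps)
    consider "fst v \<in> Tx" "fst (snd v) \<in> Ty" | "fst (snd v) \<in> Ty" "snd (snd v) \<in> Tz" | "snd (snd v) \<in> Tz" "fst v \<in> Tx"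
      using x y z nonsing by blast
    then show "v \<in> Q A B C Tx Ty \<union> (cyc \<circ> cyc) ` Q B C A Ty Tz \<union> cyc ` Q C A B Tz Tx"
    proof cases
      case 1
      then show ?thesis using vS by (simp add: Q_def)
    next
      case 2
      then have "cyc v \<in> Q B C A Ty Tz" using c1 by (simp add: Q_def) (simp add: cyc_def)
      then have "(cyc \<circ> cyc) (cyc v) \<in> (cyc \<circ> cyc) ` Q B C A Ty Tz" by (rule imageI)
      then show ?thesis by simp
    next
      case 3
      then have "cyc (cyc v) \<in> Q C A B Tz Tx" using c2 by (simp add: Q_def) (simp add: cyc_def)
      then have "cyc (cyc (cyc v)) \<in> cyc ` Q C A B Tz Tx" by (rule imageI)
      then show ?thesis by simp
    qed
  qed
  have "finite (vorb A B C u)"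
    by (rule finite_subset[OF sub]) (intro finite_UnI finite_imageI finQ Tx(1) Ty(1) Tz(1))
  then show False using u by blast
qed

text \<open>Openness at a single transverse point spreads over the closure with the same radius: a
  word that brings \<open>w\<close> close to \<open>u0\<close> is an isometry and carries the
  neighbourhood of \<open>w\<close> along.\<close>

theorem orbit_closure_open:
  fixes A B C D :: "'p::prime_card padic"
  assumes ints: "A \<in> padic_ints" "B \<in> padic_ints" "C \<in> padic_ints"
    and u: "u \<in> int_surface A B C D" "\<And>v. v \<in> int_surface A B C D \<Longrightarrow> infinite (vorb A B C v)"
    and w: "w \<in> closure (vorb A B C u)"
  shows "\<exists>e>0. \<forall>v \<in> int_surface A B C D. sup_norm (v - w) \<le> e \<longrightarrow> v \<in> closure (vorb A B C u)"
proof -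
  obtain u0 where u0: "u0 \<in> vorb A B C u" "transverse A B C u0 \<or> transverse B C A (cyc u0) \<or> transverse C A B (cyc (cyc u0))"
    using transverse_exists[OF ints u] by blast
  have u0S: "u0 \<in> int_surface A B C D" by (rule vorb_int_surface[OF ints u0(1) u(1)])
  have cube: "v \<in> int_cube" if "v \<in> int_surface A B C D" for v using that by (simp add: int_surface_eq)
  have "\<exists>e>0. \<forall>v \<in> int_surface A B C D. sup_norm (v - u0) \<le> e \<longrightarrow> v \<in> closure (vorb A B C u0)"
    using u0(2)
  proof (elim disjE)
    assume "transverse A B C u0"
    then show ?thesis by (rule transverse_open[OF ints u0S])
  next
    assume t: "transverse B C A (cyc u0)"
    have "cyc u0 \<in> int_surface B C A D" using u0S by simp
    then obtain e where e: "e > 0" "\<And>v. v \<in> int_surface B C A D \<Longrightarrow> sup_norm (v - cyc u0) \<le> e \<Longrightarrow> v \<in> closure (vorb B C A (cyc u0))"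
      using transverse_open[OF ints(2,3,1) _ t] by blast
    have "v \<in> closure (vorb A B C u0)" if "v \<in> int_surface A B C D" "sup_norm (v - u0) \<le> e" for v
      using e(2)[of "cyc v"] that by (simp add: cyc_diff cyc_closure_vorb)
    then show ?thesis using e(1) by blast
  next
    assume t: "transverse C A B (cyc (cyc u0))"
    have "cyc (cyc u0) \<in> int_surface C A B D" using u0S by simp
    then obtain e where e: "e > 0" "\<And>v. v \<in> int_surface C A B D \<Longrightarrow> sup_norm (v - cyc (cyc u0)) \<le> e \<Longrightarrow> v \<in> closure (vorb C A B (cyc (cyc u0)))"
      using transverse_open[OF ints(3,1,2) _ t] by blast
    have "v \<in> closure (vorb A B C u0)" if "v \<in> int_surface A B C D" "sup_norm (v - u0) \<le> e" for v
      using e(2)[of "cyc (cyc v)"] that by (simp add: cyc_diff cyc_closure_vorb)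
    then show ?thesis using e(1) by blast
  qed
  then obtain e where e: "e > 0" "\<And>v. v \<in> int_surface A B C D \<Longrightarrow> sup_norm (v - u0) \<le> e \<Longrightarrow> v \<in> closure (vorb A B C u0)" by blast
  have cl: "closure (vorb A B C u0) = closure (vorb A B C u)" using vorb_eq[OF u0(1)] by simp
  have wS: "w \<in> int_surface A B C D" using closure_vorb_int_surface[OF ints u(1)] w by blast
  have "u0 \<in> closure (vorb A B C w)"
    using closure_vorb_eq[OF ints cube[OF u(1)] cube[OF wS] w] u0(1) closure_subset by blast
  then obtain w' where w': "w' \<in> vorb A B C w" "sup_norm (u0 - w') \<le> e" using e(1) unfolding closure_sup_norm by blast
  have "v \<in> closure (vorb A B C u)" if v: "v \<in> int_surface A B C D" "sup_norm (v - w) \<le> e" for v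
  proof -
    obtain v' where v': "v' \<in> vorb A B C v" "sup_norm (w' - v') \<le> e"
      using vorb_shadow[OF ints w'(1) cube[OF wS] cube[OF v(1)], of e] v(2) by (auto simp: sup_norm_diff_commute)
    have v'S: "v' \<in> int_surface A B C D" by (rule vorb_int_surface[OF ints v'(1) v(1)])
    have "sup_norm (v' - u0) \<le> e" using sup_norm_trans[OF w'(2) v'(2)] by (simp add: sup_norm_diff_commute)
    then have 1: "v' \<in> closure (vorb A B C u)" using e(2)[OF v'S] cl by simp
    have 2: "v \<in> closure (vorb A B C v')" using vorb_sym[OF v'(1)] closure_subset by blast
    show ?thesis by (rule closure_vorb_trans[OF ints cube[OF u(1)] cube[OF v'S] 1 2])
  qed
  then show ?thesis using e(1) by blast
qed

section \<open>Haar measure on the p-adic numbers\<close>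

lemma borel_eq_basis:
  assumes "topological_basis (B :: 'a::second_countable_topology set set)"
  shows "sets borel = sigma_sets UNIV B"
proof
  have "sets (borel :: 'a measure) = sigma_sets UNIV {S. open S}" by (simp add: borel_def)
  also have "\<dots> \<subseteq> sigma_sets UNIV B"
  proof (rule sigma_sets_mono, rule subsetI)
    fix U :: "'a set" assume "U \<in> {S. open S}"
    then obtain B' where B': "B' \<subseteq> B" "\<Union>B' = U" using assms unfolding topological_basis_def by blast
    have "\<And>S. S \<in> B' \<Longrightarrow> open S" using B'(1) assms topological_basis_open by blast
    then obtain F where F: "F \<subseteq> B'" "countable F" "\<Union>F = \<Union>B'" by (rule Lindelof)
    have "\<Union>F \<in> sigma_sets UNIV B"
      by (rule sigma_sets_UNION[OF F(2)]) (use F(1) B'(1) in blast)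
    then show "U \<in> sigma_sets UNIV B" using F(3) B'(2) by simp
  qed
  finally show "sets (borel :: 'a measure) \<subseteq> sigma_sets UNIV B" .
  show "sigma_sets UNIV B \<subseteq> sets (borel :: 'a measure)"
  proof -
    have "B \<subseteq> sets borel" using topological_basis_open[OF assms] by (auto intro: borel_open)
    from sets.sigma_sets_subset[OF this] show ?thesis by simp
  qed
qed

text \<open>Ultrametric balls form a basis that is closed under intersection up to the empty set.\<close>

lemma measure_eqI_basis:
  fixes M N :: "'a::second_countable_topology measure"
  assumes basis: "topological_basis B" and int: "\<And>U V. U \<in> B \<Longrightarrow> V \<in> B \<Longrightarrow> U \<inter> V = {} \<or> U \<inter> V \<in> B"
    and sets: "sets M = sets borel" "sets N = sets borel"
    and eq: "\<And>U. U \<in> B \<Longrightarrow> emeasure M U = emeasure N U" and fin: "\<And>U. U \<in> B \<Longrightarrow> emeasure M U \<noteq> \<infinity>"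
  shows "M = N"
proof -
  let ?E = "insert {} B"
  have b2: "sigma_sets UNIV ?E = sigma_sets UNIV B"
    by (rule antisym[OF sigma_sets_mono sigma_sets_mono]) (auto intro: sigma_sets.intros)
  have "\<And>S. S \<in> B \<Longrightarrow> open S" using topological_basis_open[OF basis] .
  then obtain F where F: "F \<subseteq> B" "countable F" "\<Union>F = \<Union>B" by (rule Lindelof)
  have UN: "\<Union>B = UNIV" using basis unfolding topological_basis_def by (metis Sup_subset_mono open_UNIV top.extremum_uniqueI)
  show ?thesis
  proof (rule measure_eqI_generator_eq_countable[where E="?E" and \<Omega>=UNIV and A="F"])
    show "Int_stable ?E" unfolding Int_stable_def using int by blast
    show "\<And>X. X \<in> ?E \<Longrightarrow> emeasure M X = emeasure N X" using eq by auto
    show "sets M = sigma_sets UNIV ?E" "sets N = sigma_sets UNIV ?E"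
      using borel_eq_basis[OF basis] b2 sets by auto
    show "F \<subseteq> ?E" "countable F" using F by auto
    show "\<Union>F = UNIV" using F(3) UN by simp
    show "\<And>a. a \<in> F \<Longrightarrow> emeasure M a \<noteq> \<infinity>" using F(1) fin by blast
  qed auto
qed

definition padic_balls :: "nat \<Rightarrow> 'p::prime_card padic set set" where
  "padic_balls m = {cball a (1 / real CARD('p) ^ n) | a n. n \<ge> m}"

lemma padic_cball_eq:
  assumes "b \<in> cball (a :: 'p::prime_card padic) r"
  shows "cball a r = cball b r"
proof -
  have 1: "padic_norm (a - b) \<le> r" "padic_norm (b - a) \<le> r"
    using assms by (simp_all add: mem_padic_cball padic_norm_diff_commute del: mem_cball)
  show ?thesis
    using padic_norm_trans[OF _ 1(1)] padic_norm_trans[OF _ 1(2)]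
    by (auto simp: mem_padic_cball simp del: mem_cball)
qed

lemma padic_cball_Int:
  assumes "r \<le> s"
  shows "cball (a :: 'p::prime_card padic) r \<inter> cball b s = {} \<or> cball a r \<inter> cball b s = cball a r"
proof (cases "cball a r \<inter> cball b s = {}")
  case False
  then obtain c where c: "c \<in> cball a r" "c \<in> cball b s" by blast
  have "cball c r \<subseteq> cball c s" using assms by (rule subset_cball)
  then show ?thesis using padic_cball_eq[OF c(1)] padic_cball_eq[OF c(2)] by blast
qed simp

lemma card_inverse_power_mono:
  "m \<le> n \<Longrightarrow> 1 / real CARD('p::prime_card) ^ n \<le> 1 / real CARD('p) ^ m"
  using card_prime_gt_1[where 'p='p] by (simp add: field_simps power_increasing)

lemma padic_balls_basis: "topological_basis (padic_balls m :: 'p::prime_card padic set set)"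
proof (rule topological_basisI)
  fix B' :: "'p padic set" assume "B' \<in> padic_balls m"
  then show "open B'" by (auto simp: padic_balls_def open_padic_cball)
next
  fix U and x :: "'p padic" assume U: "open U" "x \<in> U"
  then obtain e where e: "e > 0" "cball x e \<subseteq> U" by (auto simp: open_contains_cball)
  obtain n where n: "1 / real CARD('p) ^ n < e" using padic_radius_small[OF e(1), where 'p='p] by blast
  have "1 / real CARD('p) ^ max m n \<le> e" using card_inverse_power_mono[of n "max m n", where 'p='p] n by simp
  then have "cball x (1 / real CARD('p) ^ max m n) \<subseteq> U" using e(2) subset_cball by blast
  moreover have "x \<in> cball x (1 / real CARD('p) ^ max m n)" by simp
  moreover have "cball x (1 / real CARD('p) ^ max m n) \<in> padic_balls m" unfolding padic_balls_def by force
  ultimately show "\<exists>B'\<in>padic_balls m. x \<in> B' \<and> B' \<subseteq> U" by blast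
qed

lemma padic_balls_Int:
  assumes "U \<in> padic_balls m" "V \<in> padic_balls m"
  shows "U \<inter> V = {} \<or> U \<inter> V \<in> (padic_balls m :: 'p::prime_card padic set set)"
proof -
  obtain a n b k where *: "U = cball a (1 / real CARD('p) ^ n)" "V = cball b (1 / real CARD('p) ^ k)" "n \<ge> m" "k \<ge> m"
    using assms by (auto simp: padic_balls_def)
  show ?thesis
  proof (cases "n \<ge> k")
    case True
    then show ?thesis using padic_cball_Int[OF card_inverse_power_mono[OF True], of a b] * assms by auto
  next
    case False
    then have "n \<le> k" by simp
    then show ?thesis using padic_cball_Int[OF card_inverse_power_mono[OF \<open>n \<le> k\<close>], of b a] * assms
      by (auto simp: Int_commute)
  qed
qed

lemma padic_measure_eqI:
  fixes M N :: "'p::prime_card padic measure"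
  assumes "sets M = sets borel" "sets N = sets borel"
    "\<And>a n. n \<ge> m \<Longrightarrow> emeasure M (cball a (1 / real CARD('p) ^ n)) = emeasure N (cball a (1 / real CARD('p) ^ n))"
    "\<And>a n. n \<ge> m \<Longrightarrow> emeasure M (cball a (1 / real CARD('p) ^ n)) \<noteq> \<infinity>"
  shows "M = N"
  by (rule measure_eqI_basis[OF padic_balls_basis[of m] padic_balls_Int]) (use assms in \<open>auto simp: padic_balls_def\<close>)

subsection \<open>Existence\<close>

text \<open>\<open>digit_rev n m\<close> reverses the first \<open>n\<close> base-\<open>p\<close> digits of \<open>m\<close>. Expanding a real number in
  base \<open>p\<close> and reading its digits as a p-adic expansion carries Lebesgue measure on \<open>[0, 1)\<close> to Haar
  measure on the p-adic integers.\<close>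

fun digit_rev :: "nat \<Rightarrow> nat \<Rightarrow> nat \<Rightarrow> nat" where
  "digit_rev p 0 m = 0"
| "digit_rev p (Suc n) m = (m mod p) * p ^ n + digit_rev p n (m div p)"

lemma digit_rev_less: "p > 0 \<Longrightarrow> digit_rev p n m < p ^ n"
proof (induction n arbitrary: m)
  case (Suc n)
  have "digit_rev p (Suc n) m < (m mod p) * p ^ n + p ^ n" using Suc by simp
  also have "\<dots> = (m mod p + 1) * p ^ n" by simp
  also have "\<dots> \<le> p * p ^ n" using Suc.prems by (intro mult_right_mono) (simp_all add: Suc_leI)
  finally show ?case by simp
qed simp

lemma digit_rev_inj:
  assumes "p > 0" "m < p ^ n" "m' < p ^ n" "digit_rev p n m = digit_rev p n m'"
  shows "m = m'"
  using assms(2-)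
proof (induction n arbitrary: m m')
  case (Suc n)
  have lt: "digit_rev p n (k div p) < p ^ n" for k using digit_rev_less assms(1) by blast
  have "digit_rev p (Suc n) k div p ^ n = k mod p" "digit_rev p (Suc n) k mod p ^ n = digit_rev p n (k div p)" for k
    using lt[of k] assms(1) by simp_all
  then have "m mod p = m' mod p" "digit_rev p n (m div p) = digit_rev p n (m' div p)"
    using Suc.prems(3) by metis+
  moreover have "m div p < p ^ n" "m' div p < p ^ n"
    using Suc.prems(1,2) by (simp_all add: less_mult_imp_div_less mult.commute)
  ultimately show ?case using Suc.IH by (metis div_mult_mod_eq)
qed simp

text \<open>Partial sums of the p-adic expansion whose coefficient of p^i is the base-p digit of
  \<open>t\<close> at place p^(-i-1).\<close>

definition digit_sum :: "nat \<Rightarrow> real \<Rightarrow> 'p::prime_card padic" where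
  "digit_sum n t = of_nat (digit_rev CARD('p) n (nat \<lfloor>real CARD('p) ^ n * t\<rfloor>))"

lemma digit_sum_Suc:
  assumes "t \<ge> 0"
  shows "padic_norm (digit_sum (Suc n) t - digit_sum n t :: 'p::prime_card padic) \<le> 1 / real CARD('p) ^ n"
proof -
  let ?p = "CARD('p)"
  define m where "m = nat \<lfloor>real ?p ^ Suc n * t\<rfloor>"
  have p0: "?p > 0" using card_prime_gt_1[where 'p='p] by simp
  have "\<lfloor>real ?p ^ n * t\<rfloor> = \<lfloor>real ?p ^ Suc n * t / real ?p\<rfloor>" using p0 by simp
  also have "\<dots> = \<lfloor>real ?p ^ Suc n * t\<rfloor> div int ?p"     using floor_divide_real_eq_div[of "int ?p" "real ?p ^ Suc n * t"]
    by (simp only: of_int_of_nat_eq of_nat_0_le_iff simp_thms)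
  finally have "nat \<lfloor>real ?p ^ n * t\<rfloor> = m div ?p" using assms by (simp add: m_def nat_div_distrib)
  then have "digit_sum (Suc n) t - digit_sum n t = (of_nat (m mod ?p) * of_nat ?p ^ n :: 'p padic)"
    by (simp add: digit_sum_def m_def)
  moreover have "padic_norm (of_nat (m mod ?p) * of_nat ?p ^ n :: 'p padic) \<le> 1 / real ?p ^ n"
    by (rule padic_norm_mult_le') (simp_all add: padic_norm_of_nat_le_1 padic_norm_power power_one_over)
  ultimately show ?thesis by simp
qed

lemma digit_sum_diff:
  assumes "t \<ge> 0" "n \<le> k"
  shows "padic_norm (digit_sum k t - digit_sum n t :: 'p::prime_card padic) \<le> 1 / real CARD('p) ^ n"
  using assms(2)
proof (induction k rule: dec_induct)
  case (step k)
  have "padic_norm (digit_sum (Suc k) t - digit_sum k t :: 'p padic) \<le> 1 / real CARD('p) ^ n"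
    using digit_sum_Suc[OF assms(1), of k, where 'p='p] card_inverse_power_mono[OF step.hyps(1), where 'p='p] by linarith
  then show ?case using step.IH by (rule padic_norm_trans)
qed simp

lemma digit_sum_Cauchy:
  assumes "t \<ge> 0"
  shows "Cauchy (\<lambda>n. digit_sum n t :: 'p::prime_card padic)"
  unfolding Cauchy_def
proof (intro allI impI)
  fix e :: real assume "e > 0"
  then obtain N where N: "1 / real CARD('p) ^ N < e" using padic_radius_small[where 'p='p] by blast
  have "dist (digit_sum m t) (digit_sum n t :: 'p padic) < e" if "m \<ge> N" "n \<ge> N" for m n
  proof -
    have "padic_norm (digit_sum N t - digit_sum n t :: 'p padic) \<le> 1 / real CARD('p) ^ N"
      using digit_sum_diff[OF assms that(2), where 'p='p] by (simp add: padic_norm_diff_commute)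
    with digit_sum_diff[OF assms that(1)]
    have "padic_norm (digit_sum m t - digit_sum n t :: 'p padic) \<le> 1 / real CARD('p) ^ N" by (rule padic_norm_trans)
    then show ?thesis using N by (simp add: dist_padic_def)
  qed
  then show "\<exists>M. \<forall>m\<ge>M. \<forall>n\<ge>M. dist (digit_sum m t) (digit_sum n t :: 'p padic) < e" by blast
qed

definition digit_map :: "real \<Rightarrow> 'p::prime_card padic" where
  "digit_map t = lim (\<lambda>n. digit_sum n t)"

lemma digit_map_lim: "t \<ge> 0 \<Longrightarrow> (\<lambda>n. digit_sum n t) \<longlonglongrightarrow> (digit_map t :: 'p::prime_card padic)"
  unfolding digit_map_def using digit_sum_Cauchy[of t] by (simp add: Cauchy_convergent_iff convergent_LIMSEQ_iff)

lemma digit_map_close: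
  assumes "t \<ge> 0"
  shows "padic_norm (digit_map t - digit_sum n t :: 'p::prime_card padic) \<le> 1 / real CARD('p) ^ n"
proof -
  have "(digit_map t :: 'p padic) \<in> cball (digit_sum n t) (1 / real CARD('p) ^ n)"
  proof (rule closed_sequentially[OF closed_cball])
    show "(\<lambda>k. digit_sum (k + n) t) \<longlonglongrightarrow> (digit_map t :: 'p padic)"
      using digit_map_lim[OF assms] by (rule LIMSEQ_ignore_initial_segment)
    show "digit_sum (k + n) t \<in> cball (digit_sum n t :: 'p padic) (1 / real CARD('p) ^ n)" for k
      unfolding mem_padic_cball by (rule digit_sum_diff[OF assms]) simp
  qed
  then show ?thesis by (simp only: mem_padic_cball)
qed

definition unit_lebesgue :: "real measure" where
  "unit_lebesgue = restrict_space lborel {0..<1}"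

lemma space_unit_lebesgue [simp]: "space unit_lebesgue = {0..<1}"
  by (simp add: unit_lebesgue_def space_restrict_space)

lemma emeasure_unit_lebesgue: "S \<in> sets borel \<Longrightarrow> S \<subseteq> {0..<1} \<Longrightarrow> emeasure unit_lebesgue S = emeasure lborel S"
  unfolding unit_lebesgue_def by (rule emeasure_restrict_space) auto

lemma digit_map_measurable [measurable]: "(digit_map :: real \<Rightarrow> 'p::prime_card padic) \<in> measurable unit_lebesgue borel"
proof (rule borel_measurable_LIMSEQ_metric)
  fix n
  have "(\<lambda>t. nat \<lfloor>real CARD('p) ^ n * t\<rfloor>) \<in> measurable unit_lebesgue (count_space UNIV)"
    unfolding unit_lebesgue_def by (rule measurable_restrict_space1) measurable
  then show "(\<lambda>t. digit_sum n t :: 'p padic) \<in> borel_measurable unit_lebesgue"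
    unfolding digit_sum_def by (rule measurable_compose) simp
next
  fix t assume "t \<in> space unit_lebesgue"
  then show "(\<lambda>n. digit_sum n t) \<longlonglongrightarrow> (digit_map t :: 'p padic)" by (intro digit_map_lim) simp
qed

definition padic_int_haar :: "'p::prime_card padic measure" where
  "padic_int_haar = distr unit_lebesgue borel digit_map"

lemma sets_padic_int_haar [simp, measurable_cong]: "sets padic_int_haar = sets borel"
  by (simp add: padic_int_haar_def)

text \<open>A ball of radius p^(-n) fixes the first n p-adic digits, so its preimage is the interval
  of real numbers with n prescribed leading digits, of length p^(-n).\<close>

lemma padic_int_haar_cball:
  assumes "padic_norm (a :: 'p::prime_card padic) \<le> 1"
  shows "emeasure padic_int_haar (cball a (1 / real CARD('p) ^ n)) = ennreal (1 / real CARD('p) ^ n)"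
proof -
  let ?p = "CARD('p)" and ?r = "1 / real CARD('p) ^ n"
  have p0: "?p > 0" using card_prime_gt_1[where 'p='p] by simp
  have pn: "real ?p ^ n > 0" by simp
  \<comment> \<open>Reversal permutes the blocks of n digits, so exactly one block \<open>m\<close>
    is sent to the residue of \<open>a\<close>.\<close>
  define R where "R m = digit_rev ?p n m" for m
  have "inj_on R {..<?p ^ n}" unfolding R_def by (intro inj_onI) (auto intro: digit_rev_inj[OF p0])
  moreover have "R ` {..<?p ^ n} \<subseteq> {..<?p ^ n}" using digit_rev_less[OF p0] by (auto simp: R_def)
  ultimately have surj: "R ` {..<?p ^ n} = {..<?p ^ n}" by (intro endo_inj_surj) auto
  obtain b where b: "b < ?p ^ n" "padic_norm (a - of_nat b) \<le> ?r" using padic_residue[OF assms] by blast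
  then obtain m where m: "m < ?p ^ n" "R m = b" using surj by (metis imageE lessThan_iff)
  have iff: "padic_norm (digit_map t - a) \<le> ?r \<longleftrightarrow> nat \<lfloor>real ?p ^ n * t\<rfloor> = m" if t: "0 \<le> t" "t < 1" for t
  proof -
    let ?k = "nat \<lfloor>real ?p ^ n * t\<rfloor>"
    have "\<lfloor>real ?p ^ n * t\<rfloor> < int (?p ^ n)" using t pn by (simp add: floor_less_iff)
    then have k: "?k < ?p ^ n" using t pn by (simp add: nat_less_iff)
    have c: "padic_norm (digit_map t - of_nat (R ?k) :: 'p padic) \<le> ?r"
      using digit_map_close[OF t(1), of n, where 'p='p] by (simp add: digit_sum_def R_def)
    show ?thesis
    proof
      assume "padic_norm (digit_map t - a) \<le> ?r"
      then have "padic_norm (digit_map t - of_nat b :: 'p padic) \<le> ?r" using b(2) by (rule padic_norm_trans)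
      then have "padic_norm (of_nat (R ?k) - of_nat b :: 'p padic) \<le> ?r"
        using c padic_norm_trans[of "of_nat (R ?k)" "digit_map t :: 'p padic" ?r "of_nat b"] by (simp add: padic_norm_diff_commute)
      moreover have "R ?k < ?p ^ n" by (simp add: R_def digit_rev_less[OF p0])
      ultimately have "R ?k = R m" using padic_residue_unique[where 'p='p] b(1) m(2) by blast
      then show "?k = m" using k m(1) digit_rev_inj[OF p0] unfolding R_def by blast
    next
      assume "?k = m"
      then have "padic_norm (digit_map t - of_nat b :: 'p padic) \<le> ?r" using c m(2) by simp
      moreover have "padic_norm (of_nat b - a) \<le> ?r" using b(2) by (simp add: padic_norm_diff_commute)
      ultimately show "padic_norm (digit_map t - a) \<le> ?r" by (rule padic_norm_trans)
    qed
  qed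
  have "digit_map -` cball a ?r \<inter> {0..<1} = {real m / real ?p ^ n..<(real m + 1) / real ?p ^ n}"
  proof (rule Set.set_eqI, rule iffI)
    fix t assume "t \<in> digit_map -` cball a ?r \<inter> {0..<1}"
    then have t: "0 \<le> t" "t < 1" "nat \<lfloor>real ?p ^ n * t\<rfloor> = m" using iff by (auto simp: mem_padic_cball simp del: mem_cball)
    then have "\<lfloor>real ?p ^ n * t\<rfloor> = int m" using pn by auto
    then show "t \<in> {real m / real ?p ^ n..<(real m + 1) / real ?p ^ n}"
      using pn by (auto simp: floor_eq_iff field_simps)
  next
    fix t assume "t \<in> {real m / real ?p ^ n..<(real m + 1) / real ?p ^ n}"
    then have t: "real m \<le> real ?p ^ n * t" "real ?p ^ n * t < real m + 1" using pn by (auto simp: field_simps)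
    then have fl: "\<lfloor>real ?p ^ n * t\<rfloor> = int m" by (simp add: floor_eq_iff)
    have "real m + 1 \<le> real ?p ^ n" using m(1) by (metis Suc_leI of_nat_Suc of_nat_le_iff of_nat_power add.commute)
    then have "real ?p ^ n * t < real ?p ^ n * 1" using t(2) by linarith
    then have "t < 1" using pn mult_less_cancel_left_pos by blast
    moreover have "t \<ge> 0"
    proof (rule ccontr)
      assume "\<not> t \<ge> 0"
      then have "real ?p ^ n * t < 0" using pn by (simp add: mult_pos_neg)
      then show False using t(1) by linarith
    qed
    ultimately show "t \<in> digit_map -` cball a ?r \<inter> {0..<1}"
      using iff[of t] fl by (auto simp: mem_padic_cball simp del: mem_cball)
  qed
  moreover have "{real m / real ?p ^ n..<(real m + 1) / real ?p ^ n} \<subseteq> {0..<1}"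
    using calculation by blast
  moreover have "emeasure padic_int_haar (cball a ?r) = emeasure unit_lebesgue (digit_map -` cball a ?r \<inter> {0..<1})"
    unfolding padic_int_haar_def by (subst emeasure_distr) auto
  ultimately have "emeasure padic_int_haar (cball a ?r) = emeasure lborel {real m / real ?p ^ n..<(real m + 1) / real ?p ^ n}"
    by (simp add: emeasure_unit_lebesgue)
  also have "\<dots> = ennreal ((real m + 1) / real ?p ^ n - real m / real ?p ^ n)"
    using pn by (intro emeasure_lborel_Ico) (simp add: field_simps)
  also have "(real m + 1) / real ?p ^ n - real m / real ?p ^ n = ?r" by (simp flip: diff_divide_distrib)
  finally show ?thesis .
qed

lemma padic_int_haar_outside:
  assumes "padic_norm (a :: 'p::prime_card padic) > 1" "r \<le> 1"
  shows "emeasure padic_int_haar (cball a r) = 0"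
proof -
  have "digit_map -` cball a r \<inter> {0..<1} = {}"
  proof (intro equals0I)
    fix t assume "t \<in> digit_map -` cball a r \<inter> {0..<1}"
    then have t: "t \<ge> 0" "padic_norm (digit_map t - a) \<le> 1"
      using assms(2) by (auto simp: mem_padic_cball simp del: mem_cball)
    have "padic_norm (digit_map t :: 'p padic) \<le> 1"
      using digit_map_close[OF t(1), of 0, where 'p='p] by (simp add: digit_sum_def)
    then have "padic_norm (digit_map t - (digit_map t - a)) \<le> 1" using t(2) by (rule padic_norm_diff_le)
    then show False using assms(1) by simp
  qed
  then show ?thesis unfolding padic_int_haar_def by (subst emeasure_distr) auto
qed

text \<open>Two points of one coset of the p-adic integers define the same predicate, so the choice
  depends on the coset only.\<close>

definition coset_rep :: "'p::prime_card padic \<Rightarrow> 'p padic" where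
  "coset_rep x = (SOME y. padic_norm (y - x) \<le> 1)"

lemma coset_rep: "padic_norm (coset_rep x - x) \<le> 1"
  unfolding coset_rep_def by (rule someI[of _ x]) simp

lemma coset_rep_cong:
  assumes "padic_norm (x - y) \<le> 1"
  shows "coset_rep x = coset_rep y"
proof -
  have "padic_norm (w - x) \<le> 1 \<longleftrightarrow> padic_norm (w - y) \<le> 1" for w
    using padic_norm_trans[of w x 1 y] padic_norm_trans[of w y 1 x] assms padic_norm_diff_commute[of x y] by auto
  then show ?thesis by (simp add: coset_rep_def)
qed

lemma countable_coset_reps: "countable (range (coset_rep :: 'p::prime_card padic \<Rightarrow> 'p padic))"
proof -
  obtain Q :: "'p padic set" where Q: "countable Q" "\<And>x e. e > 0 \<Longrightarrow> \<exists>q\<in>Q. padic_norm (x - q) < e"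
    using countable_padic_centers by metis
  have "range (coset_rep :: 'p padic \<Rightarrow> 'p padic) \<subseteq> coset_rep ` Q"
  proof
    fix y assume "y \<in> range (coset_rep :: 'p padic \<Rightarrow> 'p padic)"
    then obtain x :: "'p padic" where x: "y = coset_rep x" by blast
    obtain q where "q \<in> Q" "padic_norm (x - q) < 1" using Q(2)[of 1 x] by auto
    then show "y \<in> coset_rep ` Q" using coset_rep_cong[of x q] x by auto
  qed
  then show ?thesis using Q(1) countable_subset by blast
qed

lemma translation_measurable [measurable]: "(\<lambda>x. a + x) \<in> borel_measurable (borel :: 'p::prime_card padic measure)"
  by (intro borel_measurable_continuous_onI continuous_intros)

text \<open>One translated copy of the measure on the p-adic integers for each of the countably many
  cosets.\<close>

definition haar_model :: "'p::prime_card padic measure" where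
  "haar_model = distr (count_space (range coset_rep) \<Otimes>\<^sub>M padic_int_haar) borel (\<lambda>(c, x). c + x)"

lemma sets_haar_model: "sets haar_model = sets borel"
  by (simp add: haar_model_def)

text \<open>The radius is at most 1, so the ball lies in the coset of \<open>a\<close> and only this
  coset contributes.\<close>

lemma haar_model_cball:
  fixes a :: "'p::prime_card padic"
  shows "emeasure haar_model (cball a (1 / real CARD('p) ^ n)) = ennreal (1 / real CARD('p) ^ n)"
proof -
  let ?r = "1 / real CARD('p) ^ n" and ?C = "range (coset_rep :: 'p padic \<Rightarrow> 'p padic)"
  have r1: "?r \<le> 1" using card_inverse_power_mono[of 0 n, where 'p='p] by simp
  interpret H: finite_measure "padic_int_haar :: 'p padic measure"
    unfolding padic_int_haar_def
    by (rule finite_measure.finite_measure_distr)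
      (auto intro!: finite_measureI simp: emeasure_unit_lebesgue)
  have [measurable]: "(\<lambda>(c, x). c + x) \<in> borel_measurable (count_space ?C \<Otimes>\<^sub>M (padic_int_haar :: 'p padic measure))"
    by (rule measurable_pair_measure_countable1[OF countable_coset_reps])
       (simp add: measurable_cong_sets[OF sets_padic_int_haar refl] translation_measurable)
  let ?S = "(\<lambda>(c, x). c + x) -` cball a ?r \<inter> space (count_space ?C \<Otimes>\<^sub>M (padic_int_haar :: 'p padic measure))"
  have "emeasure haar_model (cball a ?r) = emeasure (count_space ?C \<Otimes>\<^sub>M padic_int_haar) ?S"
    unfolding haar_model_def by (rule emeasure_distr) auto
  also have "\<dots> = (\<integral>\<^sup>+ c. emeasure padic_int_haar (Pair c -` ?S) \<partial>count_space ?C)"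
    by (rule H.emeasure_pair_measure_alt) measurable
  also have "\<dots> = (\<integral>\<^sup>+ c. ennreal ?r * indicator {coset_rep a} c \<partial>count_space ?C)"
  proof (rule nn_integral_cong)
    fix c assume "c \<in> space (count_space ?C)"
    then obtain b where b: "c = coset_rep b" by auto
    have S: "Pair c -` ?S = cball (a - c) ?r"
      using b by (auto simp: space_pair_measure mem_padic_cball algebra_simps padic_int_haar_def simp del: mem_cball)
    show "emeasure padic_int_haar (Pair c -` ?S) = ennreal ?r * indicator {coset_rep a} c"
    proof (cases "c = coset_rep a")
      case True
      have "padic_norm (a - c) \<le> 1" using coset_rep[of a] True by (simp add: padic_norm_diff_commute)
      then show ?thesis unfolding S using padic_int_haar_cball True by simp
    next
      case False
      have "padic_norm (a - c) > 1"
      proof (rule ccontr)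
        assume "\<not> padic_norm (a - c) > 1"
        then have "padic_norm (a - coset_rep b) \<le> 1" by (simp add: b)
        then have "padic_norm (a - b) \<le> 1" using coset_rep[of b] by (rule padic_norm_trans)
        then show False using coset_rep_cong[of a b] False b by simp
      qed
      then show ?thesis unfolding S using padic_int_haar_outside[OF _ r1] False by simp
    qed
  qed
  also have "\<dots> = ennreal ?r * emeasure (count_space ?C) {coset_rep a}"
    by (subst nn_integral_cmult_indicator) auto
  also have "emeasure (count_space ?C) {coset_rep a} = 1"
    by (subst emeasure_count_space_finite) auto
  finally show ?thesis by simp
qed

subsection \<open>Uniqueness\<close>

lemma translate_cball:
  "(\<lambda>x. a + x) -` cball b r = cball (b - a :: 'p::prime_card padic) r"
  by (auto simp: mem_padic_cball algebra_simps simp del: mem_cball)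

lemma haar_model_translation: "distr haar_model borel (\<lambda>x. a + x) = (haar_model :: 'p::prime_card padic measure)"
proof (rule padic_measure_eqI[where m=0])
  have m: "(\<lambda>x. a + x) \<in> measurable haar_model borel"
    using translation_measurable measurable_cong_sets[OF sets_haar_model refl] by blast
  have sp: "space haar_model = (UNIV :: 'p padic set)" using sets_eq_imp_space_eq[OF sets_haar_model] by simp
  fix b :: "'p padic" and n
  show "emeasure (distr haar_model borel (\<lambda>x. a + x)) (cball b (1 / real CARD('p) ^ n)) = emeasure haar_model (cball b (1 / real CARD('p) ^ n))"
    by (subst emeasure_distr[OF m]) (simp_all add: translate_cball sp haar_model_cball)
  show "emeasure (distr haar_model borel (\<lambda>x. a + x)) (cball b (1 / real CARD('p) ^ n)) \<noteq> \<infinity>"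
    by (subst emeasure_distr[OF m]) (simp_all add: translate_cball sp haar_model_cball)
qed (simp_all add: sets_haar_model)

lemma padic_ints_decomposition:
  "(padic_ints :: 'p::prime_card padic set) = (\<Union>k\<in>{..<CARD('p) ^ n}. cball (of_nat k) (1 / real CARD('p) ^ n))"
  "disjoint_family_on (\<lambda>k. cball (of_nat k :: 'p padic) (1 / real CARD('p) ^ n)) {..<CARD('p) ^ n}"
proof -
  let ?r = "1 / real CARD('p) ^ n"
  have r1: "?r \<le> 1" using card_inverse_power_mono[of 0 n, where 'p='p] by simp
  show "(padic_ints :: 'p padic set) = (\<Union>k\<in>{..<CARD('p) ^ n}. cball (of_nat k) ?r)"
  proof (rule Set.set_eqI, rule iffI)
    fix x :: "'p padic" assume "x \<in> padic_ints"
    then obtain k where "k < CARD('p) ^ n" "padic_norm (x - of_nat k) \<le> ?r"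
      using padic_residue[of x n] by (auto simp: padic_ints_def)
    then show "x \<in> (\<Union>k\<in>{..<CARD('p) ^ n}. cball (of_nat k) ?r)"
      by (auto simp: mem_padic_cball simp del: mem_cball)
  next
    fix x :: "'p padic" assume "x \<in> (\<Union>k\<in>{..<CARD('p) ^ n}. cball (of_nat k) ?r)"
    then obtain k where "padic_norm (x - of_nat k) \<le> ?r" by (auto simp: mem_padic_cball simp del: mem_cball)
    then have "padic_norm (x - of_nat k) \<le> 1" using r1 by (rule order_trans)
    then have "padic_norm ((x - of_nat k) + of_nat k) \<le> 1" using padic_norm_of_nat_le_1 by (rule padic_norm_add_le)
    then show "x \<in> padic_ints" by (simp add: padic_ints_def)
  qed
  show "disjoint_family_on (\<lambda>k. cball (of_nat k :: 'p padic) ?r) {..<CARD('p) ^ n}"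
    unfolding disjoint_family_on_def
  proof (intro ballI impI, rule ccontr)
    fix j k assume jk: "j \<in> {..<CARD('p) ^ n}" "k \<in> {..<CARD('p) ^ n}" "j \<noteq> k"
      and "cball (of_nat j :: 'p padic) ?r \<inter> cball (of_nat k) ?r \<noteq> {}"
    then obtain x :: "'p padic" where "padic_norm (x - of_nat j) \<le> ?r" "padic_norm (x - of_nat k) \<le> ?r"
      by (auto simp: mem_padic_cball simp del: mem_cball)
    then have "padic_norm (of_nat j - of_nat k :: 'p padic) \<le> ?r"
      using padic_norm_trans[of "of_nat j" x ?r "of_nat k"] by (simp add: padic_norm_diff_commute)
    then show False using padic_residue_unique[of j n k, where 'p='p] jk by auto
  qed
qed

text \<open>The p-adic integers are a disjoint union of p^n translates of one ball of radius p^(-n);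
  invariance and total mass 1 fix its mass.\<close>

lemma haar_unique_cball:
  fixes M :: "'p::prime_card padic measure"
  assumes s: "sets M = sets borel" and t: "\<And>a. distr M borel (\<lambda>x. a + x) = M" and one: "emeasure M padic_ints = 1"
  shows "emeasure M (cball a (1 / real CARD('p) ^ n)) = ennreal (1 / real CARD('p) ^ n)"
proof -
  let ?r = "1 / real CARD('p) ^ n" and ?N = "CARD('p) ^ n"
  have sp: "space M = UNIV" using sets_eq_imp_space_eq[OF s] by simp
  have m: "(\<lambda>x. a + x) \<in> measurable M borel" for a
    using translation_measurable measurable_cong_sets[OF s refl] by blast
  have shift: "emeasure M (cball b ?r) = emeasure M (cball 0 ?r)" for b
  proof -
    have "emeasure M (cball b ?r) = emeasure (distr M borel (\<lambda>x. b + x)) (cball b ?r)" by (simp add: t)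
    also have "\<dots> = emeasure M (cball 0 ?r)" by (subst emeasure_distr[OF m]) (simp_all add: translate_cball sp)
    finally show ?thesis .
  qed
  have "1 = emeasure M (\<Union>k\<in>{..<?N}. cball (of_nat k) ?r)"
    using one padic_ints_decomposition(1)[of n, where 'p='p] by simp
  also have "\<dots> = (\<Sum>k<?N. emeasure M (cball (of_nat k) ?r))"
    by (rule sum_emeasure[symmetric]) (auto simp: s padic_ints_decomposition(2))
  also have "\<dots> = of_nat ?N * emeasure M (cball 0 ?r)" by (simp add: shift[of "of_nat _"])
  finally have eq: "of_nat ?N * emeasure M (cball 0 ?r) = 1" by simp
  have N0: "real ?N > 0" using card_power_gt_0[where 'p='p, of n] by simp
  have "emeasure M (cball 0 ?r) = ennreal ?r * (ennreal (real ?N) * emeasure M (cball 0 ?r))"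
    using N0 by (simp add: mult.assoc[symmetric] ennreal_mult[symmetric])
  also have "ennreal (real ?N) * emeasure M (cball 0 ?r) = 1" using eq by (simp add: ennreal_of_nat_eq_real_of_nat)
  finally show ?thesis using shift[of a] by simp
qed

theorem padic_haar_eq: "padic_haar = (haar_model :: 'p::prime_card padic measure)"
  unfolding padic_haar_def
proof (rule the_equality)
  have "emeasure (haar_model :: 'p padic measure) padic_ints = 1"
    using haar_model_cball[of "0 :: 'p padic" 0] by (simp add: padic_ints_eq_cball)
  then show "sets haar_model = sets borel \<and> (\<forall>a. distr haar_model borel (\<lambda>x. a + x) = haar_model) \<and>
      emeasure haar_model (padic_ints :: 'p padic set) = 1"
    using sets_haar_model haar_model_translation by blast
next
  fix M :: "'p padic measure"
  assume M: "sets M = sets borel \<and> (\<forall>a. distr M borel (\<lambda>x. a + x) = M) \<and> emeasure M padic_ints = 1"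
  then have c: "emeasure M (cball a (1 / real CARD('p) ^ n)) = ennreal (1 / real CARD('p) ^ n)" for a n
    by (intro haar_unique_cball) auto
  show "M = haar_model"
    by (rule padic_measure_eqI[where m=0]) (use M in \<open>auto simp: c haar_model_cball sets_haar_model\<close>)
qed

lemma sets_padic_haar [simp, measurable_cong]: "sets padic_haar = sets borel"
  by (simp add: padic_haar_eq sets_haar_model)

lemma space_padic_haar [simp]: "space padic_haar = UNIV"
  using sets_eq_imp_space_eq[OF sets_padic_haar] by simp

lemma padic_haar_cball:
  "emeasure padic_haar (cball (a :: 'p::prime_card padic) (1 / real CARD('p) ^ n)) = ennreal (1 / real CARD('p) ^ n)"
  by (simp add: padic_haar_eq haar_model_cball)

lemma sigma_finite_padic_haar: "sigma_finite_measure (padic_haar :: 'p::prime_card padic measure)"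
proof
  obtain Q :: "'p padic set" where Q: "countable Q" "\<And>x e. e > 0 \<Longrightarrow> \<exists>q\<in>Q. padic_norm (x - q) < e"
    using countable_padic_centers by metis
  show "\<exists>A. countable A \<and> A \<subseteq> sets padic_haar \<and> \<Union>A = space (padic_haar :: 'p padic measure) \<and> (\<forall>a\<in>A. emeasure padic_haar a \<noteq> \<infinity>)"
  proof (intro exI[of _ "(\<lambda>q. cball q 1) ` Q"] conjI)
    show "\<Union> ((\<lambda>q. cball q 1) ` Q) = space (padic_haar :: 'p padic measure)"
    proof -
      have "x \<in> \<Union> ((\<lambda>q. cball q 1) ` Q)" for x :: "'p padic"
        using Q(2)[of 1 x] by (auto simp: mem_padic_cball simp del: mem_cball intro: less_imp_le)
      then show ?thesis by auto
    qed
    show "\<forall>a\<in>(\<lambda>q. cball q 1) ` Q. emeasure padic_haar a \<noteq> \<infinity>"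
      using padic_haar_cball[of _ 0, where 'p='p] by auto
  qed (use Q(1) in auto)
qed

section \<open>Haar measure and scaling\<close>

lemma disjoint_equal_cballs:
  "disjoint ((\<lambda>x. cball (x :: 'p::prime_card padic) r) ` E)"
proof (rule disjointI)
  fix U V assume "U \<in> (\<lambda>x. cball x r) ` E" "V \<in> (\<lambda>x. cball x r) ` E" "U \<noteq> V"
  then obtain x y where xy: "U = cball x r" "V = cball y r" by blast
  show "U \<inter> V = {}"
  proof (rule ccontr)
    assume "U \<inter> V \<noteq> {}"
    then obtain z where "z \<in> cball x r" "z \<in> cball y r" using xy by blast
    then show False using padic_cball_eq[of z x r] padic_cball_eq[of z y r] xy \<open>U \<noteq> V\<close> by blast
  qed
qed

text \<open>Two compact projections of the same set between which distances are multiplied by a constant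
  have proportional Haar measure: cover one by balls of equal radius and compare.\<close>

lemma padic_haar_scaling_le:
  fixes f g :: "'a::topological_space \<Rightarrow> 'p::prime_card padic"
  assumes E: "compact E" and cont: "continuous_on E f" "continuous_on E g"
    and ab: "\<alpha> \<noteq> (0 :: 'p padic)" "\<beta> \<noteq> (0 :: 'p padic)"
    and scale: "\<And>u v. u \<in> E \<Longrightarrow> v \<in> E \<Longrightarrow>
      padic_norm (f u - f v) * padic_norm \<alpha> = padic_norm (g u - g v) * padic_norm \<beta>"
  shows "emeasure padic_haar (g ` E) * ennreal (padic_norm \<beta>) \<le> emeasure padic_haar (f ` E) * ennreal (padic_norm \<alpha>)"
proof -
  let ?P = "real CARD('p)" and ?r = "\<lambda>n. 1 / real CARD('p) ^ n"
  have P: "?P > 1" using card_prime_gt_1[where 'p='p] by simp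
  define c where "c = \<alpha> / \<beta>"
  have a0: "padic_norm \<alpha> > 0" "padic_norm \<beta> > 0" using ab padic_norm_pos by auto
  obtain k where k: "padic_norm c = ?P powi k" using padic_norm_value[of c] ab by (auto simp: c_def)
  have cab: "padic_norm c = padic_norm \<alpha> / padic_norm \<beta>" by (simp add: c_def padic_norm_divide)
  define X where "X = f ` E"
  have X: "compact X" unfolding X_def by (rule compact_continuous_image[OF cont(1) E])
  \<comment> \<open>Ball neighbourhoods of the compact set \<open>X\<close>. They have computable
    finite measure and decrease to \<open>X\<close>, so their measures converge to that of
    \<open>X\<close>.\<close>
  define Y where "Y n = (\<Union>x\<in>X. cball x (?r n))" for n
  have key: "emeasure padic_haar (g ` E) * ennreal (padic_norm \<beta>) \<le> emeasure padic_haar (Y n) * ennreal (padic_norm \<alpha>) \<and>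
      emeasure padic_haar (Y n) \<noteq> \<infinity>" if n: "n \<ge> nat k" for n
  proof -
    \<comment> \<open>The scaling turns balls of radius p^(-n) into balls of radius p^(-m);
      \<open>n \<ge> nat k\<close> keeps this exponent natural.\<close>
    define m where "m = nat (int n - k)"
    have nk: "int m = int n - k" using n by (simp add: m_def)
    have rm: "?r n * padic_norm c = ?r m"
    proof -
      have "?r n * padic_norm c = ?P powi (- int n) * ?P powi k"
        by (simp add: k power_int_minus field_simps)
      also have "\<dots> = ?P powi (- int n + k)" by (rule power_int_add[symmetric]) (use P in simp)
      also have "- int n + k = - int m" using nk by simp
      also have "?P powi (- int m) = ?r m" by (simp add: power_int_minus field_simps)
      finally show ?thesis .
    qed
    define \<B> where "\<B> = (\<lambda>x. cball x (?r n)) ` X"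
    have "X \<subseteq> \<Union>\<B>"
    proof
      fix x assume "x \<in> X"
      moreover have "x \<in> cball x (?r n)" by simp
      ultimately show "x \<in> \<Union>\<B>" unfolding \<B>_def by blast
    qed
    moreover have "\<And>B. B \<in> \<B> \<Longrightarrow> open B" by (auto simp: \<B>_def open_padic_cball)
    ultimately obtain \<B>' where B': "\<B>' \<subseteq> \<B>" "finite \<B>'" "X \<subseteq> \<Union>\<B>'"
      using compactE[OF X] by metis
    have "\<forall>B\<in>\<B>'. \<exists>u\<in>E. B = cball (f u) (?r n)" using B'(1) by (auto simp: \<B>_def X_def)
    then obtain e where e: "\<And>B. B \<in> \<B>' \<Longrightarrow> e B \<in> E" "\<And>B. B \<in> \<B>' \<Longrightarrow> B = cball (f (e B)) (?r n)" by metis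
    have Y: "Y n = \<Union>\<B>'"
    proof (rule equalityI; rule subsetI)
      fix y assume "y \<in> Y n"
      then obtain x where x: "x \<in> X" "y \<in> cball x (?r n)" by (auto simp: Y_def)
      then obtain B where B: "B \<in> \<B>'" "x \<in> B" using B'(3) by blast
      then show "y \<in> \<Union>\<B>'" using padic_cball_eq[of x "f (e B)" "?r n"] e(2)[OF B(1)] x(2) by blast
    next
      fix y assume "y \<in> \<Union>\<B>'"
      then obtain x where "x \<in> X" "y \<in> cball x (?r n)" using B'(1) unfolding \<B>_def by blast
      then show "y \<in> Y n" unfolding Y_def by blast
    qed
    have disj: "disjoint \<B>'"       using disjoint_equal_cballs B'(1) unfolding \<B>_def by (rule pairwise_subset)
    have "emeasure padic_haar (\<Union>\<B>') = (\<Sum>B\<in>\<B>'. emeasure padic_haar B)"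
    proof -
      have "(\<Sum>B\<in>\<B>'. emeasure padic_haar (id B)) = emeasure padic_haar (\<Union>B\<in>\<B>'. id B)"
      proof (rule sum_emeasure)
        show "id ` \<B>' \<subseteq> sets padic_haar" using B'(1) by (auto simp: \<B>_def)
        show "disjoint_family_on id \<B>'" using disj by (auto simp: disjoint_family_on_def disjoint_def)
      qed (rule B'(2))
      then show ?thesis by simp
    qed
    also have "\<dots> = (\<Sum>B\<in>\<B>'. ennreal (?r n))"
      by (rule sum.cong[OF refl]) (metis e(2) padic_haar_cball)
    finally have Ymeas: "emeasure padic_haar (Y n) = of_nat (card \<B>') * ennreal (?r n)" by (simp add: Y)
    have sub: "g ` E \<subseteq> (\<Union>B\<in>\<B>'. cball (g (e B)) (?r m))"
    proof
      fix y assume "y \<in> g ` E"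
      then obtain u where u: "u \<in> E" "y = g u" by blast
      then have "f u \<in> X" by (simp add: X_def)
      then obtain B where B: "B \<in> \<B>'" "f u \<in> B" using B'(3) by blast
      have "padic_norm (f u - f (e B)) \<le> ?r n" using B(2) e(2)[OF B(1)] by (metis mem_padic_cball)
      then have "padic_norm (f u - f (e B)) * padic_norm \<alpha> \<le> ?r n * padic_norm \<alpha>" using a0 by (intro mult_right_mono) auto
      then have "padic_norm (g u - g (e B)) * padic_norm \<beta> \<le> ?r n * padic_norm \<alpha>" using scale[OF u(1) e(1)[OF B(1)]] by simp
      then have "padic_norm (g u - g (e B)) \<le> ?r n * padic_norm c" using a0 by (simp add: cab field_simps)
      then have "y \<in> cball (g (e B)) (?r m)" unfolding mem_padic_cball u(2) rm .
      then show "y \<in> (\<Union>B\<in>\<B>'. cball (g (e B)) (?r m))" using B(1) by blast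
    qed
    have "emeasure padic_haar (g ` E) \<le> emeasure padic_haar (\<Union>B\<in>\<B>'. cball (g (e B)) (?r m))"
      by (rule emeasure_mono[OF sub]) (use B'(2) in \<open>auto intro!: sets.finite_UN\<close>)
    also have "\<dots> \<le> (\<Sum>B\<in>\<B>'. emeasure padic_haar (cball (g (e B)) (?r m)))"
      by (rule emeasure_subadditive_finite[OF B'(2)]) auto
    also have "\<dots> = of_nat (card \<B>') * ennreal (?r m)" by (simp add: padic_haar_cball)
    finally have "emeasure padic_haar (g ` E) * ennreal (padic_norm \<beta>) \<le> of_nat (card \<B>') * (ennreal (?r m) * ennreal (padic_norm \<beta>))"
      by (metis mult.assoc mult_right_mono zero_le)
    also have "ennreal (?r m) * ennreal (padic_norm \<beta>) = ennreal (?r m * padic_norm \<beta>)"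
      using a0 by (intro ennreal_mult[symmetric]) auto
    also have "?r m * padic_norm \<beta> = ?r n * padic_norm \<alpha>" unfolding rm[symmetric] cab using a0 by simp
    also have "ennreal (?r n * padic_norm \<alpha>) = ennreal (?r n) * ennreal (padic_norm \<alpha>)"
      using a0 by (intro ennreal_mult) auto
    finally show ?thesis unfolding Ymeas by (simp add: mult.assoc ennreal_mult_eq_top_iff)
  qed
  define Y' where "Y' n = Y (n + nat k)" for n
  have "(\<Inter>n. Y' n) = X"
  proof (rule equalityI; rule subsetI)
    fix y assume y: "y \<in> (\<Inter>n. Y' n)"
    have "y \<in> closure X"
      unfolding closure_approachable
    proof (intro allI impI)
      fix e :: real assume "e > 0"
      then obtain n where n: "?r n < e" using padic_radius_small[where 'p='p] by blast
      obtain x where "x \<in> X" "y \<in> cball x (?r (n + nat k))" using y by (auto simp: Y'_def Y_def)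
      moreover have "?r (n + nat k) \<le> ?r n" by (rule card_inverse_power_mono) simp
      ultimately show "\<exists>x\<in>X. dist x y < e" using n by (intro bexI[of _ x]) auto
    qed
    then show "y \<in> X" using compact_imp_closed[OF X] by simp
  next
    fix y assume "y \<in> X"
    moreover have "y \<in> cball y (?r n)" for n by simp
    ultimately show "y \<in> (\<Inter>n. Y' n)" unfolding Y'_def Y_def by blast
  qed
  moreover have "(\<lambda>n. emeasure padic_haar (Y' n)) \<longlonglongrightarrow> emeasure padic_haar (\<Inter>n. Y' n)"
  proof (rule Lim_emeasure_decseq)
    show "range Y' \<subseteq> sets padic_haar"
      by (auto simp: Y'_def Y_def intro!: borel_open open_UN open_padic_cball)
    show "decseq Y'"
    proof (rule decseq_SucI)
      fix n
      have "?r (Suc n + nat k) \<le> ?r (n + nat k)" by (rule card_inverse_power_mono) simp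
      then show "Y' (Suc n) \<le> Y' n" unfolding Y'_def Y_def by (intro UN_mono subset_cball order_refl)
    qed
    show "emeasure padic_haar (Y' i) \<noteq> \<infinity>" for i using key[of "i + nat k"] by (simp add: Y'_def)
  qed
  ultimately have "(\<lambda>n. emeasure padic_haar (Y' n)) \<longlonglongrightarrow> emeasure padic_haar X" by simp
  then have "(\<lambda>n. ennreal (padic_norm \<alpha>) * emeasure padic_haar (Y' n)) \<longlonglongrightarrow> ennreal (padic_norm \<alpha>) * emeasure padic_haar X"
    using a0 by (intro tendsto_mult_ennreal tendsto_const) auto
  then show ?thesis unfolding X_def[symmetric] mult.commute[of _ "ennreal (padic_norm \<alpha>)"]
    by (rule LIMSEQ_le_const) (use key in \<open>auto simp: Y'_def mult.commute\<close>)
qed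

lemma padic_haar_scaling:
  fixes f g :: "'a::topological_space \<Rightarrow> 'p::prime_card padic"
  assumes E: "compact E" and cont: "continuous_on E f" "continuous_on E g"
    and ab: "\<alpha> \<noteq> (0 :: 'p padic)" "\<beta> \<noteq> (0 :: 'p padic)"
    and scale: "\<And>u v. u \<in> E \<Longrightarrow> v \<in> E \<Longrightarrow>
      padic_norm (f u - f v) * padic_norm \<alpha> = padic_norm (g u - g v) * padic_norm \<beta>"
  shows "emeasure padic_haar (g ` E) * ennreal (padic_norm \<beta>) = emeasure padic_haar (f ` E) * ennreal (padic_norm \<alpha>)"
  using padic_haar_scaling_le[OF E cont ab scale] padic_haar_scaling_le[OF E cont(2,1) ab(2,1) scale[symmetric]]
  by (intro antisym)

abbreviation padic_haar2 :: "('p::prime_card padic \<times> 'p padic) measure" where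
  "padic_haar2 \<equiv> padic_haar \<Otimes>\<^sub>M padic_haar"

lemma sets_padic_haar2: "sets padic_haar2 = sets borel"
  using sets_pair_measure_cong[OF sets_padic_haar sets_padic_haar] unfolding borel_prod .

section \<open>The charts\<close>

definition proj_xy :: "'p::prime_card padic3 \<Rightarrow> 'p padic \<times> 'p padic" where
  "proj_xy = (\<lambda>(x, y, z). (x, y))"

definition proj_yz :: "'p::prime_card padic3 \<Rightarrow> 'p padic \<times> 'p padic" where
  "proj_yz = (\<lambda>(x, y, z). (y, z))"

definition proj_zx :: "'p::prime_card padic3 \<Rightarrow> 'p padic \<times> 'p padic" where
  "proj_zx = (\<lambda>(x, y, z). (z, x))"

lemma proj_cyc: "proj_xy (cyc u) = proj_yz u" "proj_yz (cyc u) = proj_zx u" "proj_zx (cyc u) = proj_xy u"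
  by (cases u; simp add: proj_xy_def proj_yz_def proj_zx_def)+

definition charts ::
  "'p::prime_card padic \<Rightarrow> 'p padic \<Rightarrow> 'p padic \<Rightarrow> (('p padic3 \<Rightarrow> 'p padic \<times> 'p padic) \<times> ('p padic3 \<Rightarrow> 'p padic)) set"
  where
  "charts A B C = {(proj_xy, dz C), (proj_yz, dx A), (proj_zx, dy B)}"

text \<open>The change of charts by Fubini over the common coordinate y. On a slice with fixed y,
  \<open>fibre_equation\<close> makes the displacements in x and z proportional with ratio |dz| :
  |dx|, because \<open>E\<close> is so small that both derivatives have constant norm;
  \<open>padic_haar_scaling\<close> then compares the two images of the slice.\<close>

lemma chart_volume_compare_xy_yz:
  fixes A B C D :: "'p::prime_card padic"
  assumes E: "compact E" "E \<subseteq> surface A B C D" "E \<subseteq> int_cube"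
    and u0: "u0 \<in> int_cube" "\<And>u. u \<in> E \<Longrightarrow> sup_norm (u - u0) \<le> r" "r < padic_norm (dz C u0)" "r < padic_norm (dx A u0)"
  shows "emeasure padic_haar2 (proj_yz ` E) * ennreal (padic_norm (dz C u0)) =
    emeasure padic_haar2 (proj_xy ` E) * ennreal (padic_norm (dx A u0))"
proof (cases "E = {}")
  case False
  then obtain e0 where "e0 \<in> E" by blast
  then have "r \<ge> 0" using u0(2)[of e0] sup_norm_nonneg[of "e0 - u0"] by linarith
  then have nz: "dz C u0 \<noteq> 0" "dx A u0 \<noteq> 0" using u0(3,4) by auto
  have near: "padic_norm (dz C u) = padic_norm (dz C u0)" "padic_norm (dx A u) = padic_norm (dx A u0)" if "u \<in> E" for u
  proof -
    have c: "u \<in> int_cube" using that E by blast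
    have "padic_norm (dz C u0 - dz C u) < padic_norm (dz C u0)"
      using dz_lipschitz[OF u0(1) c, of C] u0(2)[OF that] u0(3) by (simp add: sup_norm_diff_commute)
    then show "padic_norm (dz C u) = padic_norm (dz C u0)" by (rule padic_norm_eq_of_close)
    have "padic_norm (dx A u0 - dx A u) < padic_norm (dx A u0)"
      using dx_lipschitz[OF u0(1) c, of A] u0(2)[OF that] u0(4) by (simp add: sup_norm_diff_commute)
    then show "padic_norm (dx A u) = padic_norm (dx A u0)" by (rule padic_norm_eq_of_close)
  qed
  define Ey where "Ey y = E \<inter> {u. fst (snd u) = y}" for y
  have Ey: "compact (Ey y)" for y
    unfolding Ey_def by (intro compact_Int_closed E(1) closed_Collect_eq continuous_intros)
  have slice: "emeasure padic_haar ((\<lambda>u. snd (snd u)) ` Ey y) * ennreal (padic_norm (dz C u0)) =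
      emeasure padic_haar (fst ` Ey y) * ennreal (padic_norm (dx A u0))" for y
  proof (rule padic_haar_scaling[OF Ey _ _ nz(2,1)])
    show "continuous_on (Ey y) (fst :: 'p padic3 \<Rightarrow> _)" "continuous_on (Ey y) (\<lambda>u :: 'p padic3. snd (snd u))"
      by (intro continuous_intros)+
    fix u v assume uv: "u \<in> Ey y" "v \<in> Ey y"
    obtain x z where u: "u = (x, y, z)" using uv(1) by (cases u) (auto simp: Ey_def)
    define a b where "a = snd (snd v) - z" and "b = fst v - x"
    have v: "v = (x + b, y, z + a)" using uv(2) by (cases v) (auto simp: Ey_def a_def b_def)
    have EU: "u \<in> E" "v \<in> E" using uv by (auto simp: Ey_def)
    \<comment> \<open>Rotated so that the fixed coordinate y comes last, as
      \<open>fibre_equation\<close> expects.\<close>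
    have S: "(z, x, y) \<in> surface C A B D" "(z + a, x + b, y) \<in> surface C A B D"
      using EU E(2) by (auto simp: u v surface_def algebra_simps)
    have eq: "b * (dy A (z, x, y) + (b + y * a)) = - (a * (a + dx C (z, x, y)))"
      by (rule fibre_equation[OF S])
    have d: "dy A (z, x, y) = dx A u" "dx C (z, x, y) = dz C u"
      by (simp_all add: u dx_def dy_def dz_def mult.commute)
    have "sup_norm (v - u) \<le> r"
      using sup_norm_trans[of v u0 r u] u0(2)[OF EU(1)] u0(2)[OF EU(2)] by (simp add: sup_norm_diff_commute)
    then have ab: "padic_norm a \<le> r" "padic_norm b \<le> r" using padic_norm_le_sup_norm[of "v - u"] by (auto simp: u v)
    have y1: "padic_norm y \<le> 1" using EU(1) E(3) by (auto simp: u mem_int_cube_iff sup_norm_le_iff)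
    have "padic_norm (b + y * a) \<le> r" using ab y1 by (intro padic_norm_add_le padic_norm_mult_le')
    then have 1: "padic_norm (dx A u + (b + y * a)) = padic_norm (dx A u0)"
      using near(2)[OF EU(1)] u0(4) by (subst padic_norm_add_eq) auto
    have "padic_norm (dz C u + a) = padic_norm (dz C u0)"
      using near(1)[OF EU(1)] u0(3) ab(1) by (subst padic_norm_add_eq) auto
    then have 2: "padic_norm (a + dz C u) = padic_norm (dz C u0)" by (simp add: add.commute)
    have "padic_norm b * padic_norm (dx A u0) = padic_norm a * padic_norm (dz C u0)"
      using arg_cong[OF eq, of padic_norm] unfolding d padic_norm_mult padic_norm_uminus 1 2 .
    moreover have "fst u - fst v = - b" "snd (snd u) - snd (snd v) = - a" by (simp_all add: u v)
    ultimately show "padic_norm (fst u - fst v) * padic_norm (dx A u0) = padic_norm (snd (snd u) - snd (snd v)) * padic_norm (dz C u0)"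
      by (simp add: padic_norm_uminus)
  qed
  interpret h: sigma_finite_measure "padic_haar :: 'p padic measure" by (rule sigma_finite_padic_haar)
  interpret pair_sigma_finite "padic_haar :: 'p padic measure" "padic_haar :: 'p padic measure" ..
  have contp: "continuous_on E proj_xy" "continuous_on E proj_yz"
    unfolding proj_xy_def proj_yz_def case_prod_beta by (intro continuous_intros)+
  have meas: "proj_xy ` E \<in> sets padic_haar2" "proj_yz ` E \<in> sets padic_haar2"
    unfolding sets_padic_haar2 by (intro borel_closed compact_imp_closed compact_continuous_image contp E(1))+
  have sl1: "(\<lambda>x. (x, y)) -` proj_xy ` E = fst ` Ey y" for y
    by (force simp: proj_xy_def Ey_def image_iff)
  have sl2: "Pair y -` proj_yz ` E = (\<lambda>u. snd (snd u)) ` Ey y" for y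
    by (force simp: proj_yz_def Ey_def image_iff)
  have m1: "(\<lambda>y. emeasure padic_haar (fst ` Ey y)) \<in> borel_measurable padic_haar"
    using measurable_emeasure_Pair2[OF meas(1)] by (simp add: sl1)
  have m2: "(\<lambda>y. emeasure padic_haar ((\<lambda>u. snd (snd u)) ` Ey y)) \<in> borel_measurable padic_haar"
    using h.measurable_emeasure_Pair[OF meas(2)] by (simp add: sl2)
  have "emeasure padic_haar2 (proj_yz ` E) * ennreal (padic_norm (dz C u0)) =
      (\<integral>\<^sup>+ y. emeasure padic_haar ((\<lambda>u. snd (snd u)) ` Ey y) * ennreal (padic_norm (dz C u0)) \<partial>padic_haar)"
    by (simp add: h.emeasure_pair_measure_alt[OF meas(2)] sl2 nn_integral_multc m2)
  also have "\<dots> = (\<integral>\<^sup>+ y. emeasure padic_haar (fst ` Ey y) * ennreal (padic_norm (dx A u0)) \<partial>padic_haar)"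
    by (simp add: slice)
  also have "\<dots> = emeasure padic_haar2 (proj_xy ` E) * ennreal (padic_norm (dx A u0))"
    by (simp add: emeasure_pair_measure_alt2[OF meas(1)] sl1 nn_integral_multc m1)
  finally show ?thesis .
qed simp

lemma continuous_on_cyc: "continuous_on S cyc"
  unfolding cyc_def by (intro continuous_intros)

lemma cyc_surface [simp]: "cyc u \<in> surface B C A D \<longleftrightarrow> u \<in> surface A B C D"
  by (cases u) (auto simp: surface_def algebra_simps)

text \<open>The three comparisons of neighbouring charts are cyclic images of one another; together
  with symmetry they cover every pair.\<close>

lemma chart_volume_compare:
  fixes A B C D :: "'p::prime_card padic"
  assumes E: "compact E" "E \<subseteq> surface A B C D" "E \<subseteq> int_cube"
    and u0: "u0 \<in> int_cube" "\<And>u. u \<in> E \<Longrightarrow> sup_norm (u - u0) \<le> r"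
    and ch: "(\<pi>, g) \<in> charts A B C" "(\<pi>', g') \<in> charts A B C" and r: "r < padic_norm (g u0)" "r < padic_norm (g' u0)"
  shows "emeasure padic_haar2 (\<pi> ` E) * ennreal (padic_norm (g' u0)) =
    emeasure padic_haar2 (\<pi>' ` E) * ennreal (padic_norm (g u0))"
proof -
  have cycle: "compact (cyc ` X) \<and> cyc ` X \<subseteq> surface B C A D \<and> cyc ` X \<subseteq> int_cube \<and> cyc w \<in> int_cube \<and>
      (\<forall>u\<in>cyc ` X. sup_norm (u - cyc w) \<le> r)"
    if "compact X \<and> X \<subseteq> surface A B C D \<and> X \<subseteq> int_cube \<and> w \<in> int_cube \<and> (\<forall>u\<in>X. sup_norm (u - w) \<le> r)"
    for X w and A B C :: "'p padic"
  proof (intro conjI ballI)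
    show "compact (cyc ` X)" using that by (intro compact_continuous_image continuous_on_cyc) blast
    show "cyc ` X \<subseteq> surface B C A D" "cyc ` X \<subseteq> int_cube"
      by (rule image_subsetI, use that cyc_surface cyc_int_cube in blast)+
    show "cyc w \<in> int_cube" using that cyc_int_cube by blast
    fix u assume "u \<in> cyc ` X"
    then obtain v where "v \<in> X" "u = cyc v" by blast
    then show "sup_norm (u - cyc w) \<le> r" using that by (simp only: cyc_diff sup_norm_cyc)
  qed
  have compare: "emeasure padic_haar2 (proj_yz ` X) * ennreal (padic_norm (dz C w)) =
      emeasure padic_haar2 (proj_xy ` X) * ennreal (padic_norm (dx A w))"
    if "compact X \<and> X \<subseteq> surface A B C D \<and> X \<subseteq> int_cube \<and> w \<in> int_cube \<and> (\<forall>u\<in>X. sup_norm (u - w) \<le> r)"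
      "r < padic_norm (dz C w)" "r < padic_norm (dx A w)" for X w and A B C :: "'p padic"
    by (rule chart_volume_compare_xy_yz[of X A B C D w r]) (use that in blast)+
  have E': "compact E \<and> E \<subseteq> surface A B C D \<and> E \<subseteq> int_cube \<and> u0 \<in> int_cube \<and> (\<forall>u\<in>E. sup_norm (u - u0) \<le> r)"
    using E u0 by blast
  have img: "proj_yz ` cyc ` X = proj_zx ` X" "proj_xy ` cyc ` X = proj_yz ` X" "proj_zx ` cyc ` X = proj_xy ` X"
    for X :: "'p padic3 set"
    unfolding image_image proj_cyc by (rule refl)+
  have 1: "emeasure padic_haar2 (proj_yz ` E) * ennreal (padic_norm (dz C u0)) =
      emeasure padic_haar2 (proj_xy ` E) * ennreal (padic_norm (dx A u0))"
    if "r < padic_norm (dz C u0)" "r < padic_norm (dx A u0)"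
    using compare[OF E'] that by blast
  have 2: "emeasure padic_haar2 (proj_zx ` E) * ennreal (padic_norm (dx A u0)) =
      emeasure padic_haar2 (proj_yz ` E) * ennreal (padic_norm (dy B u0))"
    if "r < padic_norm (dx A u0)" "r < padic_norm (dy B u0)"
    using compare[OF cycle[OF E']] that unfolding d_cyc img by blast
  have 3: "emeasure padic_haar2 (proj_xy ` E) * ennreal (padic_norm (dy B u0)) =
      emeasure padic_haar2 (proj_zx ` E) * ennreal (padic_norm (dz C u0))"
    if "r < padic_norm (dy B u0)" "r < padic_norm (dz C u0)"
    using compare[OF cycle[OF cycle[OF E']]] that unfolding d_cyc img by blast
  consider "\<pi> = proj_xy" "g = dz C" | "\<pi> = proj_yz" "g = dx A" | "\<pi> = proj_zx" "g = dy B"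
    using ch(1) by (auto simp: charts_def)
  then have ?thesis if "\<pi>' = proj_xy" "g' = dz C"
    using 1 3 r that by cases simp_all
  moreover have ?thesis if "\<pi>' = proj_yz" "g' = dx A"
    using \<open>(\<pi>, g) \<in> charts A B C\<close> 1 2 r that by (auto simp: charts_def)
  moreover have ?thesis if "\<pi>' = proj_zx" "g' = dy B"
    using \<open>(\<pi>, g) \<in> charts A B C\<close> 2 3 r that by (auto simp: charts_def)
  ultimately show ?thesis using ch(2) by (auto simp: charts_def)
qed

section \<open>The symplectic measure\<close>

definition cube :: "'p::prime_card padic3 \<Rightarrow> nat \<Rightarrow> 'p padic3 set" where
  "cube a n = {u. sup_norm (u - a) \<le> 1 / real CARD('p) ^ n}"

lemma mem_cube: "(u :: 'p::prime_card padic3) \<in> cube a n \<longleftrightarrow> sup_norm (u - a) \<le> 1 / real CARD('p) ^ n"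
  by (simp add: cube_def)

lemma center_in_cube [simp]: "a \<in> cube a n"
  by (simp add: mem_cube)

lemma cube_eq:
  assumes "b \<in> cube a n"
  shows "cube a n = (cube b n :: 'p::prime_card padic3 set)"
proof -
  let ?r = "1 / real CARD('p) ^ n"
  have 1: "sup_norm (a - b) \<le> ?r" "sup_norm (b - a) \<le> ?r"
    using assms by (simp_all add: mem_cube sup_norm_diff_commute)
  show ?thesis using sup_norm_trans[OF _ 1(1)] sup_norm_trans[OF _ 1(2)] by (auto simp: cube_def)
qed

lemma open_cube: "open (cube (a :: 'p::prime_card padic3) n)"
  unfolding open_sup_norm
proof
  fix u assume u: "u \<in> cube a n"
  have "v \<in> cube a n" if "sup_norm (v - u) \<le> 1 / real CARD('p) ^ n" for v
    using that unfolding cube_eq[OF u] mem_cube .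
  then show "\<exists>e>0. \<forall>v. sup_norm (v - u) \<le> e \<longrightarrow> v \<in> cube a n"
    by (intro exI[of _ "1 / real CARD('p) ^ n"]) auto
qed

lemma closed_cube: "closed (cube (a :: 'p::prime_card padic3) n)"
proof -
  have "- cube a n = (\<Union>b \<in> - cube a n. cube b n)"
  proof (rule equalityI; rule subsetI)
    fix x assume "x \<in> - cube a n"
    then show "x \<in> (\<Union>b \<in> - cube a n. cube b n)" by (auto intro: center_in_cube)
  next
    fix x assume "x \<in> (\<Union>b \<in> - cube a n. cube b n)"
    then obtain b where b: "b \<notin> cube a n" "x \<in> cube b n" by blast
    show "x \<in> - cube a n"
    proof
      assume "x \<in> cube a n"
      then show False using cube_eq[of x a n] cube_eq[OF b(2)] b(1) center_in_cube[of b n] by blast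
    qed
  qed
  also have "open \<dots>" by (intro open_UN ballI open_cube)
  finally show ?thesis by (simp add: closed_def)
qed

lemma cube_mono: "m \<le> n \<Longrightarrow> cube (a :: 'p::prime_card padic3) n \<subseteq> cube a m"
  using card_inverse_power_mono[of m n, where 'p='p] by (auto simp: cube_def)

lemma cube_cases:
  assumes "m \<le> n"
  shows "cube (a :: 'p::prime_card padic3) n \<inter> cube b m = {} \<or> cube a n \<subseteq> cube b m"
proof (cases "cube a n \<inter> cube b m = {}")
  case False
  then obtain c where "c \<in> cube a n" "c \<in> cube b m" by blast
  then show ?thesis using cube_eq[of c a n] cube_eq[of c b m] cube_mono[OF assms, of c] by blast
qed simp

definition cubes :: "'p::prime_card padic3 set set" where
  "cubes = {cube a n | a n. True}"

lemma cubes_basis: "topological_basis (cubes :: 'p::prime_card padic3 set set)"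
proof (rule topological_basisI)
  fix B :: "'p padic3 set" assume "B \<in> cubes"
  then show "open B" by (auto simp: cubes_def open_cube)
next
  fix U and u :: "'p padic3" assume "open U" "u \<in> U"
  then obtain e where e: "e > 0" "\<forall>v. sup_norm (v - u) \<le> e \<longrightarrow> v \<in> U" unfolding open_sup_norm by blast
  obtain n where "1 / real CARD('p) ^ n < e" using padic_radius_small[OF e(1), where 'p='p] by blast
  then have "cube u n \<subseteq> U" using e(2) by (auto simp only: cube_def mem_Collect_eq)
  then show "\<exists>B\<in>cubes. u \<in> B \<and> B \<subseteq> U" using center_in_cube[of u n] unfolding cubes_def by blast
qed

lemma cubes_Int:
  assumes "U \<in> cubes" "V \<in> cubes"
  shows "U \<inter> V = {} \<or> U \<inter> V \<in> (cubes :: 'p::prime_card padic3 set set)"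
proof -
  obtain a n b m where UV: "U = cube a n" "V = cube b m" using assms by (auto simp: cubes_def)
  show ?thesis
  proof (cases "m \<le> n")
    case True
    then have "U \<inter> V = {} \<or> U \<inter> V = U" using cube_cases[OF True, of a b] UV by blast
    then show ?thesis using assms by auto
  next
    case False
    then have "U \<inter> V = {} \<or> U \<inter> V = V" using cube_cases[of n m b a] UV by auto
    then show ?thesis using assms by auto
  qed
qed

text \<open>Cubes of one radius are open and pairwise equal or disjoint, so a finite subcover of the
  compact \<open>int_cube\<close> already contains every cube with centre in it.\<close>

lemma finite_cubes:
  assumes "S \<subseteq> int_cube"
  shows "finite ((\<lambda>u. cube u n) ` S :: 'p::prime_card padic3 set set)"
proof -
  let ?B = "(\<lambda>u. cube u n) ` int_cube :: 'p padic3 set set"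
  have "int_cube \<subseteq> \<Union>?B" by (auto intro: center_in_cube)
  moreover have "\<And>B. B \<in> ?B \<Longrightarrow> open B" by (auto simp: open_cube)
  ultimately obtain F where F: "F \<subseteq> ?B" "finite F" "int_cube \<subseteq> \<Union>F"
    using compactE[OF compact_int_cube] by metis
  have "?B \<subseteq> F"
  proof
    fix B assume "B \<in> ?B"
    then obtain u where u: "u \<in> int_cube" "B = cube u n" by blast
    then obtain C where C: "C \<in> F" "u \<in> C" using F(3) by blast
    then obtain v where "C = cube v n" using F(1) by blast
    then have "C = B" using cube_eq[of u v n] C(2) u(2) by simp
    then show "B \<in> F" using C(1) by simp
  qed
  then have "finite ?B" using F(2) finite_subset by blast
  then show ?thesis using assms by (meson finite_subset image_mono)
qed

text \<open>A continuous injection on a compact set has a continuous inverse, and the image of a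
  Borel set is its preimage under this inverse.\<close>

lemma borel_image_compact:
  fixes f :: "'a::metric_space \<Rightarrow> 'b::metric_space"
  assumes W: "compact W" "continuous_on W f" "inj_on f W" and E: "E \<in> sets borel"
  shows "f ` (E \<inter> W) \<in> sets borel"
proof -
  let ?g = "the_inv_into W f"
  have "continuous_on (f ` W) ?g"
    using W(2,1) by (rule continuous_on_inv) (auto simp: the_inv_into_f_f[OF W(3)])
  then have g: "?g \<in> borel_measurable (restrict_space borel (f ` W))"
    by (rule borel_measurable_continuous_on_restrict)
  have fW: "f ` W \<in> sets borel"
    by (intro borel_closed compact_imp_closed compact_continuous_image W)
  have "?g -` E \<inter> space (restrict_space borel (f ` W)) \<in> sets (restrict_space borel (f ` W))"
    by (rule measurable_sets[OF g E])
  also have "?g -` E \<inter> space (restrict_space borel (f ` W)) = f ` (E \<inter> W)"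
    by (auto simp: space_restrict_space the_inv_into_f_f[OF W(3)])
  finally show ?thesis using sets_restrict_space_iff[of "f ` W" borel] fW by auto
qed

text \<open>The measure Omega on a piece \<open>W\<close> where its density in the chart
  \<open>\<pi>\<close> has the constant value \<open>c\<close>.\<close>

definition cell_measure :: "('p::prime_card padic3 \<Rightarrow> 'p padic \<times> 'p padic) \<Rightarrow> 'p padic3 set \<Rightarrow> ennreal \<Rightarrow> 'p padic3 measure" where
  "cell_measure \<pi> W c = measure_of UNIV (sets borel) (\<lambda>E. c * emeasure padic_haar2 (\<pi> ` (E \<inter> W)))"

lemma sets_cell_measure [simp]: "sets (cell_measure \<pi> W c) = sets borel"
  unfolding cell_measure_def by (rule sets.sets_measure_of_eq[of borel, unfolded space_borel])

lemma emeasure_cell_measure: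
  assumes W: "compact W" "continuous_on W \<pi>" "inj_on \<pi> W" and E: "E \<in> sets borel"
  shows "emeasure (cell_measure \<pi> W c) E = c * emeasure padic_haar2 (\<pi> ` (E \<inter> W))"
  unfolding cell_measure_def
proof (rule emeasure_measure_of_sigma)
  show "sigma_algebra UNIV (sets (borel :: 'a padic3 measure))" using sets.sigma_algebra_axioms[of borel] by simp
  show "positive (sets borel) (\<lambda>E. c * emeasure padic_haar2 (\<pi> ` (E \<inter> W)))" by (simp add: positive_def)
  show "countably_additive (sets borel) (\<lambda>E. c * emeasure padic_haar2 (\<pi> ` (E \<inter> W)))"
    unfolding countably_additive_def
  proof (intro allI impI)
    fix A :: "nat \<Rightarrow> 'a padic3 set"
    assume A: "range A \<subseteq> sets borel" "disjoint_family A"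
    have "(\<Sum>i. c * emeasure padic_haar2 (\<pi> ` (A i \<inter> W))) = c * (\<Sum>i. emeasure padic_haar2 (\<pi> ` (A i \<inter> W)))"
      by simp
    also have "(\<Sum>i. emeasure padic_haar2 (\<pi> ` (A i \<inter> W))) = emeasure padic_haar2 (\<Union>i. \<pi> ` (A i \<inter> W))"
    proof (rule suminf_emeasure)
      show "range (\<lambda>i. \<pi> ` (A i \<inter> W)) \<subseteq> sets padic_haar2"
        unfolding sets_padic_haar2 using borel_image_compact[OF W] A(1) by blast
      show "disjoint_family (\<lambda>i. \<pi> ` (A i \<inter> W))"
        unfolding disjoint_family_on_def
      proof (intro ballI impI equals0I)
        fix i j w assume ij: "i \<noteq> j" and "w \<in> \<pi> ` (A i \<inter> W) \<inter> \<pi> ` (A j \<inter> W)"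
        then obtain u v where uv: "u \<in> A i" "v \<in> A j" "u \<in> W" "v \<in> W" "\<pi> u = \<pi> v" by auto
        then have "u = v" using inj_onD[OF W(3)] by blast
        then show False using disjoint_family_onD[OF A(2), of i j] ij uv by blast
      qed
    qed
    also have "(\<Union>i. \<pi> ` (A i \<inter> W)) = \<pi> ` ((\<Union>i. A i) \<inter> W)" by blast
    finally show "(\<Sum>i. c * emeasure padic_haar2 (\<pi> ` (A i \<inter> W))) = c * emeasure padic_haar2 (\<pi> ` ((\<Union>i. A i) \<inter> W))" .
  qed
qed (rule E)

lemma emeasure_sum_measures:
  assumes I: "finite I" and N: "\<And>i. i \<in> I \<Longrightarrow> sets (N i) = sets M" and E: "E \<in> sets M"
  shows "emeasure (measure_of (space M) (sets M) (\<lambda>E. \<Sum>i\<in>I. emeasure (N i) E)) E = (\<Sum>i\<in>I. emeasure (N i) E)"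
proof (rule emeasure_measure_of_sigma)
  show "sigma_algebra (space M) (sets M)" by (rule sets.sigma_algebra_axioms)
  show "positive (sets M) (\<lambda>E. \<Sum>i\<in>I. emeasure (N i) E)" by (simp add: positive_def)
  show "countably_additive (sets M) (\<lambda>E. \<Sum>i\<in>I. emeasure (N i) E)"
    unfolding countably_additive_def
  proof (intro allI impI)
    fix A :: "nat \<Rightarrow> 'b set" assume A: "range A \<subseteq> sets M" "disjoint_family A"
    have "(\<Sum>n. \<Sum>i\<in>I. emeasure (N i) (A n)) = (\<Sum>i\<in>I. \<Sum>n. emeasure (N i) (A n))"
      by (rule suminf_sum) simp
    also have "\<dots> = (\<Sum>i\<in>I. emeasure (N i) (\<Union>n. A n))"
      by (rule sum.cong[OF refl], rule suminf_emeasure) (use A N in auto)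
    finally show "(\<Sum>n. \<Sum>i\<in>I. emeasure (N i) (A n)) = (\<Sum>i\<in>I. emeasure (N i) (\<Union>n. A n))" .
  qed
qed (rule E)

lemma chart_volume_const:
  assumes inj: "inj_on \<pi> U" and g: "\<And>u. u \<in> U \<Longrightarrow> padic_norm (g u) = \<gamma>" and meas: "\<pi> ` U \<in> sets borel"
  shows "chart_volume \<pi> g U = ennreal (1 / \<gamma>) * emeasure padic_haar2 (\<pi> ` U)"
proof -
  have "chart_volume \<pi> g U = (\<integral>\<^sup>+w. ennreal (1 / \<gamma>) * indicator (\<pi> ` U) w \<partial>padic_haar2)"
    unfolding chart_volume_def
    by (rule nn_integral_cong) (auto simp: indicator_def the_inv_into_f_f[OF inj] g)
  also have "\<dots> = ennreal (1 / \<gamma>) * emeasure padic_haar2 (\<pi> ` U)"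
    by (rule nn_integral_cmult_indicator) (use meas in \<open>simp only: sets_padic_haar2\<close>)
  finally show ?thesis .
qed

section \<open>Cells on which a chart is injective and its density constant\<close>

lemma chart_continuous: "(\<pi>, g) \<in> charts A B C \<Longrightarrow> continuous_on S \<pi>"
  unfolding charts_def proj_xy_def proj_yz_def proj_zx_def case_prod_beta
  by (auto intro!: continuous_intros)

lemma chart_lipschitz:
  "(\<pi>, g) \<in> charts A B C \<Longrightarrow> u \<in> int_cube \<Longrightarrow> v \<in> int_cube \<Longrightarrow> padic_norm (g u - g v) \<le> sup_norm (u - v)"
  unfolding charts_def using dx_lipschitz dy_lipschitz dz_lipschitz by blast

lemma chart_fibre:
  assumes ch: "(\<pi>, g) \<in> charts A B C" and uv: "u \<in> surface A B C D" "v \<in> surface A B C D" "\<pi> u = \<pi> v" "u \<noteq> v"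
  shows "sup_norm (u - v) = padic_norm (g u)"
proof -
  have zx: "sup_norm (u - v) = padic_norm (dy B u)"
    if "u \<in> surface A B C D" "v \<in> surface A B C D" "proj_zx u = proj_zx v" "u \<noteq> v" for A B C D and u v :: "'a padic3"
    using that by (intro surface_fibre_unique[of u A B C D v]) (auto simp: proj_zx_def split: prod.splits)
  consider "\<pi> = proj_xy" "g = dz C" | "\<pi> = proj_yz" "g = dx A" | "\<pi> = proj_zx" "g = dy B"
    using ch by (auto simp: charts_def)
  then show ?thesis
  proof cases
    case 1
    then show ?thesis using zx[of "cyc u" B C A D "cyc v"] uv by (simp add: proj_cyc d_cyc cyc_diff)
  next
    case 2
    then show ?thesis using zx[of "cyc (cyc u)" C A B D "cyc (cyc v)"] uv by (simp add: proj_cyc d_cyc cyc_diff)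
  next
    case 3
    then show ?thesis using zx uv by blast
  qed
qed

lemma chart_image_ints:
  "(\<pi>, g) \<in> charts A B C \<Longrightarrow> U \<subseteq> int_cube \<Longrightarrow> \<pi> ` U \<subseteq> padic_ints \<times> padic_ints"
  by (fastforce simp: charts_def proj_xy_def proj_yz_def proj_zx_def int_cube_eq)

lemma padic_haar2_Times:
  assumes "X \<in> sets borel" "Y \<in> sets borel"
  shows "emeasure padic_haar2 (X \<times> Y) = emeasure padic_haar X * emeasure (padic_haar :: 'p::prime_card padic measure) (Y :: 'p padic set)"
proof -
  interpret h: sigma_finite_measure "padic_haar :: 'p padic measure" by (rule sigma_finite_padic_haar)
  show ?thesis using assms by (intro h.emeasure_pair_measure_Times) auto
qed

lemma padic_haar2_le_1:
  assumes "S \<subseteq> padic_ints \<times> (padic_ints :: 'p::prime_card padic set)"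
  shows "emeasure padic_haar2 S \<le> 1"
proof -
  have b: "(padic_ints :: 'p padic set) \<in> sets borel" by (simp add: padic_ints_eq_cball)
  have "emeasure padic_haar2 S \<le> emeasure padic_haar2 (padic_ints \<times> (padic_ints :: 'p padic set))"
    using assms b by (intro emeasure_mono) (auto intro!: pair_measureI)
  also have "\<dots> = emeasure padic_haar (padic_ints :: 'p padic set) * emeasure padic_haar (padic_ints :: 'p padic set)"
    by (rule padic_haar2_Times[OF b b])
  also have "\<dots> = 1" using padic_haar_cball[of "0 :: 'p padic" 0] by (simp add: padic_ints_eq_cball)
  finally show ?thesis .
qed

context
  fixes A B C D :: "'p::prime_card padic"
  assumes nonsing: "\<And>u. u \<in> int_surface A B C D \<Longrightarrow> \<exists>\<pi> g. (\<pi>, g) \<in> charts A B C \<and> g u \<noteq> 0"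
begin

lemma cell_const:
  assumes "(\<pi>, g) \<in> charts A B C" "u \<in> int_surface A B C D" "1 / real CARD('p) ^ n < padic_norm (g u)" "v \<in> int_surface A B C D \<inter> cube u n"
  shows "padic_norm (g v) = padic_norm (g u)"
proof -
  have "padic_norm (g u - g v) < padic_norm (g u)"
    using chart_lipschitz[OF assms(1), of u v] assms by (auto simp: int_surface_eq mem_cube sup_norm_diff_commute)
  then show ?thesis by (rule padic_norm_eq_of_close)
qed

text \<open>Two points of the cell with equal projection would be at distance |g u|, which exceeds
  the radius of the cell.\<close>

lemma cell_inj:
  assumes "(\<pi>, g) \<in> charts A B C" "u \<in> int_surface A B C D" "1 / real CARD('p) ^ n < padic_norm (g u)"
  shows "inj_on \<pi> (int_surface A B C D \<inter> cube u n)"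
proof (rule inj_onI, rule ccontr)
  fix v w assume v: "v \<in> int_surface A B C D \<inter> cube u n" and w: "w \<in> int_surface A B C D \<inter> cube u n" and eq: "\<pi> v = \<pi> w" "v \<noteq> w"
  have "sup_norm (v - w) = padic_norm (g u)"
    using chart_fibre[OF assms(1) _ _ eq] v w cell_const[OF assms v] by (auto simp: int_surface_eq)
  moreover have "v \<in> cube w n" using v w cube_eq[of w u n] by blast
  ultimately show False using assms(3) by (simp add: mem_cube)
qed

lemma cell_compact: "compact (int_surface A B C D \<inter> cube u n)"
  by (rule compact_Int_closed[OF compact_int_surface closed_cube])

lemma chart_image_borel:
  assumes "(\<pi>, g) \<in> charts A B C" "u \<in> int_surface A B C D" "1 / real CARD('p) ^ n < padic_norm (g u)" "U \<in> sets borel" "U \<subseteq> int_surface A B C D \<inter> cube u n"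
  shows "\<pi> ` U \<in> sets borel"
  using borel_image_compact[OF cell_compact chart_continuous[OF assms(1)] cell_inj[OF assms(1-3)] assms(4)] assms(5)
  by (simp add: Int_absorb2)

text \<open>The equality of the three expressions for Omega, as measures on a cell. It is tested on
  cubes, because the comparison of charts is available for compact sets.\<close>

lemma cell_measure_chart_independent:
  assumes c1: "(\<pi>, g) \<in> charts A B C" "1 / real CARD('p) ^ n < padic_norm (g u)"
    and c2: "(\<pi>', g') \<in> charts A B C" "1 / real CARD('p) ^ n < padic_norm (g' u)" and u: "u \<in> int_surface A B C D"
  shows "cell_measure \<pi> (int_surface A B C D \<inter> cube u n) (ennreal (1 / padic_norm (g u))) =
    cell_measure \<pi>' (int_surface A B C D \<inter> cube u n) (ennreal (1 / padic_norm (g' u)))" (is "?M = ?N")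
proof (rule measure_eqI_basis[OF cubes_basis cubes_Int])
  have pos: "padic_norm (g u) > 0" "padic_norm (g' u) > 0"
    using c1(2) c2(2) card_power_gt_0[where 'p='p and n=n] by (auto intro: order.strict_trans[rotated])
  let ?V = "int_surface A B C D \<inter> cube u n"
  fix E :: "'p padic3 set" assume "E \<in> cubes"
  then have E: "closed E" by (auto simp: cubes_def closed_cube)
  then have Eb: "E \<in> sets borel" by simp
  have em: "emeasure ?M E = ennreal (1 / padic_norm (g u)) * emeasure padic_haar2 (\<pi> ` (E \<inter> ?V))"
    by (rule emeasure_cell_measure[OF cell_compact chart_continuous[OF c1(1)] cell_inj[OF c1(1) u c1(2)] Eb])
  have en: "emeasure ?N E = ennreal (1 / padic_norm (g' u)) * emeasure padic_haar2 (\<pi>' ` (E \<inter> ?V))"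
    by (rule emeasure_cell_measure[OF cell_compact chart_continuous[OF c2(1)] cell_inj[OF c2(1) u c2(2)] Eb])
  have "compact (E \<inter> ?V)" using E cell_compact by (rule closed_Int_compact)
  then have "emeasure padic_haar2 (\<pi> ` (E \<inter> ?V)) * ennreal (padic_norm (g' u)) =
    emeasure padic_haar2 (\<pi>' ` (E \<inter> ?V)) * ennreal (padic_norm (g u))"
    by (rule chart_volume_compare[of _ A B C D u "1 / real CARD('p) ^ n"])
      (use c1 c2 u in \<open>auto simp: int_surface_eq mem_cube\<close>)
  then have "ennreal (1 / padic_norm (g u)) * ennreal (1 / padic_norm (g' u)) * (emeasure padic_haar2 (\<pi> ` (E \<inter> ?V)) * ennreal (padic_norm (g' u))) =
    ennreal (1 / padic_norm (g u)) * ennreal (1 / padic_norm (g' u)) * (emeasure padic_haar2 (\<pi>' ` (E \<inter> ?V)) * ennreal (padic_norm (g u)))"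
    by simp
  moreover have "ennreal (1 / x) * ennreal (1 / y) * (a * ennreal y) = ennreal (1 / x) * a" if "y > 0" for x y :: real and a
  proof -
    have "ennreal (1 / y) * ennreal y = 1" using that by (simp add: ennreal_mult[symmetric])
    then show ?thesis by (metis mult.assoc mult.commute mult.right_neutral)
  qed
  ultimately show "emeasure ?M E = emeasure ?N E"
    unfolding em en using pos by (metis mult.commute)
  have "emeasure padic_haar2 (\<pi> ` (E \<inter> ?V)) \<le> 1"
    by (rule padic_haar2_le_1[OF chart_image_ints[OF c1(1)]]) (auto simp: int_surface_eq)
  then have "emeasure padic_haar2 (\<pi> ` (E \<inter> ?V)) \<noteq> \<top>" by (metis ennreal_one_neq_top neq_top_trans)
  then show "emeasure ?M E \<noteq> \<infinity>" unfolding em by (simp add: ennreal_mult_eq_top_iff)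
qed simp_all

text \<open>Around each point a nonzero derivative keeps its norm on a cell. Finitely many such
  cells cover the surface, and the largest of their exponents serves everywhere.\<close>

lemma uniform_level: "\<exists>m. \<forall>u\<in>int_surface A B C D. \<exists>\<pi> g. (\<pi>, g) \<in> charts A B C \<and> 1 / real CARD('p) ^ m < padic_norm (g u)"
proof -
  have "\<exists>n. \<exists>\<pi> g. (\<pi>, g) \<in> charts A B C \<and> 1 / real CARD('p) ^ n < padic_norm (g u)" if u: "u \<in> int_surface A B C D" for u
  proof -
    obtain \<pi> g where g: "(\<pi>, g) \<in> charts A B C" "g u \<noteq> 0" using nonsing[OF u] by blast
    then obtain n where "1 / real CARD('p) ^ n < padic_norm (g u)"
      using padic_radius_small[OF padic_norm_pos[OF g(2)], where 'p='p] by blast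
    then show ?thesis using g(1) by blast
  qed
  then obtain n where n: "\<And>u. u \<in> int_surface A B C D \<Longrightarrow> \<exists>\<pi> g. (\<pi>, g) \<in> charts A B C \<and> 1 / real CARD('p) ^ n u < padic_norm (g u)" by metis
  have cover: "int_surface A B C D \<subseteq> (\<Union>u\<in>int_surface A B C D. cube u (n u))" by auto
  obtain F where F: "F \<subseteq> int_surface A B C D" "finite F" "int_surface A B C D \<subseteq> (\<Union>u\<in>F. cube u (n u))"
    by (rule compactE_image[OF compact_int_surface open_cube cover])
  define m where "m = Max (insert 0 (n ` F))"
  show ?thesis
  proof (intro exI[of _ m] ballI)
    fix u assume u: "u \<in> int_surface A B C D"
    then obtain v where v: "v \<in> F" "u \<in> cube v (n v)" using F(3) by blast
    have vS: "v \<in> int_surface A B C D" using v(1) F(1) by blast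
    obtain \<pi> g where g: "(\<pi>, g) \<in> charts A B C" "1 / real CARD('p) ^ n v < padic_norm (g v)" using n[OF vS] by blast
    have "padic_norm (g u) = padic_norm (g v)" using cell_const[OF g(1) vS g(2)] u v(2) by blast
    moreover have "n v \<le> m" unfolding m_def using F(2) v(1) by (intro Max_ge) auto
    ultimately have "1 / real CARD('p) ^ m < padic_norm (g u)"
      using card_inverse_power_mono[of "n v" m, where 'p='p] g(2) by linarith
    then show "\<exists>\<pi> g. (\<pi>, g) \<in> charts A B C \<and> 1 / real CARD('p) ^ m < padic_norm (g u)" using g(1) by blast
  qed
qed

text \<open>The radius of a cell is computed from the norm of \<open>g\<close> at its centre alone,
  and this norm is constant on the cell. All points of a cell thus give the same cell, which makes
  the cells disjoint. The bound \<open>m\<close> makes them fine enough for the measure formulas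
  used on them.\<close>

lemma countable_chart_cells:
  assumes ch: "(\<pi>, g) \<in> charts A B C"
  obtains \<V> where "countable \<V>" "disjoint \<V>" "\<Union>\<V> = {u \<in> int_surface A B C D. g u \<noteq> 0}"
    "\<And>V. V \<in> \<V> \<Longrightarrow> \<exists>u n. u \<in> int_surface A B C D \<and> n \<ge> m \<and> 1 / real CARD('p) ^ n < padic_norm (g u) \<and> V = int_surface A B C D \<inter> cube u n"
proof
  define lev where "lev u = (LEAST n. n \<ge> m \<and> 1 / real CARD('p) ^ n < padic_norm (g u))" for u
  define \<V> where "\<V> = (\<lambda>u. (int_surface A B C D) \<inter> cube u (lev u)) ` {u \<in> int_surface A B C D. g u \<noteq> 0}"
  have lev: "lev u \<ge> m \<and> 1 / real CARD('p) ^ lev u < padic_norm (g u)" if gu: "g u \<noteq> 0" for u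
  proof -
    obtain n where n: "1 / real CARD('p) ^ n < padic_norm (g u)"
      using padic_radius_small[OF padic_norm_pos[OF gu], where 'p='p] by blast
    have "1 / real CARD('p) ^ max m n < padic_norm (g u)"
      using card_inverse_power_mono[of n "max m n", where 'p='p] n by simp
    then have "max m n \<ge> m \<and> 1 / real CARD('p) ^ max m n < padic_norm (g u)" by simp
    then show ?thesis unfolding lev_def by (rule LeastI)
  qed
  have const: "padic_norm (g v) = padic_norm (g u)" "lev v = lev u" if u: "u \<in> int_surface A B C D" "g u \<noteq> 0" and v: "v \<in> int_surface A B C D \<inter> cube u (lev u)" for u v
  proof -
    show "padic_norm (g v) = padic_norm (g u)" using cell_const[OF ch u(1) _ v] lev[OF u(2)] by blast
    then show "lev v = lev u" by (simp add: lev_def)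
  qed
  have "\<V> \<subseteq> (\<Union>n. (\<inter>) (int_surface A B C D) ` ((\<lambda>u. cube u n) ` (int_surface A B C D)))" by (auto simp: \<V>_def)
  moreover have "countable ((\<inter>) (int_surface A B C D) ` ((\<lambda>u. cube u n) ` (int_surface A B C D)))" for n
    by (rule countable_finite, rule finite_imageI, rule finite_cubes) (auto simp: int_surface_eq)
  then have "countable (\<Union>n. (\<inter>) (int_surface A B C D) ` ((\<lambda>u. cube u n) ` (int_surface A B C D)))" by blast
  ultimately show "countable \<V>" by (rule countable_subset)
  show "disjoint \<V>"
  proof (rule disjointI)
    fix V W assume "V \<in> \<V>" "W \<in> \<V>" "V \<noteq> W"
    then obtain u v where uv: "u \<in> int_surface A B C D" "g u \<noteq> 0" "V = int_surface A B C D \<inter> cube u (lev u)" "v \<in> int_surface A B C D" "g v \<noteq> 0" "W = int_surface A B C D \<inter> cube v (lev v)"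
      unfolding \<V>_def by blast
    show "V \<inter> W = {}"
    proof (rule ccontr)
      assume "V \<inter> W \<noteq> {}"
      then obtain w where w: "w \<in> V" "w \<in> W" by blast
      have "lev w = lev u" "lev w = lev v" using const uv w by blast+
      then have "cube u (lev u) = cube v (lev v)"
        using cube_eq[of w u "lev u"] cube_eq[of w v "lev v"] w uv(3,6) by auto
      then show False using uv(3,6) \<open>V \<noteq> W\<close> by simp
    qed
  qed
  show "\<Union>\<V> = {u \<in> int_surface A B C D. g u \<noteq> 0}"
  proof (rule equalityI; rule subsetI)
    fix v assume "v \<in> \<Union>\<V>"
    then obtain u where u: "u \<in> int_surface A B C D" "g u \<noteq> 0" "v \<in> int_surface A B C D \<inter> cube u (lev u)" unfolding \<V>_def by blast
    then have "padic_norm (g v) > 0" using const(1)[OF u] padic_norm_pos by metis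
    then show "v \<in> {u \<in> int_surface A B C D. g u \<noteq> 0}" using u(3) by auto
  next
    fix v assume "v \<in> {u \<in> int_surface A B C D. g u \<noteq> 0}"
    then have "int_surface A B C D \<inter> cube v (lev v) \<in> \<V>" "v \<in> int_surface A B C D \<inter> cube v (lev v)"
      unfolding \<V>_def using center_in_cube by blast+
    then show "v \<in> \<Union>\<V>" by blast
  qed
  fix V assume "V \<in> \<V>"
  then show "\<exists>u n. u \<in> int_surface A B C D \<and> n \<ge> m \<and> 1 / real CARD('p) ^ n < padic_norm (g u) \<and> V = int_surface A B C D \<inter> cube u n"
    unfolding \<V>_def using lev by blast
qed

text \<open>On \<open>U\<close> the function \<open>g\<close> may come arbitrarily close to 0, so
  the density can be unbounded. Cutting \<open>U\<close> into countably many cells of constant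
  density and exchanging sum and integral gives the formula; since \<open>\<pi>\<close> is injective
  on \<open>U\<close>, each image point belongs to exactly one cell.\<close>

lemma chart_formula_from_cells:
  fixes M :: "'p padic3 measure"
  assumes ch: "(\<pi>, g) \<in> charts A B C" and sM: "sets M = sets (restrict_space borel (int_surface A B C D))"
    and small: "\<And>u n U. u \<in> int_surface A B C D \<Longrightarrow> n \<ge> m \<Longrightarrow> 1 / real CARD('p) ^ n < padic_norm (g u) \<Longrightarrow> U \<in> sets borel \<Longrightarrow> U \<subseteq> int_surface A B C D \<inter> cube u n \<Longrightarrow>
      emeasure M U = ennreal (1 / padic_norm (g u)) * emeasure padic_haar2 (\<pi> ` U)"
    and U: "U \<in> sets M" "inj_on \<pi> U" "0 \<notin> g ` U"
  shows "emeasure M U = chart_volume \<pi> g U"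
proof -
  have Sb: "int_surface A B C D \<in> sets borel" by (intro borel_closed closed_int_surface)
  have Ub: "U \<in> sets borel" "U \<subseteq> int_surface A B C D" using U(1) Sb by (auto simp: sM sets_restrict_space_iff)
  obtain \<V> where V: "countable \<V>" "disjoint \<V>" "\<Union>\<V> = {u \<in> int_surface A B C D. g u \<noteq> 0}"
    "\<And>V. V \<in> \<V> \<Longrightarrow> \<exists>u n. u \<in> int_surface A B C D \<and> n \<ge> m \<and> 1 / real CARD('p) ^ n < padic_norm (g u) \<and> V = int_surface A B C D \<inter> cube u n"
    by (rule countable_chart_cells[OF ch, of m]) (rule that, assumption, assumption, assumption, blast)
  have "\<exists>a n. \<forall>V\<in>\<V>. a V \<in> int_surface A B C D \<and> n V \<ge> m \<and> 1 / real CARD('p) ^ n V < padic_norm (g (a V)) \<and> V = int_surface A B C D \<inter> cube (a V) (n V)"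
  proof -
    have "\<forall>V\<in>\<V>. \<exists>t. fst t \<in> int_surface A B C D \<and> snd t \<ge> m \<and> 1 / real CARD('p) ^ snd t < padic_norm (g (fst t)) \<and> V = int_surface A B C D \<inter> cube (fst t) (snd t)"
    proof
      fix V assume "V \<in> \<V>"
      then obtain u k where "u \<in> int_surface A B C D \<and> k \<ge> m \<and> 1 / real CARD('p) ^ k < padic_norm (g u) \<and> V = int_surface A B C D \<inter> cube u k"
        using V(4) by blast
      then show "\<exists>t. fst t \<in> int_surface A B C D \<and> snd t \<ge> m \<and> 1 / real CARD('p) ^ snd t < padic_norm (g (fst t)) \<and> V = int_surface A B C D \<inter> cube (fst t) (snd t)"
        by (intro exI[of _ "(u, k)"]) simp
    qed
    from bchoice[OF this] obtain t where t: "\<forall>V\<in>\<V>. fst (t V) \<in> int_surface A B C D \<and> snd (t V) \<ge> m \<and>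
        1 / real CARD('p) ^ snd (t V) < padic_norm (g (fst (t V))) \<and> V = int_surface A B C D \<inter> cube (fst (t V)) (snd (t V))"
      by (rule exE)
    show ?thesis by (rule exI[of _ "\<lambda>V. fst (t V)"], rule exI[of _ "\<lambda>V. snd (t V)"], rule t)
  qed
  then obtain a n where t: "\<forall>V\<in>\<V>. a V \<in> int_surface A B C D \<and> n V \<ge> m \<and> 1 / real CARD('p) ^ n V < padic_norm (g (a V)) \<and> V = int_surface A B C D \<inter> cube (a V) (n V)"
    by (elim exE)
  have an: "\<And>V. V \<in> \<V> \<Longrightarrow> a V \<in> int_surface A B C D" "\<And>V. V \<in> \<V> \<Longrightarrow> n V \<ge> m"
    "\<And>V. V \<in> \<V> \<Longrightarrow> 1 / real CARD('p) ^ n V < padic_norm (g (a V))" "\<And>V. V \<in> \<V> \<Longrightarrow> V = int_surface A B C D \<inter> cube (a V) (n V)"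
    using t by blast+
  define c where "c V = ennreal (1 / padic_norm (g (a V)))" for V
  have Vb: "V \<in> sets borel" if "V \<in> \<V>" for V
    by (subst an(4)[OF that]) (intro borel_closed compact_imp_closed cell_compact)
  have UVb: "U \<inter> V \<in> sets borel" if "V \<in> \<V>" for V using Ub(1) Vb[OF that] by blast
  have UVsub: "U \<inter> V \<subseteq> int_surface A B C D \<inter> cube (a V) (n V)" if "V \<in> \<V>" for V using equalityD1[OF an(4)[OF that]] by blast
  have img: "\<pi> ` (U \<inter> V) \<in> sets borel" if "V \<in> \<V>" for V
    by (rule chart_image_borel[OF ch an(1)[OF that] an(3)[OF that] UVb[OF that] UVsub[OF that]])
  have eqU: "(\<Union>V\<in>\<V>. U \<inter> V) = U"
  proof -
    have "U \<subseteq> \<Union>\<V>" unfolding V(3) using Ub(2) U(3) by force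
    then show ?thesis by blast
  qed
  have disj: "disjoint_family_on (\<lambda>V. U \<inter> V) \<V>" using V(2) by (auto simp: disjoint_family_on_def disjoint_def)
  have "emeasure M U = emeasure M (\<Union>V\<in>\<V>. U \<inter> V)" by (simp only: eqU)
  also have "\<dots> = (\<integral>\<^sup>+V. emeasure M (U \<inter> V) \<partial>count_space \<V>)"
    by (rule emeasure_UN_countable[OF _ V(1) disj]) (use UVb Ub(2) Sb in \<open>auto simp: sM sets_restrict_space_iff\<close>)
  also have "\<dots> = (\<integral>\<^sup>+V. c V * emeasure padic_haar2 (\<pi> ` (U \<inter> V)) \<partial>count_space \<V>)"
    by (rule nn_integral_cong) (use small[OF an(1,2,3) UVb UVsub] in \<open>simp add: c_def\<close>)
  also have "\<dots> = (\<integral>\<^sup>+V. \<integral>\<^sup>+w. c V * indicator (\<pi> ` (U \<inter> V)) w \<partial>padic_haar2 \<partial>count_space \<V>)"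
    by (rule nn_integral_cong, subst nn_integral_cmult_indicator) (simp_all only: img sets_padic_haar2 space_count_space)
  also have "\<dots> = (\<integral>\<^sup>+w. \<integral>\<^sup>+V. c V * indicator (\<pi> ` (U \<inter> V)) w \<partial>count_space \<V> \<partial>padic_haar2)"
  proof (rule nn_integral_count_space_nn_integral[symmetric, OF V(1)])
    fix V assume "V \<in> \<V>"
    then have "\<pi> ` (U \<inter> V) \<in> sets padic_haar2" using img by (simp only: sets_padic_haar2)
    then show "(\<lambda>w. c V * indicator (\<pi> ` (U \<inter> V)) w) \<in> borel_measurable padic_haar2" by measurable
  qed
  also have "\<dots> = chart_volume \<pi> g U"
    unfolding chart_volume_def
  proof (rule nn_integral_cong)
    fix w
    show "(\<integral>\<^sup>+V. c V * indicator (\<pi> ` (U \<inter> V)) w \<partial>count_space \<V>) =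
        ennreal (1 / padic_norm (g (the_inv_into U \<pi> w))) * indicator (\<pi> ` U) w"
    proof (cases "w \<in> \<pi> ` U")
      case False
      then have "indicator (\<pi> ` (U \<inter> V)) w = (0::ennreal)" for V by (auto simp: indicator_def)
      then show ?thesis using False by simp
    next
      case True
      then obtain u where u: "u \<in> U" "w = \<pi> u" by blast
      then obtain V0 where V0: "V0 \<in> \<V>" "u \<in> V0" using eqU by blast
      have ind: "indicator (\<pi> ` (U \<inter> V)) w = (indicator {V0} V :: ennreal)" if "V \<in> \<V>" for V
      proof (cases "V = V0")
        case True
        then show ?thesis using u V0 by (simp add: indicator_def)
      next
        case False
        have "w \<notin> \<pi> ` (U \<inter> V)"
        proof
          assume "w \<in> \<pi> ` (U \<inter> V)"
          then obtain v where v: "v \<in> U" "v \<in> V" "\<pi> v = \<pi> u" using u(2) by auto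
          then have "v = u" using inj_onD[OF U(2)] u(1) by blast
          then show False using V(2) that V0 v(2) False by (auto simp: disjoint_def)
        qed
        then show ?thesis using False by (simp add: indicator_def)
      qed
      have "(\<integral>\<^sup>+V. c V * indicator (\<pi> ` (U \<inter> V)) w \<partial>count_space \<V>) = (\<integral>\<^sup>+V. c V0 * indicator {V0} V \<partial>count_space \<V>)"
        by (rule nn_integral_cong) (auto simp: ind split: split_indicator)
      also have "\<dots> = c V0 * emeasure (count_space \<V>) {V0}"
        using V0(1) by (intro nn_integral_cmult_indicator) auto
      also have "emeasure (count_space \<V>) {V0} = 1" using V0(1) by (subst emeasure_count_space_finite) auto
      also have "c V0 = ennreal (1 / padic_norm (g u))"
      proof -
        have "u \<in> int_surface A B C D \<inter> cube (a V0) (n V0)" using V0(2) equalityD1[OF an(4)[OF V0(1)]] by blast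
        then have "padic_norm (g u) = padic_norm (g (a V0))" by (rule cell_const[OF ch an(1)[OF V0(1)] an(3)[OF V0(1)]])
        then show ?thesis by (simp only: c_def)
      qed
      finally show ?thesis using u the_inv_into_f_f[OF U(2) u(1)] by simp
    qed
  qed
  finally show ?thesis .
qed

text \<open>Each cube of the uniform level gets the cell measure of one admissible chart, and the
  finitely many pieces are added. By chart independence the sum satisfies the formula in every chart
  on small cells, and \<open>chart_formula_from_cells\<close> extends it to all admissible
  sets.\<close>

lemma symplectic_exists:
  "\<exists>M. sets M = sets (restrict_space borel (int_surface A B C D)) \<and> emeasure M (int_surface A B C D) \<noteq> \<infinity> \<and>
    (\<forall>\<pi> g U. (\<pi>, g) \<in> charts A B C \<longrightarrow> U \<in> sets M \<longrightarrow> inj_on \<pi> U \<longrightarrow> 0 \<notin> g ` U \<longrightarrow> emeasure M U = chart_volume \<pi> g U)"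
proof -
  obtain m where m: "\<And>u. u \<in> int_surface A B C D \<Longrightarrow> \<exists>\<pi> g. (\<pi>, g) \<in> charts A B C \<and> 1 / real CARD('p) ^ m < padic_norm (g u)"
    using uniform_level by blast
  define \<W> where "\<W> = (\<lambda>u. cube u m) ` (int_surface A B C D)"
  have finW: "finite \<W>" unfolding \<W>_def by (rule finite_cubes) (auto simp: int_surface_eq)
  have "\<forall>W\<in>\<W>. \<exists>u \<pi> g. u \<in> int_surface A B C D \<and> W = cube u m \<and> (\<pi>, g) \<in> charts A B C \<and> 1 / real CARD('p) ^ m < padic_norm (g u)"
    using m unfolding \<W>_def by blast
  then obtain a \<pi>W gW where W: "\<And>W. W \<in> \<W> \<Longrightarrow> a W \<in> int_surface A B C D" "\<And>W. W \<in> \<W> \<Longrightarrow> W = cube (a W) m"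
    "\<And>W. W \<in> \<W> \<Longrightarrow> (\<pi>W W, gW W) \<in> charts A B C" "\<And>W. W \<in> \<W> \<Longrightarrow> 1 / real CARD('p) ^ m < padic_norm (gW W (a W))"
    by metis
  define N where "N W = cell_measure (\<pi>W W) (int_surface A B C D \<inter> cube (a W) m) (ennreal (1 / padic_norm (gW W (a W))))" for W
  define M0 where "M0 = measure_of (space borel) (sets borel) (\<lambda>E. \<Sum>W\<in>\<W>. emeasure (N W) E)"
  have sN: "sets (N W) = sets borel" for W by (simp add: N_def)
  have sM0: "sets M0 = sets borel" unfolding M0_def by (rule sets.sets_measure_of_eq)
  have eN: "emeasure (N W) E = ennreal (1 / padic_norm (gW W (a W))) * emeasure padic_haar2 (\<pi>W W ` (E \<inter> (int_surface A B C D \<inter> cube (a W) m)))"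
    if "W \<in> \<W>" "E \<in> sets borel" for W E
    unfolding N_def
    by (rule emeasure_cell_measure[OF cell_compact chart_continuous[OF W(3)[OF that(1)]] cell_inj[OF W(3)[OF that(1)] W(1)[OF that(1)] W(4)[OF that(1)]] that(2)])
  have eM0: "emeasure M0 E = (\<Sum>W\<in>\<W>. emeasure (N W) E)" if "E \<in> sets borel" for E
    unfolding M0_def by (rule emeasure_sum_measures[OF finW sN that])
  have Sb: "int_surface A B C D \<in> sets borel" by (intro borel_closed closed_int_surface)
  define M where "M = restrict_space M0 (int_surface A B C D)"
  have sM: "sets M = sets (restrict_space borel (int_surface A B C D))" unfolding M_def by (rule sets_restrict_space_cong[OF sM0])
  have eM: "emeasure M E = emeasure M0 E" if "E \<subseteq> int_surface A B C D" for E
    unfolding M_def using Sb that sM0 by (intro emeasure_restrict_space) auto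
  have "emeasure (N W) (int_surface A B C D) \<noteq> \<infinity>" if "W \<in> \<W>" for W
  proof -
    have "emeasure padic_haar2 (\<pi>W W ` (int_surface A B C D \<inter> (int_surface A B C D \<inter> cube (a W) m))) \<le> 1"
      by (rule padic_haar2_le_1[OF chart_image_ints[OF W(3)[OF that]]]) (auto simp: int_surface_eq)
    then have "emeasure padic_haar2 (\<pi>W W ` (int_surface A B C D \<inter> (int_surface A B C D \<inter> cube (a W) m))) \<noteq> \<top>" by (metis ennreal_one_neq_top neq_top_trans)
    then show ?thesis unfolding eN[OF that Sb] by (simp add: ennreal_mult_eq_top_iff)
  qed
  then have fin: "emeasure M (int_surface A B C D) \<noteq> \<infinity>" using finW by (simp add: eM eM0[OF Sb])
  \<comment> \<open>The chart chosen for the cube of \<open>u\<close> and the given chart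
    \<open>\<pi>\<close> are compared on the smaller cell of level n, where both are
    admissible.\<close>
  have small: "emeasure M U = ennreal (1 / padic_norm (g u)) * emeasure padic_haar2 (\<pi> ` U)"
    if ch: "(\<pi>, g) \<in> charts A B C" and u: "u \<in> int_surface A B C D" and n: "n \<ge> m" "1 / real CARD('p) ^ n < padic_norm (g u)"
      and U: "U \<in> sets borel" "U \<subseteq> int_surface A B C D \<inter> cube u n" for \<pi> g u n U
  proof -
    define W0 where "W0 = cube u m"
    have W0: "W0 \<in> \<W>" using u by (simp add: W0_def \<W>_def)
    have UW0: "U \<subseteq> W0" using U(2) cube_mono[OF n(1), of u] by (auto simp: W0_def)
    have au: "cube (a W0) m = cube u m" using W(2)[OF W0] by (simp add: W0_def)
    have zero: "emeasure (N W) U = 0" if "W \<in> \<W> - {W0}" for W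
    proof -
      have WW: "W \<in> \<W>" "W \<noteq> W0" using that by auto
      have "U \<inter> (int_surface A B C D \<inter> cube (a W) m) = {}"
      proof (rule ccontr)
        assume "U \<inter> (int_surface A B C D \<inter> cube (a W) m) \<noteq> {}"
        then obtain v where v: "v \<in> cube u m" "v \<in> cube (a W) m" using UW0 by (auto simp: W0_def)
        then show False using cube_eq[of v u m] cube_eq[of v "a W" m] W(2)[OF WW(1)] WW(2) by (simp add: W0_def)
      qed
      then show ?thesis by (simp add: eN[OF WW(1) U(1)])
    qed
    have "a W0 \<in> int_surface A B C D \<inter> cube u m" using W(1)[OF W0] au center_in_cube by blast
    then have uc: "u \<in> int_surface A B C D \<inter> cube (a W0) m" using u au by simp
    have gu: "padic_norm (gW W0 u) = padic_norm (gW W0 (a W0))"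
      by (rule cell_const[OF W(3)[OF W0] W(1)[OF W0] W(4)[OF W0] uc])
    have lt: "1 / real CARD('p) ^ n < padic_norm (gW W0 u)"
      using W(4)[OF W0] gu card_inverse_power_mono[OF n(1), where 'p='p] by linarith
    have Uc: "U \<inter> (int_surface A B C D \<inter> cube (a W0) m) = U" using U(2) UW0 au by (auto simp: W0_def)
    have Un: "U \<inter> (int_surface A B C D \<inter> cube u n) = U" using U(2) by blast
    have "emeasure M U = emeasure (N W0) U"
      using U by (simp add: eM eM0 sum.remove[OF finW W0] zero)
    also have "\<dots> = ennreal (1 / padic_norm (gW W0 u)) * emeasure padic_haar2 (\<pi>W W0 ` U)"
      by (simp only: eN[OF W0 U(1)] Uc gu)
    also have "\<dots> = emeasure (cell_measure (\<pi>W W0) (int_surface A B C D \<inter> cube u n) (ennreal (1 / padic_norm (gW W0 u)))) U"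
      by (simp only: emeasure_cell_measure[OF cell_compact chart_continuous[OF W(3)[OF W0]] cell_inj[OF W(3)[OF W0] u lt] U(1)] Un)
    also have "\<dots> = emeasure (cell_measure \<pi> (int_surface A B C D \<inter> cube u n) (ennreal (1 / padic_norm (g u)))) U"
      by (simp only: cell_measure_chart_independent[OF W(3)[OF W0] lt ch n(2) u])
    also have "\<dots> = ennreal (1 / padic_norm (g u)) * emeasure padic_haar2 (\<pi> ` U)"
      by (simp only: emeasure_cell_measure[OF cell_compact chart_continuous[OF ch] cell_inj[OF ch u n(2)] U(1)] Un)
    finally show ?thesis .
  qed
  have "emeasure M U = chart_volume \<pi> g U"
    if "(\<pi>, g) \<in> charts A B C" "U \<in> sets M" "inj_on \<pi> U" "0 \<notin> g ` U" for \<pi> g U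
    by (rule chart_formula_from_cells[OF that(1) sM small[OF that(1)] that(2-4)])
  then show ?thesis using sM fin by blast
qed

text \<open>Intersected with a cube of the uniform level, any measurable set is admissible for some
  chart, so the chart formulas determine its mass.\<close>

lemma symplectic_unique:
  assumes M: "sets M = sets (restrict_space borel (int_surface A B C D))" "\<And>\<pi> g U. (\<pi>, g) \<in> charts A B C \<Longrightarrow> U \<in> sets M \<Longrightarrow> inj_on \<pi> U \<Longrightarrow> 0 \<notin> g ` U \<Longrightarrow> emeasure M U = chart_volume \<pi> g U"
    and N: "sets N = sets (restrict_space borel (int_surface A B C D))" "\<And>\<pi> g U. (\<pi>, g) \<in> charts A B C \<Longrightarrow> U \<in> sets N \<Longrightarrow> inj_on \<pi> U \<Longrightarrow> 0 \<notin> g ` U \<Longrightarrow> emeasure N U = chart_volume \<pi> g U"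
  shows "M = N"
proof (rule measure_eqI)
  show "sets M = sets N" using M(1) N(1) by simp
  fix U assume U: "U \<in> sets M"
  have Sb: "int_surface A B C D \<in> sets borel" by (intro borel_closed closed_int_surface)
  have Ub: "U \<in> sets borel" "U \<subseteq> int_surface A B C D" using U Sb by (auto simp: M(1) sets_restrict_space_iff)
  obtain m where m: "\<And>u. u \<in> int_surface A B C D \<Longrightarrow> \<exists>\<pi> g. (\<pi>, g) \<in> charts A B C \<and> 1 / real CARD('p) ^ m < padic_norm (g u)"
    using uniform_level by blast
  define \<W> where "\<W> = (\<lambda>u. cube u m) ` (int_surface A B C D)"
  have finW: "finite \<W>" unfolding \<W>_def by (rule finite_cubes) (auto simp: int_surface_eq)
  have disj: "disjoint_family_on (\<lambda>W. U \<inter> W) \<W>"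
    unfolding disjoint_family_on_def
  proof (intro ballI impI equals0I)
    fix V W u assume VW: "V \<in> \<W>" "W \<in> \<W>" "V \<noteq> W" "u \<in> U \<inter> V \<inter> (U \<inter> W)"
    then obtain v w where "V = cube v m" "W = cube w m" unfolding \<W>_def by blast
    then show False using cube_eq[of u v m] cube_eq[of u w m] VW(3,4) by simp
  qed
  have cover: "U = (\<Union>W\<in>\<W>. U \<inter> W)" using Ub(2) by (auto simp: \<W>_def intro: center_in_cube)
  have Wb: "U \<inter> W \<in> sets borel" if "W \<in> \<W>" for W
  proof -
    obtain w where "W = cube w m" using \<open>W \<in> \<W>\<close> unfolding \<W>_def by blast
    then show ?thesis using Ub(1) borel_closed[OF closed_cube[of w m]] by (simp only: sets.Int)
  qed
  have meas: "U \<inter> W \<in> sets M" "U \<inter> W \<in> sets N" if "W \<in> \<W>" for W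
    using Wb[OF that] Ub(2) Sb by (auto simp: M(1) N(1) sets_restrict_space_iff)
  have eq: "emeasure M (U \<inter> W) = emeasure N (U \<inter> W)" if W: "W \<in> \<W>" for W
  proof -
    obtain u where u: "u \<in> int_surface A B C D" "W = cube u m" using W by (auto simp: \<W>_def)
    obtain \<pi> g where g: "(\<pi>, g) \<in> charts A B C" "1 / real CARD('p) ^ m < padic_norm (g u)" using m[OF u(1)] by blast
    have sub: "U \<inter> W \<subseteq> int_surface A B C D \<inter> cube u m" using Ub(2) u(2) by blast
    have inj: "inj_on \<pi> (U \<inter> W)" using cell_inj[OF g(1) u(1) g(2)] sub by (rule inj_on_subset)
    have nz: "0 \<notin> g ` (U \<inter> W)"
    proof
      assume "0 \<in> g ` (U \<inter> W)"
      then obtain v where v: "v \<in> U \<inter> W" "g v = 0" by auto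
      have "padic_norm (g v) = padic_norm (g u)" using cell_const[OF g(1) u(1) g(2), of v] v(1) sub by blast
      moreover have "padic_norm (g u) > 0" using g(2) card_power_gt_0[where 'p='p and n=m] by (auto intro: order.strict_trans[rotated])
      ultimately show False using v(2) by simp
    qed
    show ?thesis using M(2)[OF g(1) meas(1)[OF W] inj nz] N(2)[OF g(1) meas(2)[OF W] inj nz] by simp
  qed
  have "emeasure M U = emeasure M (\<Union>W\<in>\<W>. U \<inter> W)" using cover by simp
  also have "\<dots> = (\<Sum>W\<in>\<W>. emeasure M (U \<inter> W))"
    by (rule sum_emeasure[symmetric]) (use meas disj finW in auto)
  also have "\<dots> = (\<Sum>W\<in>\<W>. emeasure N (U \<inter> W))" by (rule sum.cong[OF refl eq])
  also have "\<dots> = emeasure N (\<Union>W\<in>\<W>. U \<inter> W)"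
    by (rule sum_emeasure) (use meas disj finW in auto)
  finally show "emeasure M U = emeasure N U" using cover by simp
qed

lemma symplectic_measure_props:
  "sets (symplectic_measure A B C D) = sets (restrict_space borel (int_surface A B C D))"
  "emeasure (symplectic_measure A B C D) (int_surface A B C D) \<noteq> \<infinity>"
  "(\<pi>, g) \<in> charts A B C \<Longrightarrow> U \<in> sets (symplectic_measure A B C D) \<Longrightarrow> inj_on \<pi> U \<Longrightarrow> 0 \<notin> g ` U \<Longrightarrow>
     emeasure (symplectic_measure A B C D) U = chart_volume \<pi> g U"
proof -
  obtain M where M: "sets M = sets (restrict_space borel (int_surface A B C D))" "emeasure M (int_surface A B C D) \<noteq> \<infinity>"
    "\<And>\<pi> g U. (\<pi>, g) \<in> charts A B C \<Longrightarrow> U \<in> sets M \<Longrightarrow> inj_on \<pi> U \<Longrightarrow> 0 \<notin> g ` U \<Longrightarrow> emeasure M U = chart_volume \<pi> g U"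
    using symplectic_exists by blast
  have d: "(\<lambda>(x, y, z). 2 * x - A + y * z) = dx A" "(\<lambda>(x, y, z). 2 * y - B + z * x) = dy B"
    "(\<lambda>(x, y, z). 2 * z - C + x * y) = dz C"
    by (auto simp: dx_def dy_def dz_def fun_eq_iff)
  \<comment> \<open>By smoothness the clause on singular points in the definite description speaks
    of the empty set.\<close>
  have sing: "{u \<in> int_surface A B C D. dx A u = 0 \<and> dy B u = 0 \<and> dz C u = 0} = {}"
    using nonsing by (fastforce simp: charts_def)
  have "symplectic_measure A B C D = M"
    unfolding symplectic_measure_def Let_def d
    unfolding proj_xy_def[symmetric] proj_yz_def[symmetric] proj_zx_def[symmetric] charts_def[symmetric] sing
  proof (rule the_equality)
    show "sets M = sets (restrict_space borel (int_surface A B C D)) \<and>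
      (\<forall>(\<pi>, g) \<in> charts A B C. \<forall>U \<in> sets M. inj_on \<pi> U \<and> 0 \<notin> g ` U \<longrightarrow> emeasure M U = chart_volume \<pi> g U) \<and>
      emeasure M {} = 0"
      using M by auto
  next
    fix N assume N: "sets N = sets (restrict_space borel (int_surface A B C D)) \<and>
      (\<forall>(\<pi>, g) \<in> charts A B C. \<forall>U \<in> sets N. inj_on \<pi> U \<and> 0 \<notin> g ` U \<longrightarrow> emeasure N U = chart_volume \<pi> g U) \<and>
      emeasure N {} = 0"
    show "N = M"
      by (rule symplectic_unique) (use M N in auto)
  qed
  then show "sets (symplectic_measure A B C D) = sets (restrict_space borel (int_surface A B C D))"
    "emeasure (symplectic_measure A B C D) (int_surface A B C D) \<noteq> \<infinity>"
    "(\<pi>, g) \<in> charts A B C \<Longrightarrow> U \<in> sets (symplectic_measure A B C D) \<Longrightarrow> inj_on \<pi> U \<Longrightarrow> 0 \<notin> g ` U \<Longrightarrow>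
     emeasure (symplectic_measure A B C D) U = chart_volume \<pi> g U"
    using M by auto
qed

end

section \<open>Invariance and positivity of the symplectic measure\<close>

lemma vieta_chart:
  assumes "s \<in> vietas A B C"
  shows "\<exists>\<pi> g. (\<pi>, g) \<in> charts A B C \<and> (\<forall>u. \<pi> (s u) = \<pi> u \<and> padic_norm (g (s u)) = padic_norm (g u) \<and> (g u = 0 \<longrightarrow> s u = u))"
proof -
  have yz: "proj_yz (vieta1 A u) = proj_yz u" "dx A (vieta1 A u) = - dx A u" for u
    by (cases u; simp add: proj_yz_def vieta1_def dx_def)+
  have zx: "proj_zx (vieta2 B u) = proj_zx u" "dy B (vieta2 B u) = - dy B u" for u
    by (cases u; simp add: proj_zx_def vieta2_def dy_def)+
  have xy: "proj_xy (vieta3 C u) = proj_xy u" "dz C (vieta3 C u) = - dz C u" for u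
    by (cases u; simp add: proj_xy_def vieta3_def dz_def)+
  from assms consider "s = vieta1 A" | "s = vieta2 B" | "s = vieta3 C" by (auto simp: vietas_def)
  then show ?thesis
  proof cases
    case 1
    then show ?thesis
      by (intro exI[of _ proj_yz] exI[of _ "dx A"] conjI allI impI)
        (simp_all only: yz padic_norm_uminus vieta_fixed_iff, simp add: charts_def)
  next
    case 2
    then show ?thesis
      by (intro exI[of _ proj_zx] exI[of _ "dy B"] conjI allI impI)
        (simp_all only: zx padic_norm_uminus vieta_fixed_iff, simp add: charts_def)
  next
    case 3
    then show ?thesis
      by (intro exI[of _ proj_xy] exI[of _ "dz C"] conjI allI impI)
        (simp_all only: xy padic_norm_uminus vieta_fixed_iff, simp add: charts_def)
  qed
qed

lemma continuous_on_vietas: "s \<in> vietas A B C \<Longrightarrow> continuous_on X s"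
  unfolding vietas_def vieta1_def vieta2_def vieta3_def case_prod_beta
  by (auto intro!: continuous_intros)

lemma vietas_vimage_borel: "s \<in> vietas A B C \<Longrightarrow> E \<in> sets borel \<Longrightarrow> s -` E \<in> sets borel"
  using measurable_sets[OF borel_measurable_continuous_onI[OF continuous_on_vietas], of s A B C E] by simp

lemma vietas_image_eq:
  assumes "s \<in> vietas A B C"
  shows "s ` E = s -` E"
proof (rule Set.set_eqI, rule iffI)
  fix v assume "v \<in> s ` E"
  then obtain u where "u \<in> E" "v = s u" by (rule imageE)
  then show "v \<in> s -` E" by (simp add: vietas_involutive[OF assms])
next
  fix v assume "v \<in> s -` E"
  then show "v \<in> s ` E" by (intro image_eqI[of _ _ "s v"]) (simp_all add: vietas_involutive[OF assms])
qed

lemma finite_vietas [simp]: "finite (vietas A B C)"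
  by (simp add: vietas_def)

lemma int_surface_borel: "int_surface A B C D \<in> sets borel"
  by (intro borel_closed closed_int_surface)

context
  fixes A B C D :: "'p::prime_card padic"
  assumes ints: "A \<in> padic_ints" "B \<in> padic_ints" "C \<in> padic_ints"
    and inf: "\<And>v. v \<in> int_surface A B C D \<Longrightarrow> infinite (vorb A B C v)"
begin

lemma int_surface_nonsingular:
  assumes "u \<in> int_surface A B C D"
  shows "\<exists>\<pi> g. (\<pi>, g) \<in> charts A B C \<and> g u \<noteq> 0"
proof (rule ccontr)
  assume "\<not> ?thesis"
  then have z: "dx A u = 0" "dy B u = 0" "dz C u = 0" by (auto simp: charts_def)
  then have fix_u: "s u = u" if "s \<in> vietas A B C" for s
    using that by (auto simp: vietas_def vieta_fixed_iff)
  have "w = u" if "w \<in> vorb A B C u" for w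
    using that by (induction rule: vorb.induct) (auto simp: fix_u)
  then have "vorb A B C u \<subseteq> {u}" by blast
  then have "finite (vorb A B C u)" by (rule finite_subset) simp
  then show False using inf[OF assms] by blast
qed

lemmas symplectic_props = symplectic_measure_props[OF int_surface_nonsingular]

lemma sets_symplectic_iff: "E \<in> sets (symplectic_measure A B C D) \<longleftrightarrow> E \<in> sets borel \<and> E \<subseteq> int_surface A B C D"
  using int_surface_borel[of A B C D] by (auto simp: symplectic_props(1) sets_restrict_space_iff)

lemma vietas_image_int_surface: "s \<in> vietas A B C \<Longrightarrow> E \<subseteq> int_surface A B C D \<Longrightarrow> s ` E \<subseteq> int_surface A B C D"
  using vietas_int_surface[OF ints] by blast

text \<open>Take the chart preserved by \<open>s\<close>. Where its derivative \<open>g\<close> is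
  nonzero, \<open>E\<close> is cut into cells: \<open>s\<close> preserves both the projection of a
  piece and the norm of \<open>g\<close> on it, hence the volume. Where \<open>g\<close> vanishes,
  \<open>s\<close> is the identity, so nothing has to be known about the mass of that locus.\<close>

lemma symplectic_invariant:
  assumes s: "s \<in> vietas A B C" and E: "E \<in> sets (symplectic_measure A B C D)"
  shows "emeasure (symplectic_measure A B C D) (s ` E) = emeasure (symplectic_measure A B C D) E"
proof -
  obtain \<pi> g where *: "(\<pi>, g) \<in> charts A B C \<and> (\<forall>u. \<pi> (s u) = \<pi> u \<and> padic_norm (g (s u)) = padic_norm (g u) \<and> (g u = 0 \<longrightarrow> s u = u))"
    using vieta_chart[OF s] by (elim exE)
  have ch: "(\<pi>, g) \<in> charts A B C" using * by (rule conjunct1)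
  have \<pi>: "\<pi> (s u) = \<pi> u" and g: "padic_norm (g (s u)) = padic_norm (g u)" "g u = 0 \<Longrightarrow> s u = u" for u
    using spec[OF conjunct2[OF *], of u] by (elim conjE, simp only:)+
  obtain \<V> where V: "countable \<V>" "disjoint \<V>" "\<Union>\<V> = {u \<in> int_surface A B C D. g u \<noteq> 0}"
    "\<And>V. V \<in> \<V> \<Longrightarrow> \<exists>u n. u \<in> int_surface A B C D \<and> n \<ge> 0 \<and> 1 / real CARD('p) ^ n < padic_norm (g u) \<and> V = int_surface A B C D \<inter> cube u n"
  proof (rule countable_chart_cells[where m = 0, OF int_surface_nonsingular ch])
    fix \<V> assume V: "countable \<V>" "disjoint \<V>" "\<Union>\<V> = {u \<in> int_surface A B C D. g u \<noteq> 0}"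
      "\<And>V. V \<in> \<V> \<Longrightarrow> \<exists>u n. u \<in> int_surface A B C D \<and> n \<ge> 0 \<and> 1 / real CARD('p) ^ n < padic_norm (g u) \<and> V = int_surface A B C D \<inter> cube u n"
    show thesis by (rule that[OF V])
  qed
  have Eb: "E \<in> sets borel" "E \<subseteq> int_surface A B C D" using E by (auto simp: sets_symplectic_iff)
  have Vb: "V \<in> sets borel" if VV: "V \<in> \<V>" for V
  proof -
    obtain u n where "V = int_surface A B C D \<inter> cube u n" using V(4)[OF VV] by blast
    then show ?thesis by (simp only:) (intro sets.Int int_surface_borel borel_closed closed_cube)
  qed
  have img: "s ` X \<in> sets (symplectic_measure A B C D)" if "X \<in> sets (symplectic_measure A B C D)" for X
  proof -
    have "X \<in> sets borel" "X \<subseteq> int_surface A B C D" using that unfolding sets_symplectic_iff by blast+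
    then show ?thesis
      unfolding sets_symplectic_iff using vietas_vimage_borel[OF s] vietas_image_int_surface[OF s] vietas_image_eq[OF s] by metis
  qed
  have injs: "inj s" by (rule injI) (metis vietas_involutive[OF s])
  define E1 where "E1 = (\<Union>V\<in>\<V>. E \<inter> V)"
  have E1: "E1 = {u \<in> E. g u \<noteq> 0}" unfolding E1_def using V(3) Eb(2) by blast
  have EV: "E \<inter> V \<in> sets (symplectic_measure A B C D)" if "V \<in> \<V>" for V using Vb[OF that] Eb by (auto simp: sets_symplectic_iff)
  have E1m: "E1 \<in> sets (symplectic_measure A B C D)" unfolding E1_def using V(1) EV by (intro sets.countable_UN') auto
  have disj: "disjoint_family_on (\<lambda>V. E \<inter> V) \<V>" using V(2) by (auto simp: disjoint_family_on_def disjoint_def)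
  have disj': "disjoint_family_on (\<lambda>V. s ` (E \<inter> V)) \<V>"
    unfolding disjoint_family_on_def
  proof (intro ballI impI)
    fix V W assume "V \<in> \<V>" "W \<in> \<V>" "V \<noteq> W"
    then have "(E \<inter> V) \<inter> (E \<inter> W) = {}" using disjoint_family_onD[OF disj] by blast
    then show "s ` (E \<inter> V) \<inter> s ` (E \<inter> W) = {}" using image_Int[OF injs] by (metis image_empty)
  qed
  have piece: "emeasure (symplectic_measure A B C D) (s ` (E \<inter> V)) = emeasure (symplectic_measure A B C D) (E \<inter> V)" if VV: "V \<in> \<V>" for V
  proof -
    obtain u n where u: "u \<in> int_surface A B C D" "1 / real CARD('p) ^ n < padic_norm (g u)" "V = int_surface A B C D \<inter> cube u n" using V(4)[OF VV] by blast
    let ?U = "E \<inter> V" and ?c = "padic_norm (g u)"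
    have sub: "?U \<subseteq> int_surface A B C D \<inter> cube u n" using u(3) by blast
    have inj: "inj_on \<pi> ?U" using cell_inj[OF int_surface_nonsingular ch u(1,2)] sub by (rule inj_on_subset)
    have const: "padic_norm (g v) = ?c" if "v \<in> ?U" for v
      using cell_const[OF int_surface_nonsingular ch u(1,2)] sub that by blast
    have cpos: "?c > 0" using u(2) card_power_gt_0[where 'p='p and n=n] by (auto intro: order.strict_trans[rotated])
    have imb: "\<pi> ` ?U \<in> sets borel"
      by (rule chart_image_borel[OF int_surface_nonsingular ch u(1,2) _ sub]) (use Eb Vb[OF VV] in auto)
    have inj': "inj_on \<pi> (s ` ?U)"
      using inj by (auto simp: inj_on_def \<pi>)
    have im': "\<pi> ` s ` ?U = \<pi> ` ?U" by (simp add: image_image \<pi>)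
    have const': "padic_norm (g v) = ?c" if "v \<in> s ` ?U" for v using that const g(1) by auto
    have nz: "0 \<notin> g ` X" if "\<And>v. v \<in> X \<Longrightarrow> padic_norm (g v) = ?c" for X
      using that cpos by fastforce
    have "emeasure (symplectic_measure A B C D) (s ` ?U) = chart_volume \<pi> g (s ` ?U)"
      by (rule symplectic_props(3)[OF _ ch img[OF EV[OF VV]] inj' nz[OF const']])
    also have "\<dots> = ennreal (1 / ?c) * emeasure padic_haar2 (\<pi> ` ?U)"
      using chart_volume_const[OF inj' const'] imb by (simp only: im')
    also have "\<dots> = chart_volume \<pi> g ?U" by (rule chart_volume_const[OF inj const imb, symmetric])
    also have "\<dots> = emeasure (symplectic_measure A B C D) ?U"
      by (rule symplectic_props(3)[OF _ ch EV[OF VV] inj nz[OF const], symmetric])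
    finally show ?thesis .
  qed
  have "emeasure (symplectic_measure A B C D) (s ` E1) = emeasure (symplectic_measure A B C D) (\<Union>V\<in>\<V>. s ` (E \<inter> V))" by (simp only: E1_def image_UN)
  also have "\<dots> = (\<integral>\<^sup>+V. emeasure (symplectic_measure A B C D) (s ` (E \<inter> V)) \<partial>count_space \<V>)"
    by (rule emeasure_UN_countable[OF _ V(1) disj']) (rule img[OF EV])
  also have "\<dots> = (\<integral>\<^sup>+V. emeasure (symplectic_measure A B C D) (E \<inter> V) \<partial>count_space \<V>)"
    by (rule nn_integral_cong) (simp add: piece)
  also have "\<dots> = emeasure (symplectic_measure A B C D) E1" unfolding E1_def
    by (rule emeasure_UN_countable[OF _ V(1) disj, symmetric]) (rule EV)
  finally have eq1: "emeasure (symplectic_measure A B C D) (s ` E1) = emeasure (symplectic_measure A B C D) E1" .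
  define E0 where "E0 = E - E1"
  have E0m: "E0 \<in> sets (symplectic_measure A B C D)" using E E1m by (simp add: E0_def)
  have E0: "E0 = {u \<in> E. g u = 0}" by (auto simp: E0_def E1)
  have sE0: "s ` E0 = E0"
  proof -
    have "s ` E0 = id ` E0" by (rule image_cong) (simp_all add: E0 g(2))
    then show ?thesis by simp
  qed
  have d1: "E0 \<inter> E1 = {}" "E = E0 \<union> E1" by (auto simp: E0_def E1)
  have d2: "E0 \<inter> s ` E1 = {}"
  proof (rule equals0I)
    fix v assume "v \<in> E0 \<inter> s ` E1"
    then obtain u where "g v = 0" "u \<in> E1" "v = s u" by (auto simp: E0)
    then show False using g(1)[of u] by (auto simp: E1 padic_norm_eq_0)
  qed
  have "s ` E = E0 \<union> s ` E1" using d1(2) sE0 by (metis image_Un)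
  then have "emeasure (symplectic_measure A B C D) (s ` E) = emeasure (symplectic_measure A B C D) E0 + emeasure (symplectic_measure A B C D) (s ` E1)"
    using plus_emeasure[OF E0m img[OF E1m] d2] by simp
  also have "\<dots> = emeasure (symplectic_measure A B C D) E" using plus_emeasure[OF E0m E1m d1(1)] eq1 d1(2) by simp
  finally show ?thesis .
qed

text \<open>The two-step filling at a transverse point, read in the chart that forgets the dependent
  coordinate: the projection of the orbit closure contains a product of balls.\<close>

lemma orbit_closure_fills_chart:
  assumes u: "u \<in> int_surface A B C D"
  shows "\<exists>\<pi> g u0 a b n. (\<pi>, g) \<in> charts A B C \<and> u0 \<in> int_surface A B C D \<and> g u0 \<noteq> 0 \<and>
    cball a (1 / real CARD('p) ^ n) \<times> cball b (1 / real CARD('p) ^ n) \<subseteq>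
      \<pi> ` {v \<in> closure (vorb A B C u). sup_norm (v - u0) < padic_norm (g u0)}"
proof -
  have fill: "\<exists>a b n. cball a (1 / real CARD('p) ^ n) \<times> cball b (1 / real CARD('p) ^ n) \<subseteq>
      proj_zx ` {v \<in> closure (vorb A B C u0). sup_norm (v - u0) < padic_norm (dy B u0)}"
    if t: "A \<in> padic_ints" "B \<in> padic_ints" "C \<in> padic_ints" "u0 \<in> int_surface A B C D" "transverse A B C u0"
    for A B C :: "'p padic" and u0
  proof -
    obtain e where e: "e > 0" "\<And>x z. padic_norm (x - fst u0) \<le> e \<Longrightarrow> padic_norm (z - snd (snd u0)) \<le> e \<Longrightarrow>
      \<exists>v \<in> closure (vorb A B C u0). fst v = x \<and> snd (snd v) = z \<and> sup_norm (v - u0) < padic_norm (dy B u0)"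
      using transverse_fill[OF t] by blast
    obtain n where n: "1 / real CARD('p) ^ n < e" using padic_radius_small[OF e(1), where 'p='p] by blast
    have "cball (snd (snd u0)) (1 / real CARD('p) ^ n) \<times> cball (fst u0) (1 / real CARD('p) ^ n) \<subseteq>
      proj_zx ` {v \<in> closure (vorb A B C u0). sup_norm (v - u0) < padic_norm (dy B u0)}"
    proof (rule subsetI)
      fix w assume "w \<in> cball (snd (snd u0)) (1 / real CARD('p) ^ n) \<times> cball (fst u0) (1 / real CARD('p) ^ n)"
      then have "padic_norm (fst w - snd (snd u0)) \<le> e" "padic_norm (snd w - fst u0) \<le> e"
        using n by (auto simp: mem_padic_cball simp del: mem_cball)
      then obtain v where v: "v \<in> closure (vorb A B C u0)" "fst v = snd w" "snd (snd v) = fst w" "sup_norm (v - u0) < padic_norm (dy B u0)"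
        using e(2) by blast
      moreover have "w = proj_zx v" using v(2,3) by (simp add: proj_zx_def case_prod_beta prod_eq_iff)
      ultimately show "w \<in> proj_zx ` {v \<in> closure (vorb A B C u0). sup_norm (v - u0) < padic_norm (dy B u0)}" by blast
    qed
    then show ?thesis by blast
  qed
  obtain u0 where u0: "u0 \<in> vorb A B C u" "transverse A B C u0 \<or> transverse B C A (cyc u0) \<or> transverse C A B (cyc (cyc u0))"
    using transverse_exists[OF ints u inf] by blast
  have u0S: "u0 \<in> int_surface A B C D" by (rule vorb_int_surface[OF ints u0(1) u])
  have cl: "closure (vorb A B C u0) = closure (vorb A B C u)" using vorb_eq[OF u0(1)] by simp
  show ?thesis using u0(2)
  proof (elim disjE)
    assume t: "transverse A B C u0"
    have "(proj_zx, dy B) \<in> charts A B C" by (simp add: charts_def)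
    moreover have "dy B u0 \<noteq> 0" using t by (simp add: transverse_def)
    ultimately show ?thesis using fill[OF ints u0S t] u0S unfolding cl by blast
  next
    assume t: "transverse B C A (cyc u0)"
    have "proj_zx ` {v \<in> closure (vorb B C A (cyc u0)). sup_norm (v - cyc u0) < padic_norm (dy C (cyc u0))} \<subseteq>
      proj_xy ` {v \<in> closure (vorb A B C u). sup_norm (v - u0) < padic_norm (dz C u0)}"
    proof (rule image_subsetI)
      fix v assume v: "v \<in> {v \<in> closure (vorb B C A (cyc u0)). sup_norm (v - cyc u0) < padic_norm (dy C (cyc u0))}"
      define v' where "v' = cyc (cyc v)"
      have "v = cyc v'" by (simp add: v'_def)
      then show "proj_zx v \<in> proj_xy ` {v \<in> closure (vorb A B C u). sup_norm (v - u0) < padic_norm (dz C u0)}"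
        using v by (intro image_eqI[of _ _ v']) (simp_all add: proj_cyc cyc_closure_vorb cyc_diff d_cyc cl)
    qed
    moreover have "(proj_xy, dz C) \<in> charts A B C" by (simp add: charts_def)
    moreover have "dz C u0 \<noteq> 0" using t by (simp add: transverse_def d_cyc)
    moreover have "cyc u0 \<in> int_surface B C A D" using u0S by simp
    ultimately show ?thesis using fill[OF ints(2,3,1) _ t] u0S by (meson order_trans)
  next
    assume t: "transverse C A B (cyc (cyc u0))"
    have "proj_zx ` {v \<in> closure (vorb C A B (cyc (cyc u0))). sup_norm (v - cyc (cyc u0)) < padic_norm (dy A (cyc (cyc u0)))} \<subseteq>
      proj_yz ` {v \<in> closure (vorb A B C u). sup_norm (v - u0) < padic_norm (dx A u0)}"
    proof (rule image_subsetI)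
      fix v assume v: "v \<in> {v \<in> closure (vorb C A B (cyc (cyc u0))). sup_norm (v - cyc (cyc u0)) < padic_norm (dy A (cyc (cyc u0)))}"
      define v' where "v' = cyc v"
      have "v = cyc (cyc v')" by (simp add: v'_def)
      then show "proj_zx v \<in> proj_yz ` {v \<in> closure (vorb A B C u). sup_norm (v - u0) < padic_norm (dx A u0)}"
        using v by (intro image_eqI[of _ _ v']) (simp_all add: proj_cyc cyc_closure_vorb cyc_diff d_cyc cl)
    qed
    moreover have "(proj_yz, dx A) \<in> charts A B C" by (simp add: charts_def)
    moreover have "dx A u0 \<noteq> 0" using t by (simp add: transverse_def d_cyc)
    moreover have "cyc (cyc u0) \<in> int_surface C A B D" using u0S by simp
    ultimately show ?thesis using fill[OF ints(3,1,2) _ t] u0S by (meson order_trans)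
  qed
qed

text \<open>Strictly within rho = |g u0| of \<open>u0\<close> the chart is injective with constant
  density 1/rho, and the projection of this part of the closure contains a product of balls, which
  has positive Haar measure.\<close>

lemma symplectic_positive:
  assumes u: "u \<in> int_surface A B C D"
  shows "emeasure (symplectic_measure A B C D) (closure (vorb A B C u)) > 0"
proof -
  obtain \<pi> g u0 a b n where *: "(\<pi>, g) \<in> charts A B C" "u0 \<in> int_surface A B C D" "g u0 \<noteq> 0"
    "cball a (1 / real CARD('p) ^ n) \<times> cball b (1 / real CARD('p) ^ n) \<subseteq>
      \<pi> ` {v \<in> closure (vorb A B C u). sup_norm (v - u0) < padic_norm (g u0)}"
    using orbit_closure_fills_chart[OF u] by blast
  define \<rho> where "\<rho> = padic_norm (g u0)"
  define U where "U = {v \<in> closure (vorb A B C u). sup_norm (v - u0) < \<rho>}"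
  have \<rho>: "\<rho> > 0" using *(3) by (simp add: \<rho>_def padic_norm_pos)
  have OS: "closure (vorb A B C u) \<subseteq> int_surface A B C D" by (rule closure_vorb_int_surface[OF ints u])
  have "open {v. sup_norm (v - u0) < \<rho>}"
    unfolding open_sup_norm
  proof
    fix v assume v: "v \<in> {v. sup_norm (v - u0) < \<rho>}"
    have "sup_norm (w - u0) < \<rho>" if "sup_norm (w - v) \<le> \<rho> / 2" for w
    proof -
      have "sup_norm (w - u0) \<le> max (\<rho> / 2) (sup_norm (v - u0))"
        by (rule sup_norm_trans[of w v]) (use that in auto)
      then show ?thesis using v \<rho> by auto
    qed
    then show "\<exists>e>0. \<forall>w. sup_norm (w - v) \<le> e \<longrightarrow> w \<in> {v. sup_norm (v - u0) < \<rho>}"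
      using \<rho> by (intro exI[of _ "\<rho> / 2"]) simp
  qed
  then have "closure (vorb A B C u) \<inter> {v. sup_norm (v - u0) < \<rho>} \<in> sets borel" by (intro sets.Int) auto
  moreover have "closure (vorb A B C u) \<inter> {v. sup_norm (v - u0) < \<rho>} = U" by (auto simp: U_def)
  ultimately have Ub: "U \<in> sets (symplectic_measure A B C D)" using OS by (auto simp: sets_symplectic_iff U_def)
  have Ob: "closure (vorb A B C u) \<in> sets (symplectic_measure A B C D)" using OS by (auto simp: sets_symplectic_iff)
  have const: "padic_norm (g v) = \<rho>" if "v \<in> U" for v
  proof -
    have "padic_norm (g u0 - g v) < padic_norm (g u0)"
      using chart_lipschitz[OF *(1), of u0 v] that *(2) OS by (auto simp: U_def \<rho>_def int_surface_eq sup_norm_diff_commute)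
    then show ?thesis using padic_norm_eq_of_close by (simp add: \<rho>_def)
  qed
  have inj: "inj_on \<pi> U"
  proof (rule inj_onI, rule ccontr)
    fix v w assume vw: "v \<in> U" "w \<in> U" "\<pi> v = \<pi> w" "v \<noteq> w"
    have "sup_norm (v - w) = \<rho>"
    proof -
      have "v \<in> int_surface A B C D" "w \<in> int_surface A B C D" using vw(1,2) OS by (auto simp: U_def)
      then have "v \<in> surface A B C D" "w \<in> surface A B C D" by (simp_all add: int_surface_eq)
      from chart_fibre[OF *(1) this vw(3,4)] const[OF vw(1)] show ?thesis by simp
    qed
    moreover have "sup_norm (v - w) \<le> max (sup_norm (v - u0)) (sup_norm (w - u0))"
      by (rule sup_norm_trans[of v u0]) (simp_all add: sup_norm_diff_commute)
    ultimately show False using vw(1,2) by (auto simp: U_def)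
  qed
  have nz: "0 \<notin> g ` U" using const \<rho> by fastforce
  let ?Q = "cball a (1 / real CARD('p) ^ n) \<times> cball b (1 / real CARD('p) ^ n)"
  have Qb: "?Q \<in> sets padic_haar2" by (rule pair_measureI) auto
  have "0 < ennreal (1 / \<rho>) * (ennreal (1 / real CARD('p) ^ n) * ennreal (1 / real CARD('p) ^ n))"
    using \<rho> by (simp add: ennreal_zero_less_mult_iff)
  also have "\<dots> = ennreal (1 / \<rho>) * emeasure padic_haar2 ?Q"
    by (simp add: padic_haar2_Times padic_haar_cball)
  also have "\<dots> = (\<integral>\<^sup>+w. ennreal (1 / \<rho>) * indicator ?Q w \<partial>padic_haar2)"
    using Qb by (rule nn_integral_cmult_indicator[symmetric])
  also have "\<dots> \<le> chart_volume \<pi> g U"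
    unfolding chart_volume_def
  proof (rule nn_integral_mono)
    fix w
    show "ennreal (1 / \<rho>) * indicator ?Q w \<le> ennreal (1 / padic_norm (g (the_inv_into U \<pi> w))) * indicator (\<pi> ` U) w"
    proof (cases "w \<in> ?Q")
      case True
      then have w: "w \<in> \<pi> ` U" using *(4) by (auto simp: U_def \<rho>_def)
      then have "padic_norm (g (the_inv_into U \<pi> w)) = \<rho>" using const the_inv_into_f_f[OF inj] by auto
      then show ?thesis using True w by simp
    qed simp
  qed
  also have "\<dots> = emeasure (symplectic_measure A B C D) U" by (rule symplectic_props(3)[OF _ *(1) Ub inj nz, symmetric])
  also have "\<dots> \<le> emeasure (symplectic_measure A B C D) (closure (vorb A B C u))"
    using Ob by (intro emeasure_mono) (auto simp: U_def)
  finally show ?thesis .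
qed

section \<open>Stationary measures on orbit closures\<close>

lemma orbit_closure_vimage:
  assumes u: "u \<in> int_surface A B C D" and s: "s \<in> vietas A B C"
  shows "s v \<in> closure (vorb A B C u) \<longleftrightarrow> v \<in> closure (vorb A B C u)"
proof -
  have cube: "w \<in> int_cube" if "w \<in> int_surface A B C D" for w using that by (simp add: int_surface_eq)
  have imp: "s v \<in> closure (vorb A B C u)" if v: "v \<in> closure (vorb A B C u)" for v
  proof -
    have "v \<in> int_surface A B C D" using v closure_vorb_int_surface[OF ints u] by blast
    moreover have "s v \<in> closure (vorb A B C v)" using vorb_step[OF vorb_base s] closure_subset by blast
    ultimately show ?thesis using closure_vorb_trans[OF ints cube[OF u] cube v] by blast
  qed
  show ?thesis using imp[of v] imp[of "s v"] by (auto simp: vietas_involutive[OF s])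
qed

text \<open>The masses of the balls of a given radius form a harmonic function on a finite transitive graph,
  hence are constant.\<close>

lemma stationary_cube_mass:
  fixes N :: "'p padic3 measure"
  assumes N: "finite_measure N" "sets N = sets borel" and u: "u \<in> int_surface A B C D"
    and p: "\<And>s. s \<in> vietas A B C \<Longrightarrow> p s > 0" "(\<Sum>s\<in>vietas A B C. p s) = (1::real)"
    and stat: "\<And>E. E \<in> sets borel \<Longrightarrow> (\<Sum>s\<in>vietas A B C. p s * measure N (s -` E)) = measure N E"
    and v: "v \<in> closure (vorb A B C u)"
  shows "real (card ((\<lambda>w. cube w n) ` closure (vorb A B C u))) * measure N (cube v n \<inter> closure (vorb A B C u)) =
    measure N (closure (vorb A B C u))"
proof -
  interpret N: finite_measure N by (rule N(1))
  let ?O = "closure (vorb A B C u)"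
  have OS: "?O \<subseteq> int_surface A B C D" by (rule closure_vorb_int_surface[OF ints u])
  have cube: "w \<in> int_cube" if "w \<in> ?O" for w using that OS by (auto simp: int_surface_eq)
  have cu: "u \<in> int_cube" using u by (simp add: int_surface_eq)
  have cubeb: "cube w n \<in> sets borel" for w :: "'p padic3" by (intro borel_closed closed_cube)
  define h where "h w = measure N (cube w n \<inter> ?O)" for w
  have vim: "s -` (cube w n \<inter> ?O) = cube (s w) n \<inter> ?O" if w: "w \<in> ?O" and s: "s \<in> vietas A B C" for w s
  proof (rule Set.set_eqI)
    fix y
    have "s y \<in> cube w n \<longleftrightarrow> y \<in> cube (s w) n" if y: "y \<in> ?O"
    proof -
      have "s w \<in> int_cube" using vietas_int_cube[OF ints s cube[OF w]] .
      then have "sup_norm (s y - s (s w)) = sup_norm (y - s w)" using vietas_isometry[OF ints s cube[OF y]] by blast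
      then show ?thesis by (simp add: mem_cube vietas_involutive[OF s])
    qed
    then show "y \<in> s -` (cube w n \<inter> ?O) \<longleftrightarrow> y \<in> cube (s w) n \<inter> ?O"
      using orbit_closure_vimage[OF u s, of y] by auto
  qed
  have harm: "(\<Sum>s\<in>vietas A B C. p s * h (s w)) = h w" if w: "w \<in> ?O" for w
  proof -
    have "(\<Sum>s\<in>vietas A B C. p s * measure N (s -` (cube w n \<inter> ?O))) = measure N (cube w n \<inter> ?O)"
      by (rule stat) (use cubeb in auto)
    moreover have "(\<Sum>s\<in>vietas A B C. p s * measure N (s -` (cube w n \<inter> ?O))) = (\<Sum>s\<in>vietas A B C. p s * h (s w))"
      unfolding h_def by (rule sum.cong[OF refl]) (simp only: vim[OF w])
    ultimately show ?thesis by (simp add: h_def)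
  qed
  let ?C = "(\<lambda>w. cube w n) ` ?O"
  have finC: "finite ?C" by (rule finite_cubes) (use cube in blast)
  have hC: "h w = measure N (cube w n \<inter> ?O)" for w by (simp add: h_def)
  have fin_range: "finite (h ` ?O)"
  proof -
    have "h ` ?O = (\<lambda>W. measure N (W \<inter> ?O)) ` ?C" by (simp add: image_image h_def)
    then show ?thesis using finC by simp
  qed
  have ne: "?O \<noteq> {}" by (rule ex_in_conv[THEN iffD1, OF exI, OF v])
  define M where "M = Max (h ` ?O)"
  have "M \<in> h ` ?O" unfolding M_def by (rule Max_in[OF fin_range]) (simp only: image_is_empty ne not_False_eq_True)
  then obtain v0 where "M = h v0" and v0_in: "v0 \<in> ?O" by (rule imageE)
  then have v0: "v0 \<in> ?O" "h v0 = M" by simp_all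
  have le: "h w \<le> M" if "w \<in> ?O" for w unfolding M_def by (rule Max_ge[OF fin_range imageI[OF that]])
  \<comment> \<open>At a maximum the weighted average of the differences \<open>M - h\<close> is 0
    although none is negative; since all weights are positive, every neighbour is a maximum
    too.\<close>
  have max_orb: "w \<in> ?O \<and> h w = M" if "w \<in> vorb A B C v0" for w
    using that
  proof (induction rule: vorb.induct)
    case (vorb_step w s)
    have sO: "t w \<in> ?O" if "t \<in> vietas A B C" for t using orbit_closure_vimage[OF u that] vorb_step.IH by blast
    have "(\<Sum>t\<in>vietas A B C. p t * (M - h (t w))) = M * (\<Sum>t\<in>vietas A B C. p t) - (\<Sum>t\<in>vietas A B C. p t * h (t w))"
      by (simp add: sum_distrib_left sum_subtractf algebra_simps)
    also have "\<dots> = 0" using harm[of w] vorb_step.IH p(2) by simp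
    finally have z: "(\<Sum>t\<in>vietas A B C. p t * (M - h (t w))) = 0" .
    have "p s * (M - h (s w)) = 0"
    proof (rule sum_nonneg_0[OF finite_vietas _ z vorb_step.hyps(2)])
      fix t assume "t \<in> vietas A B C"
      then show "0 \<le> p t * (M - h (t w))" using p(1)[of t] le[OF sO] by (intro mult_nonneg_nonneg) auto
    qed
    then show ?case using p(1)[OF vorb_step.hyps(2)] sO[OF vorb_step.hyps(2)] by simp
  qed (use v0 in simp)
  have const: "h w = M" if w: "w \<in> ?O" for w
  proof -
    have "closure (vorb A B C v0) = ?O" by (rule closure_vorb_eq[OF ints cu cube[OF v0(1)] v0(1)])
    then have "w \<in> closure (vorb A B C v0)" using w by simp
    \<comment> \<open>The orbit of the maximum point is dense in \<open>?O\<close>, so it meets the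
      cube of every point.\<close>
    then obtain w' where w': "w' \<in> vorb A B C v0" "sup_norm (w - w') \<le> 1 / real CARD('p) ^ n"
      unfolding closure_sup_norm using card_power_gt_0[where 'p='p and n=n] by (metis zero_less_divide_1_iff)
    then have "w' \<in> cube w n" by (simp add: mem_cube sup_norm_diff_commute)
    then have "h w = h w'" unfolding h_def using cube_eq by metis
    then show ?thesis using max_orb[OF w'(1)] by simp
  qed
  have disj: "disjoint_family_on (\<lambda>W. W \<inter> ?O) ?C"
    unfolding disjoint_family_on_def
  proof (intro ballI impI equals0I)
    fix V W y assume VW: "V \<in> ?C" "W \<in> ?C" "V \<noteq> W" "y \<in> V \<inter> ?O \<inter> (W \<inter> ?O)"
    then obtain v' w' where "V = cube v' n" "W = cube w' n" by blast
    then show False using cube_eq[of y v' n] cube_eq[of y w' n] VW(3,4) by simp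
  qed
  have "?O = (\<Union>W\<in>?C. W \<inter> ?O)" by (auto intro: center_in_cube)
  then have "measure N ?O = measure N (\<Union>W\<in>?C. W \<inter> ?O)" by (rule arg_cong)
  also have "\<dots> = (\<Sum>W\<in>?C. measure N (W \<inter> ?O))"
    by (rule N.finite_measure_finite_Union[OF finC _ disj]) (use cubeb in \<open>auto simp: N(2)\<close>)
  also have "\<dots> = (\<Sum>W\<in>?C. M)"
  proof (rule sum.cong[OF refl])
    fix W assume "W \<in> ?C"
    then obtain w where "w \<in> ?O" "W = cube w n" by blast
    then show "measure N (W \<inter> ?O) = M" using const hC by simp
  qed
  also have "\<dots> = real (card ?C) * h v" using const[OF v] by simp
  finally show ?thesis by (simp add: h_def)
qed

text \<open>Within the orbit closure, each cube has the same fraction of the total mass for both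
  measures, since this fraction only counts cubes. The cross-multiplied measures therefore agree on
  cubes; no division by a total mass, which may be 0, is made.\<close>

lemma stationary_proportional:
  fixes N N' :: "'p padic3 measure"
  assumes N: "finite_measure N" "sets N = sets borel" "finite_measure N'" "sets N' = sets borel" and u: "u \<in> int_surface A B C D"
    and p: "\<And>s. s \<in> vietas A B C \<Longrightarrow> p s > 0" "(\<Sum>s\<in>vietas A B C. p s) = (1::real)"
    and stat: "\<And>E. E \<in> sets borel \<Longrightarrow> (\<Sum>s\<in>vietas A B C. p s * measure N (s -` E)) = measure N E"
      "\<And>E. E \<in> sets borel \<Longrightarrow> (\<Sum>s\<in>vietas A B C. p s * measure N' (s -` E)) = measure N' E"
    and E: "E \<in> sets borel" "E \<subseteq> closure (vorb A B C u)"
  shows "measure N' (closure (vorb A B C u)) * measure N E = measure N (closure (vorb A B C u)) * measure N' E"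
proof -
  interpret N: finite_measure N by (rule N(1))
  interpret N': finite_measure N' by (rule N(3))
  let ?O = "closure (vorb A B C u)"
  have Ob: "?O \<in> sets borel" by simp
  define K where "K = scale_measure (ennreal (measure N' ?O)) (density N (indicator ?O))"
  define K' where "K' = scale_measure (ennreal (measure N ?O)) (density N' (indicator ?O))"
  have eK: "emeasure K X = ennreal (measure N' ?O * measure N (?O \<inter> X))" if "X \<in> sets borel" for X
    using that N Ob by (simp add: K_def emeasure_restricted N.emeasure_eq_measure ennreal_mult)
  have eK': "emeasure K' X = ennreal (measure N ?O * measure N' (?O \<inter> X))" if "X \<in> sets borel" for X
    using that N Ob by (simp add: K'_def emeasure_restricted N'.emeasure_eq_measure ennreal_mult)
  have "K = K'"
  proof (rule measure_eqI_basis[OF cubes_basis cubes_Int])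
    show "sets K = sets borel" "sets K' = sets borel" using N by (simp_all add: K_def K'_def)
    fix X :: "'p padic3 set" assume "X \<in> cubes"
    then obtain a n where X: "X = cube a n" by (auto simp: cubes_def)
    have Xb: "X \<in> sets borel" unfolding X by (intro borel_closed closed_cube)
    show "emeasure K X \<noteq> \<infinity>" by (simp add: eK[OF Xb])
    have "measure N' ?O * measure N (?O \<inter> X) = measure N ?O * measure N' (?O \<inter> X)"
    proof (cases "?O \<inter> X = {}")
      case False
      then obtain v where v: "v \<in> ?O" "v \<in> cube a n" using X by blast
      have "X = cube v n" using cube_eq[OF v(2)] X by simp
      then have eq: "?O \<inter> X = cube v n \<inter> ?O" by blast
      let ?c = "real (card ((\<lambda>w. cube w n) ` ?O))"
      have c: "?c * measure N (?O \<inter> X) = measure N ?O" "?c * measure N' (?O \<inter> X) = measure N' ?O"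
        unfolding eq using stationary_cube_mass[OF N(1,2) u p stat(1) v(1)] stationary_cube_mass[OF N(3,4) u p stat(2) v(1)] by auto
      show ?thesis by (simp only: c[symmetric] mult_ac)
    qed simp
    then show "emeasure K X = emeasure K' X" by (simp add: eK[OF Xb] eK'[OF Xb])
  qed
  then have "ennreal (measure N' ?O * measure N (?O \<inter> E)) = ennreal (measure N ?O * measure N' (?O \<inter> E))"
    using eK[OF E(1)] eK'[OF E(1)] by simp
  moreover have "?O \<inter> E = E" using E(2) by (rule Int_absorb1)
  ultimately show ?thesis by (simp add: ennreal_inj)
qed

end

section \<open>Escape of mass\<close>

text \<open>On the surface, the equation forces \<open>|x| = |y| |z|\<close> whenever all coordinates are large and \<open>x\<close> is
  the largest one. Off the integral points every orbit is a tree in which the involution of the dominant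
  coordinate leads to the parent.\<close>

definition dominant :: "'p::prime_card padic3 \<Rightarrow> bool" where
  "dominant u \<longleftrightarrow> padic_norm (fst u) > 1 \<and> padic_norm (fst (snd u)) > 1 \<and> padic_norm (snd (snd u)) > 1 \<and>
     padic_norm (fst u) = padic_norm (fst (snd u)) * padic_norm (snd (snd u))"

section \<open>Ascent and descent among non-integral points\<close>

lemma dominant_exclusive:
  assumes "dominant u"
  shows "\<not> dominant (cyc u)" "\<not> dominant (cyc (cyc u))"
proof -
  let ?a = "padic_norm (fst u)" and ?b = "padic_norm (fst (snd u))" and ?c = "padic_norm (snd (snd u))"
  have *: "?a > 1" "?b > 1" "?c > 1" "?a = ?b * ?c" using assms by (auto simp: dominant_def)
  have lt: "?b < ?a" "?c < ?a" using *(2,3) unfolding *(4) by simp_all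
  show "\<not> dominant (cyc u)"
  proof
    assume "dominant (cyc u)"
    then have "?b = ?c * ?a" by (simp add: dominant_def cyc_def)
    then have "?a < ?b" using *(1,3) by simp
    then show False using lt by simp
  qed
  show "\<not> dominant (cyc (cyc u))"
  proof
    assume "dominant (cyc (cyc u))"
    then have "?c = ?a * ?b" by (simp add: dominant_def cyc_def)
    then have "?a < ?c" using *(1,2) by simp
    then show False using lt by simp
  qed
qed

text \<open>The term y z outweighs both x and A, so the new first coordinate has norm exactly |y|
  |z|.\<close>

lemma dominant_vieta1:
  assumes "A \<in> padic_ints" "padic_norm y > 1" "padic_norm z > 1" "padic_norm x < padic_norm y * padic_norm z"
  shows "dominant (vieta1 A (x, y, z))"
proof -
  have "padic_norm y * padic_norm z > 1" using assms(2,3) by (metis less_1_mult)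
  then have "padic_norm (- x + A) < padic_norm (- (y * z))"
    using assms by (intro padic_norm_add_less) (auto simp: padic_norm_uminus padic_norm_mult padic_ints_def)
  then have "padic_norm (- (y * z) + (- x + A)) = padic_norm (- (y * z))" by (rule padic_norm_add_eq)
  then have "padic_norm (- x + A - y * z) = padic_norm y * padic_norm z"
    by (simp add: padic_norm_uminus padic_norm_mult algebra_simps)
  then show ?thesis using assms(2,3) \<open>padic_norm y * padic_norm z > 1\<close> by (simp add: dominant_def vieta1_def)
qed

text \<open>Each of the other two involutions leads from a dominant point to a child, which is
  dominant in the coordinate just changed.\<close>

lemma dominant_step:
  assumes "A \<in> padic_ints" "B \<in> padic_ints" "C \<in> padic_ints" and u: "dominant u"
  shows "dominant (cyc (vieta2 B u))" "dominant (cyc (cyc (vieta3 C u)))"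
proof -
  obtain x y z where [simp]: "u = (x, y, z)" by (cases u)
  let ?a = "padic_norm x" and ?b = "padic_norm y" and ?c = "padic_norm z"
  have *: "?a > 1" "?b > 1" "?c > 1" "?a = ?b * ?c" using u by (auto simp: dominant_def)
  have lt: "?b < ?a" "?c < ?a" using *(2,3) unfolding *(4) by simp_all
  have "?b < ?c * ?a" using lt(1) *(1,3) by (smt (verit) mult_less_cancel_right1)
  then show "dominant (cyc (vieta2 B u))" unfolding cyc_vieta using dominant_vieta1[OF assms(2) *(3,1)] by simp
  have "?c < ?a * ?b" using lt(2) *(1,2) by (smt (verit) mult_less_cancel_left1)
  then show "dominant (cyc (cyc (vieta3 C u)))" unfolding cyc_vieta using dominant_vieta1[OF assms(3) *(1,2)] by simp
qed

text \<open>By Vieta the old and the new first coordinate have product y^2 + z^2 - B y - C z - D.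
  With M the larger of |y| and |z|, this has norm at most M^2, while |x| = |y| |z| is at least M;
  hence the new coordinate has norm at most M. The smaller of |y| and |z| is at least p, so M is at
  most |x| / p.\<close>

lemma dominant_descent:
  fixes u :: "'p::prime_card padic3"
  assumes ints: "A \<in> padic_ints" "B \<in> padic_ints" "C \<in> padic_ints" "D \<in> padic_ints"
    and u: "u \<in> surface A B C D" "dominant u"
  shows "sup_norm (vieta1 A u) \<le> sup_norm u / real CARD('p)"
proof -
  obtain x y z where [simp]: "u = (x, y, z)" by (cases u)
  let ?a = "padic_norm x" and ?b = "padic_norm y" and ?c = "padic_norm z" and ?P = "real CARD('p)"
  have P: "?P > 1" using card_prime_gt_1[where 'p='p] by simp
  have *: "?a > 1" "?b > 1" "?c > 1" "?a = ?b * ?c" using u(2) by (auto simp: dominant_def)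
  have bP: "?b \<ge> ?P" "?c \<ge> ?P" using padic_norm_gt_1_imp *(2,3) by auto
  define M where "M = max ?b ?c"
  define x' where "x' = - x + A - y * z"
  have M: "M > 1" "?b \<le> M" "?c \<le> M" using *(2) by (auto simp: M_def)
  have "?b * ?P \<le> ?a" "?c * ?P \<le> ?a" unfolding *(4) using bP *(2,3) by (auto simp: mult.commute[of ?c])
  then have MP: "M \<le> ?a / ?P" using P by (auto simp: M_def field_simps)
  have sq: "v \<le> M * M" if "v \<le> M" for v using that M(1) by (smt (verit) mult_less_cancel_left1)
  have eq: "x * x' = y\<^sup>2 + z\<^sup>2 - B * y - C * z - D"
    using u(1) by (simp add: surface_def x'_def algebra_simps power2_eq_square)
  have "?b * ?b \<le> M * M" "?c * ?c \<le> M * M" using M *(2,3) by (auto intro!: mult_mono)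
  moreover have "padic_norm (B * y) \<le> M * M" "padic_norm (C * z) \<le> M * M"
    using ints(2,3) sq[OF M(2)] sq[OF M(3)] by (auto simp: padic_ints_def intro!: padic_norm_mult_le')
  moreover have "padic_norm D \<le> M * M" using ints(4) sq[of 1] M(1) by (auto simp: padic_ints_def)
  ultimately have "padic_norm (y\<^sup>2 + z\<^sup>2 - B * y - C * z - D) \<le> M * M"
    by (intro padic_norm_diff_le padic_norm_add_le) (simp_all add: padic_norm_mult power2_eq_square)
  then have "?b * ?c * padic_norm x' \<le> M * M" unfolding eq[symmetric] padic_norm_mult *(4) .
  moreover have "M \<le> ?b * ?c" unfolding M_def using *(2,3) by (auto simp: max_def)
  ultimately have "M * padic_norm x' \<le> M * M"
    using padic_norm_nonneg[of x'] by (meson mult_right_mono order_trans)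
  then have "padic_norm x' \<le> M" using M(1) by simp
  then have "sup_norm (vieta1 A u) \<le> M" using M by (simp add: vieta1_def sup_norm_le_iff x'_def)
  also have "\<dots> \<le> sup_norm u / ?P" using MP P padic_norm_le_sup_norm(1)[of u] by (auto simp: field_simps)
  finally show ?thesis .
qed

text \<open>If y and z were integral, every term other than x^2 would have norm at most |x|, and
  nothing could balance x^2.\<close>

lemma surface_single_large:
  assumes ints: "A \<in> padic_ints" "B \<in> padic_ints" "C \<in> padic_ints" "D \<in> padic_ints"
    and u: "(x, y, z) \<in> surface A B C D" and x: "padic_norm x > 1"
  shows "padic_norm y > 1 \<or> padic_norm z > 1"
proof (rule ccontr)
  assume "\<not> ?thesis"
  then have yz: "padic_norm y \<le> 1" "padic_norm z \<le> 1" by auto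
  let ?a = "padic_norm x"
  have eq: "x * x = A * x + B * y + C * z + D - y * y - z * z - x * (y * z)"
    using u by (simp add: surface_def algebra_simps power2_eq_square)
  have yz': "padic_norm (y * z) \<le> 1" using yz by (intro padic_norm_mult_le)
  have le: "padic_norm w \<le> ?a" if "padic_norm w \<le> 1" for w using that x by linarith
  have Ax: "padic_norm (A * x) \<le> ?a" by (rule padic_norm_mult_le') (use ints(1) in \<open>simp_all add: padic_ints_def\<close>)
  have xyz: "padic_norm (x * (y * z)) \<le> ?a" by (rule padic_norm_mult_le[OF order_refl yz'])
  have one: "padic_norm (B * y) \<le> 1" "padic_norm (C * z) \<le> 1" "padic_norm D \<le> 1" "padic_norm (y * y) \<le> 1" "padic_norm (z * z) \<le> 1"
    using ints yz by (auto simp: padic_ints_def intro: padic_norm_mult_le)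
  have "padic_norm (A * x + B * y + C * z + D - y * y - z * z - x * (y * z)) \<le> ?a"
    by (intro padic_norm_diff_le padic_norm_add_le Ax xyz le[OF one(1)] le[OF one(2)] le[OF one(3)] le[OF one(4)] le[OF one(5)])
  then have "?a * ?a \<le> ?a" unfolding eq[symmetric] padic_norm_mult .
  then show False using x by simp
qed

text \<open>Unless |x| = |y| |z|, there is no cancellation in x + y z, and x (x + y z) is strictly
  larger than all remaining terms of the equation.\<close>

lemma surface_large_dominant:
  assumes ints: "A \<in> padic_ints" "B \<in> padic_ints" "C \<in> padic_ints" "D \<in> padic_ints"
    and u: "u = (x, y, z)" "u \<in> surface A B C D" and big: "padic_norm x > 1" "padic_norm y > 1" "padic_norm z > 1"
    and mx: "padic_norm y \<le> padic_norm x" "padic_norm z \<le> padic_norm x"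
  shows "dominant u"
proof (rule ccontr)
  let ?a = "padic_norm x" and ?b = "padic_norm y" and ?c = "padic_norm z"
  assume "\<not> dominant u"
  then have ne: "?a \<noteq> ?b * ?c" using big by (simp add: dominant_def u(1))
  have eq: "x * (x + y * z) = A * x + B * y + C * z + D - y * y - z * z"
    using u by (simp add: surface_def algebra_simps power2_eq_square)
  define R where "R = padic_norm (A * x + B * y + C * z + D - y * y - z * z)"
  have le: "R < r" if r: "?a < r" "?b * ?b < r" "?c * ?c < r" for r
    unfolding R_def using ints big mx r
    by (intro padic_norm_diff_less padic_norm_add_less)
      (auto simp: padic_norm_mult padic_ints_def padic_norm_nonneg intro: le_less_trans[OF mult_left_le_one_le])
  show False
  proof (cases "?a < ?b * ?c")
    case True
    then have "padic_norm (y * z + x) = padic_norm (y * z)" by (intro padic_norm_add_eq) (simp add: padic_norm_mult)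
    then have R: "R = ?a * (?b * ?c)" unfolding R_def eq[symmetric] padic_norm_mult by (simp add: add.commute padic_norm_mult)
    have 1: "?a < ?a * (?b * ?c)" using big by (simp add: less_1_mult)
    have "?b * ?b \<le> ?a * ?b" using mx big by simp
    also have "\<dots> < (?a * ?b) * ?c" using big by simp
    finally have 2: "?b * ?b < ?a * (?b * ?c)" by (simp add: mult.assoc)
    have "?c * ?c \<le> ?a * ?c" using mx big by simp
    also have "\<dots> < (?a * ?c) * ?b" using big by simp
    finally have 3: "?c * ?c < ?a * (?b * ?c)" by (simp add: mult_ac)
    show False using le[OF 1 2 3] R by simp
  next
    case False
    then have lt: "?b * ?c < ?a" using ne by simp
    then have "padic_norm (x + y * z) = ?a" by (intro padic_norm_add_eq) (simp add: padic_norm_mult)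
    then have R: "R = ?a * ?a" unfolding R_def eq[symmetric] padic_norm_mult by simp
    have "?b < ?b * ?c" "?c < ?b * ?c" using big by simp_all
    then have "?b < ?a" "?c < ?a" using lt by linarith+
    then have "?b * ?b < ?a * ?a" "?c * ?c < ?a * ?a" using big by (auto intro!: mult_strict_mono)
    moreover have "?a < ?a * ?a" using big by simp
    ultimately show False using le[of "?a * ?a"] R by simp
  qed
qed

text \<open>At such a point exactly two coordinates are non-integral, and changing the integral one
  leads to a dominant point.\<close>

lemma not_dominant_imp:
  fixes u :: "'p::prime_card padic3"
  assumes ints: "A \<in> padic_ints" "B \<in> padic_ints" "C \<in> padic_ints" "D \<in> padic_ints"
    and u: "u \<in> surface A B C D" "u \<notin> int_cube" and nd: "\<not> dominant u" "\<not> dominant (cyc u)" "\<not> dominant (cyc (cyc u))"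
  shows "dominant (vieta1 A u) \<or> dominant (cyc (vieta2 B u)) \<or> dominant (cyc (cyc (vieta3 C u)))"
proof -
  obtain x y z where xyz: "u = (x, y, z)" by (cases u)
  let ?a = "padic_norm x" and ?b = "padic_norm y" and ?c = "padic_norm z"
  have S2: "(y, z, x) \<in> surface B C A D" and S3: "(z, x, y) \<in> surface C A B D"
    using u(1) by (auto simp: xyz surface_def algebra_simps)
  have some: "?a > 1 \<or> ?b > 1 \<or> ?c > 1" using u(2) by (auto simp: xyz mem_int_cube_iff sup_norm_le_iff)
  have imp: "?a > 1 \<Longrightarrow> ?b > 1 \<or> ?c > 1" "?b > 1 \<Longrightarrow> ?c > 1 \<or> ?a > 1" "?c > 1 \<Longrightarrow> ?a > 1 \<or> ?b > 1"
    using surface_single_large[OF ints u(1)[unfolded xyz]] surface_single_large[OF ints(2,3,1,4) S2]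
      surface_single_large[OF ints(3,1,2,4) S3] by blast+
  have notall: "\<not> (?a > 1 \<and> ?b > 1 \<and> ?c > 1)"
  proof
    assume big: "?a > 1 \<and> ?b > 1 \<and> ?c > 1"
    consider "?b \<le> ?a" "?c \<le> ?a" | "?c \<le> ?b" "?a \<le> ?b" | "?a \<le> ?c" "?b \<le> ?c" by linarith
    then show False
    proof cases
      case 1
      then show False using surface_large_dominant[OF ints xyz u(1)] big nd(1) by blast
    next
      case 2
      then show False using surface_large_dominant[OF ints(2,3,1,4) refl S2] big nd(2) by (simp add: xyz)
    next
      case 3
      then show False using surface_large_dominant[OF ints(3,1,2,4) refl S3] big nd(3) by (simp add: xyz)
    qed
  qed
  consider "?b > 1" "?c > 1" "?a \<le> 1" | "?c > 1" "?a > 1" "?b \<le> 1" | "?a > 1" "?b > 1" "?c \<le> 1"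
    using some imp notall by argo
  then show ?thesis
  proof cases
    case 1
    have "?a < ?b * ?c" using 1 less_1_mult[of ?b ?c] by linarith
    then show ?thesis using dominant_vieta1[OF ints(1) 1(1,2)] by (simp add: xyz)
  next
    case 2
    have "?b < ?c * ?a" using 2 less_1_mult[of ?c ?a] by linarith
    then show ?thesis using dominant_vieta1[OF ints(2) 2(1,2)] by (simp add: xyz cyc_vieta)
  next
    case 3
    have "?c < ?a * ?b" using 3 less_1_mult[of ?a ?b] by linarith
    then show ?thesis using dominant_vieta1[OF ints(3) 3(1,2)] by (simp add: xyz cyc_vieta)
  qed
qed

text \<open>Points without a dominant coordinate are their own parents, so the iteration becomes
  stationary once it reaches one.\<close>

definition parent :: "'p::prime_card padic \<Rightarrow> 'p padic \<Rightarrow> 'p padic \<Rightarrow> 'p padic3 \<Rightarrow> 'p padic3" where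
  "parent A B C u = (if dominant u then vieta1 A u else if dominant (cyc u) then vieta2 B u
     else if dominant (cyc (cyc u)) then vieta3 C u else u)"

definition edge_weight :: "real \<Rightarrow> real \<Rightarrow> real \<Rightarrow> 'p::prime_card padic3 \<Rightarrow> real" where
  "edge_weight a b c u = (if dominant u then a else if dominant (cyc u) then b
     else if dominant (cyc (cyc u)) then c else 1)"

text \<open>The product of the weights of all edges on the way down. As a limit of finite products
  it is defined and measurable on the whole space; on the surface the products are eventually
  constant.\<close>

definition path_weight where
  "path_weight A B C a b c u = lim (\<lambda>n. \<Prod>k<n. edge_weight a b c ((parent A B C ^^ k) u))"

context
  fixes A B C D :: "'p::prime_card padic" and a b c :: real
  assumes ints: "A \<in> padic_ints" "B \<in> padic_ints" "C \<in> padic_ints" "D \<in> padic_ints"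
    and abc: "0 < a" "a < 1" "0 < b" "b < 1" "0 < c" "c < 1"
begin

abbreviation (input) "wt \<equiv> edge_weight a b c"
abbreviation (input) "par \<equiv> parent A B C"
abbreviation (input) "\<psi> \<equiv> path_weight A B C a b c"

lemma edge_weight_bounds: "0 < wt u" "wt u \<le> 1"
  using abc by (auto simp: edge_weight_def)

lemma partial_weight_bounds: "0 < (\<Prod>k<n. wt (f k))" "(\<Prod>k<n. wt (f k)) \<le> 1"
  by (intro prod_pos ballI edge_weight_bounds(1)) (intro prod_le_1 conjI less_imp_le[OF edge_weight_bounds(1)] edge_weight_bounds(2))

lemma path_weight_lim: "(\<lambda>n. \<Prod>k<n. wt ((par ^^ k) u)) \<longlonglongrightarrow> \<psi> u"
proof -
  let ?f = "\<lambda>n. \<Prod>k<n. wt ((par ^^ k) u)"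
  have "decseq ?f"
  proof (rule decseq_SucI)
    fix n
    show "?f (Suc n) \<le> ?f n"
      using partial_weight_bounds(1)[of "\<lambda>k. (par ^^ k) u" n] edge_weight_bounds[of "(par ^^ n) u"]
      by (simp add: mult_left_le)
  qed
  moreover have "\<forall>n. 0 \<le> ?f n" by (intro allI less_imp_le partial_weight_bounds(1))
  ultimately obtain L where "?f \<longlonglongrightarrow> L" by (rule decseq_convergent)
  then have "convergent ?f" by (auto simp: convergent_def)
  then show ?thesis by (simp add: path_weight_def convergent_LIMSEQ_iff)
qed

lemma path_weight_le_1: "\<psi> u \<le> 1"
  by (rule LIMSEQ_le_const2[OF path_weight_lim]) (intro exI allI impI partial_weight_bounds(2))

lemma path_weight_parent: "\<psi> u = wt u * \<psi> (par u)"
proof (rule LIMSEQ_unique)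
  show "(\<lambda>n. \<Prod>k<Suc n. wt ((par ^^ k) u)) \<longlonglongrightarrow> \<psi> u" by (rule LIMSEQ_Suc[OF path_weight_lim])
  have "(\<Prod>k<Suc n. wt ((par ^^ k) u)) = wt u * (\<Prod>k<n. wt ((par ^^ k) (par u)))" for n
    by (simp only: prod.lessThan_Suc_shift funpow_Suc_right o_apply funpow_0)
  moreover have "(\<lambda>n. wt u * (\<Prod>k<n. wt ((par ^^ k) (par u)))) \<longlonglongrightarrow> wt u * \<psi> (par u)"
    by (rule tendsto_mult_left[OF path_weight_lim])
  ultimately show "(\<lambda>n. \<Prod>k<Suc n. wt ((par ^^ k) u)) \<longlonglongrightarrow> wt u * \<psi> (par u)" by simp
qed

lemma dominant_sup_norm: "dominant u \<or> dominant (cyc u) \<or> dominant (cyc (cyc u)) \<Longrightarrow> sup_norm u > 1"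
  by (auto simp: dominant_def cyc_def sup_norm_def)

lemma parent_surface: "u \<in> surface A B C D \<Longrightarrow> par u \<in> surface A B C D"
  by (simp add: parent_def vieta_surface)

lemma parent_descent:
  assumes "u \<in> surface A B C D" "dominant u \<or> dominant (cyc u) \<or> dominant (cyc (cyc u))"
  shows "sup_norm (par u) \<le> sup_norm u / real CARD('p)"
proof -
  have c1: "cyc u \<in> surface B C A D" "cyc (cyc u) \<in> surface C A B D" using assms(1) by simp_all
  consider "dominant u" | "\<not> dominant u" "dominant (cyc u)" | "\<not> dominant u" "\<not> dominant (cyc u)" "dominant (cyc (cyc u))"
    using assms(2) by blast
  then show ?thesis
  proof cases
    case 1
    then show ?thesis using dominant_descent[OF ints assms(1)] by (simp add: parent_def)
  next
    case 2
    have "sup_norm (cyc (vieta2 B u)) \<le> sup_norm (cyc u) / real CARD('p)"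
      unfolding cyc_vieta by (rule dominant_descent[OF ints(2,3,1,4) c1(1) 2(2)])
    then show ?thesis using 2 by (simp add: parent_def)
  next
    case 3
    have "sup_norm (cyc (cyc (vieta3 C u))) \<le> sup_norm (cyc (cyc u)) / real CARD('p)"
      unfolding cyc_vieta by (rule dominant_descent[OF ints(3,1,2,4) c1(2) 3(3)])
    then show ?thesis using 3 by (simp add: parent_def)
  qed
qed

text \<open>Each step to the parent divides the maximum norm by at least p, while a point with a
  dominant coordinate has norm above 1. So only finitely many factors differ from 1.\<close>

lemma path_weight_pos:
  assumes u: "u \<in> surface A B C D"
  shows "\<psi> u > 0"
proof -
  let ?t = "\<lambda>v. dominant v \<or> dominant (cyc v) \<or> dominant (cyc (cyc v))"
  have P: "real CARD('p) > 1" using card_prime_gt_1[where 'p='p] by simp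
  have S: "(par ^^ k) u \<in> surface A B C D" for k by (induction k) (auto simp: u parent_surface)
  have "\<exists>n. \<not> ?t ((par ^^ n) u)"
  proof (rule ccontr)
    assume "\<not> ?thesis"
    then have t: "?t ((par ^^ n) u)" for n by blast
    have "sup_norm ((par ^^ n) u) \<le> sup_norm u / real CARD('p) ^ n" for n
    proof (induction n)
      case (Suc n)
      have "sup_norm ((par ^^ Suc n) u) \<le> sup_norm ((par ^^ n) u) / real CARD('p)"
        using parent_descent[OF S t, of n] by simp
      also have "\<dots> \<le> (sup_norm u / real CARD('p) ^ n) / real CARD('p)" using Suc P by (intro divide_right_mono) auto
      finally show ?case by (simp add: mult.commute)
    qed simp
    moreover have "sup_norm ((par ^^ n) u) > 1" for n by (rule dominant_sup_norm[OF t])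
    ultimately have *: "1 < sup_norm u / real CARD('p) ^ n" for n by (meson less_le_trans)
    have s0: "sup_norm u > 0" using *[of 0] by simp
    obtain n where "1 / real CARD('p) ^ n < 1 / sup_norm u"
      using padic_radius_small[of "1 / sup_norm u", where 'p='p] s0 by auto
    then have "sup_norm u / real CARD('p) ^ n < 1" using s0 P by (simp add: field_simps)
    then show False using *[of n] by simp
  qed
  then obtain n where n: "\<not> ?t ((par ^^ n) u)" by blast
  have stop: "(par ^^ (n + j)) u = (par ^^ n) u" for j
  proof (induction j)
    case (Suc j)
    have "(par ^^ (n + Suc j)) u = par ((par ^^ n) u)" using Suc by simp
    also have "\<dots> = (par ^^ n) u" using n by (auto simp: parent_def)
    finally show ?case .
  qed simp
  have "(\<Prod>k<n. wt ((par ^^ k) u)) \<le> (\<Prod>k<m. wt ((par ^^ k) u))" if m: "m \<ge> n" for m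
  proof -
    obtain j where j: "m = n + j" using le_Suc_ex[OF m] by blast
    have "(\<Prod>k<n + j. wt ((par ^^ k) u)) = (\<Prod>k<n. wt ((par ^^ k) u))"
    proof (induction j)
      case (Suc j)
      have "wt ((par ^^ (n + j)) u) = 1" unfolding stop using n by (auto simp: edge_weight_def)
      then show ?case using Suc by simp
    qed simp
    then show ?thesis by (simp add: j)
  qed
  then have "(\<Prod>k<n. wt ((par ^^ k) u)) \<le> \<psi> u"
    by (intro LIMSEQ_le_const[OF path_weight_lim]) blast
  then show ?thesis using partial_weight_bounds(1)[of "\<lambda>k. (par ^^ k) u" n] by linarith
qed

lemma path_weight_dominant:
  "dominant u \<Longrightarrow> \<psi> u = a * \<psi> (vieta1 A u)"
  "dominant (cyc u) \<Longrightarrow> \<psi> u = b * \<psi> (vieta2 B u)"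
  "dominant (cyc (cyc u)) \<Longrightarrow> \<psi> u = c * \<psi> (vieta3 C u)"
  using path_weight_parent[of u] dominant_exclusive[of u] dominant_exclusive[of "cyc u"] dominant_exclusive[of "cyc (cyc u)"]
  by (auto simp: edge_weight_def parent_def)

text \<open>At a point dominant in x the parent carries the value of \<open>u\<close> divided by
  \<open>a\<close>, and the two children carry it times \<open>b\<close> and times \<open>c\<close>;
  the three hypotheses \<open>w\<close> are the resulting inequalities for the three coordinates. At
  a point without dominant coordinate the value is 1, the maximum, and some neighbour has a smaller
  value.\<close>

lemma path_weight_superharmonic:
  assumes p: "0 < p1" "0 < p2" "0 < p3" "p1 + p2 + p3 = 1"
    and w: "p1 / a + p2 * b + p3 * c < 1" "p1 * a + p2 / b + p3 * c < 1" "p1 * a + p2 * b + p3 / c < 1"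
    and u: "u \<in> surface A B C D" "u \<notin> int_cube"
  shows "p1 * \<psi> (vieta1 A u) + p2 * \<psi> (vieta2 B u) + p3 * \<psi> (vieta3 C u) < \<psi> u"
proof -
  have pos: "\<psi> u > 0" by (rule path_weight_pos[OF u(1)])
  have up1: "\<psi> (vieta1 A u) = a * \<psi> u" if "dominant (vieta1 A u)"
    using path_weight_dominant(1)[OF that] by (simp add: vieta_involutive)
  have up2: "\<psi> (vieta2 B u) = b * \<psi> u" if "dominant (cyc (vieta2 B u))"
    using path_weight_dominant(2)[OF that] by (simp add: vieta_involutive)
  have up3: "\<psi> (vieta3 C u) = c * \<psi> u" if "dominant (cyc (cyc (vieta3 C u)))"
    using path_weight_dominant(3)[OF that] by (simp add: vieta_involutive)
  have c1: "cyc (cyc (vieta1 A u)) = vieta2 A (cyc (cyc u))" "cyc (vieta1 A u) = vieta3 A (cyc u)"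
    "cyc (cyc (vieta2 B u)) = vieta3 B (cyc (cyc u))" by (simp_all add: cyc_vieta)
  consider (1) "dominant u" | (2) "dominant (cyc u)" | (3) "dominant (cyc (cyc u))" |
    (base) "\<not> dominant u" "\<not> dominant (cyc u)" "\<not> dominant (cyc (cyc u))" by blast
  then show ?thesis
  proof cases
    case 1
    have "\<psi> (vieta1 A u) = \<psi> u / a" using path_weight_dominant(1)[OF 1] abc by simp
    moreover have "\<psi> (vieta2 B u) = b * \<psi> u" "\<psi> (vieta3 C u) = c * \<psi> u"
      using dominant_step[OF ints(1-3) 1] up2 up3 by blast+
    ultimately have "p1 * \<psi> (vieta1 A u) + p2 * \<psi> (vieta2 B u) + p3 * \<psi> (vieta3 C u) = (p1 / a + p2 * b + p3 * c) * \<psi> u"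
      by (simp add: algebra_simps)
    then show ?thesis using w(1) pos by simp
  next
    case 2
    have "\<psi> (vieta2 B u) = \<psi> u / b" using path_weight_dominant(2)[OF 2] abc by simp
    moreover have "dominant (cyc (cyc (vieta3 C u)))"
      using dominant_step(1)[OF ints(2,3,1) 2] by (simp only: cyc_vieta)
    moreover have "dominant (cyc (cyc (cyc (vieta1 A u))))"
      using dominant_step(2)[OF ints(2,3,1) 2] by (simp only: c1(2))
    then have "dominant (vieta1 A u)" by (simp only: cyc_cyc_cyc)
    ultimately have "p1 * \<psi> (vieta1 A u) + p2 * \<psi> (vieta2 B u) + p3 * \<psi> (vieta3 C u) = (p1 * a + p2 / b + p3 * c) * \<psi> u"
      using up1 up3 by (simp add: algebra_simps)
    then show ?thesis using w(2) pos by simp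
  next
    case 3
    have "\<psi> (vieta3 C u) = \<psi> u / c" using path_weight_dominant(3)[OF 3] abc by simp
    moreover have "dominant (cyc (cyc (cyc (vieta1 A u))))"
      using dominant_step(1)[OF ints(3,1,2) 3] by (simp only: c1(1))
    then have "dominant (vieta1 A u)" by (simp only: cyc_cyc_cyc)
    moreover have "dominant (cyc (cyc (cyc (cyc (vieta2 B u)))))"
      using dominant_step(2)[OF ints(3,1,2) 3] by (simp only: c1(3))
    then have "dominant (cyc (vieta2 B u))" by (simp only: cyc_cyc_cyc)
    ultimately have "p1 * \<psi> (vieta1 A u) + p2 * \<psi> (vieta2 B u) + p3 * \<psi> (vieta3 C u) = (p1 * a + p2 * b + p3 / c) * \<psi> u"
      using up1 up2 by (simp add: algebra_simps)
    then show ?thesis using w(3) pos by simp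
  next
    case base
    have one: "\<psi> u = 1"
    proof -
      have "par u = u" "wt u = 1" using base by (simp_all add: parent_def edge_weight_def)
      then have "(par ^^ k) u = u" for k by (induction k) auto
      then have "(\<lambda>n. \<Prod>k<n. wt ((par ^^ k) u)) = (\<lambda>n. 1)" using \<open>wt u = 1\<close> by simp
      then show ?thesis using path_weight_lim[of u] by (simp add: LIMSEQ_const_iff)
    qed
    have le: "p1 * \<psi> (vieta1 A u) \<le> p1" "p2 * \<psi> (vieta2 B u) \<le> p2" "p3 * \<psi> (vieta3 C u) \<le> p3"
      using p path_weight_le_1 by (simp_all add: mult_left_le)
    have "\<psi> (vieta1 A u) < 1 \<or> \<psi> (vieta2 B u) < 1 \<or> \<psi> (vieta3 C u) < 1"
      using not_dominant_imp[OF ints u base] up1 up2 up3 one abc by auto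
    then have "p1 * \<psi> (vieta1 A u) < p1 \<or> p2 * \<psi> (vieta2 B u) < p2 \<or> p3 * \<psi> (vieta3 C u) < p3"
      using p by auto
    then show ?thesis using le one p(4) by linarith
  qed
qed

lemma path_weight_measurable: "\<psi> \<in> borel_measurable borel"
proof -
  have cont: "continuous_on UNIV (cyc :: 'p padic3 \<Rightarrow> _)" by (rule continuous_on_cyc)
  have pn: "padic_norm \<in> borel_measurable (borel :: 'p padic measure)"
  proof (intro borel_measurable_continuous_onI)
    have "padic_norm = (\<lambda>x :: 'p padic. dist x 0)" by (simp add: dist_padic_def fun_eq_iff)
    then show "continuous_on UNIV (padic_norm :: 'p padic \<Rightarrow> real)" by (rule ssubst) (intro continuous_intros)
  qed
  have "(\<lambda>u :: 'p padic3. fst u) \<in> borel_measurable borel" "(\<lambda>u :: 'p padic3. fst (snd u)) \<in> borel_measurable borel"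
    "(\<lambda>u :: 'p padic3. snd (snd u)) \<in> borel_measurable borel"
    by (intro borel_measurable_continuous_onI continuous_intros)+
  then have [measurable]: "(\<lambda>u :: 'p padic3. padic_norm (fst u)) \<in> borel_measurable borel"
    "(\<lambda>u :: 'p padic3. padic_norm (fst (snd u))) \<in> borel_measurable borel"
    "(\<lambda>u :: 'p padic3. padic_norm (snd (snd u))) \<in> borel_measurable borel"
    using measurable_compose[OF _ pn] by blast+
  have d [measurable]: "Measurable.pred borel (dominant :: 'p padic3 \<Rightarrow> bool)"
    unfolding dominant_def by measurable
  have [measurable]: "(cyc :: 'p padic3 \<Rightarrow> _) \<in> borel_measurable borel"
    by (rule borel_measurable_continuous_onI[OF cont])
  have v [measurable]: "vieta1 A \<in> borel_measurable borel" "vieta2 B \<in> borel_measurable borel" "vieta3 C \<in> borel_measurable borel"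
    by (rule borel_measurable_continuous_onI, rule continuous_on_vietas[of _ A B C], simp add: vietas_def)+
  have [measurable]: "par \<in> borel_measurable borel" unfolding parent_def by measurable
  have [measurable]: "wt \<in> borel_measurable (borel :: 'p padic3 measure)" unfolding edge_weight_def by measurable
  have [measurable]: "(\<lambda>u. (par ^^ k) u) \<in> borel_measurable borel" for k
  proof (induction k)
    case (Suc k)
    then show ?case using measurable_compose[OF Suc \<open>par \<in> borel_measurable borel\<close>] by simp
  qed simp
  show ?thesis
  proof (rule borel_measurable_LIMSEQ_real)
    show "(\<lambda>n. \<Prod>k<n. wt ((par ^^ k) u)) \<longlonglongrightarrow> \<psi> u" for u by (rule path_weight_lim)
  qed measurable
qed

end

lemma stationary_nn_integral:
  fixes N :: "'a::topological_space measure"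
  assumes W: "finite W" "\<And>s. s \<in> W \<Longrightarrow> s \<in> borel_measurable borel" and N: "sets N = sets borel"
    and stat: "\<And>E. E \<in> sets borel \<Longrightarrow> (\<Sum>s\<in>W. p s * emeasure N (s -` E)) = emeasure N E"
    and f: "f \<in> borel_measurable borel"
  shows "(\<Sum>s\<in>W. p s * (\<integral>\<^sup>+u. f (s u) \<partial>N)) = (\<integral>\<^sup>+u. f u \<partial>N)"
  using f
proof (induction rule: borel_measurable_induct)
  case (cong f g)
  then show ?case by simp
next
  case (set E)
  have sp: "space N = UNIV" using sets_eq_imp_space_eq[OF N] by simp
  have "(\<integral>\<^sup>+u. indicator E (s u) \<partial>N) = emeasure N (s -` E)" if "s \<in> W" for s
  proof -
    have "s -` E \<in> sets N" using measurable_sets[OF W(2)[OF that] set] by (simp add: N)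
    moreover have "(\<lambda>u. indicator E (s u) :: ennreal) = indicator (s -` E)" by (auto simp: indicator_def fun_eq_iff)
    ultimately show ?thesis by simp
  qed
  then show ?case using stat[OF set] set by (simp add: N)
next
  case (mult f c)
  have m: "(\<lambda>u. f (s u)) \<in> borel_measurable N" if "s \<in> W" for s
    using measurable_compose[OF W(2)[OF that] mult(2)] measurable_cong_sets[OF N refl] by blast
  have m1: "f \<in> borel_measurable N" using mult(2) measurable_cong_sets[OF N refl] by blast
  have "(\<Sum>s\<in>W. p s * (\<integral>\<^sup>+u. c * f (s u) \<partial>N)) = (\<Sum>s\<in>W. c * (p s * (\<integral>\<^sup>+u. f (s u) \<partial>N)))"
    by (rule sum.cong[OF refl]) (simp add: nn_integral_cmult[OF m] mult_ac)
  also have "\<dots> = c * (\<integral>\<^sup>+u. f u \<partial>N)" using mult.IH by (simp add: sum_distrib_left[symmetric])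
  finally show ?case by (simp add: nn_integral_cmult[OF m1])
next
  case (add f g)
  have m: "(\<lambda>u. f (s u)) \<in> borel_measurable N" "(\<lambda>u. g (s u)) \<in> borel_measurable N" if "s \<in> W" for s
    using measurable_compose[OF W(2)[OF that] add(1)] measurable_compose[OF W(2)[OF that] add(3)]
    by (simp_all only: measurable_cong_sets[OF N refl])
  have m1: "f \<in> borel_measurable N" "g \<in> borel_measurable N" using add(1,3) by (simp_all only: measurable_cong_sets[OF N refl])
  have "(\<Sum>s\<in>W. p s * (\<integral>\<^sup>+u. g (s u) + f (s u) \<partial>N)) =
      (\<Sum>s\<in>W. p s * (\<integral>\<^sup>+u. g (s u) \<partial>N) + p s * (\<integral>\<^sup>+u. f (s u) \<partial>N))"
    by (rule sum.cong[OF refl]) (simp add: nn_integral_add[OF m(2,1)] distrib_left)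
  then show ?case using add.IH by (simp add: sum.distrib nn_integral_add[OF m1(2,1)])
next
  case (seq U)
  have mU: "U i \<in> borel_measurable N" for i using seq(1) by (simp only: measurable_cong_sets[OF N refl])
  have mUs: "(\<lambda>u. U i (s u)) \<in> borel_measurable N" if "s \<in> W" for s i
    using measurable_compose[OF W(2)[OF that] seq(1)] by (simp only: measurable_cong_sets[OF N refl])
  have inc: "incseq (\<lambda>i u. U i (s u))" for s using seq(3) by (auto simp: incseq_def le_fun_def)
  have f: "(\<integral>\<^sup>+u. (SUP i. U i) (s u) \<partial>N) = (SUP i. \<integral>\<^sup>+u. U i (s u) \<partial>N)" if "s \<in> W" for s
    using nn_integral_monotone_convergence_SUP[OF inc mUs[OF that]] by (simp add: image_comp)
  have "(\<Sum>s\<in>W. p s * (\<integral>\<^sup>+u. (SUP i. U i) (s u) \<partial>N)) = (\<Sum>s\<in>W. SUP i. p s * (\<integral>\<^sup>+u. U i (s u) \<partial>N))"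
    by (rule sum.cong[OF refl]) (simp only: f SUP_mult_left_ennreal)
  also have "\<dots> = (SUP i. \<Sum>s\<in>W. p s * (\<integral>\<^sup>+u. U i (s u) \<partial>N))"
  proof (rule ennreal_SUP_sum[symmetric])
    fix s assume "s \<in> W"
    show "incseq (\<lambda>i. p s * (\<integral>\<^sup>+u. U i (s u) \<partial>N))"
      using inc[of s] by (auto simp: incseq_def le_fun_def intro!: mult_left_mono nn_integral_mono)
  qed
  also have "\<dots> = (SUP i. \<integral>\<^sup>+u. U i u \<partial>N)" using seq.IH by simp
  also have "\<dots> = (\<integral>\<^sup>+u. (SUP i. U i) u \<partial>N)"
    using nn_integral_monotone_convergence_SUP[OF seq(3) mU] by (simp add: image_comp)
  finally show ?case .
qed

section \<open>Classification of stationary measures\<close>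

text \<open>Ensures that a sum over the set of involutions really has three terms.\<close>

lemma vietas_distinct:
  "vieta1 A \<noteq> vieta2 B" "vieta1 A \<noteq> vieta3 C" "vieta2 B \<noteq> vieta3 (C :: 'p::prime_card padic)"
proof -
  show "vieta1 A \<noteq> vieta2 B"
  proof
    assume eq: "vieta1 A = vieta2 B"
    have "A = 0" using fun_cong[OF eq, of "(0, 0, 0)"] by (simp add: vieta1_def vieta2_def)
    moreover have "A = 1" using fun_cong[OF eq, of "(0, 1, 1)"] by (simp add: vieta1_def vieta2_def)
    ultimately show False by simp
  qed
  show "vieta1 A \<noteq> vieta3 C"
  proof
    assume eq: "vieta1 A = vieta3 C"
    have "A = 0" using fun_cong[OF eq, of "(0, 0, 0)"] by (simp add: vieta1_def vieta3_def)
    moreover have "A = 1" using fun_cong[OF eq, of "(0, 1, 1)"] by (simp add: vieta1_def vieta3_def)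
    ultimately show False by simp
  qed
  show "vieta2 B \<noteq> vieta3 C"
  proof
    assume eq: "vieta2 B = vieta3 C"
    have "B = 0" using fun_cong[OF eq, of "(0, 0, 0)"] by (simp add: vieta2_def vieta3_def)
    moreover have "B = 1" using fun_cong[OF eq, of "(1, 0, 1)"] by (simp add: vieta2_def vieta3_def)
    ultimately show False by simp
  qed
qed

lemma sum_vietas: "(\<Sum>s\<in>vietas A B C. f s) = f (vieta1 A) + f (vieta2 B) + f (vieta3 C)"
  using vietas_distinct(1)[of A B] vietas_distinct(2)[of A C] vietas_distinct(3)[of B C]
  by (simp add: vietas_def add.assoc)

text \<open>For w(q) = q / (q + eps) one has q / w(q) = q + eps and q w(q) = q - eps w(q). Each of
  the three sums becomes 1 + eps - eps (w' + w'') with the two other weights w' and w'', and these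
  exceed 1/2 as soon as eps is below all three probabilities.\<close>

lemma superharmonic_weights:
  fixes p1 p2 p3 :: real
  assumes p: "0 < p1" "0 < p2" "0 < p3" "p1 + p2 + p3 = 1"
  obtains a b c where "0 < a" "a < 1" "0 < b" "b < 1" "0 < c" "c < 1"
    "p1 / a + p2 * b + p3 * c < 1" "p1 * a + p2 / b + p3 * c < 1" "p1 * a + p2 * b + p3 / c < 1"
proof -
  define \<epsilon> where "\<epsilon> = min p1 (min p2 p3) / 2"
  have e: "\<epsilon> > 0" "\<epsilon> < p1" "\<epsilon> < p2" "\<epsilon> < p3" using p by (auto simp: \<epsilon>_def min_def)
  define w where "w q = q / (q + \<epsilon>)" for q
  have w: "1 / 2 < w q" "w q < 1" "q / w q = q + \<epsilon>" "q * w q = q - \<epsilon> * w q" if q: "q > \<epsilon>" for q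
  proof -
    have q0: "q > 0" "q + \<epsilon> > 0" using q e(1) by linarith+
    show "1 / 2 < w q" "w q < 1" "q / w q = q + \<epsilon>" using q0 q e(1) by (simp_all add: w_def field_simps)
    have "w q * (q + \<epsilon>) = q" using q0 by (simp add: w_def)
    then show "q * w q = q - \<epsilon> * w q" by (simp add: algebra_simps)
  qed
  have neg: "\<epsilon> * x + \<epsilon> * y > \<epsilon>" if "x > 1 / 2" "y > 1 / 2" for x y :: real
  proof -
    have "\<epsilon> * 1 < \<epsilon> * (x + y)" using e(1) that by (intro mult_strict_left_mono) auto
    then show ?thesis by (simp add: distrib_left)
  qed
  note w1 = w[OF e(2)] and w2 = w[OF e(3)] and w3 = w[OF e(4)]
  show ?thesis
  proof (rule that[of "w p1" "w p2" "w p3"])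
    show "0 < w p1" "0 < w p2" "0 < w p3" using w1(1) w2(1) w3(1) by linarith+
    show "w p1 < 1" "w p2 < 1" "w p3 < 1" using w1(2) w2(2) w3(2) by auto
    show "p1 / w p1 + p2 * w p2 + p3 * w p3 < 1" unfolding w1(3) w2(4) w3(4) using neg[OF w2(1) w3(1)] p(4) by linarith
    show "p1 * w p1 + p2 / w p2 + p3 * w p3 < 1" unfolding w2(3) w1(4) w3(4) using neg[OF w1(1) w3(1)] p(4) by linarith
    show "p1 * w p1 + p2 * w p2 + p3 / w p3 < 1" unfolding w3(3) w1(4) w2(4) using neg[OF w1(1) w2(1)] p(4) by linarith
  qed
qed

lemma sum_fun_apply: "(\<Sum>i\<in>I. f i) x = (\<Sum>i\<in>I. f i x :: 'b::comm_monoid_add)"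
  by (induction I rule: infinite_finite_induct) auto

context
  fixes A B C D :: "'p::prime_card padic" and p :: "('p padic3 \<Rightarrow> 'p padic3) \<Rightarrow> real"
  assumes ints: "A \<in> padic_ints" "B \<in> padic_ints" "C \<in> padic_ints" "D \<in> padic_ints"
    and p: "\<And>s. s \<in> vietas A B C \<Longrightarrow> p s > 0" "(\<Sum>s\<in>vietas A B C. p s) = 1"
begin

lemma surface_vimage: "s \<in> vietas A B C \<Longrightarrow> s u \<in> surface A B C D \<longleftrightarrow> u \<in> surface A B C D"
  using vieta_surface[of u A B C D] vieta_surface[of "s u" A B C D] by (auto simp: vietas_def vieta_involutive)

lemma int_cube_vimage: "s \<in> vietas A B C \<Longrightarrow> s u \<in> int_cube \<longleftrightarrow> u \<in> int_cube"
  using vietas_int_cube[OF ints(1-3), of s u] vietas_int_cube[OF ints(1-3), of s "s u"] by (auto simp: vietas_involutive)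

text \<open>The average of \<open>f\<close> over the three involutions has the same integral as
  \<open>f\<close> by stationarity, yet it is strictly smaller at every non-integral point of the
  surface. As \<open>f\<close> is bounded and \<open>N\<close> finite, the integrals can be
  subtracted, and the set where the inequality is strict must be null.\<close>

lemma stationary_escape_null:
  fixes N :: "'p padic3 measure"
  assumes N: "finite_measure N" "sets N = sets borel"
    and stat: "\<And>E. E \<in> sets borel \<Longrightarrow> (\<Sum>s\<in>vietas A B C. p s * measure N (s -` E)) = measure N E"
  shows "emeasure N (surface A B C D - int_cube) = 0"
proof -
  interpret N: finite_measure N by (rule N(1))
  let ?E = "surface A B C D - int_cube"
  have ps: "0 < p (vieta1 A)" "0 < p (vieta2 B)" "0 < p (vieta3 C)" "p (vieta1 A) + p (vieta2 B) + p (vieta3 C) = 1"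
    using p(1) p(2) by (auto simp: sum_vietas) (auto simp: vietas_def)
  obtain a b c where abc: "0 < a" "a < 1" "0 < b" "b < 1" "0 < c" "c < 1"
    and w: "p (vieta1 A) / a + p (vieta2 B) * b + p (vieta3 C) * c < 1" "p (vieta1 A) * a + p (vieta2 B) / b + p (vieta3 C) * c < 1"
      "p (vieta1 A) * a + p (vieta2 B) * b + p (vieta3 C) / c < 1"
    using superharmonic_weights[OF ps] by metis
  let ?\<psi> = "path_weight A B C a b c"
  \<comment> \<open>Extended by 0 off the invariant set \<open>?E\<close>, because the strict
    inequality is available on it only.\<close>
  define f where "f u = ennreal (indicator ?E u * ?\<psi> u)" for u
  have Eb: "?E \<in> sets borel"
    using closed_surface compact_imp_closed[OF compact_int_cube] by (intro sets.Diff borel_closed)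
  have [measurable]: "?\<psi> \<in> borel_measurable borel" by (rule path_weight_measurable[OF ints abc])
  have fm: "f \<in> borel_measurable borel" unfolding f_def using Eb by measurable
  have sm: "s \<in> borel_measurable borel" if "s \<in> vietas A B C" for s
    by (rule borel_measurable_continuous_onI[OF continuous_on_vietas[OF that]])
  define g where "g u = (\<Sum>s\<in>vietas A B C. ennreal (p s) * f (s u))" for u
  have fsm: "(\<lambda>u. f (s u)) \<in> borel_measurable N" if "s \<in> vietas A B C" for s
    using measurable_compose[OF sm[OF that] fm] measurable_cong_sets[OF N(2) refl] by blast
  have pm: "(\<lambda>u. ennreal (p s) * f (s u)) \<in> borel_measurable N" if "s \<in> vietas A B C" for s
    by (rule borel_measurable_times_ennreal[OF borel_measurable_const fsm[OF that]])
  have gm: "g \<in> borel_measurable N" unfolding g_def by (rule borel_measurable_sum[OF pm])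
  have fmN: "f \<in> borel_measurable N" using fm measurable_cong_sets[OF N(2) refl] by blast
  have stat': "(\<Sum>s\<in>vietas A B C. ennreal (p s) * emeasure N (s -` E)) = emeasure N E" if E: "E \<in> sets borel" for E
  proof -
    have "(\<Sum>s\<in>vietas A B C. ennreal (p s) * emeasure N (s -` E)) = (\<Sum>s\<in>vietas A B C. ennreal (p s * measure N (s -` E)))"
      by (rule sum.cong[OF refl]) (simp add: N.emeasure_eq_measure ennreal_mult less_imp_le[OF p(1)])
    also have "\<dots> = ennreal (\<Sum>s\<in>vietas A B C. p s * measure N (s -` E))"
      by (rule sum_ennreal) (simp add: less_imp_le[OF p(1)])
    also have "\<dots> = emeasure N E" by (simp add: stat[OF E] N.emeasure_eq_measure)
    finally show ?thesis .
  qed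
  have "(\<integral>\<^sup>+u. g u \<partial>N) = (\<Sum>s\<in>vietas A B C. \<integral>\<^sup>+u. ennreal (p s) * f (s u) \<partial>N)"
    unfolding g_def by (rule nn_integral_sum) (rule pm)
  also have "\<dots> = (\<Sum>s\<in>vietas A B C. ennreal (p s) * (\<integral>\<^sup>+u. f (s u) \<partial>N))"
    by (rule sum.cong[OF refl]) (rule nn_integral_cmult[OF fsm])
  also have "\<dots> = (\<integral>\<^sup>+u. f u \<partial>N)"
    by (rule stationary_nn_integral[OF finite_vietas sm N(2) stat' fm])
  finally have int_eq: "(\<integral>\<^sup>+u. g u \<partial>N) = (\<integral>\<^sup>+u. f u \<partial>N)" .
  have pos: "?\<psi> u > 0" if "u \<in> surface A B C D" for u by (rule path_weight_pos[OF ints abc that])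
  have f1: "f u \<le> 1" for u using path_weight_le_1[OF ints abc, of u] by (auto simp: f_def indicator_def)
  have "(\<integral>\<^sup>+u. f u \<partial>N) \<le> (\<integral>\<^sup>+u. 1 \<partial>N)" by (rule nn_integral_mono) (rule f1)
  also have "\<dots> < \<infinity>" using N.emeasure_finite[of "space N"] by (simp add: less_top[symmetric])
  finally have fin: "(\<integral>\<^sup>+u. f u \<partial>N) < \<infinity>" .
  have Eiff: "s u \<in> ?E \<longleftrightarrow> u \<in> ?E" if "s \<in> vietas A B C" for s u
    using surface_vimage[OF that] int_cube_vimage[OF that] by blast
  have out: "g u = 0" "f u = 0" if "u \<notin> ?E" for u
  proof -
    show "f u = 0" using that by (simp add: f_def)
    have "f (s u) = 0" if "s \<in> vietas A B C" for s
      using \<open>u \<notin> ?E\<close> Eiff[OF that, of u] by (simp add: f_def)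
    then show "g u = 0" unfolding g_def by (intro sum.neutral ballI) simp
  qed
  have strict: "g u < f u" if u: "u \<in> ?E" for u
  proof -
    have su: "s u \<in> ?E" "0 \<le> p s * ?\<psi> (s u)" if "s \<in> vietas A B C" for s
    proof -
      show *: "s u \<in> ?E" using Eiff[OF that] u by (rule iffD2)
      then show "0 \<le> p s * ?\<psi> (s u)" using pos[of "s u"] p(1)[OF that] by (intro mult_nonneg_nonneg less_imp_le) auto
    qed
    have "g u = (\<Sum>s\<in>vietas A B C. ennreal (p s * ?\<psi> (s u)))"
      unfolding g_def
    proof (rule sum.cong[OF refl])
      fix s assume s: "s \<in> vietas A B C"
      have "f (s u) = ennreal (?\<psi> (s u))" using su(1)[OF s] by (simp add: f_def)
      then show "ennreal (p s) * f (s u) = ennreal (p s * ?\<psi> (s u))"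
        using p(1)[OF s] pos[of "s u"] su(1)[OF s] by (simp add: ennreal_mult)
    qed
    also have "\<dots> = ennreal (\<Sum>s\<in>vietas A B C. p s * ?\<psi> (s u))" by (rule sum_ennreal[OF su(2)])
    also have "\<dots> < ennreal (?\<psi> u)"
    proof (rule ennreal_lessI)
      show "0 < ?\<psi> u" using pos u by blast
      show "(\<Sum>s\<in>vietas A B C. p s * ?\<psi> (s u)) < ?\<psi> u"
        unfolding sum_vietas using path_weight_superharmonic[OF ints abc ps w] u by blast
    qed
    also have "ennreal (?\<psi> u) = f u" using u by (simp add: f_def)
    finally show ?thesis .
  qed
  have le: "g u \<le> f u" for u using strict[of u] out[of u] by (cases "u \<in> ?E") auto
  have "(\<integral>\<^sup>+u. f u - g u \<partial>N) = (\<integral>\<^sup>+u. f u \<partial>N) - (\<integral>\<^sup>+u. g u \<partial>N)"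
    by (rule nn_integral_diff[OF fmN gm]) (use fin int_eq le in auto)
  also have "\<dots> = 0" unfolding int_eq by (rule diff_eq_0_ennreal) (use fin in auto)
  finally have "AE u in N. f u - g u = 0"
    by (subst (asm) nn_integral_0_iff_AE) (use fmN gm in auto)
  then have "AE u in N. u \<notin> ?E"
  proof (rule AE_mp, intro AE_I2 impI)
    fix u assume "f u - g u = 0"
    then show "u \<notin> ?E" using strict[of u] by (metis diff_gt_0_iff_gt_ennreal less_irrefl)
  qed
  then have "?E \<in> null_sets N" using Eb N(2) by (subst AE_iff_null_sets) auto
  then show ?thesis by (rule null_setsD1)
qed

end

section \<open>Orbit closures and the stationary measures they carry\<close>

context
  fixes A B C D :: "'p::prime_card padic" and \<mu> :: "('p padic3 \<Rightarrow> 'p padic3) pmf"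
  assumes ints: "A \<in> padic_ints" "B \<in> padic_ints" "C \<in> padic_ints" "D \<in> padic_ints"
    and inf: "\<And>v. v \<in> int_surface A B C D \<Longrightarrow> infinite (vorb A B C v)"
    and \<mu>: "\<And>s. s \<in> vietas A B C \<Longrightarrow> pmf \<mu> s > 0" "(\<Sum>s\<in>vietas A B C. pmf \<mu> s) = 1"
begin

abbreviation (input) "X \<equiv> surface A B C D"
abbreviation (input) "R \<equiv> restrict_space borel (surface A B C D)"
abbreviation (input) "orb \<equiv> (\<lambda>x. closure (vorb A B C x))"

definition orbit_closures :: "'p padic3 set set" where
  "orbit_closures = orb ` (int_surface A B C D)"

text \<open>Pushed forward along the inclusion: the symplectic measure lives on the integral points,
  stationary measures on all p-adic points of the surface.\<close>

definition normalized :: "'p padic3 set \<Rightarrow> 'p padic3 measure" where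
  "normalized T = distr (uniform_measure (symplectic_measure A B C D) T) R (\<lambda>u. u)"

lemma surface_borel: "X \<in> sets borel"
  by (intro borel_closed closed_surface)

lemma sets_R_iff: "E \<in> sets R \<longleftrightarrow> E \<in> sets borel \<and> E \<subseteq> X"
  using surface_borel by (auto simp: sets_restrict_space_iff)

lemma space_R: "space R = X"
  by (simp add: space_restrict_space)

lemma S_subset_X: "int_surface A B C D \<subseteq> X"
  by (auto simp: int_surface_eq)

lemma S_int_cube: "u \<in> int_surface A B C D \<Longrightarrow> u \<in> int_cube"
  by (simp add: int_surface_eq)

lemma orbit_closure_props:
  assumes "T \<in> orbit_closures"
  shows "T \<subseteq> int_surface A B C D" "T \<in> sets borel" "T \<in> sets R" "T \<in> sets (symplectic_measure A B C D)" "closed T" "T \<noteq> {}"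
proof -
  obtain x where x: "x \<in> int_surface A B C D" "T = orb x" using assms unfolding orbit_closures_def by blast
  show TS: "T \<subseteq> int_surface A B C D" unfolding x(2) by (rule closure_vorb_int_surface[OF ints(1-3) x(1)])
  show "closed T" by (simp add: x(2))
  then show Tb: "T \<in> sets borel" by simp
  then show "T \<in> sets R" "T \<in> sets (symplectic_measure A B C D)" using TS S_subset_X by (auto simp: sets_R_iff sets_symplectic_iff[OF ints(1-3) inf])
  show "T \<noteq> {}" using vorb_base[of x A B C] by (simp add: x(2)) blast
qed

lemma orbit_closure_open_cube:
  assumes "T \<in> orbit_closures" "v \<in> T"
  shows "\<exists>n. (int_surface A B C D) \<inter> cube v n \<subseteq> T"
proof -
  obtain x where x: "x \<in> int_surface A B C D" "T = orb x" using assms unfolding orbit_closures_def by blast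
  obtain e where e: "e > 0" "\<And>w. w \<in> int_surface A B C D \<Longrightarrow> sup_norm (w - v) \<le> e \<Longrightarrow> w \<in> T"
    using orbit_closure_open[OF ints(1-3) x(1) inf, of v] assms(2) unfolding x(2) by blast
  obtain n where "1 / real CARD('p) ^ n < e" using padic_radius_small[OF e(1), where 'p='p] by blast
  then have "int_surface A B C D \<inter> cube v n \<subseteq> T" using e(2) by (auto simp only: mem_cube Int_iff)
  then show ?thesis ..
qed

lemma orbit_closure_eq_orb:
  assumes "T \<in> orbit_closures" "v \<in> T"
  shows "T = orb v"
proof -
  obtain x where x: "x \<in> int_surface A B C D" "T = orb x" using assms unfolding orbit_closures_def by blast
  have "v \<in> int_surface A B C D" using orbit_closure_props(1)[OF assms(1)] assms(2) by blast
  then show ?thesis using closure_vorb_eq[OF ints(1-3) S_int_cube[OF x(1)] S_int_cube, of v] assms(2) x(2) by simp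
qed

lemma orbit_closures_disjoint:
  assumes "T \<in> orbit_closures" "T' \<in> orbit_closures" "T \<noteq> T'"
  shows "T \<inter> T' = {}"
  using orbit_closure_eq_orb[OF assms(1)] orbit_closure_eq_orb[OF assms(2)] assms(3) by blast

lemma in_orb: "v \<in> orb v"
  by (rule subsetD[OF closure_subset vorb_base])

lemma orbit_closures_cover: "\<Union>orbit_closures = int_surface A B C D"
proof
  show "\<Union>orbit_closures \<subseteq> int_surface A B C D" using orbit_closure_props(1) by blast
  show "int_surface A B C D \<subseteq> \<Union>orbit_closures"
    unfolding orbit_closures_def by (rule subsetI, rule UN_I, assumption, rule in_orb)
qed

lemma finite_orbit_closures: "finite orbit_closures"
proof -
  have "\<forall>v\<in>int_surface A B C D. \<exists>n. (int_surface A B C D) \<inter> cube v n \<subseteq> orb v"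
    by (intro ballI orbit_closure_open_cube in_orb) (simp add: orbit_closures_def)
  from bchoice[OF this] obtain n where n: "\<forall>v\<in>int_surface A B C D. int_surface A B C D \<inter> cube v (n v) \<subseteq> orb v"
    by (rule exE)
  have cover: "int_surface A B C D \<subseteq> (\<Union>u\<in>int_surface A B C D. cube u (n u))"
    by (rule subsetI, rule UN_I, assumption, rule center_in_cube)
  obtain F where F: "F \<subseteq> int_surface A B C D" "finite F" "int_surface A B C D \<subseteq> (\<Union>u\<in>F. cube u (n u))"
    by (rule compactE_image[OF compact_int_surface open_cube cover])
  have "orbit_closures \<subseteq> orb ` F"
  proof
    fix T assume T: "T \<in> orbit_closures"
    then obtain v where v: "v \<in> T" "v \<in> int_surface A B C D" using orbit_closure_props(1,6)[OF T] by blast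
    then obtain u where u: "u \<in> F" "v \<in> cube u (n u)" using F(3) by blast
    then have "v \<in> orb u" using bspec[OF n, of u] F(1) v(2) by blast
    moreover have "orb u \<in> orbit_closures" using u(1) F(1) unfolding orbit_closures_def by blast
    ultimately have "T = orb u" using orbit_closure_eq_orb[OF T v(1)] orbit_closure_eq_orb[of "orb u" v] by simp
    then show "T \<in> orb ` F" using u(1) by blast
  qed
  then show ?thesis using F(2) finite_subset by blast
qed

lemma symplectic_orbit_closure:
  assumes "T \<in> orbit_closures"
  shows "emeasure (symplectic_measure A B C D) T \<noteq> 0" "emeasure (symplectic_measure A B C D) T \<noteq> \<infinity>"
proof -
  obtain x where x: "x \<in> int_surface A B C D" "T = orb x" using assms unfolding orbit_closures_def by blast
  show "emeasure (symplectic_measure A B C D) T \<noteq> 0" using symplectic_positive[OF ints(1-3) inf x(1)] by (simp add: x(2))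
  have Sm: "int_surface A B C D \<in> sets (symplectic_measure A B C D)" using int_surface_borel[of A B C D] by (simp add: sets_symplectic_iff[OF ints(1-3) inf])
  have "emeasure (symplectic_measure A B C D) T \<le> emeasure (symplectic_measure A B C D) (int_surface A B C D)" by (rule emeasure_mono[OF orbit_closure_props(1)[OF assms] Sm])
  then show "emeasure (symplectic_measure A B C D) T \<noteq> \<infinity>" using symplectic_props(2)[OF ints(1-3) inf] by (metis infinity_ennreal_def neq_top_trans)
qed

lemma normalized_measurable: "(\<lambda>u. u) \<in> measurable (uniform_measure (symplectic_measure A B C D) T) R"
proof (rule measurableI)
  have spO: "space (symplectic_measure A B C D) = int_surface A B C D" using sets_eq_imp_space_eq[OF symplectic_props(1)[OF ints(1-3) inf]] by (simp add: space_restrict_space)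
  show "u \<in> space R" if "u \<in> space (uniform_measure (symplectic_measure A B C D) T)" for u using that S_subset_X by (auto simp: spO space_R)
  fix E assume "E \<in> sets R"
  then show "(\<lambda>u. u) -` E \<inter> space (uniform_measure (symplectic_measure A B C D) T) \<in> sets (uniform_measure (symplectic_measure A B C D) T)"
    using int_surface_borel[of A B C D] by (auto simp: spO sets_R_iff sets_symplectic_iff[OF ints(1-3) inf])
qed

lemma normalized_prob:
  assumes "T \<in> orbit_closures"
  shows "prob_space (normalized T)" "sets (normalized T) = sets R"
  unfolding normalized_def
  using prob_space.prob_space_distr[OF prob_space_uniform_measure[OF symplectic_orbit_closure[OF assms]] normalized_measurable]
  by auto

lemma measure_normalized:
  assumes T: "T \<in> orbit_closures" and E: "E \<in> sets R"
  shows "measure (normalized T) E = measure (symplectic_measure A B C D) (T \<inter> E) / measure (symplectic_measure A B C D) T"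
proof -
  have spO: "space (symplectic_measure A B C D) = int_surface A B C D" using sets_eq_imp_space_eq[OF symplectic_props(1)[OF ints(1-3) inf]] by (simp add: space_restrict_space)
  have ES: "E \<inter> int_surface A B C D \<in> sets (symplectic_measure A B C D)" using E int_surface_borel[of A B C D] by (auto simp: sets_R_iff sets_symplectic_iff[OF ints(1-3) inf])
  have "measure (normalized T) E = measure (uniform_measure (symplectic_measure A B C D) T) (E \<inter> int_surface A B C D)"
    unfolding normalized_def measure_distr[OF normalized_measurable E] by (simp add: spO)
  also have "\<dots> = measure (symplectic_measure A B C D) (T \<inter> (E \<inter> int_surface A B C D)) / measure (symplectic_measure A B C D) T"
    using symplectic_orbit_closure[OF T] ES by (intro measure_uniform_measure) auto
  also have "T \<inter> (E \<inter> int_surface A B C D) = T \<inter> E" using orbit_closure_props(1)[OF T] by blast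
  finally show ?thesis .
qed

lemma measure_normalized_self:
  assumes T: "T \<in> orbit_closures"
  shows "measure (normalized T) T = 1"
proof -
  have "measure (symplectic_measure A B C D) T \<noteq> 0" using symplectic_orbit_closure[OF T] by (simp add: measure_def enn2real_eq_0_iff)
  then show ?thesis by (simp add: measure_normalized[OF T orbit_closure_props(3)[OF T]])
qed

lemma measure_normalized_other:
  assumes T: "T \<in> orbit_closures" "T' \<in> orbit_closures" "T \<noteq> T'"
  shows "measure (normalized T) T' = 0"
  using orbit_closures_disjoint[OF T] by (simp add: measure_normalized[OF T(1) orbit_closure_props(3)[OF T(2)]])

lemma stationary_iff:
  "\<nu> \<in> stationary_measures A B C D \<mu> \<longleftrightarrow> prob_space \<nu> \<and> sets \<nu> = sets R \<and>
    (\<forall>E\<in>sets R. (\<Sum>s\<in>vietas A B C. pmf \<mu> s * measure \<nu> (s -` E \<inter> X)) = measure \<nu> E)"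
proof -
  have "space \<nu> = X" if "sets \<nu> = sets R" using sets_eq_imp_space_eq[OF that] by (simp add: space_R)
  then show ?thesis unfolding stationary_measures_def vietas_def[symmetric] by auto
qed

lemma normalized_stationary:
  assumes T: "T \<in> orbit_closures"
  shows "normalized T \<in> stationary_measures A B C D \<mu>"
  unfolding stationary_iff
proof (intro conjI ballI)
  obtain x where x: "x \<in> int_surface A B C D" "T = orb x" using T unfolding orbit_closures_def by blast
  fix E assume E: "E \<in> sets R"
  have Eb: "E \<in> sets borel" "E \<subseteq> X" using E by (auto simp: sets_R_iff)
  have "measure (normalized T) (s -` E \<inter> X) = measure (normalized T) E" if s: "s \<in> vietas A B C" for s
  proof -
    have m: "s -` E \<inter> X \<in> sets R"
      using vietas_vimage_borel[OF s Eb(1)] surface_borel by (auto simp: sets_R_iff)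
    have "T \<inter> (s -` E \<inter> X) = s -` (T \<inter> E)"
      using orbit_closure_vimage[OF ints(1-3) inf x(1) s] orbit_closure_props(1)[OF T] S_subset_X unfolding x(2) by blast
    also have "\<dots> = s ` (T \<inter> E)" by (simp add: vietas_image_eq[OF s])
    finally have eq: "T \<inter> (s -` E \<inter> X) = s ` (T \<inter> E)" .
    have "T \<inter> E \<in> sets (symplectic_measure A B C D)" using orbit_closure_props[OF T] Eb by (auto simp: sets_symplectic_iff[OF ints(1-3) inf])
    then have "measure (symplectic_measure A B C D) (s ` (T \<inter> E)) = measure (symplectic_measure A B C D) (T \<inter> E)"
      unfolding measure_def using symplectic_invariant[OF ints(1-3) inf s] by simp
    then show ?thesis by (simp add: measure_normalized[OF T] m E eq)
  qed
  then have "(\<Sum>s\<in>vietas A B C. pmf \<mu> s * measure (normalized T) (s -` E \<inter> X)) =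
      (\<Sum>s\<in>vietas A B C. pmf \<mu> s) * measure (normalized T) E"
    by (simp add: sum_distrib_right)
  then show "(\<Sum>s\<in>vietas A B C. pmf \<mu> s * measure (normalized T) (s -` E \<inter> X)) = measure (normalized T) E"
    by (simp add: \<mu>(2))
qed (use normalized_prob[OF T] in auto)

text \<open>The extension by 0 to the affine space, where the cubes generate the Borel sets and
  preimages need not be cut down to the surface.\<close>

definition ambient :: "'p padic3 measure \<Rightarrow> 'p padic3 measure" where
  "ambient \<nu> = distr \<nu> borel (\<lambda>u. u)"

lemma ambient_props:
  assumes \<nu>: "\<nu> \<in> stationary_measures A B C D \<mu>"
  shows "sets (ambient \<nu>) = sets borel" "finite_measure (ambient \<nu>)"
    "E \<in> sets borel \<Longrightarrow> measure (ambient \<nu>) E = measure \<nu> (E \<inter> X)"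
    "E \<in> sets borel \<Longrightarrow> (\<Sum>s\<in>vietas A B C. pmf \<mu> s * measure (ambient \<nu>) (s -` E)) = measure (ambient \<nu>) E"
proof -
  have \<nu>': "prob_space \<nu>" "sets \<nu> = sets R" "\<And>E. E \<in> sets R \<Longrightarrow> (\<Sum>s\<in>vietas A B C. pmf \<mu> s * measure \<nu> (s -` E \<inter> X)) = measure \<nu> E"
    using \<nu> by (auto simp: stationary_iff)
  have sp: "space \<nu> = X" using sets_eq_imp_space_eq[OF \<nu>'(2)] by (simp add: space_R)
  have m: "(\<lambda>u. u) \<in> measurable \<nu> borel"
  proof (rule measurableI)
    fix E :: "'p padic3 set" assume "E \<in> sets borel"
    then show "(\<lambda>u. u) -` E \<inter> space \<nu> \<in> sets \<nu>" using surface_borel by (auto simp: sp \<nu>'(2) sets_R_iff)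
  qed simp
  show "sets (ambient \<nu>) = sets borel" by (simp add: ambient_def)
  show "finite_measure (ambient \<nu>)"
    unfolding ambient_def by (rule prob_space.finite_measure[OF prob_space.prob_space_distr[OF \<nu>'(1) m]])
  have meas: "measure (ambient \<nu>) E = measure \<nu> (E \<inter> X)" if "E \<in> sets borel" for E
    unfolding ambient_def measure_distr[OF m that] by (simp add: sp)
  then show "E \<in> sets borel \<Longrightarrow> measure (ambient \<nu>) E = measure \<nu> (E \<inter> X)" .
  assume E: "E \<in> sets borel"
  have EX: "E \<inter> X \<in> sets R" using E surface_borel by (auto simp: sets_R_iff)
  have "measure (ambient \<nu>) (s -` E) = measure \<nu> (s -` (E \<inter> X) \<inter> X)" if s: "s \<in> vietas A B C" for s
  proof -
    have "s -` E \<inter> X = s -` (E \<inter> X) \<inter> X" using surface_vimage[OF ints \<mu> s] by blast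
    then show ?thesis by (simp add: meas[OF vietas_vimage_borel[OF s E]])
  qed
  then show "(\<Sum>s\<in>vietas A B C. pmf \<mu> s * measure (ambient \<nu>) (s -` E)) = measure (ambient \<nu>) E"
    using \<nu>'(3)[OF EX] by (simp add: meas[OF E])
qed

text \<open>Nothing is charged off the integral points, and these are cut into finitely many orbit
  closures. On each of them \<open>\<nu>\<close> is proportional to \<open>normalized T\<close>, and
  testing on \<open>T\<close> identifies the factor.\<close>

lemma stationary_decomposition:
  assumes \<nu>: "\<nu> \<in> stationary_measures A B C D \<mu>" and E: "E \<in> sets R"
  shows "measure \<nu> E = (\<Sum>T\<in>orbit_closures. measure \<nu> T * measure (normalized T) E)"
proof -
  have \<nu>': "prob_space \<nu>" "sets \<nu> = sets R" using \<nu> by (auto simp: stationary_iff)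
  interpret \<nu>: prob_space \<nu> by (rule \<nu>'(1))
  have Eb: "E \<in> sets borel" "E \<subseteq> X" using E by (auto simp: sets_R_iff)
  interpret N: finite_measure "ambient \<nu>" by (rule ambient_props(2)[OF \<nu>])
  have XI: "X - int_cube \<in> sets borel"
    using closed_surface compact_imp_closed[OF compact_int_cube] by (intro sets.Diff borel_closed)
  have "emeasure (ambient \<nu>) (X - int_cube) = 0"
    by (rule stationary_escape_null[OF ints \<mu> ambient_props(2)[OF \<nu>] ambient_props(1)[OF \<nu>] ambient_props(4)[OF \<nu>]])
  then have "measure (ambient \<nu>) (X - int_cube) = 0" by (simp add: measure_def)
  then have null: "measure \<nu> (X - int_cube) = 0" by (simp add: ambient_props(3)[OF \<nu> XI] Int_absorb2)
  have ES: "E \<inter> int_surface A B C D \<in> sets \<nu>" using Eb int_surface_borel[of A B C D] by (auto simp: \<nu>'(2) sets_R_iff)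
  have EXS: "E - (int_surface A B C D) \<in> sets \<nu>" using Eb int_surface_borel[of A B C D] by (auto simp: \<nu>'(2) sets_R_iff)
  have "X - int_cube \<in> sets \<nu>" using XI by (simp add: \<nu>'(2) sets_R_iff)
  moreover have "E - (int_surface A B C D) \<subseteq> X - int_cube" using Eb(2) by (auto simp: int_surface_eq)
  ultimately have "measure \<nu> (E - (int_surface A B C D)) \<le> 0" using \<nu>.finite_measure_mono null by metis
  then have 0: "measure \<nu> (E - (int_surface A B C D)) = 0" using measure_nonneg[of \<nu> "E - (int_surface A B C D)"] by linarith
  have "measure \<nu> E = measure \<nu> ((E \<inter> int_surface A B C D) \<union> (E - (int_surface A B C D)))" by (simp add: Int_Diff_Un)
  also have "\<dots> = measure \<nu> (E \<inter> int_surface A B C D)" using \<nu>.finite_measure_Union[OF ES EXS] 0 by auto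
  also have "E \<inter> int_surface A B C D = (\<Union>T\<in>orbit_closures. E \<inter> T)" using orbit_closures_cover by blast
  also have "measure \<nu> (\<Union>T\<in>orbit_closures. E \<inter> T) = (\<Sum>T\<in>orbit_closures. measure \<nu> (E \<inter> T))"
  proof (rule \<nu>.finite_measure_finite_Union[OF finite_orbit_closures])
    show "(\<lambda>T. E \<inter> T) ` orbit_closures \<subseteq> sets \<nu>" using E orbit_closure_props(3) by (auto simp: \<nu>'(2))
    show "disjoint_family_on (\<lambda>T. E \<inter> T) orbit_closures"
      unfolding disjoint_family_on_def using orbit_closures_disjoint by blast
  qed
  also have "\<dots> = (\<Sum>T\<in>orbit_closures. measure \<nu> T * measure (normalized T) E)"
  proof (rule sum.cong[OF refl])
    fix T assume T: "T \<in> orbit_closures"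
    then obtain x where x: "x \<in> int_surface A B C D" "T = orb x" unfolding orbit_closures_def by blast
    note nT = normalized_stationary[OF T]
    have TX: "T \<inter> X = T" "E \<inter> T \<inter> X = E \<inter> T" using Eb(2) orbit_closure_props(1)[OF T] S_subset_X by auto
    have ET: "E \<inter> T \<in> sets borel" using Eb(1) orbit_closure_props(2)[OF T] by auto
    have "measure (ambient (normalized T)) T * measure (ambient \<nu>) (E \<inter> T) = measure (ambient \<nu>) T * measure (ambient (normalized T)) (E \<inter> T)"
      using stationary_proportional[OF ints(1-3) inf ambient_props(2)[OF \<nu>] ambient_props(1)[OF \<nu>] ambient_props(2)[OF nT] ambient_props(1)[OF nT]
        x(1) \<mu> ambient_props(4)[OF \<nu>] ambient_props(4)[OF nT] ET] unfolding x(2) by blast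
    then have "measure \<nu> (E \<inter> T) = measure \<nu> T * measure (normalized T) (E \<inter> T)"
      using orbit_closure_props(2)[OF T] by (simp add: ambient_props(3)[OF \<nu>] ambient_props(3)[OF nT] ET TX measure_normalized_self[OF T])
    also have "measure (normalized T) (E \<inter> T) = measure (normalized T) E"
    proof -
      have "T \<inter> (E \<inter> T) = T \<inter> E" by blast
      then show ?thesis
        by (simp only: measure_normalized[OF T sets.Int[OF E orbit_closure_props(3)[OF T]]] measure_normalized[OF T E])
    qed
    finally show "measure \<nu> (E \<inter> T) = measure \<nu> T * measure (normalized T) E" .
  qed
  finally show ?thesis .
qed

lemma mixture_stationary:
  assumes c: "\<And>T. T \<in> orbit_closures \<Longrightarrow> 0 \<le> c T" "(\<Sum>T\<in>orbit_closures. c T) = 1"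
  shows "\<exists>\<nu> \<in> stationary_measures A B C D \<mu>. measure \<nu> = (\<Sum>T\<in>orbit_closures. c T *\<^sub>R measure (normalized T))"
proof -
  define N where "N T = scale_measure (ennreal (c T)) (normalized T)" for T
  define \<nu> where "\<nu> = measure_of (space R) (sets R) (\<lambda>E. \<Sum>T\<in>orbit_closures. emeasure (N T) E)"
  have sN: "sets (N T) = sets R" if "T \<in> orbit_closures" for T using normalized_prob(2)[OF that] by (simp add: N_def)
  have s\<nu>: "sets \<nu> = sets R" unfolding \<nu>_def by (rule sets.sets_measure_of_eq)
  have e\<nu>: "emeasure \<nu> E = ennreal (\<Sum>T\<in>orbit_closures. c T * measure (normalized T) E)" if E: "E \<in> sets R" for E
  proof -
    have "emeasure \<nu> E = (\<Sum>T\<in>orbit_closures. emeasure (N T) E)"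
      unfolding \<nu>_def by (rule emeasure_sum_measures[OF finite_orbit_closures sN E])
    also have "\<dots> = (\<Sum>T\<in>orbit_closures. ennreal (c T * measure (normalized T) E))"
    proof (rule sum.cong[OF refl])
      fix T assume T: "T \<in> orbit_closures"
      interpret nT: prob_space "normalized T" by (rule normalized_prob(1)[OF T])
      show "emeasure (N T) E = ennreal (c T * measure (normalized T) E)"
        by (simp add: N_def nT.emeasure_eq_measure ennreal_mult c(1)[OF T])
    qed
    also have "\<dots> = ennreal (\<Sum>T\<in>orbit_closures. c T * measure (normalized T) E)"
      by (rule sum_ennreal) (simp add: c(1))
    finally show ?thesis .
  qed
  have nonneg: "0 \<le> (\<Sum>T\<in>orbit_closures. c T * measure (normalized T) E)" for E
    by (rule sum_nonneg) (simp add: c(1))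
  \<comment> \<open>For every set, measurable or not: both sides are 0 off the sigma-algebra, and an
    equality of set functions is wanted.\<close>
  have m\<nu>: "measure \<nu> E = (\<Sum>T\<in>orbit_closures. c T * measure (normalized T) E)" for E
  proof (cases "E \<in> sets R")
    case True
    then show ?thesis unfolding measure_def[of \<nu>] e\<nu>[OF True] using nonneg by (simp add: enn2real_ennreal)
  next
    case False
    then show ?thesis using normalized_prob(2) by (simp add: measure_notin_sets s\<nu>)
  qed
  have "prob_space \<nu>"
  proof
    have "space \<nu> = X" using sets_eq_imp_space_eq[OF s\<nu>] by (simp add: space_R)
    moreover have "measure (normalized T) X = 1" if T: "T \<in> orbit_closures" for T
    proof -
      interpret nT: prob_space "normalized T" by (rule normalized_prob(1)[OF T])
      have "space (normalized T) = X" using sets_eq_imp_space_eq[OF normalized_prob(2)[OF T]] by (simp add: space_R)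
      then show ?thesis using nT.prob_space by simp
    qed
    ultimately show "emeasure \<nu> (space \<nu>) = 1" using c(2) surface_borel by (simp add: e\<nu> sets_R_iff)
  qed
  moreover have "(\<Sum>s\<in>vietas A B C. pmf \<mu> s * measure \<nu> (s -` E \<inter> X)) = measure \<nu> E" if E: "E \<in> sets R" for E
  proof -
    have "(\<Sum>s\<in>vietas A B C. pmf \<mu> s * measure \<nu> (s -` E \<inter> X)) =
        (\<Sum>s\<in>vietas A B C. \<Sum>T\<in>orbit_closures. c T * (pmf \<mu> s * measure (normalized T) (s -` E \<inter> X)))"
      by (simp add: m\<nu> sum_distrib_left mult_ac)
    also have "\<dots> = (\<Sum>T\<in>orbit_closures. c T * (\<Sum>s\<in>vietas A B C. pmf \<mu> s * measure (normalized T) (s -` E \<inter> X)))"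
      by (subst sum.swap) (simp add: sum_distrib_left)
    also have "\<dots> = measure \<nu> E"
      unfolding m\<nu> by (rule sum.cong[OF refl]) (use normalized_stationary E in \<open>auto simp: stationary_iff\<close>)
    finally show ?thesis .
  qed
  ultimately have "\<nu> \<in> stationary_measures A B C D \<mu>" using s\<nu> by (simp add: stationary_iff)
  moreover have "measure \<nu> = (\<Sum>T\<in>orbit_closures. c T *\<^sub>R measure (normalized T))"
    by (rule ext) (simp add: m\<nu> sum_fun_apply scaleR_fun_def)
  ultimately show ?thesis by blast
qed

section \<open>The simplex of stationary measures\<close>

definition vertices where "vertices = (\<lambda>T. measure (normalized T)) ` orbit_closures"

lemma inj_vertices: "inj_on (\<lambda>T. measure (normalized T)) orbit_closures"
proof (rule inj_onI, rule ccontr)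
  fix T T' assume T: "T \<in> orbit_closures" "T' \<in> orbit_closures" "measure (normalized T) = measure (normalized T')" "T \<noteq> T'"
  then show False using measure_normalized_self[OF T(1)] measure_normalized_other[OF T(2,1)] by simp
qed

lemma finite_vertices: "finite vertices"
  unfolding vertices_def using finite_orbit_closures by simp

lemma sum_vertices: "(\<Sum>v\<in>vertices. h v) = (\<Sum>T\<in>orbit_closures. h (measure (normalized T)))"
  unfolding vertices_def by (simp add: sum.reindex[OF inj_vertices])

lemma stationary_eq_hull: "measure ` stationary_measures A B C D \<mu> = convex hull vertices"
proof
  show "measure ` stationary_measures A B C D \<mu> \<subseteq> convex hull vertices"
  proof
    fix m assume "m \<in> measure ` stationary_measures A B C D \<mu>"
    then obtain \<nu> where \<nu>: "\<nu> \<in> stationary_measures A B C D \<mu>" "m = measure \<nu>" by blast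
    have \<nu>': "prob_space \<nu>" "sets \<nu> = sets R" using \<nu>(1) by (auto simp: stationary_iff)
    \<comment> \<open>The barycentric coordinate at the vertex of \<open>T\<close> is the mass that
      \<open>\<nu>\<close> gives to \<open>T\<close>.\<close>
    define w where "w v = measure \<nu> (the_inv_into orbit_closures (\<lambda>T. measure (normalized T)) v)" for v
    have w: "w (measure (normalized T)) = measure \<nu> T" if "T \<in> orbit_closures" for T
      using the_inv_into_f_f[OF inj_vertices that] by (simp add: w_def)
    have "m E = (\<Sum>T\<in>orbit_closures. measure \<nu> T *\<^sub>R measure (normalized T)) E" for E
    proof (cases "E \<in> sets R")
      case True
      then show ?thesis using stationary_decomposition[OF \<nu>(1) True] by (simp add: \<nu>(2) sum_fun_apply scaleR_fun_def)
    next
      case False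
      then show ?thesis using normalized_prob(2) \<nu>'(2) by (simp add: \<nu>(2) sum_fun_apply scaleR_fun_def measure_notin_sets)
    qed
    then have "m = (\<Sum>T\<in>orbit_closures. measure \<nu> T *\<^sub>R measure (normalized T))" by blast
    also have "\<dots> = (\<Sum>v\<in>vertices. w v *\<^sub>R v)" unfolding sum_vertices by (rule sum.cong[OF refl]) (simp add: w)
    finally have m: "(\<Sum>v\<in>vertices. w v *\<^sub>R v) = m" by simp
    have "(\<Sum>v\<in>vertices. w v) = (\<Sum>T\<in>orbit_closures. measure \<nu> T)" unfolding sum_vertices by (rule sum.cong[OF refl]) (simp add: w)
    also have "\<dots> = (\<Sum>T\<in>orbit_closures. measure \<nu> T * measure (normalized T) X)"
    proof (rule sum.cong[OF refl])
      fix T assume T: "T \<in> orbit_closures"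
      interpret nT: prob_space "normalized T" by (rule normalized_prob(1)[OF T])
      have "space (normalized T) = X" using sets_eq_imp_space_eq[OF normalized_prob(2)[OF T]] by (simp add: space_R)
      then show "measure \<nu> T = measure \<nu> T * measure (normalized T) X" using nT.prob_space by simp
    qed
    also have "\<dots> = measure \<nu> X" by (rule stationary_decomposition[OF \<nu>(1), symmetric]) (simp add: sets_R_iff surface_borel)
    also have "\<dots> = 1"
      using prob_space.prob_space[OF \<nu>'(1)] sets_eq_imp_space_eq[OF \<nu>'(2)] by (simp add: space_R)
    finally have "(\<Sum>v\<in>vertices. w v) = 1" .
    moreover have "\<forall>v\<in>vertices. 0 \<le> w v" by (simp add: w_def)
    ultimately show "m \<in> convex hull vertices"
      unfolding convex_hull_finite[OF finite_vertices] using m by blast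
  qed
  show "convex hull vertices \<subseteq> measure ` stationary_measures A B C D \<mu>"
  proof
    fix m assume "m \<in> convex hull vertices"
    then obtain w where w: "\<forall>v\<in>vertices. 0 \<le> w v" "(\<Sum>v\<in>vertices. w v) = 1" "(\<Sum>v\<in>vertices. w v *\<^sub>R v) = m"
      unfolding convex_hull_finite[OF finite_vertices] by blast
    define c where "c T = w (measure (normalized T))" for T
    have "\<And>T. T \<in> orbit_closures \<Longrightarrow> 0 \<le> c T" using w(1) by (simp add: c_def vertices_def)
    moreover have "(\<Sum>T\<in>orbit_closures. c T) = 1" using w(2) unfolding sum_vertices c_def .
    ultimately obtain \<nu> where \<nu>: "\<nu> \<in> stationary_measures A B C D \<mu>" "measure \<nu> = (\<Sum>T\<in>orbit_closures. c T *\<^sub>R measure (normalized T))"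
      using mixture_stationary[of c] by blast
    have "m = measure \<nu>" using w(3) \<nu>(2) unfolding sum_vertices c_def by simp
    then show "m \<in> measure ` stationary_measures A B C D \<mu>" using \<nu>(1) by blast
  qed
qed

text \<open>Vertices are functions on sets. Evaluating a linear relation at the set \<open>T\<close>
  isolates the coefficient of the vertex of \<open>T\<close>, since the other normalized measures
  vanish on \<open>T\<close>.\<close>

lemma affine_independent_vertices: "\<not> affine_dependent vertices"
  unfolding affine_dependent_explicit_finite[OF finite_vertices]
proof
  assume "\<exists>U. sum U vertices = 0 \<and> (\<exists>v\<in>vertices. U v \<noteq> 0) \<and> (\<Sum>v\<in>vertices. U v *\<^sub>R v) = 0"
  then obtain U v where U: "v \<in> vertices" "U v \<noteq> 0" "(\<Sum>v\<in>vertices. U v *\<^sub>R v) = 0" by blast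
  then obtain T where T: "T \<in> orbit_closures" "v = measure (normalized T)" by (auto simp: vertices_def)
  have "0 = (\<Sum>v\<in>vertices. U v *\<^sub>R v) T" using U(3) by simp
  also have "\<dots> = (\<Sum>T'\<in>orbit_closures. U (measure (normalized T')) * measure (normalized T') T)"
    by (simp add: sum_vertices sum_fun_apply scaleR_fun_def)
  also have "\<dots> = (\<Sum>T'\<in>orbit_closures. if T' = T then U v else 0)"
    by (rule sum.cong[OF refl]) (auto simp: T measure_normalized_self measure_normalized_other)
  also have "\<dots> = U v" using finite_orbit_closures T(1) by simp
  finally show False using U(2) by simp
qed

lemma finite_dim_simplex_stationary: "finite_dim_simplex (measure ` stationary_measures A B C D \<mu>)"
  unfolding finite_dim_simplex_def stationary_eq_hull
  using finite_vertices affine_independent_vertices by blast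

text \<open>Extreme points of the hull of a finite set belong to this set;
  \<open>inj_on_measure_stationary\<close> leads back from set functions to measures.\<close>

lemma ergodic_eq_normalized:
  assumes \<nu>: "\<nu> \<in> ergodic_measures A B C D \<mu>"
  shows "\<exists>T\<in>orbit_closures. \<nu> = normalized T"
proof -
  have st: "\<nu> \<in> stationary_measures A B C D \<mu>" and ext: "measure \<nu> extreme_point_of (convex hull vertices)"
    using \<nu> by (auto simp: ergodic_measures_def stationary_eq_hull)
  then have "measure \<nu> \<in> vertices" using extreme_point_of_convex_hull by blast
  then obtain T where T: "T \<in> orbit_closures" "measure \<nu> = measure (normalized T)" by (auto simp: vertices_def)
  then have "\<nu> = normalized T"
    using inj_onD[OF inj_on_measure_stationary T(2) st normalized_stationary[OF T(1)]] by simp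
  then show ?thesis using T(1) by blast
qed

lemma orbit_closure_clopen:
  assumes T: "T \<in> orbit_closures"
  shows "openin (top_of_set (int_surface A B C D)) T" "closedin (top_of_set (int_surface A B C D)) T"
proof -
  obtain n where n: "\<And>v. v \<in> T \<Longrightarrow> (int_surface A B C D) \<inter> cube v (n v) \<subseteq> T" using orbit_closure_open_cube[OF T] by metis
  have "T = int_surface A B C D \<inter> (\<Union>v\<in>T. cube v (n v))"
    using n orbit_closure_props(1)[OF T] center_in_cube by blast
  moreover have "open (\<Union>v\<in>T. cube v (n v))" by (intro open_UN ballI open_cube)
  ultimately show "openin (top_of_set (int_surface A B C D)) T" unfolding openin_open by blast
  show "closedin (top_of_set (int_surface A B C D)) T" by (rule closed_subset[OF orbit_closure_props(1,5)[OF T]])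
qed

end

theorem theoremE:
  fixes A B C D :: "'p::prime_card padic"
    and \<mu> :: "('p padic3 \<Rightarrow> 'p padic3) pmf"
  assumes "A \<in> padic_ints" "B \<in> padic_ints" "C \<in> padic_ints" "D \<in> padic_ints"
    and no_finite_orbit: "\<And>x. x \<in> int_surface A B C D \<Longrightarrow> infinite (vieta_orbit A B C x)"
    and "set_pmf \<mu> \<subseteq> {vieta1 A, vieta2 B, vieta3 C}"
    and "pmf \<mu> (vieta1 A) * pmf \<mu> (vieta2 B) * pmf \<mu> (vieta3 C) > 0"
  shows "(\<forall>\<nu> \<in> ergodic_measures A B C D \<mu>. \<exists>x \<in> int_surface A B C D.
            measure \<nu> (closure (vieta_orbit A B C x)) = 1 \<and>
            openin (top_of_set (int_surface A B C D)) (closure (vieta_orbit A B C x)) \<and>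
            closedin (top_of_set (int_surface A B C D)) (closure (vieta_orbit A B C x)) \<and>
            \<nu> = distr (uniform_measure (symplectic_measure A B C D) (closure (vieta_orbit A B C x)))
                   (restrict_space borel (surface A B C D)) (\<lambda>u. u)) \<and>
         finite {closure (vieta_orbit A B C x) | x. x \<in> int_surface A B C D} \<and>
         finite_dim_simplex (measure ` stationary_measures A B C D \<mu>)"
proof -
  note ints = assms(1-4)
  have inf: "infinite (vorb A B C v)" if "v \<in> int_surface A B C D" for v
    using no_finite_orbit[OF that] by (simp add: vieta_orbit_eq_vorb)
  have "pmf \<mu> (vieta1 A) \<noteq> 0" "pmf \<mu> (vieta2 B) \<noteq> 0" "pmf \<mu> (vieta3 C) \<noteq> 0" using assms(7) by auto
  then have pos: "pmf \<mu> s > 0" if "s \<in> vietas A B C" for s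
    using that pmf_nonneg[of \<mu>] by (auto simp: vietas_def less_le)
  have sum1: "(\<Sum>s\<in>vietas A B C. pmf \<mu> s) = 1"
    by (rule sum_pmf_eq_1) (use assms(6) in \<open>simp_all add: vietas_def\<close>)
  note [simp] = vieta_orbit_eq_vorb
  have oc: "orbit_closures A B C D = (\<lambda>x. closure (vorb A B C x)) ` int_surface A B C D"
    by (rule orbit_closures_def[OF ints inf pos sum1])
  have nm: "normalized A B C D T = distr (uniform_measure (symplectic_measure A B C D) T) (restrict_space borel (surface A B C D)) (\<lambda>u. u)" for T
    by (rule normalized_def[OF ints inf pos sum1])
  have ergodic: "\<exists>x \<in> int_surface A B C D.
            measure \<nu> (closure (vieta_orbit A B C x)) = 1 \<and>
            openin (top_of_set (int_surface A B C D)) (closure (vieta_orbit A B C x)) \<and>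
            closedin (top_of_set (int_surface A B C D)) (closure (vieta_orbit A B C x)) \<and>
            \<nu> = distr (uniform_measure (symplectic_measure A B C D) (closure (vieta_orbit A B C x)))
                   (restrict_space borel (surface A B C D)) (\<lambda>u. u)"
    if \<nu>: "\<nu> \<in> ergodic_measures A B C D \<mu>" for \<nu>
  proof -
    obtain T where T: "T \<in> orbit_closures A B C D" "\<nu> = normalized A B C D T"
      using ergodic_eq_normalized[OF ints inf pos sum1 \<nu>] by blast
    obtain x where x: "x \<in> int_surface A B C D" "T = closure (vorb A B C x)"
      using T(1) unfolding oc by blast
    show ?thesis
      using measure_normalized_self[OF ints inf pos sum1 T(1)] orbit_closure_clopen[OF ints inf pos sum1 T(1)] T(2)
      by (intro bexI[OF _ x(1)]) (simp add: x(2)[symmetric] nm)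
  qed
  have "{closure (vieta_orbit A B C x) | x. x \<in> int_surface A B C D} = orbit_closures A B C D"
    unfolding oc vieta_orbit_eq_vorb by blast
  then show ?thesis
    using ergodic finite_orbit_closures[OF ints inf pos sum1] finite_dim_simplex_stationary[OF ints inf pos sum1] by simp
qed

end
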